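(* The parametric matroid $\ell$-interdiction problem can be solved in time $$\mathcal{O}\Big(m^2\big(k^\ell\ell^\ell\,(f(m)+\log (k\ell))+\log m\big)\Big).$$
   Context: Let $\mathcal{M}=(E,\mathcal{F})$ be a matroid on a finite ground set $E$ with family of independent sets $\mathcal{F}$, $m=|E|$, and rank $k$. Each $e\in E$ has a parametric weight $w(e,\lambda)=a_e+\lambda b_e$ with $a_e,b_e\in\mathbb{Q}$, where the parameter $\lambda$ ranges over a real interval $I\subseteq\mathbb{R}$; for $A\subseteq E$ put $w(A,\lambda)=\sum_{e\in A}w(e,\lambda)$. Let $\ell\in\mathbb{N}_{>0}$ be the number of elements allowed to be interdicted. For $F\subseteq E$, $\mathcal{M}_F$ denotes the restriction of $\mathcal{M}$ to $E\setminus F$; $B_\lambda^*$ denotes a minimum weight basis of $\mathcal{M}$ at $\lambda$ and $B_\lambda^F$ a minimum weight basis of $\mathcal{M}_F$ at $\lambda$. An equality point is a $\lambda\in I$ with $w(e,\lambda)=w(f,\lambda)$ for some $e\neq f$. Standing assumptions: (a) $\ell$ is constant, not part of the input (so implied constants may depend on $\ell$); (b) for every $F\subseteq E$ with $|F|=\ell$ the matroid $\mathcal{M}_F$ has a basis of cardinality $k$; (c) optimal bases $B_\lambda^*$ and $B_\lambda^F$ are unique (at equality points ties are resolved by a fixed ordering of the elements); (d) no two different pairs of elements have equal weights at the same $\lambda$, and no two elements have identical weight functions. For $F\subseteq E$ with $|F|=\ell$ put $y_F(\lambda)=w(B_\lambda^F,\lambda)$, and let $y(\lambda)=\max\{y_F(\lambda):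 F\subseteq E,\ |F|=\ell\}$. A set $F^*$ with $|F^*|=\ell$ is a set of $\ell$-most vital elements at $\lambda$ if $y_{F^*}(\lambda)=y(\lambda)$. Parametric matroid $\ell$-interdiction problem: given $\mathcal{M}$ with weights $w(e,\lambda)$, the interval $I$, and $\ell$, determine for each $\lambda\in I$ a set $F^*$ of $\ell$-most vital elements and the value $y(\lambda)=y_{F^*}(\lambda)$ (i.e. output the piecewise linear function $y$ by its linear pieces, with an optimal set $F^*$ for each piece). Computational model: $f(m)$ is the time needed for a single independence test in $\mathcal{M}$; arithmetic operations and comparisons of numbers take constant time. *)

theory Defs
  imports "HOL-Analysis.Analysis"
begin

section \<open>Matroids\<close>

definition matroid :: "'a set \<Rightarrow> 'a set set \<Rightarrow> bool" where
  "matroid E \<F> \<longleftrightarrow>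
     finite E \<and> (\<forall>X\<in>\<F>. X \<subseteq> E) \<and> {} \<in> \<F> \<and>
     (\<forall>X\<in>\<F>. \<forall>Y. Y \<subseteq> X \<longrightarrow> Y \<in> \<F>) \<and>
     (\<forall>X\<in>\<F>. \<forall>Y\<in>\<F>. card X < card Y \<longrightarrow> (\<exists>e\<in>Y - X. insert e X \<in> \<F>))"

definition basis :: "'a set set \<Rightarrow> 'a set \<Rightarrow> bool" where
  "basis \<F> B \<longleftrightarrow> B \<in> \<F> \<and> (\<forall>X\<in>\<F>. B \<subseteq> X \<longrightarrow> X = B)"

definition matroid_rank :: "'a set set \<Rightarrow> nat" where
  "matroid_rank \<F> = Max (card ` \<F>)"

text \<open>Independent sets of the restriction to the complement of \<open>F\<close>.\<close>
definition delete :: "'a set set \<Rightarrow> 'a set \<Rightarrow> 'a set set" where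
  "delete \<F> F = {X \<in> \<F>. X \<inter> F = {}}"

section \<open>Parametric weights and most vital elements\<close>

text \<open>The parameter is called \<open>\<theta>\<close> throughout.\<close>

definition elem_weight :: "(nat \<Rightarrow> rat) \<Rightarrow> (nat \<Rightarrow> rat) \<Rightarrow> nat \<Rightarrow> real \<Rightarrow> real" where
  "elem_weight a b e \<theta> = of_rat (a e) + \<theta> * of_rat (b e)"

definition weight :: "(nat \<Rightarrow> rat) \<Rightarrow> (nat \<Rightarrow> rat) \<Rightarrow> nat set \<Rightarrow> real \<Rightarrow> real" where
  "weight a b A \<theta> = (\<Sum>e\<in>A. elem_weight a b e \<theta>)"

definition min_weight_basis ::
  "nat set set \<Rightarrow> (nat \<Rightarrow> rat) \<Rightarrow> (nat \<Rightarrow> rat) \<Rightarrow> real \<Rightarrow> nat set \<Rightarrow> bool" where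
  "min_weight_basis \<F> a b \<theta> B \<longleftrightarrow>
     basis \<F> B \<and> (\<forall>B'. basis \<F> B' \<longrightarrow> weight a b B \<theta> \<le> weight a b B' \<theta>)"

text \<open>
  Ties are resolved by the order of the element indices: of two minimum weight bases, the one
  that contains the least element of their symmetric difference is preferred.
\<close>
definition opt_basis ::
  "nat set set \<Rightarrow> (nat \<Rightarrow> rat) \<Rightarrow> (nat \<Rightarrow> rat) \<Rightarrow> real \<Rightarrow> nat set" where
  "opt_basis \<F> a b \<theta> =
     (THE B. min_weight_basis \<F> a b \<theta> B \<and>
        (\<forall>B'. min_weight_basis \<F> a b \<theta> B' \<and> B' \<noteq> B \<longrightarrow> Min ((B - B') \<union> (B' - B)) \<in> B))"

definition interdicted_value ::
  "nat set set \<Rightarrow> (nat \<Rightarrow> rat) \<Rightarrow> (nat \<Rightarrow> rat) \<Rightarrow> nat set \<Rightarrow> real \<Rightarrow> real" where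
  "interdicted_value \<F> a b F \<theta> = weight a b (opt_basis (delete \<F> F) a b \<theta>) \<theta>"

definition interdiction_value ::
  "nat \<Rightarrow> nat \<Rightarrow> nat set set \<Rightarrow> (nat \<Rightarrow> rat) \<Rightarrow> (nat \<Rightarrow> rat) \<Rightarrow> real \<Rightarrow> real" where
  "interdiction_value l m \<F> a b \<theta> =
     Max {interdicted_value \<F> a b F \<theta> | F. F \<subseteq> {..<m} \<and> card F = l}"

definition most_vital ::
  "nat \<Rightarrow> nat \<Rightarrow> nat set set \<Rightarrow> (nat \<Rightarrow> rat) \<Rightarrow> (nat \<Rightarrow> rat) \<Rightarrow> real \<Rightarrow> nat set \<Rightarrow> bool" where
  "most_vital l m \<F> a b \<theta> F \<longleftrightarrow>
     F \<subseteq> {..<m} \<and> card F = l \<and>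
     interdicted_value \<F> a b F \<theta> = interdiction_value l m \<F> a b \<theta>"

text \<open>
  The ground set is \<open>{..<m}\<close>. Positive rank is needed for \<open>ln (k * l)\<close> to make sense, and
  \<open>l \<le> m\<close> for there to be a set of \<open>l\<close> elements at all.
\<close>
definition interdiction_instance ::
  "nat \<Rightarrow> nat \<Rightarrow> nat set set \<Rightarrow> (nat \<Rightarrow> rat) \<Rightarrow> (nat \<Rightarrow> rat) \<Rightarrow> real set \<Rightarrow> bool" where
  "interdiction_instance l m \<F> a b I \<longleftrightarrow>
     matroid {..<m} \<F> \<and> 0 < matroid_rank \<F> \<and> l \<le> m \<and>
     is_interval I \<and> I \<noteq> {} \<and>
     (\<forall>F. F \<subseteq> {..<m} \<and> card F = l \<longrightarrow>
        (\<exists>B. basis (delete \<F> F) B \<and> card B = matroid_rank \<F>)) \<and>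
     (\<forall>\<theta>\<in>I. \<forall>e<m. \<forall>f<m. \<forall>e'<m. \<forall>f'<m.
        e \<noteq> f \<and> elem_weight a b e \<theta> = elem_weight a b f \<theta> \<and>
        e' \<noteq> f' \<and> elem_weight a b e' \<theta> = elem_weight a b f' \<theta> \<longrightarrow> {e, f} = {e', f'}) \<and>
     (\<forall>e<m. \<forall>f<m. e \<noteq> f \<longrightarrow> (a e, b e) \<noteq> (a f, b f))"

section \<open>A real random access machine with an independence oracle\<close>

text \<open>
  Programs are while-programs over two unbounded memories, one for natural numbers (indices,
  flags) and one for real numbers. Memory is organised in named arrays; a program mentions only
  finitely many names, and a scalar is cell 0 of an array. The two sorts are kept apart: there
  is no rounding from reals to naturals, program constants are rational, and naturals have no
  division, so that unit-cost arithmetic cannot be abused to unpack encoded data.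
\<close>

type_synonym name = string
type_synonym state = "(name \<Rightarrow> nat \<Rightarrow> nat) \<times> (name \<Rightarrow> nat \<Rightarrow> real)"

datatype nexp =
    NConst nat
  | NCell name nexp
  | NAdd nexp nexp
  | NSub nexp nexp
  | NMul nexp nexp

datatype rexp =
    RConst rat
  | RCell name nexp
  | RAdd rexp rexp
  | RSub rexp rexp
  | RMul rexp rexp
  | RDiv rexp rexp

datatype bexp =
    NLess nexp nexp
  | RLess rexp rexp
  | BNot bexp
  | BAnd bexp bexp

text \<open>
  \<open>Test x i s off\<close> is the independence test: it stores in cell \<open>i\<close> of \<open>x\<close> whether the set
  whose characteristic vector is the segment of length \<open>m\<close> of array \<open>s\<close> starting at \<open>off\<close>
  is independent.
\<close>
datatype com =
    Skip
  | NAssign name nexp nexp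
  | RAssign name nexp rexp
  | Test name nexp name nexp
  | Seq com com
  | Cond bexp com com
  | While bexp com

primrec nval :: "nexp \<Rightarrow> state \<Rightarrow> nat" where
  "nval (NConst c) s = c"
| "nval (NCell x i) s = fst s x (nval i s)"
| "nval (NAdd u v) s = nval u s + nval v s"
| "nval (NSub u v) s = nval u s - nval v s"
| "nval (NMul u v) s = nval u s * nval v s"

primrec rval :: "rexp \<Rightarrow> state \<Rightarrow> real" where
  "rval (RConst c) s = of_rat c"
| "rval (RCell x i) s = snd s x (nval i s)"
| "rval (RAdd u v) s = rval u s + rval v s"
| "rval (RSub u v) s = rval u s - rval v s"
| "rval (RMul u v) s = rval u s * rval v s"
| "rval (RDiv u v) s = rval u s / rval v s"

primrec bval :: "bexp \<Rightarrow> state \<Rightarrow> bool" where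
  "bval (NLess u v) s \<longleftrightarrow> nval u s < nval v s"
| "bval (RLess u v) s \<longleftrightarrow> rval u s < rval v s"
| "bval (BNot c) s \<longleftrightarrow> \<not> bval c s"
| "bval (BAnd c d) s \<longleftrightarrow> bval c s \<and> bval d s"

text \<open>Every constant, memory access, arithmetic operation and comparison costs one step.\<close>

primrec ncost :: "nexp \<Rightarrow> nat" where
  "ncost (NConst c) = 1"
| "ncost (NCell x i) = 1 + ncost i"
| "ncost (NAdd u v) = 1 + ncost u + ncost v"
| "ncost (NSub u v) = 1 + ncost u + ncost v"
| "ncost (NMul u v) = 1 + ncost u + ncost v"

primrec rcost :: "rexp \<Rightarrow> nat" where
  "rcost (RConst c) = 1"
| "rcost (RCell x i) = 1 + ncost i"
| "rcost (RAdd u v) = 1 + rcost u + rcost v"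
| "rcost (RSub u v) = 1 + rcost u + rcost v"
| "rcost (RMul u v) = 1 + rcost u + rcost v"
| "rcost (RDiv u v) = 1 + rcost u + rcost v"

primrec bcost :: "bexp \<Rightarrow> nat" where
  "bcost (NLess u v) = 1 + ncost u + ncost v"
| "bcost (RLess u v) = 1 + rcost u + rcost v"
| "bcost (BNot c) = 1 + bcost c"
| "bcost (BAnd c d) = 1 + bcost c + bcost d"

definition nstore :: "name \<Rightarrow> nat \<Rightarrow> nat \<Rightarrow> state \<Rightarrow> state" where
  "nstore x i v s = ((fst s)(x := (fst s x)(i := v)), snd s)"

definition rstore :: "name \<Rightarrow> nat \<Rightarrow> real \<Rightarrow> state \<Rightarrow> state" where
  "rstore x i v s = (fst s, (snd s)(x := (snd s x)(i := v)))"

text \<open>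
  \<open>exec m \<F> \<tau> c s t s'\<close>: started in \<open>s\<close>, program \<open>c\<close> halts in \<open>s'\<close> after exactly \<open>t\<close> steps,
  where a single independence test takes \<open>\<tau>\<close> steps.
\<close>
inductive exec ::
  "nat \<Rightarrow> nat set set \<Rightarrow> nat \<Rightarrow> com \<Rightarrow> state \<Rightarrow> nat \<Rightarrow> state \<Rightarrow> bool"
  for m \<F> \<tau> where
  Skip: "exec m \<F> \<tau> Skip s 1 s"
| NAssign: "exec m \<F> \<tau> (NAssign x i u) s (1 + ncost i + ncost u)
     (nstore x (nval i s) (nval u s) s)"
| RAssign: "exec m \<F> \<tau> (RAssign x i u) s (1 + ncost i + rcost u)
     (rstore x (nval i s) (rval u s) s)"
| Test: "exec m \<F> \<tau> (Test x i y off) s (1 + ncost i + ncost off + \<tau>)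
     (nstore x (nval i s) (of_bool ({e. e < m \<and> fst s y (nval off s + e) \<noteq> 0} \<in> \<F>)) s)"
| Seq: "exec m \<F> \<tau> c s t s' \<Longrightarrow> exec m \<F> \<tau> d s' t' s'' \<Longrightarrow>
     exec m \<F> \<tau> (Seq c d) s (1 + t + t') s''"
| CondTrue: "bval q s \<Longrightarrow> exec m \<F> \<tau> c s t s' \<Longrightarrow>
     exec m \<F> \<tau> (Cond q c d) s (1 + bcost q + t) s'"
| CondFalse: "\<not> bval q s \<Longrightarrow> exec m \<F> \<tau> d s t s' \<Longrightarrow>
     exec m \<F> \<tau> (Cond q c d) s (1 + bcost q + t) s'"
| WhileFalse: "\<not> bval q s \<Longrightarrow> exec m \<F> \<tau> (While q c) s (1 + bcost q) s"
| WhileTrue: "bval q s \<Longrightarrow> exec m \<F> \<tau> c s t s' \<Longrightarrow> exec m \<F> \<tau> (While q c) s' t' s'' \<Longrightarrow>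
     exec m \<F> \<tau> (While q c) s (1 + bcost q + t + t') s''"

inductive_cases exec_SkipE: "exec m \<F> \<tau> Skip s t s'"
inductive_cases exec_NAssignE: "exec m \<F> \<tau> (NAssign x i u) s t s'"
inductive_cases exec_RAssignE: "exec m \<F> \<tau> (RAssign x i u) s t s'"
inductive_cases exec_TestE: "exec m \<F> \<tau> (Test x i y off) s t s'"
inductive_cases exec_SeqE: "exec m \<F> \<tau> (Seq c d) s t s'"
inductive_cases exec_CondE: "exec m \<F> \<tau> (Cond q c d) s t s'"
inductive_cases exec_WhileE: "exec m \<F> \<tau> (While q c) s t s'"

lemma exec_deterministic:
  "exec m \<F> \<tau> c s t s' \<Longrightarrow> exec m \<F> \<tau> c s u s'' \<Longrightarrow> u = t \<and> s'' = s'"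
proof (induction arbitrary: u s'' rule: exec.induct)
  case (Skip s)
  then show ?case by (rule exec_SkipE) simp
next
  case (NAssign x i v s)
  then show ?case by (rule exec_NAssignE) simp
next
  case (RAssign x i v s)
  then show ?case by (rule exec_RAssignE) simp
next
  case (Test x i y off s)
  then show ?case by (rule exec_TestE) simp
next
  case (Seq c s t s' d t' r)
  show ?case using Seq.prems by (rule exec_SeqE) (simp, metis Seq.IH)
next
  case (CondTrue q s c t s' d)
  show ?case using CondTrue.prems by (rule exec_CondE) (simp_all add: CondTrue.hyps(1), (metis CondTrue.IH)?)
next
  case (CondFalse q s d t s' c)
  show ?case using CondFalse.prems by (rule exec_CondE) (simp_all add: CondFalse.hyps(1), (metis CondFalse.IH)?)
next
  case (WhileFalse q s c)
  show ?case using WhileFalse.prems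
    by (rule exec_WhileE) (use WhileFalse.hyps in simp_all)
next
  case (WhileTrue q s c t s' t' r)
  show ?case using WhileTrue.prems
    by (rule exec_WhileE) (simp_all add: WhileTrue.hyps(1), (metis WhileTrue.IH)?)
qed

section \<open>Encoding of input and output\<close>

text \<open>
  Input: \<open>m\<close>, the coefficients of the weights, and for each end of the interval whether it is
  finite, its value, and whether it belongs to the interval. The matroid is accessible only
  through \<open>Test\<close>; neither its rank nor the cost of a test is part of the input. All cells not
  mentioned are 0.
\<close>
definition input_nat :: "nat \<Rightarrow> real set \<Rightarrow> name \<Rightarrow> nat \<Rightarrow> nat" where
  "input_nat m I x i =
     (if i \<noteq> 0 then 0
      else if x = ''m'' then m
      else if x = ''lo_finite'' then of_bool (bdd_below I)
      else if x = ''lo_closed'' then of_bool (bdd_below I \<and> Inf I \<in> I)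
      else if x = ''hi_finite'' then of_bool (bdd_above I)
      else if x = ''hi_closed'' then of_bool (bdd_above I \<and> Sup I \<in> I)
      else 0)"

definition input_real ::
  "nat \<Rightarrow> (nat \<Rightarrow> rat) \<Rightarrow> (nat \<Rightarrow> rat) \<Rightarrow> real set \<Rightarrow> name \<Rightarrow> nat \<Rightarrow> real" where
  "input_real m a b I x i =
     (if x = ''a'' \<and> i < m then of_rat (a i)
      else if x = ''b'' \<and> i < m then of_rat (b i)
      else if x = ''lo'' \<and> i = 0 \<and> bdd_below I then Inf I
      else if x = ''hi'' \<and> i = 0 \<and> bdd_above I then Sup I
      else 0)"

definition input_state ::
  "nat \<Rightarrow> (nat \<Rightarrow> rat) \<Rightarrow> (nat \<Rightarrow> rat) \<Rightarrow> real set \<Rightarrow> state" where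
  "input_state m a b I = (input_nat m I, input_real m a b I)"

text \<open>
  Output: \<open>p = pieces[0]\<close> pieces, separated by breakpoints \<open>bp[1] < \<dots> < bp[p - 1]\<close> in the
  interval. Piece \<open>i\<close> is the part of the interval between \<open>bp[i]\<close> and \<open>bp[i + 1]\<close>, where
  the first piece has no breakpoint on its left and the last one none on its right. On piece
  \<open>i\<close> the value is \<open>icpt[i] + \<theta> * slope[i]\<close>, and the entries \<open>F[i * l], \<dots>, F[i * l + l - 1]\<close>
  list a set of \<open>l\<close>-most vital elements.
\<close>
definition out_piece :: "real set \<Rightarrow> state \<Rightarrow> nat \<Rightarrow> real set" where
  "out_piece I s i = {\<theta>\<in>I. (0 < i \<longrightarrow> snd s ''bp'' i \<le> \<theta>) \<and>
     (i + 1 < fst s ''pieces'' 0 \<longrightarrow> \<theta> \<le> snd s ''bp'' (i + 1))}"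

definition out_set :: "nat \<Rightarrow> state \<Rightarrow> nat \<Rightarrow> nat set" where
  "out_set l s i = (\<lambda>j. fst s ''F'' (i * l + j)) ` {..<l}"

definition solves_interdiction ::
  "nat \<Rightarrow> nat \<Rightarrow> nat set set \<Rightarrow> (nat \<Rightarrow> rat) \<Rightarrow> (nat \<Rightarrow> rat) \<Rightarrow> real set \<Rightarrow> state \<Rightarrow> bool" where
  "solves_interdiction l m \<F> a b I s \<longleftrightarrow>
     (let p = fst s ''pieces'' 0; bp = snd s ''bp'' in
       0 < p \<and>
       (\<forall>i. 0 < i \<and> i < p \<longrightarrow> bp i \<in> I) \<and>
       (\<forall>i. 0 < i \<and> i + 1 < p \<longrightarrow> bp i < bp (i + 1)) \<and>
       (\<forall>i<p. \<forall>\<theta>\<in>out_piece I s i.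
          most_vital l m \<F> a b \<theta> (out_set l s i) \<and>
          interdiction_value l m \<F> a b \<theta> = snd s ''icpt'' i + \<theta> * snd s ''slope'' i))"

end

theory Submission
  imports Defs
begin

text \<open>
  Let \<open>l\<close> be the number of interdicted elements and \<open>k\<close> the rank. An element is relevant for an order
  of the elements if it belongs to the greedy basis of some \<open>E - F\<close> with \<open>card F \<le> l\<close>. The relevant
  elements lie in the union of \<open>l + 1\<close> disjoint greedy bases, so there are at most \<open>(l + 1) * k\<close> of
  them, and interdicting an irrelevant element has no effect; hence only the sets of \<open>l\<close> relevant
  elements compete.

  The relevant elements are kept in a table with \<open>P = (l + 1) * k + 2\<close> positions, some of which hold
  a dummy, and there is one slot for each of the \<open>P ^ l\<close> functions from \<open>{..<l}\<close> to the positions. A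
  slot stores the greedy basis of the complement of the set of elements at its positions, and the
  line that is the weight of this basis. At an equality point two adjacent elements \<open>e\<close>, \<open>f\<close> swap;
  each slot then exchanges \<open>e\<close> for \<open>f\<close> or keeps its basis, which one independence test decides.
  Only \<open>e\<close> and \<open>f\<close> can become relevant or irrelevant. Since inserting an irrelevant element into the
  table, or removing one, changes the set of a slot but not its basis, the slots never have to be
  recomputed, and an equality point costs \<open>O(P ^ l)\<close> tests.

  Between equality points the solution is the upper envelope of the lines of the slots with \<open>l\<close>
  distinct elements, obtained by sorting the lines by slope and a sweep with a stack. Equality points
  on the boundary of the interval are ignored: the initial order is the one immediately to the right
  of the left end, and at the right end the solution is determined by continuity.
\<close>

section \<open>Greedy bases of an ordered matroid\<close>

text \<open>The obstacle is to avoid recomputing greedy bases, which would cost \<open>m\<close>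
  independence tests per slot at each of up to \<open>m * m\<close> equality points. A slot is
  therefore a tuple of positions, not of elements: the tuple never changes, and a change of the
  relevant elements is a change of one table entry. Tuples with repetitions or dummies represent the
  sets with fewer than \<open>l\<close> elements; they are kept because the bases of all slots
  together reveal which elements are relevant, so that relevance is decided without any test. The
  table needs \<open>(l + 1) * k\<close> positions for the relevant elements, one for the element
  that is inserted before a swap, and one that still holds a dummy at that moment; this is the
  \<open>2\<close> in \<open>P\<close>. Since \<open>P \<le> (l + 3) * k\<close>, there are at most
  \<open>(l + 3) ^ l * k ^ l\<close> slots, and the first factor goes into the constant, which may
  depend on \<open>l\<close>. The term \<open>log (k * l)\<close> comes from sorting the lines of
  all slots in every cell, the term \<open>log m\<close> from sorting the equality points.\<close>

definition cl :: "'a set set \<Rightarrow> 'a set \<Rightarrow> 'a set" where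
  "cl \<F> X = {x. \<exists>J\<subseteq>X. J \<in> \<F> \<and> (x \<in> J \<or> insert x J \<notin> \<F>)}"

text \<open>A declarative form of the greedy algorithm, so that its results for different sets and
  orders can be compared directly. In a matroid every point outside the ground set belongs to every
  \<open>cl \<F> X\<close>, because the empty witness together with such a point is not
  independent.\<close>

definition greedy_basis :: "'a set set \<Rightarrow> ('a \<Rightarrow> 'a \<Rightarrow> bool) \<Rightarrow> 'a set \<Rightarrow> 'a set" where
  "greedy_basis \<F> lt D = {x\<in>D. x \<notin> cl \<F> {y\<in>D. lt y x}}"

definition strict_order_on :: "'a set \<Rightarrow> ('a \<Rightarrow> 'a \<Rightarrow> bool) \<Rightarrow> bool" where
  "strict_order_on E lt \<longleftrightarrow> (\<forall>x\<in>E. \<not> lt x x) \<and>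
     (\<forall>x\<in>E. \<forall>y\<in>E. \<forall>z\<in>E. lt x y \<longrightarrow> lt y z \<longrightarrow> lt x z) \<and>
     (\<forall>x\<in>E. \<forall>y\<in>E. x \<noteq> y \<longrightarrow> lt x y \<or> lt y x)"

lemma ex_max_nat:
  fixes g :: "'a \<Rightarrow> nat"
  assumes "finite S" "S \<noteq> {}"
  shows "\<exists>x\<in>S. \<forall>y\<in>S. g y \<le> g x"
proof -
  have "Max (g ` S) \<in> g ` S" using assms by simp
  then obtain x where "x \<in> S" "g x = Max (g ` S)" by force
  then show ?thesis using assms by (intro bexI[of _ x]) simp_all
qed

lemma ex_min_nat:
  fixes g :: "'a \<Rightarrow> nat"
  assumes "S \<noteq> {}"
  shows "\<exists>x\<in>S. \<forall>y\<in>S. g x \<le> g y"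
proof -
  obtain k where "k \<in> S" using assms by blast
  then show ?thesis using arg_min_nat_lemma[of "\<lambda>x. x \<in> S" k g] by blast
qed

section \<open>Closure and bases of a matroid\<close>

locale matroid_loc =
  fixes E :: "'a set" and \<F> :: "'a set set"
  assumes matroid: "matroid E \<F>"
begin

lemma finite_E: "finite E" and ind_sub: "X \<in> \<F> \<Longrightarrow> X \<subseteq> E" and empty_ind: "{} \<in> \<F>"
  and ind_mono: "X \<in> \<F> \<Longrightarrow> Y \<subseteq> X \<Longrightarrow> Y \<in> \<F>"
  and augment: "X \<in> \<F> \<Longrightarrow> Y \<in> \<F> \<Longrightarrow> card X < card Y \<Longrightarrow> \<exists>e\<in>Y - X. insert e X \<in> \<F>"
  using matroid by (simp_all add: matroid_def)

lemma ind_finite: "X \<in> \<F> \<Longrightarrow> finite X"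
  using finite_E ind_sub finite_subset by blast

lemma finite_ind: "finite \<F>"
  using finite_E ind_sub by (meson PowI finite_Pow_iff finite_subset subsetI)

lemma extend:
  assumes "X \<in> \<F>" "B \<in> \<F>" "card X \<le> card B"
  obtains Y where "Y \<in> \<F>" "X \<subseteq> Y" "Y \<subseteq> X \<union> B" "card Y = card B"
proof -
  have "\<exists>Y\<in>\<F>. X \<subseteq> Y \<and> Y \<subseteq> X \<union> B \<and> card Y = card B"
    using assms
  proof (induction "card B - card X" arbitrary: X)
    case 0
    then show ?case by (intro bexI[of _ X]) auto
  next
    case (Suc n)
    then obtain e where e: "e \<in> B - X" "insert e X \<in> \<F>" using augment[of X B] by force
    have c: "card (insert e X) = Suc (card X)"
      using e Suc.prems ind_finite by simp
    have "n = card B - card (insert e X)" "card (insert e X) \<le> card B" using Suc.hyps(2) c by simp_all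
    from Suc.hyps(1)[OF this(1) e(2) Suc.prems(2) this(2)]
    obtain Y where "Y \<in> \<F>" "insert e X \<subseteq> Y" "Y \<subseteq> insert e X \<union> B" "card Y = card B"
      by blast
    then show ?case using e by (intro bexI[of _ Y]) auto
  qed
  then show ?thesis using that by blast
qed

lemma cl_mono: "X \<subseteq> Y \<Longrightarrow> cl \<F> X \<subseteq> cl \<F> Y"
  unfolding cl_def by blast

lemma cl_superset: "X \<subseteq> cl \<F> X"
proof
  fix x assume "x \<in> X"
  then show "x \<in> cl \<F> X"
    using empty_ind unfolding cl_def by (cases "{x} \<in> \<F>") auto
qed

lemma insert_ind: "J \<in> \<F> \<Longrightarrow> J \<subseteq> X \<Longrightarrow> x \<notin> cl \<F> X \<Longrightarrow> insert x J \<in> \<F> \<and> x \<notin> J"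
  unfolding cl_def by blast

lemma ind_not_cl: "insert x J \<in> \<F> \<Longrightarrow> x \<notin> J \<Longrightarrow> x \<notin> cl \<F> J"
  unfolding cl_def using ind_mono[of "insert x J"] by (auto dest: insert_mono)

text \<open>A larger \<open>I\<close> would augment \<open>J\<close> by one of its own elements,
  which is impossible for an element spanned by \<open>J\<close>.\<close>

lemma card_le_cl:
  assumes "J \<in> \<F>" "I \<in> \<F>" "I \<subseteq> cl \<F> J"
  shows "card I \<le> card J"
proof (rule ccontr)
  assume "\<not> ?thesis"
  then obtain y where "y \<in> I - J" "insert y J \<in> \<F>" using augment assms by force
  then show False using ind_not_cl assms(3) by blast
qed

text \<open>Let \<open>K\<close> witness that \<open>y\<close> lies in the closure of
  \<open>Y\<close>. If \<open>J\<close> did not span \<open>y\<close>, then \<open>K\<close> could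
  be extended inside \<open>K \<union> insert y J\<close> to \<open>card J + 1\<close> elements. The
  extension omits \<open>y\<close>, since \<open>insert y K\<close> is dependent, so it lies in the
  closure of \<open>J\<close> and is too large.\<close>

lemma cl_max:
  assumes J: "J \<in> \<F>" "J \<subseteq> Y" "Y \<subseteq> cl \<F> J"
  shows "cl \<F> Y \<subseteq> cl \<F> J"
proof
  fix y assume "y \<in> cl \<F> Y"
  then obtain K where K: "K \<subseteq> Y" "K \<in> \<F>" "y \<in> K \<or> insert y K \<notin> \<F>" unfolding cl_def by blast
  show "y \<in> cl \<F> J"
  proof (rule ccontr)
    assume n: "y \<notin> cl \<F> J"
    then have i: "insert y J \<in> \<F>" "y \<notin> J" using insert_ind J by blast+
    have "insert y K \<notin> \<F>" using K J n by blast
    have c: "card (insert y J) = Suc (card J)" using i ind_finite J by simp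
    have "card K \<le> card J" using card_le_cl J K by blast
    then obtain B where B: "B \<in> \<F>" "K \<subseteq> B" "B \<subseteq> K \<union> insert y J" "card B = Suc (card J)"
      using extend[of K "insert y J"] K i c by (metis le_SucI)
    have "y \<notin> B" using B \<open>insert y K \<notin> \<F>\<close> ind_mono by (metis insert_subset)
    then have "B \<subseteq> cl \<F> J" using B K J by blast
    then show False using card_le_cl[OF J(1) B(1)] B(4) by simp
  qed
qed

lemma max_ind:
  obtains J where "J \<in> \<F>" "J \<subseteq> Y" "Y \<subseteq> cl \<F> J"
proof -
  have fin: "finite {J\<in>\<F>. J \<subseteq> Y}" using finite_ind by simp
  have ne: "{J\<in>\<F>. J \<subseteq> Y} \<noteq> {}" using empty_ind by blast
  obtain J where "J \<in> {J\<in>\<F>. J \<subseteq> Y}" "\<forall>K\<in>{J\<in>\<F>. J \<subseteq> Y}. J \<subseteq> K \<longrightarrow> J = K"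
    using finite_has_maximal[OF fin ne] by blast
  then have J: "J \<in> \<F>" "J \<subseteq> Y" and mx: "\<And>K. K \<in> \<F> \<Longrightarrow> K \<subseteq> Y \<Longrightarrow> J \<subseteq> K \<Longrightarrow> J = K"
    by simp_all
  have "Y \<subseteq> cl \<F> J"
  proof
    fix y assume "y \<in> Y"
    then show "y \<in> cl \<F> J"
      using mx[of "insert y J"] J unfolding cl_def by blast
  qed
  then show ?thesis using that J by blast
qed

text \<open>Idempotence of the closure is reduced to \<open>cl_max\<close> through a maximal
  independent \<open>J \<subseteq> Y\<close>: it spans \<open>Y\<close>, hence \<open>X\<close>, and
  then also everything spanned by \<open>X\<close>.\<close>

lemma cl_trans:
  assumes "X \<subseteq> cl \<F> Y" shows "cl \<F> X \<subseteq> cl \<F> Y"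
proof -
  obtain J where J: "J \<in> \<F>" "J \<subseteq> Y" "Y \<subseteq> cl \<F> J" using max_ind by blast
  have "X \<union> J \<subseteq> cl \<F> J" using assms cl_max[OF J] cl_superset by blast
  then have "cl \<F> (X \<union> J) \<subseteq> cl \<F> J" using cl_max[of J "X \<union> J"] J by blast
  then show ?thesis using cl_mono[of X "X \<union> J"] cl_mono[OF J(2)] by blast
qed

text \<open>Replaces maximality under inclusion by independence and spanning, the form in which
  bases of different restrictions can be compared by \<open>card_le_cl\<close>.\<close>

lemma basis_delete_iff:
  "basis (delete \<F> F) B \<longleftrightarrow> B \<in> \<F> \<and> B \<subseteq> E - F \<and> E - F \<subseteq> cl \<F> B"
proof
  assume b: "basis (delete \<F> F) B"
  then have B: "B \<in> \<F>" "B \<inter> F = {}" by (simp_all add: basis_def delete_def)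
  then have B: "B \<in> \<F>" "B \<subseteq> E - F" using ind_sub[of B] by blast+
  have "x \<in> cl \<F> B" if x: "x \<in> E - F" for x
  proof (rule ccontr)
    assume "x \<notin> cl \<F> B"
    then have "insert x B \<in> \<F>" "x \<notin> B" using insert_ind B by blast+
    moreover have "insert x B \<inter> F = {}" using x B by blast
    ultimately show False using b unfolding basis_def delete_def by blast
  qed
  then show "B \<in> \<F> \<and> B \<subseteq> E - F \<and> E - F \<subseteq> cl \<F> B" using B by blast
next
  assume B: "B \<in> \<F> \<and> B \<subseteq> E - F \<and> E - F \<subseteq> cl \<F> B"
  have "X = B" if X: "X \<in> delete \<F> F" "B \<subseteq> X" for X
  proof -
    have "x \<in> B" if x: "x \<in> X" for x
    proof (rule ccontr)
      assume "x \<notin> B"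
      moreover have "insert x B \<in> \<F>"
        using X x ind_mono[of X "insert x B"] unfolding delete_def by simp
      moreover have "x \<in> cl \<F> B" using B X x ind_sub[of X] unfolding delete_def by blast
      ultimately show False using ind_not_cl by blast
    qed
    then show ?thesis using X by blast
  qed
  then show "basis (delete \<F> F) B" using B unfolding basis_def delete_def by blast
qed

lemma basis_card_eq:
  assumes "basis (delete \<F> F) B" "basis (delete \<F> F) B'" shows "card B = card B'"
  using assms card_le_cl unfolding basis_delete_iff by (meson dual_order.trans le_antisym)

end

section \<open>Greedy bases with respect to a total order\<close>

locale ordered_matroid = matroid_loc +
  fixes lt :: "'a \<Rightarrow> 'a \<Rightarrow> bool"
  assumes order: "strict_order_on E lt"
begin

lemma lt_irrefl: "x \<in> E \<Longrightarrow> \<not> lt x x"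
  and lt_trans: "x \<in> E \<Longrightarrow> y \<in> E \<Longrightarrow> z \<in> E \<Longrightarrow> lt x y \<Longrightarrow> lt y z \<Longrightarrow> lt x z"
  and lt_total: "x \<in> E \<Longrightarrow> y \<in> E \<Longrightarrow> x \<noteq> y \<Longrightarrow> lt x y \<or> lt y x"
  using order unfolding strict_order_on_def by (simp, meson, metis)

lemma lt_asym: "x \<in> E \<Longrightarrow> y \<in> E \<Longrightarrow> lt x y \<Longrightarrow> \<not> lt y x"
  using lt_trans[of x y x] lt_irrefl[of x] by blast

text \<open>The position of \<open>x\<close> in the order. It numbers the ground set from 0, which
  turns induction and minimal choices along \<open>lt\<close> into arguments on natural numbers, and
  later indexes the array \<open>ord\<close>.\<close>

definition rnk where "rnk x = card {y\<in>E. lt y x}"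

lemma rnk_less: 
  assumes "x \<in> E" "y \<in> E" "lt x y" shows "rnk x < rnk y"
proof -
  have "z \<in> {z\<in>E. lt z y}" if "z \<in> {z\<in>E. lt z x}" for z
    using that assms lt_trans[of z x y] by simp
  moreover have "x \<in> {z\<in>E. lt z y}" "x \<notin> {z\<in>E. lt z x}" using assms lt_irrefl[of x] by simp_all
  ultimately have "{z\<in>E. lt z x} \<subset> {z\<in>E. lt z y}" by blast
  then show ?thesis unfolding rnk_def using finite_E by (intro psubset_card_mono) simp_all
qed

lemma rnk_less_iff: "x \<in> E \<Longrightarrow> y \<in> E \<Longrightarrow> rnk x < rnk y \<longleftrightarrow> lt x y"
  using rnk_less[of x y] rnk_less[of y x] lt_total[of x y] by (cases "x = y") (auto simp: lt_irrefl)

lemma rnk_inj: "inj_on rnk E"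
  using rnk_less lt_total by (intro inj_onI) (metis less_irrefl_nat)

lemma rnk_bound: 
  assumes "x \<in> E" shows "rnk x < card E"
proof -
  have "{z\<in>E. lt z x} \<subset> E" using assms lt_irrefl by blast
  then show ?thesis unfolding rnk_def using finite_E by (intro psubset_card_mono)
qed

lemma rnk_image: "rnk ` E = {..<card E}"
  using rnk_inj rnk_bound finite_E
  by (intro card_subset_eq) (auto simp: card_image)

abbreviation "gb \<equiv> greedy_basis \<F> lt"

lemma gb_sub: "gb D \<subseteq> D" unfolding greedy_basis_def by blast

text \<open>Remove the last element of \<open>S\<close>: the rest is independent by induction and
  lies before it, and a selected element is not spanned by what lies before it.\<close>

lemma sub_gb_ind:
  assumes "D \<subseteq> E" "S \<subseteq> gb D" shows "S \<in> \<F>"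
proof -
  have "finite S" using assms gb_sub finite_E finite_subset by (metis subset_trans)
  then show ?thesis using assms(2)
  proof (induction "card S" arbitrary: S)
    case 0
    then show ?case using empty_ind by simp
  next
    case (Suc n)
    have "S \<noteq> {}" using Suc.hyps(2) by auto
    then obtain x where x: "x \<in> S" "\<And>y. y \<in> S \<Longrightarrow> rnk y \<le> rnk x"
      using ex_max_nat[OF Suc.prems(1)] by blast
    have SD: "S \<subseteq> D" using Suc.prems gb_sub by blast
    have "n = card (S - {x})" using Suc.hyps(2) Suc.prems(1) x(1) by simp
    then have "S - {x} \<in> \<F>" using Suc.hyps(1)[of "S - {x}"] Suc.prems by blast
    moreover have "S - {x} \<subseteq> {y\<in>D. lt y x}"
    proof
      fix y assume y: "y \<in> S - {x}"
      then have "\<not> lt x y" using x rnk_less SD assms(1) by (meson DiffD1 leD subsetD)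
      then show "y \<in> {y\<in>D. lt y x}" using y lt_total x(1) SD assms(1) by blast
    qed
    moreover have "x \<notin> cl \<F> {y\<in>D. lt y x}" using x(1) Suc.prems unfolding greedy_basis_def by blast
    ultimately have "insert x (S - {x}) \<in> \<F>" using insert_ind by blast
    then show ?case using x(1) by (simp add: insert_absorb)
  qed
qed

lemma gb_ind: "D \<subseteq> E \<Longrightarrow> gb D \<in> \<F>" using sub_gb_ind by blast

text \<open>Induction along the order: an element that is not selected is spanned by earlier
  elements of \<open>D\<close>, and each of these is spanned by selected elements up to
  itself.\<close>

lemma gb_spans_below:
  assumes "D \<subseteq> E" "y \<in> D"
  shows "y \<in> cl \<F> {z\<in>gb D. z = y \<or> lt z y}"
  using assms(2)
proof (induction "rnk y" arbitrary: y rule: less_induct)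
  case less
  show ?case
  proof (cases "y \<in> gb D")
    case True
    then show ?thesis using cl_superset[of "{z\<in>gb D. z = y \<or> lt z y}"] by blast
  next
    case False
    then have y: "y \<in> cl \<F> {z\<in>D. lt z y}" using less.prems unfolding greedy_basis_def by blast
    have "z \<in> cl \<F> {z\<in>gb D. lt z y}" if z: "z \<in> D" "lt z y" for z
    proof -
      have zy: "z \<in> E" "y \<in> E" using z less.prems assms(1) by blast+
      have "z \<in> cl \<F> {u\<in>gb D. u = z \<or> lt u z}" using less.hyps[of z] z rnk_less zy by blast
      moreover have "{u\<in>gb D. u = z \<or> lt u z} \<subseteq> {u\<in>gb D. lt u y}"
        using z zy lt_trans gb_sub assms(1) by blast
      ultimately show ?thesis using cl_mono by blast
    qed
    then have "cl \<F> {z\<in>D. lt z y} \<subseteq> cl \<F> {z\<in>gb D. lt z y}" by (intro cl_trans) blast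
    then show ?thesis using y cl_mono[of "{z\<in>gb D. lt z y}" "{z\<in>gb D. z = y \<or> lt z y}"] by blast
  qed
qed

text \<open>Selection of \<open>x\<close> therefore depends only on the elements selected so far.
  This justifies the independence test of the greedy program and the removal of elements that are
  not selected.\<close>

lemma cl_below_gb:
  assumes "D \<subseteq> E" "x \<in> E"
  shows "cl \<F> {y\<in>D. lt y x} = cl \<F> {y\<in>gb D. lt y x}"
proof
  have "y \<in> cl \<F> {y\<in>gb D. lt y x}" if y: "y \<in> D" "lt y x" for y
  proof -
    have "{z\<in>gb D. z = y \<or> lt z y} \<subseteq> {y\<in>gb D. lt y x}"
      using y assms lt_trans gb_sub by blast
    then show ?thesis using gb_spans_below[OF assms(1) y(1)] cl_mono by blast
  qed
  then show "cl \<F> {y\<in>D. lt y x} \<subseteq> cl \<F> {y\<in>gb D. lt y x}" by (intro cl_trans) blast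
  show "cl \<F> {y\<in>gb D. lt y x} \<subseteq> cl \<F> {y\<in>D. lt y x}" using gb_sub by (intro cl_mono) blast
qed

lemma gb_spans: "D \<subseteq> E \<Longrightarrow> D \<subseteq> cl \<F> (gb D)"
  using gb_spans_below cl_mono[of "{z\<in>gb D. z = y \<or> lt z y}" "gb D" for y] by blast

lemma gb_basis: "basis (delete \<F> F) (gb (E - F))"
  unfolding basis_delete_iff using gb_ind[of "E - F"] gb_sub[of "E - F"] gb_spans[of "E - F"] by blast

text \<open>The closures that decide about selection are spanned by selected elements, which all
  survive. This is the reason why interdicting irrelevant elements has no effect.\<close>

lemma gb_remove:
  assumes "D \<subseteq> E" "S \<inter> gb D = {}"
  shows "gb (D - S) = gb D"
proof -
  have "x \<in> gb (D - S) \<longleftrightarrow> x \<in> gb D" for x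
  proof (cases "x \<in> D - S")
    case True
    then have x: "x \<in> E" using assms by blast
    have "cl \<F> {y\<in>D. lt y x} \<subseteq> cl \<F> {y\<in>D - S. lt y x}"
      unfolding cl_below_gb[OF assms(1) x] using gb_sub assms(2) by (intro cl_mono) blast
    moreover have "cl \<F> {y\<in>D - S. lt y x} \<subseteq> cl \<F> {y\<in>D. lt y x}" by (intro cl_mono) blast
    ultimately show ?thesis using True unfolding greedy_basis_def by blast
  next
    case False
    then show ?thesis using assms gb_sub by blast
  qed
  then show ?thesis by blast
qed

text \<open>Exchange argument by induction on the number of greedy elements missing from
  \<open>B\<close>: the first element in which the two sets differ is brought into \<open>B\<close>
  at the cost of a later one.\<close>

lemma gb_weight_le:
  fixes w :: "'a \<Rightarrow> real"
  assumes D: "D \<subseteq> E" and w: "\<And>x y. x \<in> D \<Longrightarrow> y \<in> D \<Longrightarrow> lt x y \<Longrightarrow> w x \<le> w y"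
  assumes "B \<in> \<F>" "B \<subseteq> D" "card B = card (gb D)"
  shows "sum w (gb D) \<le> sum w B"
  using assms(3-5)
proof (induction "card (gb D - B)" arbitrary: B rule: less_induct)
  case less
  let ?G = "gb D"
  have fG: "finite ?G" using gb_ind[OF D] ind_finite by blast
  have fB: "finite B" using less.prems ind_finite by blast
  show ?case
  proof (cases "?G - B = {}")
    case True
    then show ?thesis using less.prems fB by (metis Diff_eq_empty_iff card_subset_eq order_refl)
  next
    case False
    then have "(?G - B) \<union> (B - ?G) \<noteq> {}" by blast
    then obtain x where x: "x \<in> (?G - B) \<union> (B - ?G)"
      and xm: "\<And>y. y \<in> (?G - B) \<union> (B - ?G) \<Longrightarrow> rnk x \<le> rnk y"
      using ex_min_nat[of _ rnk] by meson
    have xE: "x \<in> E" "x \<in> D" using x less.prems(2) D gb_sub by blast+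
    have below: "{y\<in>B. lt y x} = {y\<in>?G. lt y x}"
    proof -
      have "y \<in> B \<longleftrightarrow> y \<in> ?G" if "lt y x" "y \<in> D" for y
        using xm[of y] rnk_less[of y x] that xE D by force
      then show ?thesis using less.prems(2) gb_sub by blast
    qed
    \<comment> \<open>Before \<open>x\<close> the two sets agree. If greedy had rejected
      \<open>x\<close>, the common part would span it, and \<open>B\<close> would be
      dependent.\<close>
    have xG: "x \<in> ?G"
    proof (rule ccontr)
      assume n: "x \<notin> ?G"
      then have xB: "x \<in> B" using x by blast
      have "x \<in> cl \<F> {y\<in>D. lt y x}" using n xE unfolding greedy_basis_def by blast
      then have "x \<in> cl \<F> {y\<in>B. lt y x}" using cl_below_gb[OF D xE(1)] below by simp
      moreover have "insert x {y\<in>B. lt y x} \<subseteq> B" using xB by blast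
      ultimately show False
        using ind_not_cl[of x "{y\<in>B. lt y x}"] ind_mono[OF less.prems(1)] lt_irrefl[OF xE(1)] by simp
    qed
    then have xB: "x \<notin> B" using x by blast
    \<comment> \<open>Starting the extension from \<open>insert x (B \<inter> ?G)\<close> guarantees
      that \<open>x\<close> enters, that no common element is lost, and that exactly one element
      \<open>y\<close> of \<open>B\<close> outside the greedy basis is dropped; \<open>y\<close>
      comes after \<open>x\<close>.\<close>
    have S: "insert x (B \<inter> ?G) \<in> \<F>" using xG by (intro sub_gb_ind[OF D]) blast
    have "B \<inter> ?G \<noteq> B"
      using xG xB less.prems(3) fB fG by (metis card_subset_eq inf.absorb_iff2 inf.commute)
    then have "card (B \<inter> ?G) < card B" using fB by (meson inf_le1 psubset_card_mono psubsetI)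
    then have "card (insert x (B \<inter> ?G)) \<le> card B" using fB xB by simp
    then obtain Y where Y: "Y \<in> \<F>" "insert x (B \<inter> ?G) \<subseteq> Y" "Y \<subseteq> insert x (B \<inter> ?G) \<union> B" "card Y = card B"
      using extend[OF S less.prems(1)] by blast
    have YB: "Y \<subseteq> insert x B" using Y by blast
    have "card (insert x B) = Suc (card B)" using fB xB by simp
    then obtain y where y: "y \<in> insert x B" "y \<notin> Y"
      using YB Y(4) by (metis Suc_n_not_le_n card_mono finite.insertI fB subsetI infinite_super order_refl)
    have "card (insert x B - {y}) = card B" using y fB xB by simp
    moreover have "Y \<subseteq> insert x B - {y}" using YB y by blast
    ultimately have Yeq: "Y = insert x B - {y}" using Y(4) fB
      by (metis card_subset_eq finite.insertI finite_Diff)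
    have yB: "y \<in> B" "y \<notin> ?G" "y \<noteq> x" using y Y(2) by blast+
    have "\<not> lt y x" using below yB by blast
    then have "lt x y" using lt_total[of x y] xE yB less.prems(2) D by blast
    then have wxy: "w x \<le> w y" using w xE yB less.prems(2) by blast
    have "Y = insert x (B - {y})" using Yeq yB by blast
    then have "sum w Y = w x + sum w (B - {y})" using fB xB by simp
    also have "\<dots> \<le> sum w B" using wxy sum.remove[OF fB yB(1), of w] by simp
    finally have wY: "sum w Y \<le> sum w B" .
    have "?G - Y \<subset> ?G - B" using Yeq xG xB yB by blast
    then have "card (?G - Y) < card (?G - B)" using fG by (simp add: psubset_card_mono)
    moreover have "Y \<subseteq> D" using YB xE less.prems(2) by blast
    ultimately have "sum w ?G \<le> sum w Y" using less.hyps Y less.prems(3) by simp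
    then show ?thesis using wY by simp
  qed
qed

text \<open>Sets with fewer than \<open>l\<close> elements are included because a slot whose tuple
  has repetitions or dummies removes fewer than \<open>l\<close> elements, and its basis must
  consist of relevant elements too.\<close>

definition relevant :: "nat \<Rightarrow> 'a set" where
  "relevant l = (\<Union>F\<in>{F. F \<subseteq> E \<and> card F \<le> l}. gb (E - F))"

lemma relevant_sub: "relevant l \<subseteq> E" unfolding relevant_def using gb_sub by blast

lemma gb_inter_relevant:
  assumes "F \<subseteq> E" "card F \<le> l" "relevant l \<subseteq> W"
  shows "gb (E - F) = gb (E - F \<inter> W)"
proof -
  have "card (F \<inter> W) \<le> l" using assms finite_E
    by (meson card_mono finite_subset inf_le1 le_trans)
  then have "gb (E - F \<inter> W) \<subseteq> W" using assms(1,3) unfolding relevant_def by blast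
  then have "(F - W) \<inter> gb (E - F \<inter> W) = {}" by blast
  then have "gb (E - F \<inter> W - (F - W)) = gb (E - F \<inter> W)" by (intro gb_remove) auto
  moreover have "E - F \<inter> W - (F - W) = E - F" by blast
  ultimately show ?thesis by simp
qed

section \<open>Layers of disjoint greedy bases\<close>

primrec layer :: "nat \<Rightarrow> 'a set" where
  "layer 0 = E"
| "layer (Suc j) = layer j - gb (layer j)"

lemma layer_sub: "layer j \<subseteq> E" by (induction j) auto

lemma layer_anti: "i \<le> j \<Longrightarrow> layer j \<subseteq> layer i"
  by (induction rule: dec_induct) auto

lemma layers_disjoint: "i < j \<Longrightarrow> gb (layer i) \<inter> gb (layer j) = {}"
  using layer_anti[of "Suc i" j] gb_sub[of "layer j"] by auto

lemma layers_union: "layer j = E - (\<Union>i<j. gb (layer i))"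
  by (induction j) (auto simp: lessThan_Suc)

text \<open>Pigeonhole: \<open>F\<close> has at most \<open>l\<close> elements, so one of the
  \<open>l + 1\<close> disjoint layer bases avoids it. If \<open>x\<close> is in none of these
  bases, it was rejected in that layer, so the elements of this basis before \<open>x\<close> span
  it; they are all available in \<open>E - F\<close>, and \<open>x\<close> is rejected there
  too.\<close>

lemma relevant_in_layers: "relevant l \<subseteq> (\<Union>j<Suc l. gb (layer j))"
proof
  fix x assume "x \<in> relevant l"
  then obtain F where F: "F \<subseteq> E" "card F \<le> l" "x \<in> gb (E - F)" unfolding relevant_def by blast
  then have xE: "x \<in> E" "x \<in> E - F" using gb_sub by blast+
  show "x \<in> (\<Union>j<Suc l. gb (layer j))"
  proof (rule ccontr)
    assume n: "x \<notin> (\<Union>j<Suc l. gb (layer j))"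
    have "\<exists>j<Suc l. gb (layer j) \<inter> F = {}"
    proof (rule ccontr)
      assume "\<not> ?thesis"
      then have "\<forall>j\<in>{..<Suc l}. \<exists>y. y \<in> gb (layer j) \<inter> F" by blast
      then obtain g where g: "\<And>j. j < Suc l \<Longrightarrow> g j \<in> gb (layer j) \<inter> F"
        by (metis lessThan_iff)
      have "inj_on g {..<Suc l}"
      proof (rule inj_onI)
        fix i j assume ij: "i \<in> {..<Suc l}" "j \<in> {..<Suc l}" "g i = g j"
        have ne: "g i \<in> gb (layer i) \<inter> gb (layer j)" using g[of i] g[of j] ij by auto
        show "i = j"
        proof (rule ccontr)
          assume "i \<noteq> j"
          then have "i < j \<or> j < i" by auto
          then show False using ne layers_disjoint by blast
        qed
      qed
      then have "card (g ` {..<Suc l}) = Suc l" by (simp add: card_image)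
      moreover have "g ` {..<Suc l} \<subseteq> F" using g by blast
      ultimately show False using F(1,2) finite_E
        by (metis Suc_n_not_le_n card_mono finite_subset le_trans)
    qed
    then obtain j where j: "j < Suc l" "gb (layer j) \<inter> F = {}" by blast
    have "x \<notin> (\<Union>i<j. gb (layer i))" using n j by auto
    then have "x \<in> layer j" "x \<notin> gb (layer j)" using n j xE layers_union[of j] by blast+
    then have "x \<in> cl \<F> {y\<in>layer j. lt y x}" unfolding greedy_basis_def by blast
    then have "x \<in> cl \<F> {y\<in>gb (layer j). lt y x}" using cl_below_gb layer_sub xE by metis
    moreover have "{y\<in>gb (layer j). lt y x} \<subseteq> {y\<in>E - F. lt y x}"
      using j gb_sub[of "layer j"] layer_sub[of j] by blast
    ultimately have "x \<in> cl \<F> {y\<in>E - F. lt y x}" using cl_mono by blast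
    then show False using F(3) unfolding greedy_basis_def by blast
  qed
qed

lemma card_gb_le: "D \<subseteq> E \<Longrightarrow> card (gb D) \<le> card (gb E)"
  using card_le_cl gb_ind gb_spans gb_sub by (meson order_refl subset_trans)

lemma card_layers: "card (\<Union>j<Suc l. gb (layer j)) \<le> Suc l * card (gb E)"
proof -
  have "card (\<Union>j<Suc l. gb (layer j)) \<le> (\<Sum>j<Suc l. card (gb (layer j)))"
    by (rule card_UN_le) simp
  also have "\<dots> \<le> (\<Sum>j<Suc l. card (gb E))" by (intro sum_mono card_gb_le layer_sub)
  finally show ?thesis by simp
qed

lemma card_relevant: "card (relevant l) \<le> Suc l * card (gb E)"
proof -
  have "finite (\<Union>j<Suc l. gb (layer j))"
    using gb_ind layer_sub ind_finite by blast
  then show ?thesis using card_mono[OF _ relevant_in_layers] card_layers le_trans by blast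
qed

end

text \<open>A transposition of two neighbours: the last clause says that no element lies between
  \<open>e\<close> and \<open>f\<close>.\<close>

definition order_swap :: "'a set \<Rightarrow> 'a \<Rightarrow> 'a \<Rightarrow> ('a \<Rightarrow> 'a \<Rightarrow> bool) \<Rightarrow> ('a \<Rightarrow> 'a \<Rightarrow> bool) \<Rightarrow> bool" where
  "order_swap E e f lt lt' \<longleftrightarrow> strict_order_on E lt \<and> strict_order_on E lt' \<and>
     e \<in> E \<and> f \<in> E \<and> lt e f \<and> lt' f e \<and>
     (\<forall>x\<in>E. \<forall>y\<in>E. {x, y} \<noteq> {e, f} \<longrightarrow> lt x y = lt' x y) \<and>
     (\<forall>z\<in>E. z \<noteq> e \<longrightarrow> z \<noteq> f \<longrightarrow> lt z e = lt z f)"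

text \<open>Elements other than \<open>e\<close> and \<open>f\<close> keep their predecessors. The
  set before \<open>e\<close> only grows, so \<open>e\<close> cannot enter the basis; the set before
  \<open>f\<close> only shrinks, so \<open>f\<close> cannot leave it. Both bases have the same size,
  so the only possible change is the exchange of \<open>e\<close> for \<open>f\<close>, and it
  happens exactly if the exchanged set is independent.\<close>

lemma (in matroid_loc) greedy_basis_order_swap:
  assumes sw: "order_swap E e f lt lt'" and D: "D \<subseteq> E"
  shows "\<And>x. x \<noteq> e \<Longrightarrow> x \<noteq> f \<Longrightarrow> x \<in> greedy_basis \<F> lt' D \<longleftrightarrow> x \<in> greedy_basis \<F> lt D"
    and "e \<in> greedy_basis \<F> lt' D \<Longrightarrow> e \<in> greedy_basis \<F> lt D"
    and "greedy_basis \<F> lt' D =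
      (if e \<in> greedy_basis \<F> lt D \<and> f \<in> D - greedy_basis \<F> lt D \<and>
          insert f (greedy_basis \<F> lt D - {e}) \<in> \<F>
       then insert f (greedy_basis \<F> lt D - {e}) else greedy_basis \<F> lt D)"
proof -
  have o1: "strict_order_on E lt" and o2: "strict_order_on E lt'"
    and ef: "e \<in> E" "f \<in> E" "lt e f" "lt' f e"
    using sw unfolding order_swap_def by blast+
  have same: "lt x y = lt' x y" if "x \<in> E" "y \<in> E" "{x, y} \<noteq> {e, f}" for x y
    using sw that unfolding order_swap_def by blast
  have adj: "lt z e = lt z f" if "z \<in> E" "z \<noteq> e" "z \<noteq> f" for z
    using sw that unfolding order_swap_def by blast
  interpret A: ordered_matroid E \<F> lt by unfold_locales (rule o1)
  interpret B: ordered_matroid E \<F> lt' by unfold_locales (rule o2)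
  let ?G = "greedy_basis \<F> lt D" and ?G' = "greedy_basis \<F> lt' D"
  have ne: "e \<noteq> f" using ef A.lt_irrefl by blast
  have other: "x \<in> ?G' \<longleftrightarrow> x \<in> ?G" if "x \<noteq> e" "x \<noteq> f" for x
  proof (cases "x \<in> D")
    case True
    have "{y\<in>D. lt' y x} = {y\<in>D. lt y x}" using same True D that by blast
    then show ?thesis unfolding greedy_basis_def by simp
  next
    case False
    then show ?thesis using A.gb_sub B.gb_sub by blast
  qed
  then show "\<And>x. x \<noteq> e \<Longrightarrow> x \<noteq> f \<Longrightarrow> x \<in> ?G' \<longleftrightarrow> x \<in> ?G" .
  have sube: "{y\<in>D. lt y e} \<subseteq> {y\<in>D. lt' y e}"
  proof
    fix y assume y: "y \<in> {y\<in>D. lt y e}"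
    then have "y \<noteq> f" "y \<noteq> e" using ef A.lt_asym A.lt_irrefl by blast+
    then show "y \<in> {y\<in>D. lt' y e}" using y same[of y e] D ef by blast
  qed
  show emono: "e \<in> ?G' \<Longrightarrow> e \<in> ?G"
    using cl_mono[OF sube] unfolding greedy_basis_def by blast
  have subf: "{y\<in>D. lt' y f} \<subseteq> {y\<in>D. lt y e}"
  proof
    fix y assume y: "y \<in> {y\<in>D. lt' y f}"
    then have "y \<noteq> f" "y \<noteq> e" using ef B.lt_asym B.lt_irrefl by blast+
    then show "y \<in> {y\<in>D. lt y e}" using y same[of y f] adj[of y] D ef by blast
  qed
  have sub2: "{y\<in>D. lt y e} \<subseteq> {y\<in>D. lt y f}"
    using ef A.lt_trans D by blast
  have fmono: "f \<in> ?G \<Longrightarrow> f \<in> ?G'"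
    using cl_mono[OF subset_trans[OF subf sub2]] unfolding greedy_basis_def by blast
  have fG: "finite ?G" "finite ?G'" using A.gb_ind[OF D] B.gb_ind[OF D] ind_finite by blast+
  have card: "card ?G = card ?G'"
    using card_le_cl[OF A.gb_ind[OF D] B.gb_ind[OF D]] card_le_cl[OF B.gb_ind[OF D] A.gb_ind[OF D]]
      A.gb_spans[OF D] B.gb_spans[OF D] A.gb_sub[of D] B.gb_sub[of D] by (meson le_antisym subset_trans)
  define H where "H = ?G - {e, f}"
  have H: "H = ?G' - {e, f}" using other unfolding H_def by blast
  have cG: "card ?G = card H + card (?G \<inter> {e, f})" unfolding H_def
    using fG by (metis Int_Diff_Un Int_Diff_disjoint add.commute card_Un_disjoint finite_Diff finite_Int)
  have cG': "card ?G' = card H + card (?G' \<inter> {e, f})" unfolding H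
    using fG by (metis Int_Diff_Un Int_Diff_disjoint add.commute card_Un_disjoint finite_Diff finite_Int)
  have cc: "card (?G \<inter> {e, f}) = card (?G' \<inter> {e, f})" using card cG cG' by simp
  show "?G' = (if e \<in> ?G \<and> f \<in> D - ?G \<and> insert f (?G - {e}) \<in> \<F> then insert f (?G - {e}) else ?G)"
  proof (cases "e \<in> ?G \<and> f \<notin> ?G")
    case True
    then have "card (?G' \<inter> {e, f}) = 1" using cc by (simp add: Int_insert_right)
    then have alt: "(e \<in> ?G' \<and> f \<notin> ?G') \<or> (e \<notin> ?G' \<and> f \<in> ?G')"
      using ne by (auto simp: Int_insert_right split: if_splits)
    show ?thesis
    proof (cases "f \<in> ?G'")
      case f: True
      have "x \<in> ?G' \<longleftrightarrow> x \<in> insert f (?G - {e})" for x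
        using f alt other[of x] by (cases "x = e"; cases "x = f") auto
      then have "?G' = insert f (?G - {e})" by blast
      moreover have "?G' \<in> \<F>" "f \<in> D" using B.gb_ind[OF D] f B.gb_sub by blast+
      ultimately show ?thesis using True by simp
    next
      case f: False
      have "x \<in> ?G' \<longleftrightarrow> x \<in> ?G" for x
        using f alt True other[of x] by (cases "x = e"; cases "x = f") auto
      then have eq: "?G' = ?G" by blast
      \<comment> \<open>If \<open>f\<close> is rejected in the new order, it is spanned by what
        precedes \<open>e\<close>, hence by greedy elements before \<open>e\<close>, hence by
        \<open>?G - {e}\<close>; then the exchanged set is dependent.\<close>
      have "\<not> (f \<in> D \<and> insert f (?G - {e}) \<in> \<F>)"
      proof
        assume a: "f \<in> D \<and> insert f (?G - {e}) \<in> \<F>"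
        then have "f \<in> cl \<F> {y\<in>D. lt' y f}" using f unfolding greedy_basis_def by blast
        then have "f \<in> cl \<F> {y\<in>D. lt y e}" using cl_mono[OF subf] by blast
        then have "f \<in> cl \<F> {y\<in>?G. lt y e}" using A.cl_below_gb[OF D ef(1)] by simp
        moreover have "{y\<in>?G. lt y e} \<subseteq> ?G - {e}" using A.lt_irrefl ef by blast
        ultimately have "f \<in> cl \<F> (?G - {e})" using cl_mono by blast
        moreover have "f \<notin> ?G - {e}" using True by blast
        ultimately show False using a ind_not_cl by blast
      qed
      then show ?thesis using eq by auto
    qed
  next
    case False
    have "e \<in> ?G' \<longleftrightarrow> e \<in> ?G" "f \<in> ?G' \<longleftrightarrow> f \<in> ?G"
      using emono fmono cc False ne by (auto simp: Int_insert_right split: if_splits)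
    then have "x \<in> ?G' \<longleftrightarrow> x \<in> ?G" for x using other[of x] by blast
    then have "?G' = ?G" by blast
    then show ?thesis using False by auto
  qed
qed

section \<open>Interdicted values and most vital sets\<close>

text \<open>Lexicographic selection: decide for 0, 1, 2, and so on, whether some remaining set
  contains the number, and if so discard the sets that do not. The induction runs over the numbers
  still undecided, below which all remaining sets agree.\<close>

lemma least_difference_choice:
  assumes "M \<noteq> {}" "\<And>B. B \<in> M \<Longrightarrow> B \<subseteq> {..<m}"
  shows "\<exists>B\<in>M. \<forall>B'\<in>M. B' \<noteq> B \<longrightarrow> Min ((B - B') \<union> (B' - B)) \<in> (B :: nat set)"
proof -
  have "\<exists>B\<in>M. \<forall>B'\<in>M. B' \<noteq> B \<longrightarrow> Min ((B - B') \<union> (B' - B)) \<in> B"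
    if "x \<le> m" "M \<noteq> {}" "\<And>B. B \<in> M \<Longrightarrow> B \<subseteq> {..<m}"
      "\<And>B B'. B \<in> M \<Longrightarrow> B' \<in> M \<Longrightarrow> B \<inter> {..<x} = B' \<inter> {..<x}" for M x
    using that
  proof (induction "m - x" arbitrary: M x)
    case 0
    then have x: "x = m" by simp
    obtain B where B: "B \<in> M" using 0 by blast
    have "B' = B" if "B' \<in> M" for B'
      using 0(5)[OF that B] 0(4)[OF that] 0(4)[OF B] x by blast
    then show ?case using B by blast
  next
    case (Suc n)
    have n: "n = m - Suc x" "Suc x \<le> m" using Suc.hyps(2) by simp_all
    define M' where "M' = {B\<in>M. x \<in> B}"
    show ?case
    proof (cases "M' = {}")
      case True
      have "B \<inter> {..<Suc x} = B' \<inter> {..<Suc x}" if "B \<in> M" "B' \<in> M" for B B'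
        using Suc.prems(4)[OF that] True that unfolding M'_def lessThan_Suc by blast
      then show ?thesis using Suc.hyps(1)[OF n Suc.prems(2,3)] by blast
    next
      case False
      have "B \<inter> {..<Suc x} = B' \<inter> {..<Suc x}" if "B \<in> M'" "B' \<in> M'" for B B'
        using Suc.prems(4)[of B B'] that unfolding M'_def lessThan_Suc by blast
      moreover have "\<And>B. B \<in> M' \<Longrightarrow> B \<subseteq> {..<m}" using Suc.prems(3) unfolding M'_def by blast
      ultimately obtain B where B: "B \<in> M'" "\<forall>B'\<in>M'. B' \<noteq> B \<longrightarrow> Min ((B - B') \<union> (B' - B)) \<in> B"
        using Suc.hyps(1)[OF n False] by blast
      have "Min ((B - B') \<union> (B' - B)) \<in> B" if B': "B' \<in> M" "B' \<noteq> B" for B'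
      proof (cases "B' \<in> M'")
        case True
        then show ?thesis using B B' by blast
      next
        case f: False
        have BM: "B \<in> M" "x \<in> B" "x \<notin> B'" using B(1) f B' unfolding M'_def by blast+
        have eq: "B \<inter> {..<x} = B' \<inter> {..<x}" using Suc.prems(4) BM(1) B'(1) by blast
        have "finite ((B - B') \<union> (B' - B))"
          using Suc.prems(3)[OF BM(1)] Suc.prems(3)[OF B'(1)] finite_subset by blast
        moreover have "x \<le> y" if y: "y \<in> (B - B') \<union> (B' - B)" for y
        proof (rule ccontr)
          assume "\<not> x \<le> y"
          then have "y \<in> {..<x}" by simp
          then show False using eq y by blast
        qed
        ultimately have "Min ((B - B') \<union> (B' - B)) = x" using BM by (intro Min_eqI) simp_all
        then show ?thesis using BM by simp
      qed
      then show ?thesis using B(1) unfolding M'_def by blast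
    qed
  qed
  from this[of 0 M] assms show ?thesis by simp
qed

text \<open>The definite description in \<open>opt_basis\<close> is proper: a candidate exists by
  \<open>least_difference_choice\<close>, and of two different candidates each would contain the
  least element of their symmetric difference.\<close>

lemma opt_basis_min:
  assumes "finite \<G>" "\<And>X. X \<in> \<G> \<Longrightarrow> X \<subseteq> {..<m}" "basis \<G> B0"
  shows "min_weight_basis \<G> a b \<theta> (opt_basis \<G> a b \<theta>)"
proof -
  define M where "M = {B. min_weight_basis \<G> a b \<theta> B}"
  have fin: "finite {B. basis \<G> B}" using assms(1) by (rule finite_subset[rotated]) (auto simp: basis_def)
  have "{B. basis \<G> B} \<noteq> {}" using assms(3) by blast
  then have "Min ((\<lambda>B. weight a b B \<theta>) ` {B. basis \<G> B}) \<in> (\<lambda>B. weight a b B \<theta>) ` {B. basis \<G> B}"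
    using fin by (intro Min_in) simp_all
  then obtain B where B: "basis \<G> B" "weight a b B \<theta> = Min ((\<lambda>B. weight a b B \<theta>) ` {B. basis \<G> B})"
    by force
  have "B \<in> M" unfolding M_def min_weight_basis_def using B fin by simp
  moreover have sub: "X \<subseteq> {..<m}" if "X \<in> M" for X
    using that assms(2) unfolding M_def min_weight_basis_def basis_def by simp
  ultimately obtain C where C: "C \<in> M" "\<forall>B'\<in>M. B' \<noteq> C \<longrightarrow> Min ((C - B') \<union> (B' - C)) \<in> C"
    using least_difference_choice[of M m] by blast
  have "opt_basis \<G> a b \<theta> = C" unfolding opt_basis_def
  proof (rule the_equality)
    show "min_weight_basis \<G> a b \<theta> C \<and>
      (\<forall>B'. min_weight_basis \<G> a b \<theta> B' \<and> B' \<noteq> C \<longrightarrow> Min ((C - B') \<union> (B' - C)) \<in> C)"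
      using C unfolding M_def by blast
  next
    fix D assume D: "min_weight_basis \<G> a b \<theta> D \<and>
      (\<forall>B'. min_weight_basis \<G> a b \<theta> B' \<and> B' \<noteq> D \<longrightarrow> Min ((D - B') \<union> (B' - D)) \<in> D)"
    show "D = C"
    proof (rule ccontr)
      assume ne: "D \<noteq> C"
      let ?x = "Min ((C - D) \<union> (D - C))"
      have DM: "D \<in> M" using D unfolding M_def by blast
      have "?x \<in> C" using C(2) DM ne by blast
      moreover have "?x \<in> D" using D C(1) ne unfolding M_def by (metis Un_commute mem_Collect_eq)
      moreover have "?x \<in> (C - D) \<union> (D - C)"
        using ne finite_subset[OF sub[OF DM]] finite_subset[OF sub[OF C(1)]] by (intro Min_in) auto
      ultimately show False by blast
    qed
  qed
  then show ?thesis using C(1) unfolding M_def by simp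
qed

locale interdiction =
  fixes l m :: nat and \<F> :: "nat set set" and a b :: "nat \<Rightarrow> rat" and I :: "real set"
  assumes inst: "interdiction_instance l m \<F> a b I" and l_pos: "0 < l"
begin

sublocale matroid_loc "{..<m}" \<F>
  using inst unfolding interdiction_instance_def by unfold_locales blast

abbreviation "E \<equiv> {..<m}"
abbreviation "k \<equiv> matroid_rank \<F>"
abbreviation "wt \<equiv> elem_weight a b"

lemma k_pos: "0 < k" and l_le: "l \<le> m" and I_interval: "is_interval I" and I_ne: "I \<noteq> {}"
  using inst by (simp_all add: interdiction_instance_def)

lemma basis_exists: "F \<subseteq> E \<Longrightarrow> card F = l \<Longrightarrow> \<exists>B. basis (delete \<F> F) B \<and> card B = k"
  using inst by (simp add: interdiction_instance_def)

lemma unique_tie: "\<theta> \<in> I \<Longrightarrow> e < m \<Longrightarrow> f < m \<Longrightarrow> e' < m \<Longrightarrow> f' < m \<Longrightarrow> e \<noteq> f \<Longrightarrow> wt e \<theta> = wt f \<theta> \<Longrightarrow>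
    e' \<noteq> f' \<Longrightarrow> wt e' \<theta> = wt f' \<theta> \<Longrightarrow> {e, f} = {e', f'}"
  using inst unfolding interdiction_instance_def by (elim conjE) (meson lessThan_iff)

lemma coeffs_distinct: "e < m \<Longrightarrow> f < m \<Longrightarrow> e \<noteq> f \<Longrightarrow> (a e, b e) \<noteq> (a f, b f)"
  using inst by (simp add: interdiction_instance_def)

lemma card_le_k: "X \<in> \<F> \<Longrightarrow> card X \<le> k"
  unfolding matroid_rank_def using finite_ind by simp

text \<open>The assumption on cardinalities speaks only of sets with exactly \<open>l\<close>
  elements. A smaller \<open>F\<close> is enlarged to such a set, whose basis is spanned by
  \<open>B\<close>; this gives at least \<open>k\<close> elements, and the rank gives at most
  \<open>k\<close>.\<close>

lemma basis_card: 
  assumes "F \<subseteq> E" "card F \<le> l" "basis (delete \<F> F) B" shows "card B = k"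
proof -
  obtain F' where F': "F \<subseteq> F'" "F' \<subseteq> E" "card F' = l"
    using exists_subset_between[of F l E] assms l_le by auto
  obtain B' where B': "basis (delete \<F> F') B'" "card B' = k" using basis_exists F' by blast
  then have "B' \<in> \<F>" "B' \<subseteq> E - F'" by (simp_all add: basis_delete_iff)
  moreover have "E - F' \<subseteq> cl \<F> B" using assms(3) F' unfolding basis_delete_iff by blast
  moreover have B: "B \<in> \<F>" using assms(3) by (simp add: basis_delete_iff)
  ultimately have "card B' \<le> card B" using card_le_cl[of B B'] by blast
  then show ?thesis using card_le_k[OF B] B'(2) by simp
qed

text \<open>The inequality is weak, so at an equality point the orders of both adjacent cells are
  compatible. Cells can therefore be treated as closed intervals.\<close>

definition compatible :: "(nat \<Rightarrow> nat \<Rightarrow> bool) \<Rightarrow> real \<Rightarrow> bool" where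
  "compatible lt \<theta> \<longleftrightarrow> (\<forall>x\<in>E. \<forall>y\<in>E. lt x y \<longrightarrow> wt x \<theta> \<le> wt y \<theta>)"

text \<open>The order of the weights immediately to the right of \<open>\<theta>\<close>: a tie at
  \<open>\<theta>\<close> is resolved by the slope.\<close>

definition right_less :: "real \<Rightarrow> nat \<Rightarrow> nat \<Rightarrow> bool" where
  "right_less \<theta> x y \<longleftrightarrow> wt x \<theta> < wt y \<theta> \<or> wt x \<theta> = wt y \<theta> \<and> b x < b y"

text \<open>The order of the weights for all sufficiently small parameters, where the larger slope
  gives the smaller weight.\<close>

definition left_less :: "nat \<Rightarrow> nat \<Rightarrow> bool" where
  "left_less x y \<longleftrightarrow> b y < b x \<or> b x = b y \<and> a x < a y"

lemma right_less_order: "strict_order_on E (right_less \<theta>)"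
  unfolding strict_order_on_def
proof (intro conjI ballI impI)
  fix x y assume "x \<in> E" "y \<in> E" "x \<noteq> y"
  then have "(a x, b x) \<noteq> (a y, b y)" using coeffs_distinct by simp
  then show "right_less \<theta> x y \<or> right_less \<theta> y x"
    unfolding right_less_def elem_weight_def by (cases "b x" "b y" rule: linorder_cases) (auto simp: of_rat_less)
qed (auto simp: right_less_def)

lemma left_less_order: "strict_order_on E left_less"
  unfolding strict_order_on_def
proof (intro conjI ballI impI)
  fix x y assume "x \<in> E" "y \<in> E" "x \<noteq> y"
  then have "(a x, b x) \<noteq> (a y, b y)" using coeffs_distinct by simp
  then show "left_less x y \<or> left_less y x" unfolding left_less_def by auto
qed (auto simp: left_less_def)

lemma wt_zero_between:
  assumes "0 \<le> wt y s - wt x s" "wt y t - wt x t < 0" "s < t"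
  obtains r where "s \<le> r" "r < t" "wt x r = wt y r"
proof -
  have "continuous_on {s..t} (\<lambda>r. wt x r - wt y r)" unfolding elem_weight_def by (intro continuous_intros)
  then obtain r where r: "s \<le> r" "r \<le> t" "wt x r - wt y r = 0"
    using IVT'[of "\<lambda>r. wt x r - wt y r" s 0 t] assms by auto
  moreover have "r \<noteq> t" using r assms by auto
  ultimately show ?thesis using that by force
qed

text \<open>A violation at \<open>t\<close> would force a crossing in between, which can only be at
  \<open>\<theta>\<close> itself; but there the tie was resolved by the slopes, which rules out a
  violation further right.\<close>

lemma right_less_compatible:
  assumes nc: "\<And>t x y. \<theta> < t \<Longrightarrow> t < \<theta>' \<Longrightarrow> x \<in> E \<Longrightarrow> y \<in> E \<Longrightarrow> x \<noteq> y \<Longrightarrow> wt x t \<noteq> wt y t"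
    and t: "\<theta> \<le> t" "t \<le> \<theta>'"
  shows "compatible (right_less \<theta>) t"
  unfolding compatible_def
proof (intro ballI impI)
  fix x y assume xy: "x \<in> E" "y \<in> E" "right_less \<theta> x y"
  show "wt x t \<le> wt y t"
  proof (rule ccontr)
    assume n: "\<not> ?thesis"
    then have "\<theta> < t" "x \<noteq> y" using xy(3) t by (auto simp: right_less_def less_le)
    moreover have "0 \<le> wt y \<theta> - wt x \<theta>" using xy(3) by (auto simp: right_less_def)
    ultimately obtain r where r: "\<theta> \<le> r" "r < t" "wt x r = wt y r"
      using wt_zero_between[of y \<theta> x t] n by auto
    then have "r = \<theta>" using nc[of r x y] xy t \<open>x \<noteq> y\<close> by force
    then have eq: "wt x \<theta> = wt y \<theta>" and bb: "b x < b y" using r xy(3) by (auto simp: right_less_def)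
    have "(t - \<theta>) * (of_rat (b y) - of_rat (b x)) > 0" using bb \<open>\<theta> < t\<close> by (simp add: of_rat_less)
    then show False using eq n unfolding elem_weight_def by (simp add: algebra_simps)
  qed
qed

lemma left_less_compatible:
  assumes nc: "\<And>s x y. s < t \<Longrightarrow> x \<in> E \<Longrightarrow> y \<in> E \<Longrightarrow> x \<noteq> y \<Longrightarrow> wt x s \<noteq> wt y s"
  shows "compatible left_less t"
  unfolding compatible_def
proof (intro ballI impI)
  fix x y assume xy: "x \<in> E" "y \<in> E" "left_less x y"
  show "wt x t \<le> wt y t"
  proof (cases "b x = b y")
    case True
    then show ?thesis using xy(3) unfolding left_less_def elem_weight_def by (simp add: of_rat_less_eq)
  next
    case False
    then have bb: "b y < b x" using xy(3) unfolding left_less_def by simp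
    \<comment> \<open>The crossing point of the two lines. As there are no ties before
      \<open>t\<close>, it is not before \<open>t\<close>, and before the crossing the steeper line
      is the lower one.\<close>
    define s where "s = (of_rat (a y) - of_rat (a x)) / (of_rat (b x) - of_rat (b y) :: real)"
    have d: "(of_rat (b x) - of_rat (b y) :: real) > 0" using bb by (simp add: of_rat_less)
    then have nz: "of_rat (b x) - of_rat (b y) \<noteq> (0 :: real)" by linarith
    have "s * (of_rat (b x) - of_rat (b y)) = of_rat (a y) - of_rat (a x)"
      unfolding s_def by (rule nonzero_eq_divide_eq[OF nz, THEN iffD1]) (rule refl)
    then have eq: "wt x s = wt y s" unfolding elem_weight_def by (simp add: algebra_simps)
    have "x \<noteq> y" using False by blast
    then have "t \<le> s" using nc[of s x y] eq xy by force
    then have "(s - t) * (of_rat (b x) - of_rat (b y)) \<ge> 0" using d by simp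
    then show ?thesis using eq unfolding elem_weight_def by (simp add: algebra_simps)
  qed
qed

text \<open>By the uniqueness of ties only \<open>e\<close> and \<open>f\<close> have equal weight
  at \<open>\<theta>\<close>; every other pair is strictly ordered there, so both orders agree on
  it. The earlier parameter \<open>t\<close> determines the order of \<open>e\<close> and
  \<open>f\<close> before the tie.\<close>

lemma order_change:
  assumes o: "strict_order_on E lt" and c: "compatible lt \<theta>" and I: "\<theta> \<in> I"
    and ef: "e \<in> E" "f \<in> E" "wt e \<theta> = wt f \<theta>" "b f < b e"
    and t: "t < \<theta>" "compatible lt t"
  shows "lt e f" "right_less \<theta> f e"
    and "\<And>x y. x \<in> E \<Longrightarrow> y \<in> E \<Longrightarrow> {x, y} \<noteq> {e, f} \<Longrightarrow> lt x y = right_less \<theta> x y"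
    and "\<And>z. z \<in> E \<Longrightarrow> z \<noteq> e \<Longrightarrow> z \<noteq> f \<Longrightarrow> lt z e = lt z f"
proof -
  have ne: "e \<noteq> f" using ef by blast
  show "right_less \<theta> f e" using ef unfolding right_less_def by simp
  have "(\<theta> - t) * (of_rat (b e) - of_rat (b f)) > 0" using ef(4) t(1) by (simp add: of_rat_less)
  then have "wt e t < wt f t" using ef(3) unfolding elem_weight_def by (simp add: algebra_simps)
  then have "\<not> lt f e" using t(2) ef unfolding compatible_def by force
  then show "lt e f" using o ef ne unfolding strict_order_on_def by blast
  have strict: "wt x \<theta> \<noteq> wt y \<theta>" if "x \<in> E" "y \<in> E" "{x, y} \<noteq> {e, f}" "x \<noteq> y" for x y
    using unique_tie[OF I, of x y e f] that ef ne by auto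
  have imp: "right_less \<theta> x y" if "x \<in> E" "y \<in> E" "{x, y} \<noteq> {e, f}" "lt x y" for x y
  proof -
    have "x \<noteq> y" using that o unfolding strict_order_on_def by blast
    moreover have "wt x \<theta> \<le> wt y \<theta>" using c that unfolding compatible_def by blast
    ultimately show ?thesis using strict[of x y] that unfolding right_less_def by simp
  qed
  show same: "lt x y = right_less \<theta> x y" if xy: "x \<in> E" "y \<in> E" "{x, y} \<noteq> {e, f}" for x y
  proof (cases "x = y")
    case True
    then show ?thesis using xy o right_less_order[of \<theta>] unfolding strict_order_on_def by blast
  next
    case False
    then have "lt x y \<or> lt y x" using o xy unfolding strict_order_on_def by blast
    moreover have "\<not> (right_less \<theta> x y \<and> right_less \<theta> y x)" unfolding right_less_def by auto
    moreover have "{y, x} \<noteq> {e, f}" using xy(3) by blast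
    ultimately show ?thesis using imp[of x y] imp[of y x] xy by blast
  qed
  show "lt z e = lt z f" if z: "z \<in> E" "z \<noteq> e" "z \<noteq> f" for z
  proof -
    have 1: "{z, e} \<noteq> {e, f}" "{z, f} \<noteq> {e, f}" using z by blast+
    have "wt z \<theta> \<noteq> wt e \<theta>" using strict[OF z(1) ef(1) 1(1) z(2)] .
    then show ?thesis
      using same[OF z(1) ef(1) 1(1)] same[OF z(1) ef(2) 1(2)] ef(3) unfolding right_less_def by auto
  qed
qed

end

section \<open>Values of interdicted sets for a fixed order\<close>

locale ordered_interdiction = interdiction +
  fixes lt :: "nat \<Rightarrow> nat \<Rightarrow> bool"
  assumes lt_order: "strict_order_on {..<m} lt"
begin

sublocale ordered_matroid "{..<m}" \<F> lt
  by unfold_locales (rule lt_order)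

lemma card_gb: "F \<subseteq> E \<Longrightarrow> card F \<le> l \<Longrightarrow> card (gb (E - F)) = k"
  using basis_card gb_basis by blast

lemma card_gb_E: "card (gb E) = k"
  using card_gb[of "{}"] by simp

text \<open>Only the weight of the optimal basis enters the value, so the resolution of ties in
  \<open>opt_basis\<close> need not agree with \<open>lt\<close>: both bases have minimum
  weight.\<close>

lemma interdicted_value_eq:
  assumes "compatible lt \<theta>"
  shows "interdicted_value \<F> a b F \<theta> = weight a b (gb (E - F)) \<theta>"
proof -
  let ?B = "opt_basis (delete \<F> F) a b \<theta>"
  have "min_weight_basis (delete \<F> F) a b \<theta> ?B"
  proof (rule opt_basis_min)
    show "finite (delete \<F> F)" unfolding delete_def using finite_ind by simp
    show "X \<subseteq> E" if "X \<in> delete \<F> F" for X using that ind_sub unfolding delete_def by blast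
  qed (rule gb_basis)
  then have b: "basis (delete \<F> F) ?B" and le: "weight a b ?B \<theta> \<le> weight a b (gb (E - F)) \<theta>"
    using gb_basis unfolding min_weight_basis_def by blast+
  have "?B \<in> \<F>" "?B \<subseteq> E - F" using b unfolding basis_delete_iff by blast+
  then have "weight a b (gb (E - F)) \<theta> \<le> weight a b ?B \<theta>" unfolding weight_def
    using basis_card_eq[OF b gb_basis] assms by (intro gb_weight_le) (auto simp: compatible_def)
  then show ?thesis using le unfolding interdicted_value_def by simp
qed

text \<open>All bases involved have \<open>k\<close> elements, so the basis for the larger set
  \<open>F'\<close> also competes in the complement of \<open>F\<close>.\<close>

lemma gb_weight_mono:
  assumes "compatible lt \<theta>" "F \<subseteq> F'" "F' \<subseteq> E" "card F' \<le> l"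
  shows "weight a b (gb (E - F)) \<theta> \<le> weight a b (gb (E - F')) \<theta>"
proof -
  have "card F \<le> l" using assms by (meson card_mono finite_E finite_subset le_trans)
  then have "card (gb (E - F')) = card (gb (E - F))" using card_gb assms by (metis subset_trans)
  moreover have "gb (E - F') \<in> \<F>" "gb (E - F') \<subseteq> E - F"
    using gb_ind[of "E - F'"] gb_sub[of "E - F'"] assms(2) by blast+
  ultimately show ?thesis unfolding weight_def
    using assms(1) by (intro gb_weight_le) (auto simp: compatible_def)
qed

text \<open>Otherwise all relevant elements could be removed at once. What remains still has a
  non-empty greedy basis, whose elements are relevant by definition. Hence fewer than
  \<open>l\<close> relevant elements can always be completed to \<open>l\<close> of them.\<close>

lemma card_relevant_gt: "l < card (relevant l)"
proof (rule ccontr)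
  assume n: "\<not> ?thesis"
  let ?R = "relevant l"
  have "card (gb (E - ?R)) = k" using n relevant_sub by (intro card_gb) simp_all
  then have "gb (E - ?R) \<noteq> {}" using k_pos by auto
  moreover have "gb (E - ?R) \<subseteq> ?R" using n relevant_sub[of l] unfolding relevant_def by (intro UN_upper) simp
  moreover have "gb (E - ?R) \<subseteq> E - ?R" using gb_sub by blast
  ultimately show False by blast
qed

lemma finite_relevant: "finite (relevant l)"
  using relevant_sub finite_subset by blast

text \<open>An arbitrary \<open>F\<close> is cut down to its relevant part without changing the
  value and then filled up with relevant elements without decreasing it, so the best candidate in
  \<open>S\<close> is best among all sets of \<open>l\<close> elements.\<close>

lemma most_vital_cell:
  assumes c: "compatible lt \<theta>" 
    and S: "\<And>F. F \<in> S \<Longrightarrow> F \<subseteq> E \<and> card F = l"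
    and all: "\<And>F. F \<subseteq> relevant l \<Longrightarrow> card F = l \<Longrightarrow> F \<in> S"
    and F0: "F0 \<in> S" "\<And>F. F \<in> S \<Longrightarrow> weight a b (gb (E - F)) \<theta> \<le> weight a b (gb (E - F0)) \<theta>"
  shows "most_vital l m \<F> a b \<theta> F0"
    and "interdiction_value l m \<F> a b \<theta> = weight a b (gb (E - F0)) \<theta>"
proof -
  let ?v = "\<lambda>F. weight a b (gb (E - F)) \<theta>"
  have le: "?v F \<le> ?v F0" if F: "F \<subseteq> E" "card F = l" for F
  proof -
    have "F \<inter> relevant l \<subseteq> relevant l" by blast
    moreover have "card (F \<inter> relevant l) \<le> l" using F finite_relevant
      by (metis card_mono finite_E finite_subset inf_le1)
    ultimately obtain F' where F': "F \<inter> relevant l \<subseteq> F'" "F' \<subseteq> relevant l" "card F' = l"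
      using exists_subset_between[of "F \<inter> relevant l" l "relevant l"] card_relevant_gt finite_relevant by auto
    have "?v F = ?v (F \<inter> relevant l)" using gb_inter_relevant[of F l "relevant l"] F by simp
    also have "\<dots> \<le> ?v F'" using F' relevant_sub[of l] by (intro gb_weight_mono[OF c]) auto
    also have "\<dots> \<le> ?v F0" using F0(2) all F' by blast
    finally show ?thesis .
  qed
  have "{interdicted_value \<F> a b F \<theta> | F. F \<subseteq> E \<and> card F = l} = ?v ` {F. F \<subseteq> E \<and> card F = l}"
    using interdicted_value_eq[OF c] by auto
  then have v: "interdiction_value l m \<F> a b \<theta> = Max (?v ` {F. F \<subseteq> E \<and> card F = l})"
    unfolding interdiction_value_def by simp
  have "finite {F. F \<subseteq> E \<and> card F = l}" by simp
  then have "Max (?v ` {F. F \<subseteq> E \<and> card F = l}) = ?v F0"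
    using le S[OF F0(1)] by (intro Max_eqI) auto
  then show "interdiction_value l m \<F> a b \<theta> = ?v F0" using v by simp
  then show "most_vital l m \<F> a b \<theta> F0"
    unfolding most_vital_def using S[OF F0(1)] interdicted_value_eq[OF c] by simp
qed

end

section \<open>Reasoning about programs with running times\<close>

abbreviation Var :: "name \<Rightarrow> nexp" where "Var x \<equiv> NCell x (NConst 0)"
abbreviation RVar :: "name \<Rightarrow> rexp" where "RVar x \<equiv> RCell x (NConst 0)"
abbreviation NSet :: "name \<Rightarrow> nexp \<Rightarrow> com" where "NSet x u \<equiv> NAssign x (NConst 0) u"
abbreviation RSet :: "name \<Rightarrow> rexp \<Rightarrow> com" where "RSet x u \<equiv> RAssign x (NConst 0) u"
abbreviation Positive :: "nexp \<Rightarrow> bexp" where "Positive u \<equiv> NLess (NConst 0) u"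
abbreviation NEq :: "nexp \<Rightarrow> nexp \<Rightarrow> bexp" where
  "NEq u v \<equiv> BAnd (BNot (NLess u v)) (BNot (NLess v u))"
abbreviation Increment :: "name \<Rightarrow> com" where "Increment x \<equiv> NSet x (NAdd (Var x) (NConst 1))"

fun Block :: "com list \<Rightarrow> com" where
  "Block [] = Skip"
| "Block [c] = c"
| "Block (c # d # cs) = Seq c (Block (d # cs))"

definition For :: "name \<Rightarrow> nexp \<Rightarrow> com \<Rightarrow> com" where
  "For i u c = Seq (NSet i (NConst 0)) (While (NLess (Var i) u) (Seq c (Increment i)))"

primrec nat_writes :: "com \<Rightarrow> name set" where
  "nat_writes Skip = {}"
| "nat_writes (NAssign x i u) = {x}"
| "nat_writes (RAssign x i u) = {}"
| "nat_writes (Test x i y off) = {x}"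
| "nat_writes (Seq c d) = nat_writes c \<union> nat_writes d"
| "nat_writes (Cond q c d) = nat_writes c \<union> nat_writes d"
| "nat_writes (While q c) = nat_writes c"

primrec real_writes :: "com \<Rightarrow> name set" where
  "real_writes Skip = {}"
| "real_writes (NAssign x i u) = {}"
| "real_writes (RAssign x i u) = {x}"
| "real_writes (Test x i y off) = {}"
| "real_writes (Seq c d) = real_writes c \<union> real_writes d"
| "real_writes (Cond q c d) = real_writes c \<union> real_writes d"
| "real_writes (While q c) = real_writes c"

primrec nat_reads :: "nexp \<Rightarrow> name set" where
  "nat_reads (NConst c) = {}"
| "nat_reads (NCell x i) = insert x (nat_reads i)"
| "nat_reads (NAdd u v) = nat_reads u \<union> nat_reads v"
| "nat_reads (NSub u v) = nat_reads u \<union> nat_reads v"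
| "nat_reads (NMul u v) = nat_reads u \<union> nat_reads v"

lemma writes_For [simp]:
  "nat_writes (For i u c) = insert i (nat_writes c)" "real_writes (For i u c) = real_writes c"
  by (auto simp: For_def)

text \<open>The frame condition, at the granularity of whole arrays: only arrays named in
  \<open>A\<close> (naturals) and \<open>B\<close> (reals) may differ.\<close>

definition agree :: "name set \<Rightarrow> name set \<Rightarrow> state \<Rightarrow> state \<Rightarrow> bool" where
  "agree A B s s' \<longleftrightarrow> (\<forall>x. x \<notin> A \<longrightarrow> fst s' x = fst s x) \<and> (\<forall>x. x \<notin> B \<longrightarrow> snd s' x = snd s x)"

lemma agree_refl: "agree A B s s" by (simp add: agree_def)

lemma agree_trans: "agree A B s s' \<Longrightarrow> agree A B s' s'' \<Longrightarrow> agree A B s s''"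
  by (simp add: agree_def)

lemma agree_mono: "agree A B s s' \<Longrightarrow> A \<subseteq> A' \<Longrightarrow> B \<subseteq> B' \<Longrightarrow> agree A' B' s s'"
  unfolding agree_def by blast

lemma fst_nstore [simp]: "fst (nstore x i v s) y = (if y = x then (fst s x)(i := v) else fst s y)"
  and snd_nstore [simp]: "snd (nstore x i v s) = snd s"
  and fst_rstore [simp]: "fst (rstore x i r s) = fst s"
  and snd_rstore [simp]: "snd (rstore x i r s) y = (if y = x then (snd s x)(i := r) else snd s y)"
  by (simp_all add: nstore_def rstore_def)

lemma nval_agree: "agree A B s s' \<Longrightarrow> nat_reads u \<inter> A = {} \<Longrightarrow> nval u s' = nval u s"
  by (induction u) (simp_all add: agree_def Int_Un_distrib2)

declare split_paired_Ex [simp del] split_paired_All [simp del]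

section \<open>Total correctness with running times\<close>

locale machine =
  fixes m :: nat and \<F> :: "nat set set" and \<tau> :: nat
begin

lemma exec_agree: "exec m \<F> \<tau> c s t s' \<Longrightarrow> agree (nat_writes c) (real_writes c) s s'"
proof (induction rule: exec.induct)
  case (Seq c s t s' d t' s'')
  then show ?case by (auto simp: agree_def)
next
  case (WhileTrue q s c t s' t' s'')
  then show ?case by (auto simp: agree_def)
qed (auto simp: agree_def)

text \<open>Total correctness in which the postcondition also receives the exact number of steps. As
  execution is deterministic, the existential form says all there is to say about the run.\<close>

definition wp :: "com \<Rightarrow> state \<Rightarrow> (nat \<Rightarrow> state \<Rightarrow> bool) \<Rightarrow> bool" where
  "wp c s Q \<longleftrightarrow> (\<exists>t s'. exec m \<F> \<tau> c s t s' \<and> Q t s')"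

lemma wp_mono: "wp c s Q \<Longrightarrow> (\<And>t s'. Q t s' \<Longrightarrow> R t s') \<Longrightarrow> wp c s R"
  unfolding wp_def by blast

lemma wp_agree: "wp c s Q \<Longrightarrow> wp c s (\<lambda>t s'. Q t s' \<and> agree (nat_writes c) (real_writes c) s s')"
  unfolding wp_def using exec_agree by blast

lemma wp_use:
  "wp c s Q \<Longrightarrow> (\<And>t s'. Q t s' \<Longrightarrow> agree (nat_writes c) (real_writes c) s s' \<Longrightarrow> R t s') \<Longrightarrow> wp c s R"
  using wp_agree[of c s Q] wp_mono by blast

lemma wp_Skip [simp]: "wp Skip s Q \<longleftrightarrow> Q 1 s"
  unfolding wp_def by (metis exec.Skip exec_SkipE)

lemma wp_NAssign [simp]:
  "wp (NAssign x i u) s Q \<longleftrightarrow> Q (1 + ncost i + ncost u) (nstore x (nval i s) (nval u s) s)"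
  unfolding wp_def by (metis exec.NAssign exec_NAssignE)

lemma wp_RAssign [simp]:
  "wp (RAssign x i u) s Q \<longleftrightarrow> Q (1 + ncost i + rcost u) (rstore x (nval i s) (rval u s) s)"
  unfolding wp_def by (metis exec.RAssign exec_RAssignE)

lemma wp_Test [simp]:
  "wp (Test x i y off) s Q \<longleftrightarrow> Q (1 + ncost i + ncost off + \<tau>)
     (nstore x (nval i s) (of_bool ({e. e < m \<and> fst s y (nval off s + e) \<noteq> 0} \<in> \<F>)) s)"
  unfolding wp_def
  by (rule iffI, elim exE conjE, erule exec_TestE, simp, intro exI conjI, rule exec.Test)

lemma wp_Seq [simp]: "wp (Seq c d) s Q \<longleftrightarrow> wp c s (\<lambda>t s'. wp d s' (\<lambda>t' s''. Q (1 + t + t') s''))"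
proof
  assume "wp (Seq c d) s Q"
  then obtain t s'' where 1: "exec m \<F> \<tau> (Seq c d) s t s''" "Q t s''" unfolding wp_def by blast
  show "wp c s (\<lambda>t s'. wp d s' (\<lambda>t' s''. Q (1 + t + t') s''))"
    unfolding wp_def
    by (rule exec_SeqE[OF 1(1)], intro exI conjI, assumption, assumption) (use 1(2) in simp)
next
  assume "wp c s (\<lambda>t s'. wp d s' (\<lambda>t' s''. Q (1 + t + t') s''))"
  then obtain t1 s1 t2 s'' where "exec m \<F> \<tau> c s t1 s1" "exec m \<F> \<tau> d s1 t2 s''" "Q (1 + t1 + t2) s''"
    unfolding wp_def by blast
  then show "wp (Seq c d) s Q" unfolding wp_def using exec.Seq by metis
qed

lemma wp_Cond [simp]: "wp (Cond q c d) s Q \<longleftrightarrow>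
    (if bval q s then wp c s (\<lambda>t s'. Q (1 + bcost q + t) s') else wp d s (\<lambda>t s'. Q (1 + bcost q + t) s'))"
proof -
  have "exec m \<F> \<tau> (Cond q c d) s t s'' \<longleftrightarrow>
      (\<exists>t1. exec m \<F> \<tau> (if bval q s then c else d) s t1 s'' \<and> t = 1 + bcost q + t1)" for t s''
    by (rule iffI, erule exec_CondE, simp, simp)
      (elim exE conjE, hypsubst, cases "bval q s", simp_all add: exec.CondTrue exec.CondFalse
        del: One_nat_def plus_nat.simps)
  then show ?thesis unfolding wp_def by (auto split: if_splits)
qed

text \<open>The invariant is indexed by the number of completed iterations; that it forces
  \<open>j < n\<close> whenever the guard holds is what bounds the iterations and yields
  termination.\<close>

lemma wp_While:
  assumes step: "\<And>j s. Inv j s \<Longrightarrow> bval q s \<Longrightarrow> j < n \<and> wp c s (\<lambda>t s'. t \<le> T \<and> Inv (Suc j) s')"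
    and init: "Inv 0 s0"
    and fin: "\<And>j t s. t \<le> n * (T + bcost q + 1) + bcost q + 1 \<Longrightarrow> j \<le> n \<Longrightarrow> Inv j s \<Longrightarrow> \<not> bval q s \<Longrightarrow> Q t s"
  shows "wp (While q c) s0 Q"
proof -
  have "\<exists>t s' j'. exec m \<F> \<tau> (While q c) s t s' \<and> t \<le> (n - j) * (T + bcost q + 1) + bcost q + 1 \<and>
      j' \<le> n \<and> Inv j' s' \<and> \<not> bval q s'" if "Inv j s" "j \<le> n" for j s
    using that
  proof (induction "n - j" arbitrary: j s)
    case 0
    then have "\<not> bval q s" using step[of j s] by fastforce
    then show ?case using 0 exec.WhileFalse[of q s m \<F> \<tau> c]
      by (intro exI[of _ "1 + bcost q"], intro exI[of _ s], intro exI[of _ j]) simp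
  next
    case (Suc d)
    show ?case
    proof (cases "bval q s")
      case False
      then show ?thesis
        using Suc.prems exec.WhileFalse[of q s m \<F> \<tau> c]
        by (intro exI[of _ "1 + bcost q"], intro exI[of _ s], intro exI[of _ j]) simp
    next
      case True
      then obtain t s' where 1: "exec m \<F> \<tau> c s t s'" "t \<le> T" "Inv (Suc j) s'"
        using step[OF Suc.prems(1)] unfolding wp_def by blast
      have "d = n - Suc j" "Suc j \<le> n" using Suc.hyps(2) by simp_all
      then obtain t' s'' j' where 2: "exec m \<F> \<tau> (While q c) s' t' s''" 
        "t' \<le> (n - Suc j) * (T + bcost q + 1) + bcost q + 1" "j' \<le> n" "Inv j' s''" "\<not> bval q s''"
        using Suc.hyps(1)[of "Suc j" s'] 1 by blast
      have "n - j = Suc (n - Suc j)" using Suc.hyps(2) by simp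
      then have "1 + bcost q + t + t' \<le> (n - j) * (T + bcost q + 1) + bcost q + 1"
        using 1(2) 2(2) by simp
      then show ?thesis using exec.WhileTrue[OF True 1(1) 2(1)] 2 by blast
    qed
  qed
  from this[OF init] show ?thesis using fin unfolding wp_def by fastforce
qed

text \<open>
  The invariant of a counting loop only has to describe the memory that the body changes; for
  the rest the rule provides agreement with the state before the loop.
\<close>
lemma wp_For:
  assumes i: "i \<notin> nat_writes c" "nat_reads u \<inter> insert i (nat_writes c) = {}"
    and indep: "\<And>j v s. Inv j s \<Longrightarrow> Inv j (nstore i 0 v s)"
    and init: "Inv 0 s0" and n: "nval u s0 = n"
    and step: "\<And>j s. j < n \<Longrightarrow> agree (insert i (nat_writes c)) (real_writes c) s0 s \<Longrightarrow> fst s i 0 = j \<Longrightarrow>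
      Inv j s \<Longrightarrow> wp c s (\<lambda>t s'. t \<le> T \<and> Inv (Suc j) s')"
    and fin: "\<And>t s. t \<le> n * (T + ncost u + 12) + ncost u + 12 \<Longrightarrow>
      agree (insert i (nat_writes c)) (real_writes c) s0 s \<Longrightarrow> Inv n s \<Longrightarrow> Q t s"
  shows "wp (For i u c) s0 Q"
proof -
  let ?A = "agree (insert i (nat_writes c)) (real_writes c) s0"
  define J where "J j s \<longleftrightarrow> ?A s \<and> fst s i 0 = j \<and> j \<le> n \<and> Inv j s" for j s
  have nv: "nval u s = n" if "?A s" for s using nval_agree[OF that i(2)] n by simp
  have A1: "?A (nstore i 0 v s)" if "?A s" for v s using that unfolding agree_def by auto
  \<comment> \<open>The 4 steps are the initial assignment and its sequencing. In the rule applied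
    next, the 7 added to \<open>T\<close> pays for the increment of the counter and its
    sequencing.\<close>
  have "wp (While (NLess (Var i) u) (Seq c (Increment i))) (nstore i 0 0 s0) (\<lambda>t s. Q (4 + t) s)"
  proof (rule wp_While[where Inv = J and n = n and T = "T + 7"])
    fix j s assume J: "J j s" and q: "bval (NLess (Var i) u) s"
    have j: "j < n" using J q nv unfolding J_def by simp
    have a: "?A s" using J unfolding J_def by simp
    have "wp c s (\<lambda>t s'. t \<le> T \<and> Inv (Suc j) s')" using step[OF j a] J unfolding J_def by simp
    then have "wp c s (\<lambda>t s'. (t \<le> T \<and> Inv (Suc j) s') \<and> agree (nat_writes c) (real_writes c) s s')"
      by (rule wp_agree)
    then have "wp c s (\<lambda>t s'. 1 + t + 6 \<le> T + 7 \<and> J (Suc j) (nstore i 0 (Suc j) s') \<and> fst s' i 0 = j)"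
    proof (rule wp_mono)
      fix t s' assume h: "(t \<le> T \<and> Inv (Suc j) s') \<and> agree (nat_writes c) (real_writes c) s s'"
      have "agree (insert i (nat_writes c)) (real_writes c) s s'"
        using h agree_mono[of "nat_writes c" "real_writes c" s s'] by blast
      then have "?A s'" using a agree_trans by blast
      moreover have "fst s' i 0 = j" using h i(1) J unfolding agree_def J_def by simp
      ultimately show "1 + t + 6 \<le> T + 7 \<and> J (Suc j) (nstore i 0 (Suc j) s') \<and> fst s' i 0 = j"
        using h A1 indep j unfolding J_def by simp
    qed
    then show "j < n \<and> wp (Seq c (Increment i)) s (\<lambda>t s'. t \<le> T + 7 \<and> J (Suc j) s')"
      using j unfolding wp_Seq by (auto elim!: wp_mono)
  next
    show "J 0 (nstore i 0 0 s0)" unfolding J_def using A1[OF agree_refl] indep[OF init] by simp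
  next
    fix j t s assume t: "t \<le> n * (T + 7 + bcost (NLess (Var i) u) + 1) + bcost (NLess (Var i) u) + 1"
      and j: "j \<le> n" "J j s" "\<not> bval (NLess (Var i) u) s"
    have "j = n" using j nv unfolding J_def by auto
    have "bcost (NLess (Var i) u) = ncost u + 3" by simp
    then have "4 + t \<le> n * (T + ncost u + 12) + ncost u + 12" using t by (simp add: algebra_simps)
    then show "Q (4 + t) s" using fin[of "4 + t" s] j \<open>j = n\<close> unfolding J_def by simp
  qed
  then show ?thesis unfolding For_def wp_Seq wp_NAssign by (simp add: numeral_eq_Suc)
qed

end

section \<open>Merge sort\<close>

text \<open>Quotients by \<open>w\<close> number the aligned blocks of width \<open>w\<close>; order
  is demanded only within a block.\<close>

definition runs :: "nat \<Rightarrow> nat \<Rightarrow> (nat \<Rightarrow> real) \<Rightarrow> (nat \<Rightarrow> nat) \<Rightarrow> bool" where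
  "runs w n key A \<longleftrightarrow> (\<forall>x y. x < y \<longrightarrow> y < n \<longrightarrow> x div w = y div w \<longrightarrow> key (A x) \<le> key (A y))"

text \<open>Here \<open>bs\<close> is the start of the pair of runs being merged, which occupy
  \<open>[bs, mid)\<close> and \<open>[mid, end)\<close> and are cut off at \<open>n\<close>;
  \<open>i\<close> and \<open>j\<close> are their heads. The multiset clause says that the output
  consists of everything before \<open>bs\<close> and the consumed parts of the two runs.\<close>

definition merge_inv ::
  "nat \<Rightarrow> nat \<Rightarrow> (nat \<Rightarrow> real) \<Rightarrow> (nat \<Rightarrow> nat) \<Rightarrow> (nat \<Rightarrow> nat) \<Rightarrow> nat \<Rightarrow> nat \<Rightarrow> nat \<Rightarrow> nat \<Rightarrow> nat \<Rightarrow> bool" where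
  "merge_inv w n key A B out i mid j end \<longleftrightarrow> (\<exists>bs. 2 * w dvd bs \<and> bs \<le> i \<and> i \<le> mid \<and> mid \<le> j \<and> j \<le> end \<and>
     mid = min (bs + w) n \<and> end = min (mid + w) n \<and> out = i + (j - mid) \<and>
     runs (2 * w) out key B \<and>
     (\<forall>x. bs \<le> x \<longrightarrow> x < out \<longrightarrow>
        (i < mid \<longrightarrow> key (B x) \<le> key (A i)) \<and> (j < end \<longrightarrow> key (B x) \<le> key (A j))) \<and>
     mset (map B [0..<out]) = mset (map A [0..<i]) + mset (map A [mid..<j]))"

lemma merge_inv_init: "merge_inv w n key A B 0 0 (min w n) (min w n) (min (min w n + w) n)"
  unfolding merge_inv_def runs_def by (intro exI[of _ 0]) simp

lemma upt_split: "i \<le> j \<Longrightarrow> [0..<j] = [0..<i] @ [i..<j]"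
  by (metis le0 le_add_diff_inverse upt_add_eq_append)

lemma merge_inv_restart:
  assumes inv: "merge_inv w n key A B out i mid j out" and w: "0 < w" and o: "out < n"
  shows "merge_inv w n key A B out out (min (out + w) n) (min (out + w) n) (min (min (out + w) n + w) n)"
proof -
  obtain bs where h: "2 * w dvd bs" "i \<le> mid" "mid \<le> j" "j \<le> out" "mid = min (bs + w) n"
    "out = min (mid + w) n" "out = i + (j - mid)" "runs (2 * w) out key B"
    "mset (map B [0..<out]) = mset (map A [0..<i]) + mset (map A [mid..<j])"
    using inv unfolding merge_inv_def by blast
  have "i = mid" "j = out" using h by linarith+
  then have "[0..<out] = [0..<i] @ [mid..<j]" using h(3) upt_split[of mid j] by simp
  then have ms: "mset (map B [0..<out]) = mset (map A [0..<out])" using h(9) by simp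
  \<comment> \<open>Since the output has not reached \<open>n\<close>, the pair just finished was
    not cut off, so the next one is aligned again.\<close>
  have "out = bs + 2 * w" using h(5,6) o by linarith
  then have "2 * w dvd out" using h(1) by simp
  then show ?thesis unfolding merge_inv_def
    using h(8) ms o by (intro exI[of _ out]) auto
qed

lemma div_eq_block:
  assumes "2 * w dvd (bs::nat)" "0 < w" "bs \<le> y" "y < bs + 2 * w" "x div (2 * w) = y div (2 * w)"
  shows "bs \<le> x"
proof -
  obtain q where q: "bs = 2 * w * q" using assms(1) by blast
  have "q \<le> y div (2 * w)" using assms(2,3) q by (simp add: less_eq_div_iff_mult_less_eq mult.commute)
  then have "q \<le> x div (2 * w)" using assms(5) by simp
  then show ?thesis using q assms(2) by (simp add: less_eq_div_iff_mult_less_eq mult.commute)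
qed

lemma div_eq_half:
  assumes "w dvd (bs::nat)" "bs \<le> x" "x < bs + w"
  shows "x div w = bs div w"
proof -
  obtain q where q: "bs = w * q" using assms(1) by blast
  have "w > 0" using assms by auto
  moreover have "x = (x - bs) + w * q" "x - bs < w" using q assms by simp_all
  ultimately show ?thesis using q by (metis div_less div_mult_self2 nonzero_mult_div_cancel_left add_0 less_numeral_extra(3))
qed

lemma runs_extend:
  assumes "runs (2 * w) out key B" "2 * w dvd bs" "0 < w" "bs \<le> out" "out < bs + 2 * w"
    and "\<And>x. bs \<le> x \<Longrightarrow> x < out \<Longrightarrow> key (B x) \<le> key v"
  shows "runs (2 * w) (Suc out) key (B(out := v))"
  unfolding runs_def
proof (intro allI impI)
  fix x y assume xy: "x < y" "y < Suc out" "x div (2 * w) = y div (2 * w)"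
  show "key ((B(out := v)) x) \<le> key ((B(out := v)) y)"
  proof (cases "y = out")
    case True
    then have "bs \<le> x" using div_eq_block[OF assms(2,3), of out x] assms(4,5) xy(3) by simp
    then show ?thesis using True xy assms(6) by simp
  next
    case False
    then show ?thesis using xy assms(1) unfolding runs_def by simp
  qed
qed

text \<open>All entries already written in the current block are bounded by both heads. The next
  head of the left run is at least the present one, because both lie in the same sorted block of
  width \<open>w\<close>.\<close>

lemma merge_inv_left:
  assumes inv: "merge_inv w n key A B out i mid j end" and w: "0 < w" and r: "runs w n key A"
    and c: "i < mid" "j < end \<Longrightarrow> key (A i) \<le> key (A j)"
  shows "merge_inv w n key A (B(out := A i)) (Suc out) (Suc i) mid j end"
proof -
  obtain bs where h: "2 * w dvd bs" "bs \<le> i" "i \<le> mid" "mid \<le> j" "j \<le> end" "mid = min (bs + w) n"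
    "end = min (mid + w) n" "out = i + (j - mid)" "runs (2 * w) out key B"
    "\<And>x. bs \<le> x \<Longrightarrow> x < out \<Longrightarrow> i < mid \<Longrightarrow> key (B x) \<le> key (A i)"
    "\<And>x. bs \<le> x \<Longrightarrow> x < out \<Longrightarrow> j < end \<Longrightarrow> key (B x) \<le> key (A j)"
    "mset (map B [0..<out]) = mset (map A [0..<i]) + mset (map A [mid..<j])"
    using inv unfolding merge_inv_def by blast
  have "out < end" "bs \<le> out" "out < bs + 2 * w" using h c(1) by linarith+
  then have R: "runs (2 * w) (Suc out) key (B(out := A i))"
    using runs_extend[OF h(9,1) w] h(10) c(1) by blast
  have K: "key (A i) \<le> key (A (Suc i))" if "Suc i < mid"
  proof -
    have "w dvd bs" using h(1) dvd_mult_right by blast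
    then have "i div w = Suc i div w" using div_eq_half[of w bs i] div_eq_half[of w bs "Suc i"] h that by simp
    then show ?thesis using r that h(6) unfolding runs_def by simp
  qed
  have M: "mset (map (B(out := A i)) [0..<Suc out]) = mset (map A [0..<Suc i]) + mset (map A [mid..<j])"
  proof -
    have "map (B(out := A i)) [0..<out] = map B [0..<out]" by simp
    then show ?thesis using h(12) by simp
  qed
  have H: "\<forall>x. bs \<le> x \<longrightarrow> x < Suc out \<longrightarrow>
      (Suc i < mid \<longrightarrow> key ((B(out := A i)) x) \<le> key (A (Suc i))) \<and>
      (j < end \<longrightarrow> key ((B(out := A i)) x) \<le> key (A j))"
  proof (intro allI impI)
    fix x assume x: "bs \<le> x" "x < Suc out"
    have "key ((B(out := A i)) x) \<le> key (A i)" using x h(10)[of x] c(1) by (cases "x = out") simp_all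
    then show "(Suc i < mid \<longrightarrow> key ((B(out := A i)) x) \<le> key (A (Suc i))) \<and>
      (j < end \<longrightarrow> key ((B(out := A i)) x) \<le> key (A j))" using K c(2) by force
  qed
  have G: "bs \<le> Suc i" "Suc i \<le> mid" "Suc out = Suc i + (j - mid)" using h(2,8) c(1) by simp_all
  show ?thesis unfolding merge_inv_def
    by (intro exI[of _ bs] conjI) (rule h G R M H)+
qed

lemma merge_inv_right:
  assumes inv: "merge_inv w n key A B out i mid j end" and w: "0 < w" and r: "runs w n key A"
    and o: "out < end" and c: "i < mid \<Longrightarrow> j < end \<and> key (A j) < key (A i)"
  shows "merge_inv w n key A (B(out := A j)) (Suc out) i mid (Suc j) end"
proof -
  obtain bs where h: "2 * w dvd bs" "bs \<le> i" "i \<le> mid" "mid \<le> j" "j \<le> end" "mid = min (bs + w) n"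
    "end = min (mid + w) n" "out = i + (j - mid)" "runs (2 * w) out key B"
    "\<And>x. bs \<le> x \<Longrightarrow> x < out \<Longrightarrow> i < mid \<Longrightarrow> key (B x) \<le> key (A i)"
    "\<And>x. bs \<le> x \<Longrightarrow> x < out \<Longrightarrow> j < end \<Longrightarrow> key (B x) \<le> key (A j)"
    "mset (map B [0..<out]) = mset (map A [0..<i]) + mset (map A [mid..<j])"
    using inv unfolding merge_inv_def by blast
  have je: "j < end" using c o h by fastforce
  have "out < end" "bs \<le> out" "out < bs + 2 * w" using h o by linarith+
  then have R: "runs (2 * w) (Suc out) key (B(out := A j))"
    using runs_extend[OF h(9,1) w] h(11) je by blast
  have K: "key (A j) \<le> key (A (Suc j))" if "Suc j < end"
  proof -
    have mid: "mid = bs + w" using that h by linarith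
    have "w dvd mid" using h(1) dvd_mult_right mid by (metis dvd_add_triv_right_iff)
    moreover have "j < mid + w" "Suc j < mid + w" using that h(7) by linarith+
    ultimately have "j div w = Suc j div w"
      using div_eq_half[of w mid j] div_eq_half[of w mid "Suc j"] h(4) by simp
    then show ?thesis using r that h(7) unfolding runs_def by simp
  qed
  have M: "mset (map (B(out := A j)) [0..<Suc out]) = mset (map A [0..<i]) + mset (map A [mid..<Suc j])"
  proof -
    have "map (B(out := A j)) [0..<out] = map B [0..<out]" by simp
    then show ?thesis using h(4,12) by simp
  qed
  have H: "\<forall>x. bs \<le> x \<longrightarrow> x < Suc out \<longrightarrow>
      (i < mid \<longrightarrow> key ((B(out := A j)) x) \<le> key (A i)) \<and>
      (Suc j < end \<longrightarrow> key ((B(out := A j)) x) \<le> key (A (Suc j)))"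
  proof (intro allI impI)
    fix x assume x: "bs \<le> x" "x < Suc out"
    have "key ((B(out := A j)) x) \<le> key (A j)" using x h(11)[of x] je by (cases "x = out") simp_all
    then show "(i < mid \<longrightarrow> key ((B(out := A j)) x) \<le> key (A i)) \<and>
      (Suc j < end \<longrightarrow> key ((B(out := A j)) x) \<le> key (A (Suc j)))" using K c by force
  qed
  have G: "mid \<le> Suc j" "Suc j \<le> end" "Suc out = i + (Suc j - mid)" using h(4,8) je by simp_all
  show ?thesis unfolding merge_inv_def
    by (intro exI[of _ bs] conjI) (rule h G R M H)+
qed

lemma merge_inv_final:
  assumes "merge_inv w n key A B n i mid j end"
  shows "runs (2 * w) n key B" "mset (map B [0..<n]) = mset (map A [0..<n])"
proof -
  obtain bs where h: "bs \<le> i" "i \<le> mid" "mid \<le> j" "j \<le> end" "mid = min (bs + w) n"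
    "end = min (mid + w) n" "n = i + (j - mid)" "runs (2 * w) n key B"
    "mset (map B [0..<n]) = mset (map A [0..<i]) + mset (map A [mid..<j])"
    using assms unfolding merge_inv_def by blast
  show "runs (2 * w) n key B" by fact
  have "i = mid" "j = n" using h by linarith+
  then have "[0..<n] = [0..<i] @ [mid..<j]" using h(3) upt_split[of mid j] by simp
  then show "mset (map B [0..<n]) = mset (map A [0..<n])" using h(9) by simp
qed

lemma merge_inv_bounds:
  assumes "merge_inv w n key A B out i mid j end"
  shows "end \<le> n" "out \<le> end"
proof -
  obtain bs where h: "i \<le> mid" "mid \<le> j" "j \<le> end" "end = min (mid + w) n" "out = i + (j - mid)"
    using assms unfolding merge_inv_def by blast
  show "end \<le> n" "out \<le> end" using h by linarith+
qed

text \<open>The binary logarithm rounded up, with value 0 at 0 and 1: the number of doublings of the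
  width before one run covers everything.\<close>

definition lg :: "nat \<Rightarrow> nat" where "lg n = (LEAST p. n \<le> 2 ^ p)"

lemma lg_le: "n \<le> 2 ^ lg n"
  unfolding lg_def by (rule LeastI[of _ n]) (simp add: less_imp_le)

lemma lg_greater: "2 ^ j < n \<Longrightarrow> j < lg n"
  using lg_le[of n] by (intro power_less_imp_less_exp[of "2 :: nat" j "lg n"]) linarith+

text \<open>Truncated subtraction expresses the minimum.\<close>

abbreviation NMin :: "nexp \<Rightarrow> nexp \<Rightarrow> nexp" where "NMin u v \<equiv> NSub u (NSub u v)"

definition StartBlock :: "nexp \<Rightarrow> com" where
  "StartBlock u = Block [NSet ''si'' u,
     NSet ''sm'' (NMin (NAdd (Var ''si'') (Var ''sw'')) (Var ''n'')), NSet ''sj'' (Var ''sm''),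
     NSet ''se'' (NMin (NAdd (Var ''sm'') (Var ''sw'')) (Var ''n''))]"

definition SelectHead :: com where
  "SelectHead = Cond (BAnd (NLess (Var ''si'') (Var ''sm'')) (BNot (BAnd (NLess (Var ''sj'') (Var ''se''))
        (RLess (RCell ''key'' (NCell ''idx'' (Var ''sj''))) (RCell ''key'' (NCell ''idx'' (Var ''si'')))))))
      (Block [NAssign ''tmp'' (Var ''so'') (NCell ''idx'' (Var ''si'')), Increment ''si''])
      (Block [NAssign ''tmp'' (Var ''so'') (NCell ''idx'' (Var ''sj'')), Increment ''sj''])"

text \<open>One loop over the output positions merges all pairs of runs, starting a new pair
  whenever the output reaches the end of the current one. The cost of a pass is thus visibly
  linear.\<close>

definition MergePass :: com where
  "MergePass = Block [StartBlock (NConst 0),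
     For ''so'' (Var ''n'') (Seq (Cond (NEq (Var ''so'') (Var ''se'')) (StartBlock (Var ''so'')) Skip) SelectHead),
     For ''so'' (Var ''n'') (NAssign ''idx'' (Var ''so'') (NCell ''tmp'' (Var ''so''))),
     NSet ''sw'' (NAdd (Var ''sw'') (Var ''sw''))]"

text \<open>Only the index array \<open>idx\<close> is permuted; the keys stay in place, so that
  companion arrays can be read in sorted order through \<open>idx\<close>.\<close>

definition MergeSort :: com where
  "MergeSort = Block [For ''so'' (Var ''n'') (NAssign ''idx'' (Var ''so'') (Var ''so'')),
     NSet ''sw'' (NConst 1), While (NLess (Var ''sw'') (Var ''n'')) MergePass]"

lemma nat_writes_MergeSort [simp]:
  "nat_writes (StartBlock u) = {''si'', ''sm'', ''sj'', ''se''}"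
  "nat_writes SelectHead = {''tmp'', ''si'', ''sj''}"
  "nat_writes MergePass = {''si'', ''sm'', ''sj'', ''se'', ''so'', ''tmp'', ''idx'', ''sw''}"
  "nat_writes MergeSort = {''si'', ''sm'', ''sj'', ''se'', ''so'', ''tmp'', ''idx'', ''sw''}"
  "real_writes (StartBlock u) = {}" "real_writes SelectHead = {}"
  "real_writes MergePass = {}" "real_writes MergeSort = {}"
  by (auto simp: MergeSort_def MergePass_def StartBlock_def SelectHead_def)

context machine
begin

lemma wp_MergePass:
  assumes w: "fst s0 ''sw'' 0 = w" "0 < w" and n: "fst s0 ''n'' 0 = n"
    and r: "runs w n (snd s0 ''key'') (fst s0 ''idx'')"
  shows "wp MergePass s0 (\<lambda>t s. t \<le> 220 * n + 220 \<and> fst s ''sw'' 0 = 2 * w \<and>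
     runs (2 * w) n (snd s ''key'') (fst s ''idx'') \<and>
     mset (map (fst s ''idx'') [0..<n]) = mset (map (fst s0 ''idx'') [0..<n]))"
proof -
  let ?A = "fst s0 ''idx''" and ?key = "snd s0 ''key''"
  define Inv where "Inv j s \<longleftrightarrow> merge_inv w n ?key ?A (fst s ''tmp'') j (fst s ''si'' 0) (fst s ''sm'' 0)
      (fst s ''sj'' 0) (fst s ''se'' 0)" for j and s :: state
  define s1 where "s1 = nstore ''se'' 0 (min (min w n + w) n) (nstore ''sj'' 0 (min w n)
      (nstore ''sm'' 0 (min w n) (nstore ''si'' 0 0 s0)))"
  have mn: "x - (x - y) = min x y" for x y :: nat by simp
  have start: "wp (StartBlock (NConst 0)) s0 (\<lambda>t s. t \<le> 60 \<and> s = s1)"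
    unfolding StartBlock_def s1_def using w n by (simp add: mn min_def)
  have loop: "wp (For ''so'' (Var ''n'') (Seq (Cond (NEq (Var ''so'') (Var ''se'')) (StartBlock (Var ''so'')) Skip) SelectHead)) s1
     (\<lambda>t s. t \<le> n * 170 + 20 \<and> runs (2 * w) n ?key (fst s ''tmp'') \<and>
        mset (map (fst s ''tmp'') [0..<n]) = mset (map ?A [0..<n]))"
  proof (rule wp_For[where Inv = Inv and n = n and T = 150])
    show "Inv 0 s1" unfolding Inv_def s1_def using merge_inv_init by simp
    show "nval (Var ''n'') s1 = n" unfolding s1_def using n by simp
  next
    fix j :: nat and s :: state assume j: "j < n" and ag: "agree (insert ''so'' (nat_writes (Seq (Cond (NEq (Var ''so'') (Var ''se'')) (StartBlock (Var ''so'')) Skip) SelectHead)))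
      (real_writes (Seq (Cond (NEq (Var ''so'') (Var ''se'')) (StartBlock (Var ''so'')) Skip) SelectHead)) s1 s"
      and so: "fst s ''so'' 0 = j" and inv: "Inv j s"
    have c: "fst s ''idx'' = ?A" "snd s ''key'' = ?key" "fst s ''sw'' 0 = w" "fst s ''n'' 0 = n"
      using ag w n by (simp_all add: agree_def s1_def)
    have "wp (Cond (NEq (Var ''so'') (Var ''se'')) (StartBlock (Var ''so'')) Skip) s
        (\<lambda>t s'. t \<le> 60 \<and> Inv j s' \<and> j < fst s' ''se'' 0)"
    proof (cases "fst s ''se'' 0 = j")
      case True
      then have "merge_inv w n ?key ?A (fst s ''tmp'') j j (min (j + w) n) (min (j + w) n) (min (min (j + w) n + w) n)"
        using merge_inv_restart[OF _ w(2) j] inv unfolding Inv_def by blast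
      then show ?thesis using True so c w j unfolding StartBlock_def Inv_def by (simp add: mn)
    next
      case False
      moreover have "j \<le> fst s ''se'' 0" using merge_inv_bounds[OF inv[unfolded Inv_def]] by simp
      ultimately show ?thesis using so inv by simp
    qed
    then show "wp (Seq (Cond (NEq (Var ''so'') (Var ''se'')) (StartBlock (Var ''so'')) Skip) SelectHead) s
        (\<lambda>t s'. t \<le> 150 \<and> Inv (Suc j) s')"
      unfolding wp_Seq
    proof (rule wp_use)
      fix t :: nat and s' :: state assume h: "t \<le> 60 \<and> Inv j s' \<and> j < fst s' ''se'' 0"
        and a: "agree (nat_writes (Cond (NEq (Var ''so'') (Var ''se'')) (StartBlock (Var ''so'')) Skip))
          (real_writes (Cond (NEq (Var ''so'') (Var ''se'')) (StartBlock (Var ''so'')) Skip)) s s'"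
      have d: "fst s' ''idx'' = ?A" "snd s' ''key'' = ?key" "fst s' ''so'' 0 = j"
        using a c so by (simp_all add: agree_def)
      have i: "merge_inv w n ?key ?A (fst s' ''tmp'') j (fst s' ''si'' 0) (fst s' ''sm'' 0)
          (fst s' ''sj'' 0) (fst s' ''se'' 0)" using h unfolding Inv_def by blast
      show "wp SelectHead s' (\<lambda>t' s''. 1 + t + t' \<le> 150 \<and> Inv (Suc j) s'')"
      proof (cases "fst s' ''si'' 0 < fst s' ''sm'' 0 \<and>
          (fst s' ''sj'' 0 < fst s' ''se'' 0 \<longrightarrow> ?key (?A (fst s' ''si'' 0)) \<le> ?key (?A (fst s' ''sj'' 0)))")
        case True
        then show ?thesis using merge_inv_left[OF i w(2) r] h d
          unfolding SelectHead_def Inv_def by (auto simp: not_less)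
      next
        case False
        then show ?thesis using merge_inv_right[OF i w(2) r] h d
          unfolding SelectHead_def Inv_def by (auto simp: not_less not_le)
      qed
    qed
  next
    fix t :: nat and s :: state assume "t \<le> n * (150 + ncost (Var ''n'') + 12) + ncost (Var ''n'') + 12" "Inv n s"
    then show "t \<le> n * 170 + 20 \<and> runs (2 * w) n ?key (fst s ''tmp'') \<and>
        mset (map (fst s ''tmp'') [0..<n]) = mset (map ?A [0..<n])"
      using merge_inv_final[of w n ?key ?A "fst s ''tmp''"] unfolding Inv_def by auto
  qed (auto simp: Inv_def)
  show ?thesis unfolding MergePass_def Block.simps wp_Seq
  proof (rule wp_use[OF start])
    fix t0 :: nat and s :: state assume t0: "t0 \<le> 60 \<and> s = s1"
    show "wp (For ''so'' (Var ''n'') (Seq (Cond (NEq (Var ''so'') (Var ''se'')) (StartBlock (Var ''so'')) Skip) SelectHead)) s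
       (\<lambda>t s. wp (For ''so'' (Var ''n'') (NAssign ''idx'' (Var ''so'') (NCell ''tmp'' (Var ''so'')))) s
         (\<lambda>t' s. wp (NSet ''sw'' (NAdd (Var ''sw'') (Var ''sw''))) s
           (\<lambda>t'' s. 1 + t0 + (1 + t + (1 + t' + t'')) \<le> 220 * n + 220 \<and> fst s ''sw'' 0 = 2 * w \<and>
             runs (2 * w) n (snd s ''key'') (fst s ''idx'') \<and>
             mset (map (fst s ''idx'') [0..<n]) = mset (map (fst s0 ''idx'') [0..<n]))))"
      unfolding t0[THEN conjunct2]
    proof (rule wp_use[OF loop])
      fix t :: nat and s :: state assume h: "t \<le> n * 170 + 20 \<and> runs (2 * w) n ?key (fst s ''tmp'') \<and>
          mset (map (fst s ''tmp'') [0..<n]) = mset (map ?A [0..<n])"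
        and a: "agree (nat_writes (For ''so'' (Var ''n'') (Seq (Cond (NEq (Var ''so'') (Var ''se'')) (StartBlock (Var ''so'')) Skip) SelectHead)))
          (real_writes (For ''so'' (Var ''n'') (Seq (Cond (NEq (Var ''so'') (Var ''se'')) (StartBlock (Var ''so'')) Skip) SelectHead))) s1 s"
      have d: "snd s ''key'' = ?key" "fst s ''n'' 0 = n" "fst s ''sw'' 0 = w"
        using a w n by (simp_all add: agree_def s1_def)
      show "wp (For ''so'' (Var ''n'') (NAssign ''idx'' (Var ''so'') (NCell ''tmp'' (Var ''so'')))) s
         (\<lambda>t' s. wp (NSet ''sw'' (NAdd (Var ''sw'') (Var ''sw''))) s
           (\<lambda>t'' s. 1 + t0 + (1 + t + (1 + t' + t'')) \<le> 220 * n + 220 \<and> fst s ''sw'' 0 = 2 * w \<and>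
             runs (2 * w) n (snd s ''key'') (fst s ''idx'') \<and>
             mset (map (fst s ''idx'') [0..<n]) = mset (map (fst s0 ''idx'') [0..<n])))"
      proof (rule wp_For[where Inv = "\<lambda>j s'. \<forall>x<j. fst s' ''idx'' x = fst s ''tmp'' x" and n = n and T = 8], goal_cases)
        case (6 j s')
        then show ?case by (auto simp: agree_def less_Suc_eq)
      next
        case (7 t' s')
        have "map (fst s' ''idx'') [0..<n] = map (fst s ''tmp'') [0..<n]" using 7 by simp
        then have "mset (map (fst s' ''idx'') [0..<n]) = mset (map (fst s0 ''idx'') [0..<n])" using h by argo
        moreover have "runs (2 * w) n ?key (fst s' ''idx'')" using h 7(3) unfolding runs_def by auto
        ultimately show ?case using 7 h d t0 by (simp add: agree_def del: mset_map)
      qed (use d in auto)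
    qed
  qed
qed

lemma wp_MergeSort:
  fixes s0 :: state
  assumes n: "fst s0 ''n'' 0 = n"
  shows "wp MergeSort s0 (\<lambda>t s. t \<le> (lg n + 1) * (300 * n + 300) \<and>
     mset (map (fst s ''idx'') [0..<n]) = mset [0..<n] \<and>
     (\<forall>x y. x < y \<longrightarrow> y < n \<longrightarrow> snd s0 ''key'' (fst s ''idx'' x) \<le> snd s0 ''key'' (fst s ''idx'' y)))"
proof -
  let ?key = "snd s0 ''key''"
  let ?Q = "\<lambda>t s. t \<le> (lg n + 1) * (300 * n + 300) \<and> mset (map (fst s ''idx'') [0..<n]) = mset [0..<n] \<and>
     (\<forall>x y. x < y \<longrightarrow> y < n \<longrightarrow> ?key (fst s ''idx'' x) \<le> ?key (fst s ''idx'' y))"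
  show ?thesis unfolding MergeSort_def Block.simps wp_Seq
  proof (rule wp_For[where Inv = "\<lambda>j s'. \<forall>x<j. fst s' ''idx'' x = x" and n = n and T = 8], goal_cases)
    case (6 j s')
    then show ?case by (auto simp: less_Suc_eq)
  next
    case (7 t s)
    have d: "snd s ''key'' = ?key" "fst s ''n'' 0 = n" "\<And>x. x < n \<Longrightarrow> fst s ''idx'' x = x"
      using 7 n by (simp_all add: agree_def)
    have t: "t \<le> n * 22 + 14" using 7(1) by simp
    have r: "runs (Suc 0) n ?key (fst s ''idx'')" unfolding runs_def by simp
    define Inv where "Inv j s' \<longleftrightarrow> fst s' ''sw'' 0 = 2 ^ j \<and> fst s' ''n'' 0 = n \<and> snd s' ''key'' = ?key \<and>
        runs (2 ^ j) n ?key (fst s' ''idx'') \<and> mset (map (fst s' ''idx'') [0..<n]) = mset [0..<n]" for j and s' :: state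
    have "wp (While (NLess (Var ''sw'') (Var ''n'')) MergePass) (nstore ''sw'' 0 1 s)
       (\<lambda>t' s'. ?Q (1 + t + (1 + (1 + 1 + 1) + t')) s')"
    proof (rule wp_While[where Inv = Inv and n = "lg n" and T = "220 * n + 220"], goal_cases)
      case (1 j s')
      then have j: "j < lg n" unfolding Inv_def by (intro lg_greater) simp
      have "wp MergePass s' (\<lambda>t s''. t \<le> 220 * n + 220 \<and> fst s'' ''sw'' 0 = 2 * 2 ^ j \<and>
         runs (2 * 2 ^ j) n (snd s'' ''key'') (fst s'' ''idx'') \<and>
         mset (map (fst s'' ''idx'') [0..<n]) = mset (map (fst s' ''idx'') [0..<n]))"
        using 1(1) by (intro wp_MergePass) (simp_all add: Inv_def)
      then have "wp MergePass s' (\<lambda>t s''. t \<le> 220 * n + 220 \<and> Inv (Suc j) s'')"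
        by (rule wp_use) (use 1(1) in \<open>simp add: Inv_def agree_def\<close>)
      then show ?case using j by blast
    next
      case 2
      have "map (fst s ''idx'') [0..<n] = [0..<n]" by (rule map_idI) (simp add: d(3))
      then show ?case unfolding Inv_def using d r by simp
    next
      case (3 j t' s')
      have "n \<le> 2 ^ j" using 3 unfolding Inv_def by simp
      then have srt: "\<forall>x y. x < y \<longrightarrow> y < n \<longrightarrow> ?key (fst s' ''idx'' x) \<le> ?key (fst s' ''idx'' y)"
      proof (intro allI impI)
        fix x y assume xy: "x < y" "y < n"
        then have "x div 2 ^ j = y div 2 ^ j" using \<open>n \<le> 2 ^ j\<close> by simp
        then show "?key (fst s' ''idx'' x) \<le> ?key (fst s' ''idx'' y)"
          using 3(3) xy unfolding Inv_def runs_def by blast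
      qed
      have "t' \<le> lg n * (220 * n + 226) + 6" using 3(1) by (simp add: algebra_simps)
      then have "1 + t + (1 + (1 + 1 + 1) + t') \<le> (lg n + 1) * (300 * n + 300)" using t
        by (simp add: algebra_simps)
      then show ?case using srt 3(3) unfolding Inv_def by blast
    qed
    then show ?case by (simp only: wp_NAssign nval.simps ncost.simps)
  qed (use n in auto)
qed

end

section \<open>Initial order and greedy bases\<close>

text \<open>The arrays \<open>u\<close> and \<open>v\<close> hold keys whose lexicographic order is
  the initial order: weight and slope at a finite left end, negated slope and intercept
  otherwise.\<close>

definition OrderKeys :: com where
  "OrderKeys = For ''i'' (Var ''m'') (Cond (Positive (Var ''lo_finite''))
     (Seq (RAssign ''u'' (Var ''i'') (RAdd (RCell ''a'' (Var ''i'')) (RMul (RVar ''lo'') (RCell ''b'' (Var ''i'')))))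
          (RAssign ''v'' (Var ''i'') (RCell ''b'' (Var ''i''))))
     (Seq (RAssign ''u'' (Var ''i'') (RSub (RConst 0) (RCell ''b'' (Var ''i''))))
          (RAssign ''v'' (Var ''i'') (RCell ''a'' (Var ''i'')))))"

text \<open>The guard is the lexicographic comparison of the keys, with the disjunction written by
  negation and conjunction.\<close>

definition CountBelow :: com where
  "CountBelow = For ''j'' (Var ''m'') (Cond
     (BNot (BAnd (BNot (RLess (RCell ''u'' (Var ''j'')) (RCell ''u'' (Var ''i''))))
       (BNot (BAnd (BNot (RLess (RCell ''u'' (Var ''i'')) (RCell ''u'' (Var ''j''))))
         (RLess (RCell ''v'' (Var ''j'')) (RCell ''v'' (Var ''i'')))))))
     (Increment ''r'') Skip)"

text \<open>Counting smaller elements takes quadratic time, which the bound allows, and copes with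
  pairs as keys, whereas \<open>MergeSort\<close> compares single reals.\<close>

definition OrderRanks :: com where
  "OrderRanks = For ''i'' (Var ''m'') (Block [NSet ''r'' (NConst 0), CountBelow,
     NAssign ''ord'' (Var ''r'') (Var ''i'')])"

text \<open>Elements marked in \<open>X\<close> count as deleted. The cells \<open>ri\<close> and
  \<open>rs\<close> accumulate the intercept and slope of the weight of the basis.\<close>

definition GreedyStep :: "name \<Rightarrow> com" where
  "GreedyStep A = Seq (NSet ''x'' (NCell ''ord'' (Var ''i'')))
     (Cond (Positive (NCell ''X'' (Var ''x''))) Skip
       (Block [NAssign A (NAdd (Var ''o'') (Var ''x'')) (NConst 1), Test ''t'' (NConst 0) A (Var ''o''),
         Cond (Positive (Var ''t''))
           (Block [RSet ''ri'' (RAdd (RVar ''ri'') (RCell ''a'' (Var ''x''))),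
              RSet ''rs'' (RAdd (RVar ''rs'') (RCell ''b'' (Var ''x''))), Increment ''cnt''])
           (NAssign A (NAdd (Var ''o'') (Var ''x'')) (NConst 0))]))"

definition Greedy :: "name \<Rightarrow> com" where
  "Greedy A = For ''i'' (Var ''m'') (GreedyStep A)"

definition MarkLayer :: com where
  "MarkLayer = For ''y'' (Var ''m'') (Cond (Positive (NCell ''V'' (NAdd (Var ''o'') (Var ''y''))))
     (NAssign ''X'' (Var ''y'') (NConst 1)) Skip)"

text \<open>The rank is not part of the input; the size of the first layer supplies it.\<close>

definition Layers :: "nat \<Rightarrow> com" where
  "Layers l = For ''j'' (NConst (Suc l)) (Block [NSet ''o'' (NMul (Var ''j'') (Var ''m'')), NSet ''cnt'' (NConst 0),
     Greedy ''V'', Cond (Positive (Var ''j'')) Skip (NSet ''k'' (Var ''cnt'')), MarkLayer])"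

lemma writes_order_greedy [simp]:
  "nat_writes OrderKeys = {''i''}" "real_writes OrderKeys = {''u'', ''v''}"
  "nat_writes CountBelow = {''j'', ''r''}" "real_writes CountBelow = {}"
  "nat_writes OrderRanks = {''i'', ''j'', ''r'', ''ord''}" "real_writes OrderRanks = {}"
  "nat_writes (GreedyStep A) = {''x'', A, ''t'', ''cnt''}" "real_writes (GreedyStep A) = {''ri'', ''rs''}"
  "nat_writes (Greedy A) = {''i'', ''x'', A, ''t'', ''cnt''}" "real_writes (Greedy A) = {''ri'', ''rs''}"
  "nat_writes MarkLayer = {''y'', ''X''}" "real_writes MarkLayer = {}"
  "nat_writes (Layers l) = {''i'', ''j'', ''o'', ''cnt'', ''x'', ''V'', ''t'', ''k'', ''y'', ''X''}"
  "real_writes (Layers l) = {''ri'', ''rs''}"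
  by (auto simp: OrderKeys_def CountBelow_def OrderRanks_def GreedyStep_def Greedy_def MarkLayer_def Layers_def)

locale interdiction_machine = interdiction +
  fixes \<tau> :: nat
begin

sublocale machine m \<F> \<tau> .

definition inputs :: "state \<Rightarrow> bool" where
  "inputs s \<longleftrightarrow> fst s ''m'' 0 = m \<and> (\<forall>x<m. snd s ''a'' x = of_rat (a x)) \<and> (\<forall>x<m. snd s ''b'' x = of_rat (b x))"

lemma inputs_agree: "agree A B s s' \<Longrightarrow> inputs s \<Longrightarrow> ''m'' \<notin> A \<Longrightarrow> ''a'' \<notin> B \<Longrightarrow> ''b'' \<notin> B \<Longrightarrow> inputs s'"
  unfolding inputs_def agree_def by simp

definition start_less :: "nat \<Rightarrow> nat \<Rightarrow> bool" where
  "start_less = (if bdd_below I then right_less (Inf I) else left_less)"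

lemma start_less_order: "strict_order_on E start_less"
  unfolding start_less_def using right_less_order left_less_order by simp

lemma wp_OrderKeys:
  assumes i: "inputs s0" and lo: "fst s0 ''lo_finite'' 0 = of_bool (bdd_below I)" "bdd_below I \<Longrightarrow> snd s0 ''lo'' 0 = Inf I"
  shows "wp OrderKeys s0 (\<lambda>t s. t \<le> 60 * m + 20 \<and> 
     (\<forall>x<m. \<forall>y<m. start_less x y \<longleftrightarrow> snd s ''u'' x < snd s ''u'' y \<or> snd s ''u'' x = snd s ''u'' y \<and> snd s ''v'' x < snd s ''v'' y))"
  unfolding OrderKeys_def
proof (rule wp_For[where n = m and T = 30 and
    Inv = "\<lambda>j s. \<forall>x<j. snd s ''u'' x = (if bdd_below I then wt x (Inf I) else - of_rat (b x)) \<and>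
      snd s ''v'' x = (if bdd_below I then of_rat (b x) else of_rat (a x))"], goal_cases)
  case (6 j s)
  have "inputs s" "fst s ''lo_finite'' 0 = of_bool (bdd_below I)" "bdd_below I \<Longrightarrow> snd s ''lo'' 0 = Inf I"
    using 6(2) i lo unfolding inputs_def agree_def by simp_all
  then show ?case using 6(1,3,4) by (cases "bdd_below I") (simp_all add: inputs_def less_Suc_eq elem_weight_def)
next
  case (7 t s)
  then show ?case
    by (auto simp: start_less_def right_less_def left_less_def of_rat_less)
qed (use i in \<open>auto simp: inputs_def\<close>)

lemma wp_CountBelow:
  assumes i: "inputs s0" and x: "fst s0 ''i'' 0 = x" "x < m" and r: "fst s0 ''r'' 0 = 0"
    and lt: "\<forall>x<m. \<forall>y<m. lt x y \<longleftrightarrow> snd s0 ''u'' x < snd s0 ''u'' y \<or> snd s0 ''u'' x = snd s0 ''u'' y \<and> snd s0 ''v'' x < snd s0 ''v'' y"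
  shows "wp CountBelow s0 (\<lambda>t s. t \<le> 60 * m + 20 \<and> fst s ''r'' 0 = card {y. y < m \<and> lt y x})"
  unfolding CountBelow_def
proof (rule wp_For[where n = m and T = 45 and Inv = "\<lambda>j s. fst s ''r'' 0 = card {y. y < j \<and> lt y x}"], goal_cases)
  case (6 j s)
  have d: "fst s ''i'' 0 = x" "snd s ''u'' = snd s0 ''u''" "snd s ''v'' = snd s0 ''v''"
    using 6(2) x unfolding agree_def by simp_all
  have "{y. y < Suc j \<and> lt y x} = (if lt j x then insert j {y. y < j \<and> lt y x} else {y. y < j \<and> lt y x})"
    by (auto simp: less_Suc_eq)
  then have c: "card {y. y < Suc j \<and> lt y x} = (if lt j x then Suc (card {y. y < j \<and> lt y x}) else card {y. y < j \<and> lt y x})"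
    by simp
  have "lt j x \<longleftrightarrow> snd s0 ''u'' j < snd s0 ''u'' x \<or> \<not> snd s0 ''u'' x < snd s0 ''u'' j \<and> snd s0 ''v'' j < snd s0 ''v'' x"
    using lt 6(1) x(2) by auto
  then show ?case using 6(3,4) d c by simp
qed (use i r in \<open>auto simp: inputs_def\<close>)

lemma wp_OrderRanks:
  assumes i: "inputs s0" 
    and lt: "\<forall>x<m. \<forall>y<m. lt x y \<longleftrightarrow> snd s0 ''u'' x < snd s0 ''u'' y \<or> snd s0 ''u'' x = snd s0 ''u'' y \<and> snd s0 ''v'' x < snd s0 ''v'' y"
    and inj: "inj_on (\<lambda>x. card {y. y < m \<and> lt y x}) {..<m}"
  shows "wp OrderRanks s0 (\<lambda>t s. t \<le> m * (60 * m + 60) + 20 \<and> (\<forall>x<m. fst s ''ord'' (card {y. y < m \<and> lt y x}) = x))"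
  unfolding OrderRanks_def Block.simps
proof (rule wp_For[where n = m and T = "60 * m + 40" and Inv = "\<lambda>j s. \<forall>x<j. fst s ''ord'' (card {y. y < m \<and> lt y x}) = x"], goal_cases)
  case (6 j s)
  show ?case unfolding wp_Seq wp_NAssign
  proof (rule wp_use[OF wp_CountBelow[where x = j and lt = lt]], goal_cases)
    case 1
    then show ?case using 6(2) i unfolding inputs_def agree_def by simp
  next
    case 5
    then show ?case using 6(2) lt unfolding agree_def by simp
  next
    case (6 t s')
    then have "fst s' ''i'' 0 = j" "fst s' ''ord'' = fst s ''ord''"
      using \<open>fst s ''i'' 0 = j\<close> unfolding agree_def by simp_all
    moreover have "card {y. y < m \<and> lt y x} \<noteq> card {y. y < m \<and> lt y j}" if "x < j" for x
      using inj_onD[OF inj, of x j] that \<open>j < m\<close> by auto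
    ultimately show ?case using 6(1) \<open>\<forall>x<j. fst s ''ord'' (card {y. y < m \<and> lt y x}) = x\<close>
      by (auto simp: less_Suc_eq)
  qed (use 6 in simp_all)
next
  case (7 t s)
  then show ?case by (simp add: algebra_simps)
qed (use i in \<open>auto simp: inputs_def\<close>)

end

locale ordered_machine = ordered_interdiction + interdiction_machine
begin

definition ordered :: "(nat \<Rightarrow> nat) \<Rightarrow> bool" where
  "ordered ord \<longleftrightarrow> (\<forall>x<m. ord (rnk x) = x)"

lemma rnk_alt: "rnk x = card {y. y < m \<and> lt y x}"
  unfolding rnk_def by (simp add: lessThan_def)

lemma ordered_at:
  assumes "ordered ord" "j < m" shows "ord j < m" "rnk (ord j) = j"
proof -
  have "j \<in> rnk ` E" using rnk_image assms(2) by simp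
  then obtain x where "x < m" "rnk x = j" by auto
  then show "ord j < m" "rnk (ord j) = j" using assms(1) unfolding ordered_def by auto
qed

lemma wp_GreedyStep:
  assumes A: "A \<notin> {''i'', ''x'', ''t'', ''cnt'', ''m'', ''ord'', ''X'', ''o''}"
    and i: "inputs s" and ord: "ordered (fst s ''ord'')" and o: "fst s ''o'' 0 = off"
    and D: "D = {x. x < m \<and> fst s ''X'' x = 0}" and j: "fst s ''i'' 0 = j" "j < m"
    and B: "\<forall>x<m. fst s A (off + x) \<noteq> 0 \<longleftrightarrow> x \<in> gb D \<and> rnk x < j"
    and out: "\<forall>p. p < off \<or> off + m \<le> p \<longrightarrow> fst s A p = A0 p"
    and sums: "snd s ''ri'' 0 = ri + (\<Sum>x | x \<in> gb D \<and> rnk x < j. of_rat (a x))"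
      "snd s ''rs'' 0 = rs + (\<Sum>x | x \<in> gb D \<and> rnk x < j. of_rat (b x))"
      "fst s ''cnt'' 0 = cnt + card {x \<in> gb D. rnk x < j}"
  shows "wp (GreedyStep A) s (\<lambda>t s'. t \<le> \<tau> + 60 \<and> (\<forall>x<m. fst s' A (off + x) \<noteq> 0 \<longleftrightarrow> x \<in> gb D \<and> rnk x < Suc j) \<and>
    (\<forall>p. p < off \<or> off + m \<le> p \<longrightarrow> fst s' A p = A0 p) \<and>
    snd s' ''ri'' 0 = ri + (\<Sum>x | x \<in> gb D \<and> rnk x < Suc j. of_rat (a x)) \<and>
    snd s' ''rs'' 0 = rs + (\<Sum>x | x \<in> gb D \<and> rnk x < Suc j. of_rat (b x)) \<and>
    fst s' ''cnt'' 0 = cnt + card {x \<in> gb D. rnk x < Suc j})"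
proof -
  define x where "x = fst s ''ord'' j"
  have x: "x < m" "rnk x = j" using ordered_at[OF ord j(2)] unfolding x_def by simp_all
  have DE: "D \<subseteq> E" using D by auto
  have uniq: "rnk y \<noteq> j" if "y < m" "y \<noteq> x" for y using that x inj_onD[OF rnk_inj, of y x] by auto
  have A': "''i'' \<noteq> A" "''x'' \<noteq> A" "''t'' \<noteq> A" "''cnt'' \<noteq> A" "''m'' \<noteq> A" "''ord'' \<noteq> A" "''X'' \<noteq> A" "''o'' \<noteq> A"
    using A by auto
  have gE: "gb D \<subseteq> E" using gb_sub DE by blast
  have set: "{y. y \<in> gb D \<and> rnk y < Suc j} = (if x \<in> gb D then insert x {y. y \<in> gb D \<and> rnk y < j} else {y. y \<in> gb D \<and> rnk y < j})"
  proof (rule set_eqI)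
    fix y
    show "y \<in> {y. y \<in> gb D \<and> rnk y < Suc j} \<longleftrightarrow>
        y \<in> (if x \<in> gb D then insert x {y. y \<in> gb D \<and> rnk y < j} else {y. y \<in> gb D \<and> rnk y < j})"
      using uniq[of y] gE x by (cases "y = x") (auto simp: less_Suc_eq)
  qed
  have xn: "x \<notin> {y. y \<in> gb D \<and> rnk y < j}" using x by simp
  have fin: "finite {y. y \<in> gb D \<and> rnk y < j}" using gE finite_subset[of "gb D" E] by simp
  have sums': "(\<Sum>y | y \<in> gb D \<and> rnk y < Suc j. h y) = (\<Sum>y | y \<in> gb D \<and> rnk y < j. h y) + (if x \<in> gb D then h x else 0)"
    for h :: "nat \<Rightarrow> real" unfolding set using xn fin by simp
  have card': "card {y \<in> gb D. rnk y < Suc j} = card {y \<in> gb D. rnk y < j} + (if x \<in> gb D then 1 else 0)"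
    unfolding set using xn fin by simp
  have less: "{y\<in>gb D. lt y x} = {y. y \<in> gb D \<and> rnk y < j}"
    using rnk_less_iff[of _ x] x gE by auto
  have iff: "\<And>y. y < m \<Longrightarrow> y \<in> gb D \<and> rnk y < Suc j \<longleftrightarrow> (if y = x then x \<in> gb D else y \<in> gb D \<and> rnk y < j)"
    subgoal for y using uniq[of y] x by (cases "y = x") (auto simp: less_Suc_eq) done
  have ne: "fst s A (off + y) \<noteq> 0 \<longleftrightarrow> y \<in> gb D \<and> rnk y < j" if "y < m" for y using B that by blast
  show ?thesis
  proof (cases "fst s ''X'' x = 0")
    case False
    then have "x \<notin> D" using D by simp
    then have xg: "x \<notin> gb D" using gb_sub[of D] by blast
    have "wp (GreedyStep A) s (\<lambda>t s'. t \<le> \<tau> + 60 \<and> s' = nstore ''x'' 0 x s)"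
      using False j(1) unfolding GreedyStep_def by (simp add: x_def[symmetric])
    then show ?thesis
      by (rule wp_mono) (use A A' B out sums xg x in \<open>simp add: sums' card' iff\<close>)
  next
    case True
    then have xD: "x \<in> D" using D x by simp
    have J: "{y. y \<in> gb D \<and> rnk y < j} \<in> \<F>" by (rule sub_gb_ind[OF DE]) blast
    \<comment> \<open>The oracle thus decides membership in the greedy basis: the elements selected
      before \<open>x\<close> are independent and span the same as all of \<open>D\<close> before
      \<open>x\<close>.\<close>
    have test: "insert x {y. y \<in> gb D \<and> rnk y < j} \<in> \<F> \<longleftrightarrow> x \<in> gb D"
      using ind_not_cl[OF _ xn] insert_ind[OF J order_refl] cl_below_gb[OF DE, of x] x xD
      unfolding less by (auto simp: greedy_basis_def)
    let ?s2 = "nstore A (off + x) 1 (nstore ''x'' 0 x s)"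
    have set2: "{e. e < m \<and> fst ?s2 A (off + e) \<noteq> 0} = insert x {y. y \<in> gb D \<and> rnk y < j}"
      using ne x gE A by auto
    let ?r = "rstore ''rs'' 0 (snd s ''rs'' 0 + snd s ''b'' x) (rstore ''ri'' 0 (snd s ''ri'' 0 + snd s ''a'' x) (nstore ''t'' 0 1 ?s2))"
    let ?s3 = "if x \<in> gb D then nstore ''cnt'' 0 (Suc (fst s ''cnt'' 0)) ?r
      else nstore A (off + x) 0 (nstore ''t'' 0 0 ?s2)"
    have "wp (GreedyStep A) s (\<lambda>t s'. t \<le> \<tau> + 60 \<and> s' = ?s3)"
      unfolding GreedyStep_def Block.simps using True j(1) o A A' set2 test
      by (cases "x \<in> gb D") (simp_all add: x_def[symmetric])
    then show ?thesis
    proof (rule wp_mono)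
      fix t :: nat and s' assume h: "t \<le> \<tau> + 60 \<and> s' = ?s3"
      have ab: "snd s ''a'' x = of_rat (a x)" "snd s ''b'' x = of_rat (b x)" using i x unfolding inputs_def by simp_all
      show "t \<le> \<tau> + 60 \<and> (\<forall>x<m. fst s' A (off + x) \<noteq> 0 \<longleftrightarrow> x \<in> gb D \<and> rnk x < Suc j) \<and>
        (\<forall>p. p < off \<or> off + m \<le> p \<longrightarrow> fst s' A p = A0 p) \<and>
        snd s' ''ri'' 0 = ri + (\<Sum>x | x \<in> gb D \<and> rnk x < Suc j. of_rat (a x)) \<and>
        snd s' ''rs'' 0 = rs + (\<Sum>x | x \<in> gb D \<and> rnk x < Suc j. of_rat (b x)) \<and>
        fst s' ''cnt'' 0 = cnt + card {x \<in> gb D. rnk x < Suc j}"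
      proof (cases "x \<in> gb D")
        case True
        then show ?thesis using h A A' B out sums x ab by (auto simp: sums' card' iff)
      next
        case False
        then show ?thesis using h A A' B out sums x by (auto simp: sums' card' iff)
      qed
    qed
  qed
qed

lemma wp_Greedy:
  assumes A: "A \<notin> {''i'', ''x'', ''t'', ''cnt'', ''m'', ''ord'', ''X'', ''o''}"
    and i: "inputs s0" and ord: "ordered (fst s0 ''ord'')" and o: "fst s0 ''o'' 0 = off"
    and D: "D = {x. x < m \<and> fst s0 ''X'' x = 0}"
    and B: "\<forall>x<m. fst s0 A (off + x) = 0"
  shows "wp (Greedy A) s0 (\<lambda>t s'. t \<le> m * (\<tau> + 80) + 20 \<and> (\<forall>x<m. fst s' A (off + x) \<noteq> 0 \<longleftrightarrow> x \<in> gb D) \<and>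
    (\<forall>p. p < off \<or> off + m \<le> p \<longrightarrow> fst s' A p = fst s0 A p) \<and>
    snd s' ''ri'' 0 = snd s0 ''ri'' 0 + (\<Sum>x\<in>gb D. of_rat (a x)) \<and>
    snd s' ''rs'' 0 = snd s0 ''rs'' 0 + (\<Sum>x\<in>gb D. of_rat (b x)) \<and>
    fst s' ''cnt'' 0 = fst s0 ''cnt'' 0 + card (gb D))"
  unfolding Greedy_def
proof (rule wp_For[where n = m and T = "\<tau> + 60" and Inv = "\<lambda>j s. 
    (\<forall>x<m. fst s A (off + x) \<noteq> 0 \<longleftrightarrow> x \<in> gb D \<and> rnk x < j) \<and>
    (\<forall>p. p < off \<or> off + m \<le> p \<longrightarrow> fst s A p = fst s0 A p) \<and>
    snd s ''ri'' 0 = snd s0 ''ri'' 0 + (\<Sum>x | x \<in> gb D \<and> rnk x < j. of_rat (a x)) \<and>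
    snd s ''rs'' 0 = snd s0 ''rs'' 0 + (\<Sum>x | x \<in> gb D \<and> rnk x < j. of_rat (b x)) \<and>
    fst s ''cnt'' 0 = fst s0 ''cnt'' 0 + card {x \<in> gb D. rnk x < j}"], goal_cases)
  case (6 j s)
  have A': "''i'' \<noteq> A" "''x'' \<noteq> A" "''t'' \<noteq> A" "''cnt'' \<noteq> A" "''m'' \<noteq> A" "''ord'' \<noteq> A" "''X'' \<noteq> A" "''o'' \<noteq> A"
    using A by auto
  have "inputs s" using inputs_agree[OF 6(2) i] A' by simp
  moreover have "fst s ''ord'' = fst s0 ''ord''" "fst s ''o'' = fst s0 ''o''" "fst s ''X'' = fst s0 ''X''"
    using 6(2) A' unfolding agree_def by simp_all
  ultimately show ?case using 6 A ord o D by (intro wp_GreedyStep[where off = off and D = D and j = j]) simp_all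
next
  case (7 t s)
  have mem: "x \<in> gb D \<and> rnk x < m \<longleftrightarrow> x \<in> gb D" for x using D gb_sub[of D] rnk_bound[of x] by auto
  show ?case using 7 by (simp add: algebra_simps mem)
qed (use i o B A in \<open>auto simp: inputs_def\<close>)

end

section \<open>The table of relevant elements and the slots\<close>

definition FillTable :: com where
  "FillTable = For ''y'' (Var ''m'') (Cond (Positive (NCell ''X'' (Var ''y'')))
     (Block [NAssign ''W'' (Var ''q'') (Var ''y''), Increment ''q'', NAssign ''X'' (Var ''y'') (NConst 0)]) Skip)"

definition SetupTable :: "nat \<Rightarrow> com" where
  "SetupTable l = Block [NSet ''P'' (NAdd (NMul (NConst (Suc l)) (Var ''k'')) (NConst 2)),
     For ''i'' (Var ''P'') (NAssign ''W'' (Var ''i'') (Var ''m'')), NSet ''q'' (NConst 0), FillTable]"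

definition CountSlots :: "nat \<Rightarrow> com" where
  "CountSlots l = Seq (NSet ''N'' (NConst 1)) (For ''i'' (NConst l) (NSet ''N'' (NMul (Var ''N'') (Var ''P''))))"

text \<open>There is no division on the machine. Digit \<open>j + 1\<close> of \<open>s\<close> is
  digit \<open>j\<close> of the quotient \<open>q\<close>, hence copied from the row of
  \<open>q\<close>, while quotient and remainder are maintained by counting.\<close>

definition DigitRow :: "nat \<Rightarrow> com" where
  "DigitRow l = For ''j'' (NConst (l - 1)) (NAssign ''D'' (NAdd (NAdd (NMul (Var ''s'') (NConst l)) (Var ''j'')) (NConst 1))
     (NCell ''D'' (NAdd (NMul (Var ''q'') (NConst l)) (Var ''j''))))"

definition Digits :: "nat \<Rightarrow> com" where
  "Digits l = Block [NSet ''r'' (NConst 0), NSet ''q'' (NConst 0), For ''s'' (Var ''N'') (Block [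
     NAssign ''D'' (NMul (Var ''s'') (NConst l)) (Var ''r''), DigitRow l, Increment ''r'',
     Cond (NLess (Var ''r'') (Var ''P'')) Skip (Seq (NSet ''r'' (NConst 0)) (Increment ''q''))])]"

text \<open>With \<open>c = 1\<close> the slot is marked as deleted, with \<open>c = 0\<close> the
  marks are erased at a cost independent of \<open>m\<close>. A dummy only touches cell
  \<open>m\<close> of \<open>X\<close>, which no greedy run reads.\<close>

definition MarkSlot :: "nat \<Rightarrow> nat \<Rightarrow> com" where
  "MarkSlot l c = For ''j'' (NConst l) (NAssign ''X''
     (NCell ''W'' (NCell ''D'' (NAdd (NMul (Var ''s'') (NConst l)) (Var ''j'')))) (NConst c))"

definition InitSlots :: "nat \<Rightarrow> com" where
  "InitSlots l = For ''s'' (Var ''N'') (Block [MarkSlot l 1, NSet ''o'' (NMul (Var ''s'') (Var ''m'')),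
     RSet ''ri'' (RConst 0), RSet ''rs'' (RConst 0), Greedy ''B'', RAssign ''ic'' (Var ''s'') (RVar ''ri''),
     RAssign ''sl'' (Var ''s'') (RVar ''rs''), MarkSlot l 0])"

text \<open>An element is relevant exactly if the stored basis of some slot contains it, so scanning
  the bases decides relevance without independence tests.\<close>

definition FindUse :: com where
  "FindUse = For ''s'' (Var ''N'') (Cond (Positive (NCell ''B'' (NAdd (NMul (Var ''s'') (Var ''m'')) (Var ''z''))))
     (NSet ''g'' (NConst 1)) Skip)"

definition RemoveEntry :: com where
  "RemoveEntry = For ''p'' (Var ''P'') (Cond (NEq (NCell ''W'' (Var ''p'')) (Var ''z''))
     (NAssign ''W'' (Var ''p'') (Var ''m'')) Skip)"

definition Clean :: com where
  "Clean = Block [NSet ''g'' (NConst 0), FindUse, Cond (Positive (Var ''g'')) Skip RemoveEntry]"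

lemma writes_slots [simp]:
  "nat_writes FillTable = {''y'', ''W'', ''q'', ''X''}" "real_writes FillTable = {}"
  "nat_writes (SetupTable l) = {''P'', ''i'', ''y'', ''W'', ''q'', ''X''}" "real_writes (SetupTable l) = {}"
  "nat_writes (CountSlots l) = {''N'', ''i''}" "real_writes (CountSlots l) = {}"
  "nat_writes (DigitRow l) = {''j'', ''D''}" "real_writes (DigitRow l) = {}"
  "nat_writes (Digits l) = {''j'', ''D'', ''r'', ''q'', ''s''}" "real_writes (Digits l) = {}"
  "nat_writes (MarkSlot l c) = {''j'', ''X''}" "real_writes (MarkSlot l c) = {}"
  "nat_writes (InitSlots l) = {''s'', ''j'', ''X'', ''o'', ''i'', ''x'', ''B'', ''t'', ''cnt''}"
  "real_writes (InitSlots l) = {''ri'', ''rs'', ''ic'', ''sl''}"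
  "nat_writes FindUse = {''s'', ''g''}" "real_writes FindUse = {}"
  "nat_writes RemoveEntry = {''p'', ''W''}" "real_writes RemoveEntry = {}"
  "nat_writes Clean = {''s'', ''g'', ''p'', ''W''}" "real_writes Clean = {}"
  by (auto simp: FillTable_def SetupTable_def CountSlots_def DigitRow_def Digits_def MarkSlot_def
      InitSlots_def FindUse_def RemoveEntry_def Clean_def)

text \<open>Unused positions of the table hold the dummy element \<open>m\<close>.\<close>
definition table :: "nat \<Rightarrow> (nat \<Rightarrow> nat) \<Rightarrow> nat \<Rightarrow> nat set \<Rightarrow> bool" where
  "table m W P S \<longleftrightarrow> (\<forall>p<P. W p = m \<or> W p \<in> S) \<and> S \<subseteq> W ` {..<P} \<and>
     (\<forall>p<P. \<forall>p'<P. W p = W p' \<longrightarrow> W p \<noteq> m \<longrightarrow> p = p')"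

text \<open>The rows run through all functions from \<open>{..<l}\<close> to the positions. The
  treatment of the slots relies on this alone, not on how the rows are numbered.\<close>

definition digit_table :: "nat \<Rightarrow> nat \<Rightarrow> nat \<Rightarrow> (nat \<Rightarrow> nat) \<Rightarrow> bool" where
  "digit_table l N P D \<longleftrightarrow> (\<forall>s<N. \<forall>j<l. D (s * l + j) < P) \<and>
     (\<forall>g. (\<forall>j<l. g j < P) \<longrightarrow> (\<exists>s<N. \<forall>j<l. D (s * l + j) = g j))"

text \<open>Positions may repeat or hold the dummy, so this can be a set with fewer than
  \<open>l\<close> elements of the ground set.\<close>

definition slot_set :: "nat \<Rightarrow> (nat \<Rightarrow> nat) \<Rightarrow> (nat \<Rightarrow> nat) \<Rightarrow> nat \<Rightarrow> nat set" where
  "slot_set l W D s = (\<lambda>j. W (D (s * l + j))) ` {..<l}"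

lemma card_slot_set: "card (slot_set l W D s) \<le> l"
  unfolding slot_set_def by (rule order_trans[OF card_image_le]) simp_all

lemma finite_slot_set: "finite (slot_set l W D s)"
  unfolding slot_set_def by simp

lemma div_power_Suc: "s div P ^ Suc j = s div P div P ^ (j :: nat)" for s P :: nat
  by (simp add: div_mult2_eq)

text \<open>Horner's rule: the number for the shifted tuple is multiplied by \<open>P\<close>, and
  \<open>g 0\<close> becomes the new lowest digit.\<close>

lemma digits_surj:
  assumes "\<forall>j<l. g j < P"
  shows "\<exists>s<P ^ l. \<forall>j<l. s div P ^ j mod P = (g j :: nat)"
  using assms
proof (induction l arbitrary: g)
  case 0
  then show ?case by simp
next
  case (Suc l)
  obtain s where s: "s < P ^ l" "\<forall>j<l. s div P ^ j mod P = g (Suc j)"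
    using Suc.IH[of "\<lambda>j. g (Suc j)"] Suc.prems by auto
  have g0: "g 0 < P" using Suc.prems by simp
  let ?s = "s * P + g 0"
  have d: "?s div P = s" "?s mod P = g 0" using g0 by simp_all
  have "?s div P ^ j mod P = g j" if "j < Suc l" for j
  proof (cases j)
    case 0
    then show ?thesis using d by simp
  next
    case (Suc i)
    then show ?thesis using s(2) that d(1) unfolding Suc div_power_Suc by simp
  qed
  moreover have "?s < P ^ Suc l"
  proof -
    have "s * P + g 0 < Suc s * P" using g0 by simp
    also have "\<dots> \<le> P ^ l * P" using s(1) by (intro mult_right_mono) simp_all
    finally show ?thesis by (simp add: mult.commute)
  qed
  ultimately show ?case by blast
qed

lemma digit_table_power:
  assumes "\<forall>s<P ^ l. \<forall>j<l. D (s * l + j) = s div P ^ j mod P" "0 < P"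
  shows "digit_table l (P ^ l) P D"
  unfolding digit_table_def
proof (intro conjI allI impI)
  fix g assume "\<forall>j<l. g j < P"
  then obtain s where "s < P ^ l" "\<forall>j<l. s div P ^ j mod P = g j" using digits_surj by blast
  then show "\<exists>s<P ^ l. \<forall>j<l. D (s * l + j) = g j" using assms(1) by (intro exI[of _ s]) simp
qed (use assms in simp)

section \<open>Changing table entries without changing the stored bases\<close>

context ordered_interdiction
begin

definition slots_ok ::
  "nat \<Rightarrow> (nat \<Rightarrow> nat) \<Rightarrow> (nat \<Rightarrow> nat) \<Rightarrow> (nat \<Rightarrow> nat) \<Rightarrow> (nat \<Rightarrow> real) \<Rightarrow> (nat \<Rightarrow> real) \<Rightarrow> bool" where
  "slots_ok N W D B ic sl \<longleftrightarrow> (\<forall>s<N. (\<forall>x<m. B (s * m + x) \<noteq> 0 \<longleftrightarrow> x \<in> gb (E - slot_set l W D s)) \<and>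
     ic s = (\<Sum>x\<in>gb (E - slot_set l W D s). of_rat (a x)) \<and>
     sl s = (\<Sum>x\<in>gb (E - slot_set l W D s). of_rat (b x)))"

lemma slot_gb_relevant: "gb (E - slot_set l W D s) \<subseteq> relevant l"
proof -
  have eq: "E - slot_set l W D s = E - E \<inter> slot_set l W D s" by blast
  have "card (E \<inter> slot_set l W D s) \<le> l"
    using card_slot_set[of l W D s] card_mono[OF finite_slot_set, of "E \<inter> slot_set l W D s" l W D s]
    by (meson inf_le2 le_trans)
  then have "gb (E - E \<inter> slot_set l W D s) \<subseteq> relevant l"
    unfolding relevant_def by (intro UN_upper) simp
  then show ?thesis by (simp only: eq[symmetric])
qed

text \<open>Without a dummy the entries would be \<open>P\<close> different elements of the smaller
  set \<open>S\<close>.\<close>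

lemma table_dummy:
  assumes "table m W P S" "card S < P" "finite S" obtains p where "p < P" "W p = m"
proof -
  have "\<exists>p<P. W p = m"
  proof (rule ccontr)
    assume n: "\<not> ?thesis"
    then have "inj_on W {..<P}" "W ` {..<P} \<subseteq> S" using assms(1) unfolding table_def by (auto intro: inj_onI)
    then have "P \<le> card S" using assms(3) card_inj_on_le[of W "{..<P}" S] by simp
    then show False using assms(2) by simp
  qed
  then show ?thesis using that by blast
qed

text \<open>List the positions of the elements of \<open>F\<close> and fill the remaining places of
  the tuple with a position that holds a dummy; this is why the table must always contain
  one.\<close>

lemma slot_exists:
  assumes t: "table m W P S" "S \<subseteq> E" "card S < P" and d: "digit_table l N P D"
    and F: "F \<subseteq> S" "card F \<le> l"
  obtains s where "s < N" "E \<inter> slot_set l W D s = F" "card F = l \<Longrightarrow> slot_set l W D s = F"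
proof -
  have fin: "finite S" "finite F" using t F finite_E finite_subset by (metis, metis subset_trans)
  obtain dp where dp: "dp < P" "W dp = m" using table_dummy[OF t(1,3) fin(1)] by blast
  obtain h where h: "bij_betw h {..<card F} F" using ex_bij_betw_nat_finite[OF fin(2)] by (metis atLeast0LessThan)
  have "\<forall>x\<in>F. \<exists>p<P. W p = x" using F(1) t(1) unfolding table_def by blast
  then obtain pos where pos: "\<And>x. x \<in> F \<Longrightarrow> pos x < P \<and> W (pos x) = x" by metis
  define g where "g j = (if j < card F then pos (h j) else dp)" for j
  have hF: "h j \<in> F" if "j < card F" for j using h that by (auto simp: bij_betw_def)
  have "\<forall>j<l. g j < P" unfolding g_def using pos hF dp by simp
  then obtain s where s: "s < N" "\<forall>j<l. D (s * l + j) = g j" using d unfolding digit_table_def by blast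
  have eq: "slot_set l W D s = (\<lambda>j. W (g j)) ` {..<l}" unfolding slot_set_def using s(2) by simp
  have Wg: "W (g j) = (if j < card F then h j else m)" for j unfolding g_def using pos hF dp by simp
  have FE: "F \<subseteq> E" using F t by blast
  have im: "h ` {..<card F} = F" using h by (simp add: bij_betw_def)
  have "E \<inter> slot_set l W D s = F"
  proof
    show "E \<inter> slot_set l W D s \<subseteq> F" unfolding eq Wg using hF by auto
    show "F \<subseteq> E \<inter> slot_set l W D s"
    proof
      fix x assume x: "x \<in> F"
      then obtain j where "j < card F" "x = h j" using im by blast
      then show "x \<in> E \<inter> slot_set l W D s" unfolding eq Wg using F(2) x FE by (auto intro!: image_eqI[of _ _ j])
    qed
  qed
  moreover have "slot_set l W D s = F" if "card F = l"
  proof -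
    have "slot_set l W D s = h ` {..<l}" unfolding eq Wg using that by simp
    then show ?thesis using im that by simp
  qed
  ultimately show ?thesis using that s(1) by blast
qed

lemma clean_used:
  assumes "slots_ok N W D B ic sl" "s < N" "z < m" "B (s * m + z) \<noteq> 0"
  shows "z \<in> relevant l"
  using assms slot_gb_relevant unfolding slots_ok_def by blast

text \<open>If \<open>z\<close> were relevant through some \<open>F\<close>, the slot of
  \<open>F \<inter> S\<close> would have the same greedy basis as \<open>F\<close> and would contain
  \<open>z\<close>. As \<open>z\<close> is irrelevant, replacing it by a dummy only returns to the
  complement of a slot an element that greedy does not select.\<close>

lemma clean_unused:
  assumes ok: "slots_ok N W D B ic sl" and t: "table m W P S" "S \<subseteq> E" "card S < P" "relevant l \<subseteq> S"
    and d: "digit_table l N P D" and z: "z < m" and un: "\<forall>s<N. B (s * m + z) = 0"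
  defines "W' \<equiv> \<lambda>p. if p < P \<and> W p = z then m else W p"
  shows "z \<notin> relevant l" "table m W' P (S - {z})" "slots_ok N W' D B ic sl"
proof -
  show zr: "z \<notin> relevant l"
  proof
    assume "z \<in> relevant l"
    then obtain F where F: "F \<subseteq> E" "card F \<le> l" "z \<in> gb (E - F)" unfolding relevant_def by blast
    have "card (F \<inter> S) \<le> l" using F finite_E by (meson card_mono finite_subset inf_le1 le_trans)
    then obtain s where s: "s < N" "E \<inter> slot_set l W D s = F \<inter> S"
      by (rule slot_exists[OF t(1-3) d inf_le2]) blast
    have "E - slot_set l W D s = E - F \<inter> S" using s(2) by blast
    then have "z \<in> gb (E - slot_set l W D s)" using gb_inter_relevant[OF F(1,2) t(4)] F(3) by simp
    then show False using ok s(1) z un unfolding slots_ok_def by blast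
  qed
  show "table m W' P (S - {z})" unfolding table_def
  proof (intro conjI allI impI)
    show "W' p = m \<or> W' p \<in> S - {z}" if "p < P" for p
      using t(1) that unfolding table_def W'_def by auto
    show "S - {z} \<subseteq> W' ` {..<P}"
    proof
      fix x assume x: "x \<in> S - {z}"
      then obtain p where "p < P" "W p = x" using t(1) unfolding table_def by blast
      then show "x \<in> W' ` {..<P}" using x by (intro image_eqI[of _ _ p]) (auto simp: W'_def)
    qed
    show "p = p'" if "p < P" "p' < P" "W' p = W' p'" "W' p \<noteq> m" for p p'
      using t(1) that unfolding table_def W'_def by (auto split: if_splits)
  qed
  have "gb (E - slot_set l W' D s) = gb (E - slot_set l W D s)" if s: "s < N" for s
  proof -
    have lt: "D (s * l + j) < P" if "j < l" for j using d s that unfolding digit_table_def by blast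
    have W': "W' (D (s * l + j)) = (if W (D (s * l + j)) = z then m else W (D (s * l + j)))" if "j < l" for j
      unfolding W'_def using lt[OF that] by simp
    show ?thesis
    proof (cases "z \<in> slot_set l W D s")
      case True
      \<comment> \<open>The new complement has the additional element \<open>z\<close>;
        \<open>gb_remove\<close> is applied to it, from the larger complement to the smaller
        one.\<close>
      have "E \<inter> slot_set l W' D s = E \<inter> slot_set l W D s - {z}"
        unfolding slot_set_def using W' by auto
      then have "E - slot_set l W D s = (E - slot_set l W' D s) - {z}" using True z by blast
      moreover have "z \<notin> gb (E - slot_set l W' D s)" using zr slot_gb_relevant by blast
      ultimately show ?thesis using gb_remove[of "E - slot_set l W' D s" "{z}"] by auto
    next
      case False
      have "slot_set l W' D s = slot_set l W D s" unfolding slot_set_def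
        using False W' by (intro image_cong) (auto simp: slot_set_def)
      then show ?thesis by simp
    qed
  qed
  then show "slots_ok N W' D B ic sl" using ok unfolding slots_ok_def by simp
qed

text \<open>The slots that use position \<open>p\<close> now delete \<open>f\<close> too. Since
  \<open>f\<close> is irrelevant, it is in none of their bases.\<close>

lemma table_insert:
  assumes ok: "slots_ok N W D B ic sl" and t: "table m W P S" "relevant l \<subseteq> S" "S \<subseteq> E"
    and f: "f < m" "f \<notin> S" and p: "p < P" "W p = m"
  shows "table m (W(p := f)) P (insert f S)" "slots_ok N (W(p := f)) D B ic sl"
proof -
  show "table m (W(p := f)) P (insert f S)" unfolding table_def
  proof (intro conjI allI impI)
    show "(W(p := f)) q = m \<or> (W(p := f)) q \<in> insert f S" if "q < P" for q
      using t(1) that unfolding table_def by auto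
    show "insert f S \<subseteq> (W(p := f)) ` {..<P}"
    proof
      fix x assume x: "x \<in> insert f S"
      show "x \<in> (W(p := f)) ` {..<P}"
      proof (cases "x = f")
        case True
        then show ?thesis using p by (intro image_eqI[of _ _ p]) simp_all
      next
        case xf: False
        then obtain q where q: "q < P" "W q = x" using x t(1) unfolding table_def by blast
        show ?thesis
        proof (cases "q = p")
          case True
          then have "x = m" using q p by simp
          then show ?thesis using x xf t(3) by auto
        next
          case False
          then show ?thesis using q by (intro image_eqI[of _ _ q]) simp_all
        qed
      qed
    qed
    show "q = q'" if "q < P" "q' < P" "(W(p := f)) q = (W(p := f)) q'" "(W(p := f)) q \<noteq> m" for q q'
    proof -
      have "W q \<noteq> f" if "q < P" for q using t(1) f that unfolding table_def by auto
      then show ?thesis using that t(1) unfolding table_def by (auto split: if_splits)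
    qed
  qed
  have "gb (E - slot_set l (W(p := f)) D s) = gb (E - slot_set l W D s)" for s
  proof (cases "\<exists>j<l. D (s * l + j) = p")
    case True
    have "E \<inter> slot_set l (W(p := f)) D s = insert f (E \<inter> slot_set l W D s)"
    proof -
      have "(W(p := f)) q \<in> E \<longleftrightarrow> q = p \<or> W q \<in> E" for q using f(1) by auto
      then show ?thesis unfolding slot_set_def using True p f(1) by (auto split: if_splits)
    qed
    then have "E - slot_set l (W(p := f)) D s = (E - slot_set l W D s) - {f}" by blast
    moreover have "f \<notin> gb (E - slot_set l W D s)" using slot_gb_relevant t(2) f(2) by blast
    ultimately show ?thesis using gb_remove[of "E - slot_set l W D s" "{f}"] by auto
  next
    case False
    then have "slot_set l (W(p := f)) D s = slot_set l W D s" unfolding slot_set_def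
      by (intro image_cong) auto
    then show ?thesis by simp
  qed
  then show "slots_ok N (W(p := f)) D B ic sl" using ok unfolding slots_ok_def by simp
qed

end

lemma (in machine) wp_SetI:
  "nval i s = p \<Longrightarrow> nval u s = v \<Longrightarrow> wp d (nstore x p v s) (\<lambda>t s'. Q (2 + ncost i + ncost u + t) s') \<Longrightarrow>
    wp (Seq (NAssign x i u) d) s Q"
  by simp

context ordered_machine
begin

lemma wp_MarkLayer:
  assumes "inputs s0"
  shows "wp MarkLayer s0 (\<lambda>t s. t \<le> 40 * m + 20 \<and>
     (\<forall>x<m. fst s ''X'' x = 0 \<longleftrightarrow> fst s0 ''X'' x = 0 \<and> fst s0 ''V'' (fst s0 ''o'' 0 + x) = 0))"
  unfolding MarkLayer_def
proof (rule wp_For[where n = m and T = 20 and Inv = "\<lambda>j s. \<forall>x. fst s ''X'' x =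
    (if x < j \<and> fst s0 ''V'' (fst s0 ''o'' 0 + x) \<noteq> 0 then 1 else fst s0 ''X'' x)"], goal_cases)
  case (6 j s)
  have "fst s ''V'' = fst s0 ''V''" "fst s ''o'' = fst s0 ''o''" using 6(2) unfolding agree_def by simp_all
  then show ?case using 6(3,4) by (auto simp: less_Suc_eq)
qed (use assms in \<open>auto simp: inputs_def\<close>)

lemma wp_Layers:
  assumes i: "inputs s0" and ord: "ordered (fst s0 ''ord'')" and X: "\<forall>x. fst s0 ''X'' x = 0" and V: "\<forall>p. fst s0 ''V'' p = 0"
  shows "wp (Layers l) s0 (\<lambda>t s. t \<le> Suc l * (m * (\<tau> + 120) + 120) + 20 \<and> fst s ''k'' 0 = k \<and>
     {x. x < m \<and> fst s ''X'' x \<noteq> 0} = (\<Union>j<Suc l. gb (layer j)))"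
  unfolding Layers_def
proof (rule wp_For[where n = "Suc l" and T = "m * (\<tau> + 120) + 100" and Inv = "\<lambda>j s.
    (\<forall>x<m. fst s ''X'' x = 0 \<longleftrightarrow> x \<in> layer j) \<and> (\<forall>p. j * m \<le> p \<longrightarrow> fst s ''V'' p = 0) \<and> (0 < j \<longrightarrow> fst s ''k'' 0 = k)"], goal_cases)
  case (6 j s)
  have c: "inputs s" "fst s ''ord'' = fst s0 ''ord''" "fst s ''m'' 0 = m"
    using 6(2) i unfolding agree_def inputs_def by simp_all
  define s1 where "s1 = nstore ''cnt'' 0 0 (nstore ''o'' 0 (j * m) s)"
  have s1: "inputs s1" "fst s1 ''ord'' = fst s0 ''ord''" "fst s1 ''o'' 0 = j * m" "fst s1 ''X'' = fst s ''X''"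
    "fst s1 ''V'' = fst s ''V''" "fst s1 ''j'' = fst s ''j''" "fst s1 ''k'' = fst s ''k''" "fst s1 ''cnt'' 0 = 0"
    using c unfolding s1_def inputs_def by simp_all
  have D: "layer j = {x. x < m \<and> fst s1 ''X'' x = 0}" using 6(4) layer_sub[of j] s1 by auto
  have g: "wp (Greedy ''V'') s1 (\<lambda>t s'. t \<le> m * (\<tau> + 80) + 20 \<and> (\<forall>x<m. fst s' ''V'' (j * m + x) \<noteq> 0 \<longleftrightarrow> x \<in> gb (layer j)) \<and>
    (\<forall>p. p < j * m \<or> j * m + m \<le> p \<longrightarrow> fst s' ''V'' p = fst s1 ''V'' p) \<and>
    snd s' ''ri'' 0 = snd s1 ''ri'' 0 + (\<Sum>x\<in>gb (layer j). of_rat (a x)) \<and>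
    snd s' ''rs'' 0 = snd s1 ''rs'' 0 + (\<Sum>x\<in>gb (layer j). of_rat (b x)) \<and>
    fst s' ''cnt'' 0 = fst s1 ''cnt'' 0 + card (gb (layer j)))"
    by (rule wp_Greedy[OF _ s1(1) _ s1(3) D]) (use s1 ord 6(4) in simp_all)
  have run: "wp (Seq (Greedy ''V'') (Seq (Cond (Positive (Var ''j'')) Skip (NSet ''k'' (Var ''cnt''))) MarkLayer)) s1
     (\<lambda>t s. t \<le> m * (\<tau> + 120) + 70 \<and> (\<forall>x<m. fst s ''X'' x = 0 \<longleftrightarrow> x \<in> layer (Suc j)) \<and>
       (\<forall>p. Suc j * m \<le> p \<longrightarrow> fst s ''V'' p = 0) \<and> fst s ''k'' 0 = k)"
    unfolding wp_Seq
  proof (rule wp_use[OF g], goal_cases)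
    case (1 t s2)
    have s2: "inputs s2" "fst s2 ''X'' = fst s ''X''" "fst s2 ''o'' 0 = j * m" "fst s2 ''j'' 0 = j" "fst s2 ''k'' = fst s ''k''"
      using inputs_agree[OF 1(2) s1(1)] 1(2) s1 6(3) unfolding agree_def by simp_all
    have "wp (Cond (Positive (Var ''j'')) Skip (NSet ''k'' (Var ''cnt''))) s2 (\<lambda>t s'. t \<le> 12 \<and> fst s' ''k'' 0 = k)"
      using s2 1(1) s1(8) 6(4) card_gb_E by (cases "j = 0") simp_all
    then show ?case
    proof (rule wp_use, goal_cases)
      case (1 t' s3)
      have s3: "inputs s3" "fst s3 ''X'' = fst s ''X''" "fst s3 ''o'' 0 = j * m" "fst s3 ''V'' = fst s2 ''V''"
        using inputs_agree[OF 1(2) s2(1)] 1(2) s2 unfolding agree_def by simp_all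
      show ?case
      proof (rule wp_use[OF wp_MarkLayer[OF s3(1)]], goal_cases)
        case (1 t'' s4)
        have s4: "fst s4 ''k'' 0 = k" "fst s4 ''V'' = fst s2 ''V''"
          using 1(2) \<open>t' \<le> 12 \<and> fst s3 ''k'' 0 = k\<close> s3(4) unfolding agree_def by simp_all
        have "fst s4 ''X'' x = 0 \<longleftrightarrow> x \<in> layer (Suc j)" if "x < m" for x
          using 1(1) s3 \<open>t \<le> _ \<and> _\<close> 6(4) that by auto
        moreover have "fst s4 ''V'' p = 0" if "Suc j * m \<le> p" for p
          using s4(2) \<open>t \<le> _ \<and> _\<close> s1(5) 6(4) that by (simp add: add.commute)
        moreover have "1 + t + (1 + t' + t'') \<le> m * (\<tau> + 120) + 70"
          using 1(1) \<open>t \<le> _ \<and> _\<close> \<open>t' \<le> _ \<and> _\<close> by (simp add: algebra_simps)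
        ultimately show ?case using s4 by blast
      qed
    qed
  qed
  show ?case unfolding Block.simps
    by (rule wp_SetI[where p = 0 and v = "j * m"], simp, simp add: 6(3) c(3),
        rule wp_SetI[where p = 0 and v = 0], simp, simp, fold s1_def, rule wp_mono[OF run]) simp
next
  case (7 t s)
  have "{x. x < m \<and> fst s ''X'' x \<noteq> 0} = {x. x < m \<and> x \<notin> layer (Suc l)}" using 7(3) by (intro Collect_cong) auto
  also have "\<dots> = (\<Union>j<Suc l. gb (layer j))"
    using layers_union[of "Suc l"] gb_sub layer_sub by (auto, blast)
  finally show ?case using 7 by (simp add: algebra_simps)
qed (use X V in \<open>auto simp: inputs_def\<close>)

end

text \<open>The initial table holds all elements of the layers, possibly more than the relevant
  ones. One pass over the ground set leaves exactly the relevant elements.\<close>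

definition CleanAll :: com where
  "CleanAll = For ''z'' (Var ''m'') Clean"

lemma writes_CleanAll [simp]:
  "nat_writes CleanAll = {''z'', ''s'', ''g'', ''p'', ''W''}" "real_writes CleanAll = {}"
  by (auto simp: CleanAll_def)

lemma (in machine) wp_RSetI:
  "nval i s = p \<Longrightarrow> rval u s = v \<Longrightarrow> wp d (rstore x p v s) (\<lambda>t s'. Q (2 + ncost i + rcost u + t) s') \<Longrightarrow>
    wp (Seq (RAssign x i u) d) s Q"
  by simp

section \<open>Execution of the programs for the table and the slots\<close>

context interdiction_machine
begin

lemma wp_FillTable:
  fixes s0 :: state
  assumes i: "inputs s0" and q: "fst s0 ''q'' 0 = 0" and W: "\<forall>p<P. fst s0 ''W'' p = m"
    and S: "S = {x. x < m \<and> fst s0 ''X'' x \<noteq> 0}" and c: "card S \<le> P"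
  shows "wp FillTable s0 (\<lambda>t s. t \<le> 50 * m + 20 \<and> (\<forall>x<m. fst s ''X'' x = 0) \<and> table m (fst s ''W'') P S)"
  unfolding FillTable_def
proof (rule wp_For[where n = m and T = 30 and Inv = "\<lambda>j s. fst s ''q'' 0 = card {x. x < j \<and> x \<in> S} \<and>
    fst s ''W'' ` {..<card {x. x < j \<and> x \<in> S}} = {x. x < j \<and> x \<in> S} \<and>
    (\<forall>p. card {x. x < j \<and> x \<in> S} \<le> p \<longrightarrow> p < P \<longrightarrow> fst s ''W'' p = m) \<and>
    (\<forall>x. fst s ''X'' x = (if x < j then 0 else fst s0 ''X'' x))"], goal_cases)
  case (6 j s)
  let ?c = "card {x. x < j \<and> x \<in> S}"
  have fin: "finite {x. x < j \<and> x \<in> S}" by simp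
  show ?case
  proof (cases "j \<in> S")
    case True
    have e: "{x. x < Suc j \<and> x \<in> S} = insert j {x. x < j \<and> x \<in> S}" using True by (auto simp: less_Suc_eq)
    then have c': "card {x. x < Suc j \<and> x \<in> S} = Suc ?c" by simp
    have im: "(fst s ''W'')(?c := j) ` {..<Suc ?c} = insert j (fst s ''W'' ` {..<?c})"
      unfolding lessThan_Suc by (auto simp: image_iff)
    show ?thesis unfolding c' using 6(3,4) True S im by (auto simp: e)
  next
    case False
    have e: "{x. x < Suc j \<and> x \<in> S} = {x. x < j \<and> x \<in> S}" using False by (auto simp: less_Suc_eq)
    have "fst s0 ''X'' j = 0" using False S 6(1) by simp
    then show ?thesis unfolding e using 6(3,4) by (auto simp: less_Suc_eq)
  qed
next
  case (7 t s)
  have e: "{x. x < m \<and> x \<in> S} = S" using S by auto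
  note h = 7(3)[unfolded e]
  \<comment> \<open>Injectivity is read off from cardinalities: the first \<open>card S\<close>
    cells have all of \<open>S\<close> as image.\<close>
  have "card (fst s ''W'' ` {..<card S}) = card {..<card S}" using h by simp
  then have inj: "inj_on (fst s ''W'') {..<card S}" by (intro eq_card_imp_inj_on) simp_all
  have Sm: "x < m" if "x \<in> S" for x using that S by simp
  have W1: "fst s ''W'' p \<in> S" if "p < card S" for p using h that by blast
  have W2: "fst s ''W'' p = m" if "card S \<le> p" "p < P" for p using h that by blast
  have "table m (fst s ''W'') P S" unfolding table_def
  proof (intro conjI allI impI)
    show "fst s ''W'' p = m \<or> fst s ''W'' p \<in> S" if "p < P" for p using W1 W2 that by (meson not_le)
    show "S \<subseteq> fst s ''W'' ` {..<P}"
    proof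
      fix x assume "x \<in> S"
      then have "x \<in> fst s ''W'' ` {..<card S}" using h by simp
      then show "x \<in> fst s ''W'' ` {..<P}" using c by auto
    qed
    show "p = p'" if "p < P" "p' < P" "fst s ''W'' p = fst s ''W'' p'" "fst s ''W'' p \<noteq> m" for p p'
    proof -
      have "p < card S" "p' < card S" using W2 that by (metis not_le)+
      then show ?thesis using inj that(3) by (simp add: inj_on_def)
    qed
  qed
  then show ?case using 7(1) h by simp
qed (use i q W in \<open>auto simp: inputs_def\<close>)

lemma wp_SetupTable:
  fixes s0 :: state
  assumes i: "inputs s0" and S: "S = {x. x < m \<and> fst s0 ''X'' x \<noteq> 0}" and c: "card S \<le> Suc l * fst s0 ''k'' 0"
  shows "wp (SetupTable l) s0 (\<lambda>t s. t \<le> 50 * m + 50 * (Suc l * fst s0 ''k'' 0 + 2) + 80 \<and>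
     (\<forall>x<m. fst s ''X'' x = 0) \<and> fst s ''P'' 0 = Suc l * fst s0 ''k'' 0 + 2 \<and> 
     table m (fst s ''W'') (Suc l * fst s0 ''k'' 0 + 2) S)"
proof -
  let ?P = "Suc l * fst s0 ''k'' 0 + 2"
  define s1 where "s1 = nstore ''P'' 0 ?P s0"
  have s1: "inputs s1" "fst s1 ''X'' = fst s0 ''X''" "fst s1 ''P'' 0 = ?P"
    using i unfolding s1_def inputs_def by simp_all
  have "wp (For ''i'' (Var ''P'') (NAssign ''W'' (Var ''i'') (Var ''m''))) s1
     (\<lambda>t s. t \<le> 30 * ?P + 20 \<and> (\<forall>p<?P. fst s ''W'' p = m))"
  proof (rule wp_For[where n = ?P and T = 10 and Inv = "\<lambda>j s. \<forall>p<j. fst s ''W'' p = m"], goal_cases)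
    case (6 j s)
    have "fst s ''m'' 0 = m" using 6(2) s1(1) unfolding agree_def inputs_def by simp
    then show ?case using 6(3,4) by (simp add: less_Suc_eq)
  qed (use s1 in auto)
  then have run: "wp (Seq (For ''i'' (Var ''P'') (NAssign ''W'' (Var ''i'') (Var ''m''))) (Seq (NSet ''q'' (NConst 0)) FillTable)) s1
     (\<lambda>t s. t \<le> 50 * m + 50 * ?P + 60 \<and>
     (\<forall>x<m. fst s ''X'' x = 0) \<and> fst s ''P'' 0 = ?P \<and> table m (fst s ''W'') ?P S)" unfolding wp_Seq[of "For _ _ _"]
  proof (rule wp_use, goal_cases)
    case (1 t s)
    let ?s = "nstore ''q'' 0 0 s"
    have s: "inputs ?s" "fst ?s ''X'' = fst s0 ''X''" "fst ?s ''P'' 0 = ?P"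
      using 1(2) s1 unfolding agree_def inputs_def by simp_all
    have "wp FillTable ?s (\<lambda>t s. t \<le> 50 * m + 20 \<and> (\<forall>x<m. fst s ''X'' x = 0) \<and> table m (fst s ''W'') ?P S)"
      using 1(1) s S c by (intro wp_FillTable) simp_all
    then have run: "wp FillTable ?s (\<lambda>t' s. t' \<le> 50 * m + 20 \<and> (\<forall>x<m. fst s ''X'' x = 0) \<and> table m (fst s ''W'') ?P S \<and> fst s ''P'' 0 = ?P)"
      by (rule wp_use) (use s in \<open>simp add: agree_def\<close>)
    show ?case
      by (rule wp_SetI[where p = 0 and v = 0], simp, simp, rule wp_mono[OF run]) (use 1(1) in simp)
  qed
  show ?thesis unfolding SetupTable_def Block.simps
    by (rule wp_SetI[where p = 0 and v = ?P], simp, simp, fold s1_def, rule wp_mono[OF run]) simp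
qed

lemma wp_CountSlots:
  fixes s0 :: state
  assumes P: "fst s0 ''P'' 0 = P"
  shows "wp (CountSlots l) s0 (\<lambda>t s. t \<le> 40 * l + 40 \<and> fst s ''N'' 0 = P ^ l)"
  unfolding CountSlots_def
proof (rule wp_SetI[where p = 0 and v = 1], simp, simp,
    rule wp_For[where n = l and T = 15 and Inv = "\<lambda>j s. fst s ''N'' 0 = P ^ j"], goal_cases)
  case (6 j s)
  have "fst s ''P'' 0 = P" using 6(2) P unfolding agree_def by simp
  then show ?case using 6(4) by simp
qed (use P in auto)

lemma wp_DigitRow:
  fixes s0 :: state
  assumes r: "fst s0 ''s'' 0 = r" and q: "fst s0 ''q'' 0 = r div P" and P: "1 < P"
    and rows: "\<forall>r'<r. \<forall>j<l. fst s0 ''D'' (r' * l + j) = r' div P ^ j mod P" and D: "fst s0 ''D'' (r * l) = r mod P"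
  shows "wp (DigitRow l) s0 (\<lambda>t s. t \<le> 50 * l + 20 \<and> (\<forall>r'\<le>r. \<forall>j<l. fst s ''D'' (r' * l + j) = r' div P ^ j mod P))"
  unfolding DigitRow_def
proof (rule wp_For[where n = "l - 1" and T = 30 and Inv = "\<lambda>j s. (\<forall>j'\<le>j. fst s ''D'' (r * l + j') = r div P ^ j' mod P) \<and>
    (\<forall>p<r * l. fst s ''D'' p = fst s0 ''D'' p)"], goal_cases)
  case (6 j s)
  have c: "fst s ''s'' 0 = r" "fst s ''q'' 0 = r div P" using 6(2) r q unfolding agree_def by simp_all
  have j: "j < l" using 6(1) by simp
  have "fst s ''D'' (r div P * l + j) = r div P div P ^ j mod P"
  \<comment> \<open>For \<open>r = 0\<close> the row of the quotient is the row being written, whose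
    entries up to \<open>j\<close> exist already; otherwise it is an earlier, complete row.\<close>
  proof (cases "r = 0")
    case True
    then show ?thesis using 6(4) by simp
  next
    case False
    then have lt: "r div P < r" using P by simp
    then have "Suc (r div P) * l \<le> r * l" by (intro mult_right_mono) simp_all
    then have "r div P * l + j < r * l" using j by simp
    then show ?thesis using 6(4) rows lt j by simp
  qed
  then have "fst s ''D'' (r div P * l + j) = r div P ^ Suc j mod P" by (simp only: div_power_Suc)
  then show ?case using c 6(3,4) by (auto simp: le_Suc_eq simp del: power_Suc)
next
  case (7 t s)
  have "fst s ''D'' (r' * l + j) = r' div P ^ j mod P" if "r' \<le> r" "j < l" for r' j
  proof (cases "r' = r")
    case True
    have "j \<le> l - 1" using that by simp
    then show ?thesis using 7(3) True by simp
  next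
    case False
    then have lt: "r' < r" using that by simp
    then have "Suc r' * l \<le> r * l" by (intro mult_right_mono) simp_all
    then have "r' * l + j < r * l" using that by simp
    then show ?thesis using 7(3) rows lt that by simp
  qed
  moreover have "t \<le> 50 * l + 20" using 7(1) l_pos by (simp add: algebra_simps)
  ultimately show ?case by blast
qed (use D in auto)

lemma wp_Digits:
  fixes s0 :: state
  assumes N: "fst s0 ''N'' 0 = P ^ l" and P: "fst s0 ''P'' 0 = P" "1 < P"
  shows "wp (Digits l) s0 (\<lambda>t s. t \<le> P ^ l * (50 * l + 120) + 40 \<and> digit_table l (P ^ l) P (fst s ''D''))"
proof -
  define s1 where "s1 = nstore ''q'' 0 0 (nstore ''r'' 0 0 s0)"
  have s1: "fst s1 ''N'' 0 = P ^ l" "fst s1 ''P'' 0 = P" "fst s1 ''q'' 0 = 0" "fst s1 ''r'' 0 = 0" "fst s1 ''D'' = fst s0 ''D''"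
    using N P unfolding s1_def by simp_all
  have run: "wp (For ''s'' (Var ''N'') (Block [
     NAssign ''D'' (NMul (Var ''s'') (NConst l)) (Var ''r''), DigitRow l, Increment ''r'',
     Cond (NLess (Var ''r'') (Var ''P'')) Skip (Seq (NSet ''r'' (NConst 0)) (Increment ''q''))])) s1
     (\<lambda>t s. t \<le> P ^ l * (50 * l + 120) + 20 \<and> digit_table l (P ^ l) P (fst s ''D''))"
  proof (rule wp_For[where n = "P ^ l" and T = "50 * l + 100" and Inv = "\<lambda>j s. fst s ''r'' 0 = j mod P \<and> fst s ''q'' 0 = j div P \<and>
      (\<forall>r'<j. \<forall>i<l. fst s ''D'' (r' * l + i) = r' div P ^ i mod P)"], goal_cases)
    case (6 j s)
    have c: "fst s ''P'' 0 = P" using 6(2) s1 unfolding agree_def by simp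
    let ?s = "nstore ''D'' (j * l) (j mod P) s"
    have rows: "\<forall>r'<j. \<forall>i<l. fst ?s ''D'' (r' * l + i) = r' div P ^ i mod P"
    proof (intro allI impI)
      fix r' i assume "r' < j" "i < l"
      then have "Suc r' * l \<le> j * l" by (intro mult_right_mono) simp_all
      then have "r' * l + i \<noteq> j * l" using \<open>i < l\<close> by simp
      then show "fst ?s ''D'' (r' * l + i) = r' div P ^ i mod P" using 6(4) \<open>r' < j\<close> \<open>i < l\<close> by simp
    qed
    have "wp (DigitRow l) ?s (\<lambda>t s. t \<le> 50 * l + 20 \<and> (\<forall>r'\<le>j. \<forall>i<l. fst s ''D'' (r' * l + i) = r' div P ^ i mod P))"
      using 6(3,4) rows P(2) by (intro wp_DigitRow) simp_all
    then have "wp (DigitRow l) ?s (\<lambda>t s. (t \<le> 50 * l + 20 \<and> (\<forall>r'\<le>j. \<forall>i<l. fst s ''D'' (r' * l + i) = r' div P ^ i mod P)) \<and>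
        fst s ''r'' 0 = j mod P \<and> fst s ''q'' 0 = j div P \<and> fst s ''P'' 0 = P)"
      by (rule wp_use) (use 6(4) c in \<open>simp add: agree_def\<close>)
    then show ?case unfolding Block.simps
    proof (intro wp_SetI[where p = "j * l" and v = "j mod P"], goal_cases)
      case 3
      then show ?case unfolding wp_Seq[of "DigitRow _"]
      proof (rule wp_mono, goal_cases)
        case (1 t s')
        have "Suc (j mod P) < P \<Longrightarrow> Suc j mod P = Suc (j mod P) \<and> Suc j div P = j div P"
          by (simp add: div_Suc mod_Suc)
        moreover have "\<not> Suc (j mod P) < P \<Longrightarrow> Suc j mod P = 0 \<and> Suc j div P = Suc (j div P)"
        proof -
          assume n: "\<not> Suc (j mod P) < P"
          have "j mod P < P" using P(2) by simp
          then have "Suc (j mod P) = P" using n by linarith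
          then show ?thesis by (simp add: div_Suc mod_Suc)
        qed
        ultimately show ?case using 1 by (simp add: less_Suc_eq_le)
      qed
    qed (use 6 in simp_all)
  next
    case (7 t s)
    then show ?case using digit_table_power[of P l "fst s ''D''"] P(2) by (simp add: algebra_simps)
  qed (use s1 in auto)
  show ?thesis unfolding Digits_def Block.simps
    by (rule wp_SetI[where p = 0 and v = 0], simp, simp, rule wp_SetI[where p = 0 and v = 0], simp, simp,
        fold s1_def, rule wp_mono[OF run[unfolded Block.simps]]) simp
qed

lemma wp_MarkSlot:
  fixes s0 :: state
  assumes "fst s0 ''s'' 0 = r"
  shows "wp (MarkSlot l c) s0 (\<lambda>t s. t \<le> 40 * l + 20 \<and>
    (\<forall>x. fst s ''X'' x = (if x \<in> slot_set l (fst s0 ''W'') (fst s0 ''D'') r then c else fst s0 ''X'' x)))"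
  unfolding MarkSlot_def
proof (rule wp_For[where n = l and T = 20 and Inv = "\<lambda>j s. \<forall>x. fst s ''X'' x =
    (if x \<in> (\<lambda>i. fst s0 ''W'' (fst s0 ''D'' (r * l + i))) ` {..<j} then c else fst s0 ''X'' x)"], goal_cases)
  case (6 j s)
  have "fst s ''s'' 0 = r" "fst s ''W'' = fst s0 ''W''" "fst s ''D'' = fst s0 ''D''"
    using 6(2) assms unfolding agree_def by simp_all
  then show ?case using 6(3,4) by (auto simp: lessThan_Suc)
next
  case (7 t s)
  then show ?case by (simp add: slot_set_def)
qed auto

lemma wp_FindUse:
  fixes s0 :: state
  assumes i: "inputs s0" and N: "fst s0 ''N'' 0 = N" and g: "fst s0 ''g'' 0 = 0" and z: "fst s0 ''z'' 0 = z"
  shows "wp FindUse s0 (\<lambda>t s. t \<le> 40 * N + 20 \<and> (fst s ''g'' 0 > 0 \<longleftrightarrow> (\<exists>r<N. fst s0 ''B'' (r * m + z) \<noteq> 0)))"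
  unfolding FindUse_def
proof (rule wp_For[where n = N and T = 20 and Inv = "\<lambda>j s. fst s ''g'' 0 > 0 \<longleftrightarrow> (\<exists>r<j. fst s0 ''B'' (r * m + z) \<noteq> 0)"], goal_cases)
  case (6 j s)
  have "fst s ''m'' 0 = m" "fst s ''z'' 0 = z" "fst s ''B'' = fst s0 ''B''"
    using 6(2) z i unfolding agree_def inputs_def by simp_all
  then show ?case using 6(3,4) by (auto simp: less_Suc_eq)
qed (use N g in auto)

lemma wp_RemoveEntry:
  fixes s0 :: state
  assumes i: "inputs s0" and P: "fst s0 ''P'' 0 = P" and z: "fst s0 ''z'' 0 = z"
  shows "wp RemoveEntry s0 (\<lambda>t s. t \<le> 50 * P + 20 \<and> fst s ''W'' = (\<lambda>p. if p < P \<and> fst s0 ''W'' p = z then m else fst s0 ''W'' p))"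
  unfolding RemoveEntry_def
proof (rule wp_For[where n = P and T = 30 and Inv = "\<lambda>j s. fst s ''W'' = (\<lambda>p. if p < j \<and> fst s0 ''W'' p = z then m else fst s0 ''W'' p)"], goal_cases)
  case (6 j s)
  have "fst s ''m'' 0 = m" "fst s ''z'' 0 = z"
    using 6(2) z i unfolding agree_def inputs_def by simp_all
  then show ?case using 6(3,4) by (auto simp: less_Suc_eq fun_eq_iff)
qed (use P in auto)

lemma wp_Clean:
  fixes s0 :: state
  assumes i: "inputs s0" and N: "fst s0 ''N'' 0 = N" and P: "fst s0 ''P'' 0 = P" and z: "fst s0 ''z'' 0 = z"
  shows "wp Clean s0 (\<lambda>t s. t \<le> 40 * N + 50 * P + 60 \<and> fst s ''W'' = 
    (if \<exists>r<N. fst s0 ''B'' (r * m + z) \<noteq> 0 then fst s0 ''W''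
     else (\<lambda>p. if p < P \<and> fst s0 ''W'' p = z then m else fst s0 ''W'' p)))"
  unfolding Clean_def Block.simps
proof (rule wp_SetI[where p = 0 and v = 0], simp, simp)
  let ?s = "nstore ''g'' 0 0 s0"
  have "wp FindUse ?s (\<lambda>t s. t \<le> 40 * N + 20 \<and> (fst s ''g'' 0 > 0 \<longleftrightarrow> (\<exists>r<N. fst ?s ''B'' (r * m + z) \<noteq> 0)))"
    using i N z by (intro wp_FindUse) (simp_all add: inputs_def)
  then show "wp (Seq FindUse (Cond (Positive (Var ''g'')) Skip RemoveEntry)) ?s
    (\<lambda>t s. 2 + ncost (NConst 0) + ncost (NConst 0) + t \<le> 40 * N + 50 * P + 60 \<and> fst s ''W'' = 
    (if \<exists>r<N. fst s0 ''B'' (r * m + z) \<noteq> 0 then fst s0 ''W''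
     else (\<lambda>p. if p < P \<and> fst s0 ''W'' p = z then m else fst s0 ''W'' p)))"
    unfolding wp_Seq
  proof (rule wp_use, goal_cases)
    case (1 t s)
    have c: "inputs s" "fst s ''P'' 0 = P" "fst s ''z'' 0 = z" "fst s ''W'' = fst s0 ''W''"
      using 1(2) i P z unfolding agree_def inputs_def by simp_all
    show ?case
    proof (cases "\<exists>r<N. fst s0 ''B'' (r * m + z) \<noteq> 0")
      case True
      then show ?thesis using 1(1) c by simp
    next
      case False
      then have "\<not> fst s ''g'' 0 > 0" using 1(1) by simp
      then show ?thesis unfolding wp_Cond
        using 1(1) c False wp_use[OF wp_RemoveEntry[OF c(1-3)]]
        by (auto intro!: wp_use[OF wp_RemoveEntry[OF c(1-3)]])
    qed
  qed
qed

end

context ordered_machine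
begin

text \<open>The only place where the bases of slots are computed from scratch, with \<open>m\<close>
  tests for each slot. This happens once, so the factor \<open>m\<close> is within the
  bound.\<close>

lemma wp_InitSlots:
  assumes i: "inputs s0" and ord: "ordered (fst s0 ''ord'')" and N: "fst s0 ''N'' 0 = N"
    and X: "\<forall>x<m. fst s0 ''X'' x = 0" and B: "\<forall>p. fst s0 ''B'' p = 0"
  shows "wp (InitSlots l) s0 (\<lambda>t s. t \<le> N * (m * (\<tau> + 80) + 80 * l + 150) + 20 \<and>
     slots_ok N (fst s0 ''W'') (fst s0 ''D'') (fst s ''B'') (snd s ''ic'') (snd s ''sl''))"
  unfolding InitSlots_def
proof (rule wp_For[where n = N and T = "m * (\<tau> + 80) + 80 * l + 130" and Inv = "\<lambda>j s. (\<forall>x<m. fst s ''X'' x = 0) \<and> (\<forall>p. j * m \<le> p \<longrightarrow> fst s ''B'' p = 0) \<and>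
    slots_ok j (fst s0 ''W'') (fst s0 ''D'') (fst s ''B'') (snd s ''ic'') (snd s ''sl'')"], goal_cases)
  case (6 j s)
  let ?W = "fst s0 ''W''" and ?D = "fst s0 ''D''"
  let ?F = "slot_set l ?W ?D j"
  have c: "inputs s" "fst s ''ord'' = fst s0 ''ord''" "fst s ''m'' 0 = m" "fst s ''W'' = ?W" "fst s ''D'' = ?D"
    using 6(2) i unfolding agree_def inputs_def by simp_all
  have "wp (MarkSlot l 1) s (\<lambda>t s1. t \<le> 40 * l + 20 \<and> (\<forall>x. fst s1 ''X'' x = (if x \<in> slot_set l (fst s ''W'') (fst s ''D'') j then 1 else fst s ''X'' x)))"
    by (rule wp_MarkSlot[OF 6(3)])
  then show ?case unfolding Block.simps wp_Seq[of "MarkSlot _ _"]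
  proof (rule wp_use, goal_cases)
    case (1 t1 s1)
    define s2 where "s2 = rstore ''rs'' 0 0 (rstore ''ri'' 0 0 (nstore ''o'' 0 (j * m) s1))"
    have s2: "inputs s2" "fst s2 ''ord'' = fst s0 ''ord''" "fst s2 ''o'' 0 = j * m" "fst s2 ''B'' = fst s ''B''"
      "fst s2 ''s'' 0 = j" "fst s2 ''W'' = ?W" "fst s2 ''D'' = ?D" "snd s2 ''ic'' = snd s ''ic''" "snd s2 ''sl'' = snd s ''sl''"
      "snd s2 ''ri'' 0 = 0" "snd s2 ''rs'' 0 = 0" "fst s2 ''X'' = fst s1 ''X''"
      using 1(2) c 6(3) unfolding s2_def agree_def inputs_def by simp_all
    have s1: "fst s1 ''s'' 0 = j" "fst s1 ''m'' 0 = m" using 1(2) c 6(3) unfolding agree_def by simp_all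
    have X2: "fst s2 ''X'' x = 0 \<longleftrightarrow> x \<notin> ?F" if "x < m" for x using that 1(1) 6(4) s2(12) c by simp
    have D: "E - ?F = {x. x < m \<and> fst s2 ''X'' x = 0}" using X2 by auto
    have "wp (Greedy ''B'') s2 (\<lambda>t s'. t \<le> m * (\<tau> + 80) + 20 \<and> (\<forall>x<m. fst s' ''B'' (j * m + x) \<noteq> 0 \<longleftrightarrow> x \<in> gb (E - ?F)) \<and>
      (\<forall>p. p < j * m \<or> j * m + m \<le> p \<longrightarrow> fst s' ''B'' p = fst s2 ''B'' p) \<and>
      snd s' ''ri'' 0 = snd s2 ''ri'' 0 + (\<Sum>x\<in>gb (E - ?F). of_rat (a x)) \<and>
      snd s' ''rs'' 0 = snd s2 ''rs'' 0 + (\<Sum>x\<in>gb (E - ?F). of_rat (b x)) \<and>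
      fst s' ''cnt'' 0 = fst s2 ''cnt'' 0 + card (gb (E - ?F)))"
      by (rule wp_Greedy[OF _ s2(1) _ s2(3) D]) (use s2 ord 6(4) in simp_all)
    then have run: "wp (Seq (Greedy ''B'') (Seq (RAssign ''ic'' (Var ''s'') (RVar ''ri''))
       (Seq (RAssign ''sl'' (Var ''s'') (RVar ''rs'')) (MarkSlot l 0)))) s2
       (\<lambda>t s'. t \<le> m * (\<tau> + 80) + 40 * l + 80 \<and> (\<forall>x<m. fst s' ''X'' x = 0) \<and> (\<forall>p. Suc j * m \<le> p \<longrightarrow> fst s' ''B'' p = 0) \<and>
    slots_ok (Suc j) ?W ?D (fst s' ''B'') (snd s' ''ic'') (snd s' ''sl''))" unfolding wp_Seq[of "Greedy _"]
    proof (rule wp_use, goal_cases)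
      case (1 t3 s3)
      let ?s4 = "rstore ''sl'' j (snd s3 ''rs'' 0) (rstore ''ic'' j (snd s3 ''ri'' 0) s3)"
      have s4: "fst ?s4 ''s'' 0 = j" "fst ?s4 ''W'' = ?W" "fst ?s4 ''D'' = ?D" "fst ?s4 ''X'' = fst s2 ''X''"
        "snd s3 ''ic'' = snd s ''ic''" "snd s3 ''sl'' = snd s ''sl''"
        using 1(2) s2 unfolding agree_def by simp_all
      have B3: "fst s3 ''B'' p = 0" if "Suc j * m \<le> p" for p
        using 1(1) s2(4) 6(4) that by (simp add: add.commute)
      have ok: "slots_ok (Suc j) ?W ?D (fst s3 ''B'') (snd ?s4 ''ic'') (snd ?s4 ''sl'')"
        unfolding slots_ok_def
      proof (intro allI impI)
        fix r assume r: "r < Suc j"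
        show "(\<forall>x<m. fst s3 ''B'' (r * m + x) \<noteq> 0 \<longleftrightarrow> x \<in> gb (E - slot_set l ?W ?D r)) \<and>
          snd ?s4 ''ic'' r = (\<Sum>x\<in>gb (E - slot_set l ?W ?D r). of_rat (a x)) \<and>
          snd ?s4 ''sl'' r = (\<Sum>x\<in>gb (E - slot_set l ?W ?D r). of_rat (b x))"
        proof (cases "r = j")
          case True
          then show ?thesis using 1(1) s2 by simp
        next
          case False
          then have rj: "r < j" using r by simp
          then have "Suc r * m \<le> j * m" by (intro mult_right_mono) simp_all
          then have "r * m + x < j * m" if "x < m" for x using that by simp
          then have "fst s3 ''B'' (r * m + x) = fst s ''B'' (r * m + x)" if "x < m" for x using 1(1) that s2(4) by simp
          then show ?thesis using 6(4) rj s4 unfolding slots_ok_def by simp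
        qed
      qed
      have "wp (MarkSlot l 0) ?s4 (\<lambda>t s5. t \<le> 40 * l + 20 \<and>
        (\<forall>x. fst s5 ''X'' x = (if x \<in> slot_set l (fst ?s4 ''W'') (fst ?s4 ''D'') j then 0 else fst ?s4 ''X'' x)))"
        by (rule wp_MarkSlot[OF s4(1)])
      then have fin: "wp (MarkSlot l 0) ?s4 (\<lambda>t s5. t \<le> 40 * l + 20 \<and> (\<forall>x<m. fst s5 ''X'' x = 0) \<and> (\<forall>p. Suc j * m \<le> p \<longrightarrow> fst s5 ''B'' p = 0) \<and>
          slots_ok (Suc j) ?W ?D (fst s5 ''B'') (snd s5 ''ic'') (snd s5 ''sl''))"
      proof (rule wp_use, goal_cases)
        case (1 t5 s5)
        have "fst s5 ''B'' = fst s3 ''B''" "snd s5 ''ic'' = snd ?s4 ''ic''" "snd s5 ''sl'' = snd ?s4 ''sl''"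
          using 1(2) unfolding agree_def by simp_all
        moreover have "fst s5 ''X'' x = 0" if "x < m" for x
          using 1(1) s4 X2[OF that] by simp
        ultimately show ?case using 1(1) B3 ok by simp
      qed
      have j3: "fst s3 ''s'' 0 = j" using s4(1) by simp
      show ?case
        by (rule wp_RSetI[where p = j and v = "snd s3 ''ri'' 0"], simp add: j3, simp,
           rule wp_RSetI[where p = j and v = "snd s3 ''rs'' 0"], simp add: j3, simp, rule wp_mono[OF fin])
          (use 1(1) in \<open>simp add: algebra_simps\<close>)
    qed
    show ?case
      by (rule wp_SetI[where p = 0 and v = "j * m"], simp, simp add: s1, unfold wp_Seq[of "RAssign _ _ _"] wp_RAssign nval.simps rval.simps of_rat_0,
          fold s2_def, rule wp_mono[OF run]) (use 1(1) in simp)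
  qed
next
  case (7 t s)
  then show ?case by (simp add: algebra_simps)
qed (use N X B i in \<open>auto simp: slots_ok_def\<close>)

lemma wp_CleanAll:
  assumes i: "inputs s0" and N: "fst s0 ''N'' 0 = N" and P: "fst s0 ''P'' 0 = P"
    and D: "digit_table l N P (fst s0 ''D'')" and t: "table m (fst s0 ''W'') P S" "relevant l \<subseteq> S" "S \<subseteq> E" "card S < P"
    and ok: "slots_ok N (fst s0 ''W'') (fst s0 ''D'') (fst s0 ''B'') (snd s0 ''ic'') (snd s0 ''sl'')"
  shows "wp CleanAll s0 (\<lambda>t s. t \<le> m * (40 * N + 50 * P + 80) + 20 \<and> table m (fst s ''W'') P (relevant l) \<and>
     slots_ok N (fst s ''W'') (fst s0 ''D'') (fst s0 ''B'') (snd s0 ''ic'') (snd s0 ''sl''))"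
  unfolding CleanAll_def
proof (rule wp_For[where n = m and T = "40 * N + 50 * P + 60" and Inv = "\<lambda>j s. \<exists>S. table m (fst s ''W'') P S \<and>
    relevant l \<subseteq> S \<and> S \<subseteq> E \<and> card S < P \<and> (\<forall>x\<in>S. x < j \<longrightarrow> x \<in> relevant l) \<and>
    slots_ok N (fst s ''W'') (fst s0 ''D'') (fst s0 ''B'') (snd s0 ''ic'') (snd s0 ''sl'')"], goal_cases)
  case (6 j s)
  then obtain S where S: "table m (fst s ''W'') P S" "relevant l \<subseteq> S" "S \<subseteq> E" "card S < P" "\<forall>x\<in>S. x < j \<longrightarrow> x \<in> relevant l"
    "slots_ok N (fst s ''W'') (fst s0 ''D'') (fst s0 ''B'') (snd s0 ''ic'') (snd s0 ''sl'')" by blast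
  have c: "inputs s" "fst s ''N'' 0 = N" "fst s ''P'' 0 = P" "fst s ''B'' = fst s0 ''B''"
    using 6(2) i N P unfolding agree_def inputs_def by simp_all
  have "wp Clean s (\<lambda>t s'. t \<le> 40 * N + 50 * P + 60 \<and> fst s' ''W'' = 
    (if \<exists>r<N. fst s ''B'' (r * m + j) \<noteq> 0 then fst s ''W''
     else (\<lambda>p. if p < P \<and> fst s ''W'' p = j then m else fst s ''W'' p)))"
    by (rule wp_Clean[OF c(1-3) 6(3)])
  then show ?case
  proof (rule wp_mono, goal_cases)
    case (1 t s')
    show ?case
    proof (cases "\<exists>r<N. fst s0 ''B'' (r * m + j) \<noteq> 0")
      case True
      then have W: "fst s' ''W'' = fst s ''W''" using 1 c by simp
      have "j \<in> relevant l" using True clean_used[OF S(6)] 6(1) by blast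
      then show ?thesis using 1 W S by (auto simp: less_Suc_eq)
    next
      case False
      then have "\<not> (\<exists>r<N. fst s ''B'' (r * m + j) \<noteq> 0)" using c by simp
      then have W: "fst s' ''W'' = (\<lambda>p. if p < P \<and> fst s ''W'' p = j then m else fst s ''W'' p)"
        using 1 by (simp only: if_False)
      have un: "\<forall>r<N. fst s0 ''B'' (r * m + j) = 0" using False by simp
      note cu = clean_unused[OF S(6,1,3,4,2) D 6(1) un]
      have "card (S - {j}) < P" using S(4) by (meson card_Diff1_le le_less_trans)
      then show ?thesis unfolding W using 1 cu S(2,3,5)
        by (intro conjI exI[of _ "S - {j}"]) (auto simp: less_Suc_eq)
    qed
  qed
next
  case (7 t s)
  then obtain S where S: "table m (fst s ''W'') P S" "relevant l \<subseteq> S" "S \<subseteq> E" "\<forall>x\<in>S. x < m \<longrightarrow> x \<in> relevant l"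
    "slots_ok N (fst s ''W'') (fst s0 ''D'') (fst s0 ''B'') (snd s0 ''ic'') (snd s0 ''sl'')" by blast
  then have "S = relevant l" by auto
  then show ?case using 7(1) S by (simp add: algebra_simps)
qed (use i t ok in \<open>auto simp: inputs_def\<close>)

end

section \<open>Passing an equality point\<close>

lemma (in machine) wp_TestI:
  "nval i s = p \<Longrightarrow> nval off s = q \<Longrightarrow> ({e. e < m \<and> fst s y (q + e) \<noteq> 0} \<in> \<F>) = v \<Longrightarrow>
    wp d (nstore x p (of_bool v) s) (\<lambda>t s'. Q (2 + ncost i + ncost off + \<tau> + t) s') \<Longrightarrow>
    wp (Seq (Test x i y off) d) s Q"
  by simp

definition InsertEntry :: com where
  "InsertEntry = Block [NSet ''g'' (NConst 0), For ''p'' (Var ''P'') (Seq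
     (Cond (NEq (NCell ''W'' (Var ''p'')) (Var ''f'')) (NSet ''g'' (NConst 1)) Skip)
     (Cond (NEq (NCell ''W'' (Var ''p'')) (Var ''m'')) (NSet ''fr'' (Var ''p'')) Skip)),
     Cond (Positive (Var ''g'')) Skip (NAssign ''W'' (Var ''fr'') (Var ''f''))]"

definition CheckSlot :: "nat \<Rightarrow> com" where
  "CheckSlot l = Seq (NSet ''g'' (NConst 1)) (For ''j'' (NConst l) (Cond
     (NEq (NCell ''W'' (NCell ''D'' (NAdd (NMul (Var ''s'') (NConst l)) (Var ''j'')))) (Var ''f''))
     (NSet ''g'' (NConst 0)) Skip))"

abbreviation AddLine :: "name \<Rightarrow> name \<Rightarrow> com" where
  "AddLine y w \<equiv> RAssign y (Var ''s'') (RAdd (RCell y (Var ''s'')) (RSub (RCell w (Var ''f'')) (RCell w (Var ''e''))))"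

text \<open>The oracle reads a segment of memory, so the exchange is made in place and undone if the
  test fails. On success the line changes by the difference of the coefficients of \<open>f\<close>
  and \<open>e\<close>.\<close>

definition TrySwap :: com where
  "TrySwap = Block [NAssign ''B'' (NAdd (Var ''o'') (Var ''e'')) (NConst 0),
     NAssign ''B'' (NAdd (Var ''o'') (Var ''f'')) (NConst 1), Test ''t'' (NConst 0) ''B'' (Var ''o''),
     Cond (Positive (Var ''t'')) (Seq (AddLine ''ic'' ''a'') (AddLine ''sl'' ''b''))
       (Seq (NAssign ''B'' (NAdd (Var ''o'') (Var ''e'')) (NConst 1))
         (NAssign ''B'' (NAdd (Var ''o'') (Var ''f'')) (NConst 0)))]"

text \<open>The guards are the conditions of \<open>greedy_basis_order_swap\<close> that need no
  oracle, which leaves at most one test for the slot.\<close>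

definition UpdateSlot :: "nat \<Rightarrow> com" where
  "UpdateSlot l = Seq (NSet ''o'' (NMul (Var ''s'') (Var ''m'')))
     (Cond (BAnd (Positive (NCell ''B'' (NAdd (Var ''o'') (Var ''e''))))
         (BNot (Positive (NCell ''B'' (NAdd (Var ''o'') (Var ''f''))))))
       (Seq (CheckSlot l) (Cond (Positive (Var ''g'')) TrySwap Skip)) Skip)"

definition UpdateSlots :: "nat \<Rightarrow> com" where
  "UpdateSlots l = For ''s'' (Var ''N'') (UpdateSlot l)"

definition Event :: "nat \<Rightarrow> com" where
  "Event l = Block [InsertEntry, UpdateSlots l, NSet ''z'' (Var ''e''), Clean, NSet ''z'' (Var ''f''), Clean]"

lemma writes_event [simp]:
  "nat_writes InsertEntry = {''g'', ''p'', ''fr'', ''W''}" "real_writes InsertEntry = {}"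
  "nat_writes (CheckSlot l) = {''g'', ''j''}" "real_writes (CheckSlot l) = {}"
  "nat_writes TrySwap = {''B'', ''t''}" "real_writes TrySwap = {''ic'', ''sl''}"
  "nat_writes (UpdateSlot l) = {''o'', ''g'', ''j'', ''B'', ''t''}" "real_writes (UpdateSlot l) = {''ic'', ''sl''}"
  "nat_writes (UpdateSlots l) = {''s'', ''o'', ''g'', ''j'', ''B'', ''t''}" "real_writes (UpdateSlots l) = {''ic'', ''sl''}"
  "nat_writes (Event l) = {''g'', ''p'', ''fr'', ''W'', ''s'', ''o'', ''j'', ''B'', ''t'', ''z''}"
  "real_writes (Event l) = {''ic'', ''sl''}"
  by (auto simp: InsertEntry_def CheckSlot_def TrySwap_def UpdateSlot_def UpdateSlots_def Event_def)

section \<open>Execution of the update at an equality point\<close>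

context interdiction_machine
begin

lemma wp_InsertEntry:
  fixes s0 :: state
  assumes i: "inputs s0" and P: "fst s0 ''P'' 0 = P" and f: "fst s0 ''f'' 0 = f" and d: "\<exists>p<P. fst s0 ''W'' p = m"
  shows "wp InsertEntry s0 (\<lambda>t s. t \<le> 60 * P + 60 \<and>
    (if \<exists>p<P. fst s0 ''W'' p = f then fst s ''W'' = fst s0 ''W''
     else \<exists>p<P. fst s0 ''W'' p = m \<and> fst s ''W'' = (fst s0 ''W'')(p := f)))"
  unfolding InsertEntry_def Block.simps
proof (rule wp_SetI[where p = 0 and v = 0], simp, simp)
  let ?W = "fst s0 ''W''"
  let ?s = "nstore ''g'' 0 0 s0"
  have "wp (For ''p'' (Var ''P'') (Seq
     (Cond (NEq (NCell ''W'' (Var ''p'')) (Var ''f'')) (NSet ''g'' (NConst 1)) Skip)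
     (Cond (NEq (NCell ''W'' (Var ''p'')) (Var ''m'')) (NSet ''fr'' (Var ''p'')) Skip))) ?s
     (\<lambda>t s. t \<le> 60 * P + 20 \<and> (fst s ''g'' 0 > 0 \<longleftrightarrow> (\<exists>p<P. ?W p = f)) \<and> (fst s ''fr'' 0 < P \<and> ?W (fst s ''fr'' 0) = m))"
  proof (rule wp_For[where n = P and T = 40 and Inv = "\<lambda>j s. (fst s ''g'' 0 > 0 \<longleftrightarrow> (\<exists>p<j. ?W p = f)) \<and>
      ((\<exists>p<j. ?W p = m) \<longrightarrow> fst s ''fr'' 0 < P \<and> ?W (fst s ''fr'' 0) = m)"], goal_cases)
    case (6 j s)
    have "fst s ''m'' 0 = m" "fst s ''f'' 0 = f" "fst s ''W'' = ?W"
      using 6(2) f i unfolding agree_def inputs_def by simp_all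
    then show ?case using 6(1,3,4) by (auto simp: less_Suc_eq)
  qed (use P d in auto)
  then show "wp (Seq (For ''p'' (Var ''P'') (Seq
     (Cond (NEq (NCell ''W'' (Var ''p'')) (Var ''f'')) (NSet ''g'' (NConst 1)) Skip)
     (Cond (NEq (NCell ''W'' (Var ''p'')) (Var ''m'')) (NSet ''fr'' (Var ''p'')) Skip)))
     (Cond (Positive (Var ''g'')) Skip (NAssign ''W'' (Var ''fr'') (Var ''f'')))) ?s
    (\<lambda>t s. 2 + ncost (NConst 0) + ncost (NConst 0) + t \<le> 60 * P + 60 \<and> (if \<exists>p<P. ?W p = f then fst s ''W'' = ?W
     else \<exists>p<P. ?W p = m \<and> fst s ''W'' = ?W(p := f)))"
    unfolding wp_Seq[of "For _ _ _"]
  proof (rule wp_use, goal_cases)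
    case (1 t s)
    have c: "fst s ''W'' = ?W" "fst s ''f'' 0 = f" using 1(2) f unfolding agree_def by simp_all
    show ?case
    proof (cases "\<exists>p<P. ?W p = f")
      case True
      then have g: "0 < fst s ''g'' 0" using 1(1) by blast
      show ?thesis unfolding if_P[OF True] using 1(1) g c by simp
    next
      case False
      then have g: "\<not> 0 < fst s ''g'' 0" using 1(1) by blast
      show ?thesis unfolding if_not_P[OF False] using 1(1) g c by auto
    qed
  qed
qed

lemma wp_CheckSlot:
  fixes s0 :: state
  assumes r: "fst s0 ''s'' 0 = r" and f: "fst s0 ''f'' 0 = f"
  shows "wp (CheckSlot l) s0 (\<lambda>t s. t \<le> 50 * l + 30 \<and> (fst s ''g'' 0 > 0 \<longleftrightarrow> f \<notin> slot_set l (fst s0 ''W'') (fst s0 ''D'') r))"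
  unfolding CheckSlot_def
proof (rule wp_SetI[where p = 0 and v = 1], simp, simp,
    rule wp_For[where n = l and T = 35 and Inv = "\<lambda>j s. fst s ''g'' 0 > 0 \<longleftrightarrow>
    f \<notin> (\<lambda>i. fst s0 ''W'' (fst s0 ''D'' (r * l + i))) ` {..<j}"], goal_cases)
  case (6 j s)
  have "fst s ''s'' 0 = r" "fst s ''f'' 0 = f" "fst s ''W'' = fst s0 ''W''" "fst s ''D'' = fst s0 ''D''"
    using 6(2) assms unfolding agree_def by simp_all
  then show ?case using 6(3,4) by (auto simp: lessThan_Suc)
next
  case (7 t s)
  then show ?case by (simp add: slot_set_def)
qed auto

lemma wp_TrySwap:
  fixes s0 :: state
  assumes i: "inputs s0" and o: "fst s0 ''o'' 0 = off" and ef: "fst s0 ''e'' 0 = e" "fst s0 ''f'' 0 = f" "e < m" "f < m" "e \<noteq> f"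
    and r: "fst s0 ''s'' 0 = r" and G: "\<forall>x<m. fst s0 ''B'' (off + x) \<noteq> 0 \<longleftrightarrow> x \<in> G" "G \<subseteq> E" "e \<in> G" "f \<notin> G"
  shows "wp TrySwap s0 (\<lambda>t s. t \<le> \<tau> + 80 \<and>
    (\<forall>x<m. fst s ''B'' (off + x) \<noteq> 0 \<longleftrightarrow> x \<in> (if insert f (G - {e}) \<in> \<F> then insert f (G - {e}) else G)) \<and>
    (\<forall>p. p < off \<or> off + m \<le> p \<longrightarrow> fst s ''B'' p = fst s0 ''B'' p) \<and>
    snd s ''ic'' = (if insert f (G - {e}) \<in> \<F> then (snd s0 ''ic'')(r := snd s0 ''ic'' r + (of_rat (a f) - of_rat (a e))) else snd s0 ''ic'') \<and>
    snd s ''sl'' = (if insert f (G - {e}) \<in> \<F> then (snd s0 ''sl'')(r := snd s0 ''sl'' r + (of_rat (b f) - of_rat (b e))) else snd s0 ''sl''))"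
proof -
  let ?s2 = "nstore ''B'' (off + f) 1 (nstore ''B'' (off + e) 0 s0)"
  have ne: "fst s0 ''B'' (off + x) \<noteq> 0 \<longleftrightarrow> x \<in> G" if "x < m" for x using G(1) that by blast
  have test: "{x. x < m \<and> fst ?s2 ''B'' (off + x) \<noteq> 0} = insert f (G - {e})"
    using ne G(2) ef(3-5) by (auto split: if_splits)
  have ab: "snd s0 ''a'' e = of_rat (a e)" "snd s0 ''b'' e = of_rat (b e)" "snd s0 ''a'' f = of_rat (a f)" "snd s0 ''b'' f = of_rat (b f)"
    using i ef unfolding inputs_def by simp_all
  show ?thesis
  proof (cases "insert f (G - {e}) \<in> \<F>")
    case True
    let ?s3 = "rstore ''sl'' r (snd s0 ''sl'' r + (of_rat (b f) - of_rat (b e)))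
      (rstore ''ic'' r (snd s0 ''ic'' r + (of_rat (a f) - of_rat (a e))) (nstore ''t'' 0 1 ?s2))"
    have "wp TrySwap s0 (\<lambda>t s. t \<le> \<tau> + 80 \<and> s = ?s3)"
      unfolding TrySwap_def Block.simps
      by (rule wp_SetI[where p = "off + e" and v = 0], simp add: o ef, simp,
          rule wp_SetI[where p = "off + f" and v = 1], simp add: o ef, simp,
          rule wp_TestI[where p = 0 and q = off and v = True], simp, simp add: o, simp only: test True)
        (simp add: o ef r ab)
    then show ?thesis by (rule wp_mono) (use True ne ef in \<open>auto\<close>)
  next
    case False
    let ?s3 = "nstore ''B'' (off + f) 0 (nstore ''B'' (off + e) 1 (nstore ''t'' 0 0 ?s2))"
    have "wp TrySwap s0 (\<lambda>t s. t \<le> \<tau> + 80 \<and> s = ?s3)"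
      unfolding TrySwap_def Block.simps
      by (rule wp_SetI[where p = "off + e" and v = 0], simp add: o ef, simp,
          rule wp_SetI[where p = "off + f" and v = 1], simp add: o ef, simp,
          rule wp_TestI[where p = 0 and q = off and v = False], simp, simp add: o, simp only: test False)
        (simp add: o ef r ab)
    then show ?thesis by (rule wp_mono) (use False ne ef G in \<open>auto\<close>)
  qed
qed

lemma wp_UpdateSlot:
  fixes s0 :: state
  assumes i: "inputs s0" and ef: "fst s0 ''e'' 0 = e" "fst s0 ''f'' 0 = f" "e < m" "f < m" "e \<noteq> f"
    and r: "fst s0 ''s'' 0 = r" and G: "\<forall>x<m. fst s0 ''B'' (r * m + x) \<noteq> 0 \<longleftrightarrow> x \<in> G" "G \<subseteq> E"
    and G': "G' = (if e \<in> G \<and> f \<in> (E - slot_set l (fst s0 ''W'') (fst s0 ''D'') r) - G \<and> insert f (G - {e}) \<in> \<F> then insert f (G - {e}) else G)"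
    and sums: "snd s0 ''ic'' r = (\<Sum>x\<in>G. of_rat (a x))" "snd s0 ''sl'' r = (\<Sum>x\<in>G. of_rat (b x))"
  shows "wp (UpdateSlot l) s0 (\<lambda>t s. t \<le> \<tau> + 50 * l + 200 \<and>
    (\<forall>x<m. fst s ''B'' (r * m + x) \<noteq> 0 \<longleftrightarrow> x \<in> G') \<and>
    (\<forall>p. p < r * m \<or> r * m + m \<le> p \<longrightarrow> fst s ''B'' p = fst s0 ''B'' p) \<and>
    snd s ''ic'' r = (\<Sum>x\<in>G'. of_rat (a x)) \<and> snd s ''sl'' r = (\<Sum>x\<in>G'. of_rat (b x)) \<and>
    (\<forall>r'. r' \<noteq> r \<longrightarrow> snd s ''ic'' r' = snd s0 ''ic'' r' \<and> snd s ''sl'' r' = snd s0 ''sl'' r'))"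
proof -
  let ?s1 = "nstore ''o'' 0 (r * m) s0"
  let ?Post = "\<lambda>t s. t \<le> \<tau> + 50 * l + 180 \<and>
    (\<forall>x<m. fst s ''B'' (r * m + x) \<noteq> 0 \<longleftrightarrow> x \<in> G') \<and>
    (\<forall>p. p < r * m \<or> r * m + m \<le> p \<longrightarrow> fst s ''B'' p = fst s0 ''B'' p) \<and>
    snd s ''ic'' r = (\<Sum>x\<in>G'. of_rat (a x)) \<and> snd s ''sl'' r = (\<Sum>x\<in>G'. of_rat (b x)) \<and>
    (\<forall>r'. r' \<noteq> r \<longrightarrow> snd s ''ic'' r' = snd s0 ''ic'' r' \<and> snd s ''sl'' r' = snd s0 ''sl'' r')"
  have fin: "finite G" using G(2) finite_subset by blast
  have m: "fst s0 ''m'' 0 = m" using i unfolding inputs_def by simp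
  have swapsum: "(\<Sum>x\<in>insert f (G - {e}). h x) = (\<Sum>x\<in>G. h x) + (h f - h e)" if "e \<in> G" "f \<notin> G" for h :: "nat \<Rightarrow> real"
    using fin that by (simp add: sum_diff1)
  have run: "wp (Cond (BAnd (Positive (NCell ''B'' (NAdd (Var ''o'') (Var ''e''))))
         (BNot (Positive (NCell ''B'' (NAdd (Var ''o'') (Var ''f''))))))
       (Seq (CheckSlot l) (Cond (Positive (Var ''g'')) TrySwap Skip)) Skip) ?s1 ?Post"
  proof (cases "e \<in> G \<and> f \<notin> G")
    case False
    then have nb: "\<not> bval (BAnd (Positive (NCell ''B'' (NAdd (Var ''o'') (Var ''e''))))
         (BNot (Positive (NCell ''B'' (NAdd (Var ''o'') (Var ''f'')))))) ?s1" using G(1) ef by auto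
    have "G' = G" using False unfolding G' by auto
    then show ?thesis unfolding wp_Cond if_not_P[OF nb] using G sums by simp
  next
    case True
    then have q: "0 < fst s0 ''B'' (r * m + e)" "fst s0 ''B'' (r * m + f) = 0" using G(1) ef by auto
    have chk: "wp (CheckSlot l) ?s1 (\<lambda>t s. t \<le> 50 * l + 30 \<and> (fst s ''g'' 0 > 0 \<longleftrightarrow> f \<notin> slot_set l (fst s0 ''W'') (fst s0 ''D'') r))"
      using wp_CheckSlot[of ?s1 r f] r ef by simp
    have run: "wp (Seq (CheckSlot l) (Cond (Positive (Var ''g'')) TrySwap Skip)) ?s1 (\<lambda>t s. t \<le> \<tau> + 50 * l + 150 \<and> ?Post 0 s)"
      unfolding wp_Seq
    proof (rule wp_use[OF chk], goal_cases)
      case (1 t s)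
      have c: "inputs s" "fst s ''o'' 0 = r * m" "fst s ''e'' 0 = e" "fst s ''f'' 0 = f" "fst s ''s'' 0 = r" "fst s ''B'' = fst s0 ''B''"
        "snd s ''ic'' = snd s0 ''ic''" "snd s ''sl'' = snd s0 ''sl''"
        using 1(2) i ef r unfolding agree_def inputs_def by simp_all
      show ?case
      proof (cases "f \<in> slot_set l (fst s0 ''W'') (fst s0 ''D'') r")
        case fs: True
        then have "fst s ''g'' 0 = 0" using 1(1) by simp
        moreover have "G' = G" using fs unfolding G' by auto
        ultimately show ?thesis using 1(1) c G sums by simp
      next
        case fs: False
        then have g: "0 < fst s ''g'' 0" using 1(1) by simp
        have G'2: "G' = (if insert f (G - {e}) \<in> \<F> then insert f (G - {e}) else G)"
          using fs True ef unfolding G' by auto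
        have "wp TrySwap s (\<lambda>t' s'. 1 + t + (1 + bcost (Positive (Var ''g'')) + t') \<le> \<tau> + 50 * l + 150 \<and> ?Post 0 s')"
        proof (rule wp_mono[OF wp_TrySwap[OF c(1,2,3,4) ef(3-5) c(5), of G]], goal_cases)
          case (5 t' s')
          have "snd s' ''ic'' r = (\<Sum>x\<in>G'. of_rat (a x))" "snd s' ''sl'' r = (\<Sum>x\<in>G'. of_rat (b x))"
            using 5 c sums swapsum[of "\<lambda>x. of_rat (a x)"] swapsum[of "\<lambda>x. of_rat (b x)"] True unfolding G'2
            by (simp_all split: if_splits)
          moreover have "snd s' ''ic'' r' = snd s0 ''ic'' r' \<and> snd s' ''sl'' r' = snd s0 ''sl'' r'" if "r' \<noteq> r" for r'
            using 5 c that by (simp split: if_splits)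
          moreover have "1 + t + (1 + bcost (Positive (Var ''g'')) + t') \<le> \<tau> + 50 * l + 150" using 1(1) 5 by simp
          ultimately show ?case using 5 c unfolding G'2 by simp
        qed (use c G True in simp_all)
        then show ?thesis using g unfolding wp_Cond by simp
      qed
    qed
    have b: "bval (BAnd (Positive (NCell ''B'' (NAdd (Var ''o'') (Var ''e''))))
         (BNot (Positive (NCell ''B'' (NAdd (Var ''o'') (Var ''f'')))))) ?s1" using q ef by simp
    show ?thesis unfolding wp_Cond if_P[OF b] by (rule wp_mono[OF run]) simp
  qed
  show ?thesis unfolding UpdateSlot_def
    by (rule wp_SetI[where p = 0 and v = "r * m"], simp, simp add: r m, rule wp_mono[OF run]) simp
qed

text \<open>The slots are independent of each other: those already visited are correct for the new
  order, the others still hold the data of the old order. The table stays fixed meanwhile.\<close>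

lemma wp_UpdateSlots:
  fixes s0 :: state
  assumes sw: "order_swap E e f lt lt'" and i: "inputs s0" and N: "fst s0 ''N'' 0 = N"
    and ef: "fst s0 ''e'' 0 = e" "fst s0 ''f'' 0 = f" "e < m" "f < m"
    and ok: "ordered_interdiction.slots_ok l m \<F> a b lt N (fst s0 ''W'') (fst s0 ''D'') (fst s0 ''B'') (snd s0 ''ic'') (snd s0 ''sl'')"
  shows "wp (UpdateSlots l) s0 (\<lambda>t s. t \<le> N * (\<tau> + 50 * l + 250) + 20 \<and>
    ordered_interdiction.slots_ok l m \<F> a b lt' N (fst s0 ''W'') (fst s0 ''D'') (fst s ''B'') (snd s ''ic'') (snd s ''sl''))"
proof -
  have o1: "strict_order_on E lt" and o2: "strict_order_on E lt'" and lt: "lt e f"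
    using sw unfolding order_swap_def by blast+
  interpret A: ordered_interdiction l m \<F> a b I lt by unfold_locales (rule o1)
  interpret B: ordered_interdiction l m \<F> a b I lt' by unfold_locales (rule o2)
  let ?W = "fst s0 ''W''" and ?D = "fst s0 ''D''"
  have ne: "e \<noteq> f" using lt A.lt_irrefl ef by auto
  show ?thesis unfolding UpdateSlots_def
  proof (rule wp_For[where n = N and T = "\<tau> + 50 * l + 200" and Inv = "\<lambda>j s. (\<forall>p. j * m \<le> p \<longrightarrow> fst s ''B'' p = fst s0 ''B'' p) \<and>
    (\<forall>r\<ge>j. snd s ''ic'' r = snd s0 ''ic'' r \<and> snd s ''sl'' r = snd s0 ''sl'' r) \<and>
    B.slots_ok j ?W ?D (fst s ''B'') (snd s ''ic'') (snd s ''sl'')"], goal_cases)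
    case (6 j s)
    let ?Dj = "E - slot_set l ?W ?D j"
    have c: "inputs s" "fst s ''e'' 0 = e" "fst s ''f'' 0 = f" "fst s ''W'' = ?W" "fst s ''D'' = ?D"
      using 6(2) i ef unfolding agree_def inputs_def by simp_all
    have okj: "(\<forall>x<m. fst s ''B'' (j * m + x) \<noteq> 0 \<longleftrightarrow> x \<in> A.gb ?Dj)" "snd s ''ic'' j = (\<Sum>x\<in>A.gb ?Dj. of_rat (a x))"
      "snd s ''sl'' j = (\<Sum>x\<in>A.gb ?Dj. of_rat (b x))"
      using ok 6(1,4) unfolding A.slots_ok_def by simp_all
    have sub: "A.gb ?Dj \<subseteq> E" using A.gb_sub[of ?Dj] by blast
    have eE: "e \<in> E" "f \<in> E" using ef by simp_all
    have sw: "B.gb ?Dj = (if e \<in> A.gb ?Dj \<and> f \<in> (E - slot_set l (fst s ''W'') (fst s ''D'') j) - A.gb ?Dj \<and> insert f (A.gb ?Dj - {e}) \<in> \<F>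
        then insert f (A.gb ?Dj - {e}) else A.gb ?Dj)"
      unfolding c(4,5) by (rule greedy_basis_order_swap(3)[OF sw Diff_subset])
    show ?case
    proof (rule wp_mono[OF wp_UpdateSlot[OF c(1,2,3) ef(3,4) ne 6(3) okj(1) sub sw okj(2,3)]], goal_cases)
      case (1 t s')
      have "fst s' ''B'' p = fst s0 ''B'' p" if "Suc j * m \<le> p" for p
        using 1 6(4) that by (simp add: add.commute)
      moreover have "snd s' ''ic'' r = snd s0 ''ic'' r \<and> snd s' ''sl'' r = snd s0 ''sl'' r" if "Suc j \<le> r" for r
        using 1 6(4) that by simp
      moreover have "B.slots_ok (Suc j) ?W ?D (fst s' ''B'') (snd s' ''ic'') (snd s' ''sl'')"
        unfolding B.slots_ok_def
      proof (intro allI impI)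
        fix r assume r: "r < Suc j"
        show "(\<forall>x<m. fst s' ''B'' (r * m + x) \<noteq> 0 \<longleftrightarrow> x \<in> B.gb (E - slot_set l ?W ?D r)) \<and>
          snd s' ''ic'' r = (\<Sum>x\<in>B.gb (E - slot_set l ?W ?D r). of_rat (a x)) \<and>
          snd s' ''sl'' r = (\<Sum>x\<in>B.gb (E - slot_set l ?W ?D r). of_rat (b x))"
        proof (cases "r = j")
          case True
          then show ?thesis using 1 by simp
        next
          case False
          then have rj: "r < j" using r by simp
          then have "Suc r * m \<le> j * m" by (intro mult_right_mono) simp_all
          then have "r * m + x < j * m" if "x < m" for x using that by simp
          then have "fst s' ''B'' (r * m + x) = fst s ''B'' (r * m + x)" if "x < m" for x using 1 that by simp
          then show ?thesis using 6(4) rj 1 unfolding B.slots_ok_def by simp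
        qed
      qed
      ultimately show ?case using 1 by blast
    qed
  next
    case (7 t s)
    then show ?case by (simp add: algebra_simps)
  qed (use N in \<open>auto simp: B.slots_ok_def\<close>)
qed

end

context ordered_machine
begin

lemma wp_Clean_table:
  assumes i: "inputs s0" and N: "fst s0 ''N'' 0 = N" and P: "fst s0 ''P'' 0 = P" and z: "fst s0 ''z'' 0 = z" "z < m"
    and D: "digit_table l N P (fst s0 ''D'')" and t: "table m (fst s0 ''W'') P S" "relevant l \<subseteq> S" "S \<subseteq> E" "card S < P"
    and ok: "slots_ok N (fst s0 ''W'') (fst s0 ''D'') (fst s0 ''B'') (snd s0 ''ic'') (snd s0 ''sl'')"
  shows "wp Clean s0 (\<lambda>t s. t \<le> 40 * N + 50 * P + 60 \<and>
     (\<exists>S'. table m (fst s ''W'') P S' \<and> relevant l \<subseteq> S' \<and> S' \<subseteq> S \<and> (z \<in> S' \<longrightarrow> z \<in> relevant l)) \<and>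
     slots_ok N (fst s ''W'') (fst s0 ''D'') (fst s0 ''B'') (snd s0 ''ic'') (snd s0 ''sl''))"
proof (rule wp_mono[OF wp_Clean[OF i N P z(1)]], goal_cases)
  case (1 t s)
  show ?case
  proof (cases "\<exists>r<N. fst s0 ''B'' (r * m + z) \<noteq> 0")
    case True
    then have "fst s ''W'' = fst s0 ''W''" using 1 by simp
    moreover have "z \<in> relevant l" using True clean_used[OF ok] z(2) by blast
    ultimately show ?thesis using 1 t ok by auto
  next
    case False
    then have W: "fst s ''W'' = (\<lambda>p. if p < P \<and> fst s0 ''W'' p = z then m else fst s0 ''W'' p)" using 1 by (simp only: if_False)
    have un: "\<forall>r<N. fst s0 ''B'' (r * m + z) = 0" using False by simp
    note cu = clean_unused[OF ok t(1,3,4,2) D z(2) un]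
    have "relevant l \<subseteq> S - {z}" using cu(1) t(2) by blast
    then show ?thesis unfolding W using 1 cu(2,3) by blast
  qed
qed

end

context interdiction_machine
begin

lemma wp_Event:
  fixes s0 :: state
  assumes sw: "order_swap E e f lt lt'" and i: "inputs s0" and N: "fst s0 ''N'' 0 = N" and P: "fst s0 ''P'' 0 = P" "P = Suc l * k + 2"
    and ef: "fst s0 ''e'' 0 = e" "fst s0 ''f'' 0 = f" "e < m" "f < m"
    and D: "digit_table l N P (fst s0 ''D'')"
    and t: "table m (fst s0 ''W'') P (ordered_matroid.relevant {..<m} \<F> lt l)"
    and ok: "ordered_interdiction.slots_ok l m \<F> a b lt N (fst s0 ''W'') (fst s0 ''D'') (fst s0 ''B'') (snd s0 ''ic'') (snd s0 ''sl'')"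
  shows "wp (Event l) s0 (\<lambda>t s. t \<le> N * (\<tau> + 50 * l + 350) + 200 * P + 300 \<and>
    table m (fst s ''W'') P (ordered_matroid.relevant {..<m} \<F> lt' l) \<and>
    ordered_interdiction.slots_ok l m \<F> a b lt' N (fst s ''W'') (fst s ''D'') (fst s ''B'') (snd s ''ic'') (snd s ''sl''))"
proof -
  have o1: "strict_order_on E lt" and o2: "strict_order_on E lt'" and lt: "lt e f"
    using sw unfolding order_swap_def by blast+
  interpret A: ordered_machine l m \<F> a b I lt \<tau> by unfold_locales (rule o1)
  interpret B: ordered_machine l m \<F> a b I lt' \<tau> by unfold_locales (rule o2)
  have eE: "e \<in> E" "f \<in> E" using ef by simp_all
  note swap = greedy_basis_order_swap[OF sw Diff_subset]
  \<comment> \<open>For every \<open>F\<close> the two greedy bases differ at most in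
    \<open>e\<close> and \<open>f\<close>, so no other element changes its relevance.\<close>
  have rel: "x \<in> B.relevant l \<longleftrightarrow> x \<in> A.relevant l" if "x \<noteq> e" "x \<noteq> f" for x
    unfolding A.relevant_def B.relevant_def using swap(1)[OF that] by auto
  have rele: "e \<in> B.relevant l \<Longrightarrow> e \<in> A.relevant l"
    unfolding A.relevant_def B.relevant_def using swap(2) by auto
  let ?S = "insert f (A.relevant l)"
  have S: "B.relevant l \<subseteq> ?S" "?S \<subseteq> E"
  proof -
    show "B.relevant l \<subseteq> ?S"
    proof
      fix x assume "x \<in> B.relevant l"
      then show "x \<in> ?S" using rel[of x] rele by (cases "x = e"; cases "x = f") auto
    qed
    show "?S \<subseteq> E" using A.relevant_sub[of l] ef by auto
  qed
  have cA: "card (A.relevant l) \<le> Suc l * k" using A.card_relevant[of l] A.card_gb_E by simp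
  \<comment> \<open>At most \<open>(l + 1) * k\<close> relevant elements together with
    \<open>f\<close> leave one position free; this accounts for the 2 in \<open>P\<close>.\<close>
  have cS: "card ?S < P" using cA A.finite_relevant unfolding P(2) by (simp add: card_insert_if)
  have "card (A.relevant l) < P" using cA unfolding P(2) by simp
  then obtain p where "p < P" "fst s0 ''W'' p = m" by (rule A.table_dummy[OF t _ A.finite_relevant]) blast
  then have dummy: "\<exists>p<P. fst s0 ''W'' p = m" by blast
  have "wp InsertEntry s0 (\<lambda>t s. t \<le> 60 * P + 60 \<and> table m (fst s ''W'') P ?S \<and>
    A.slots_ok N (fst s ''W'') (fst s0 ''D'') (fst s0 ''B'') (snd s0 ''ic'') (snd s0 ''sl''))"
  proof (rule wp_mono[OF wp_InsertEntry[OF i P(1) ef(2) dummy]], goal_cases)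
    case (1 t' s)
    show ?case
    proof (cases "\<exists>p<P. fst s0 ''W'' p = f")
      case True
      then have W: "fst s ''W'' = fst s0 ''W''" using 1 by simp
      have "f \<in> A.relevant l" using True t ef(4) unfolding table_def by auto
      then have "?S = A.relevant l" by blast
      then show ?thesis unfolding W using 1 t ok by simp
    next
      case False
      then obtain p where p: "p < P" "fst s0 ''W'' p = m" and W: "fst s ''W'' = (fst s0 ''W'')(p := f)"
        using 1 by (auto simp only: if_False)
      have "f \<notin> A.relevant l" using False t unfolding table_def by blast
      then show ?thesis unfolding W using A.table_insert[OF ok t order_refl A.relevant_sub ef(4) _ p] 1 by blast
    qed
  qed
  then show ?thesis unfolding Event_def Block.simps wp_Seq[of InsertEntry]
  proof (rule wp_use, goal_cases)
    case (1 t1 s1)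
    have s1: "inputs s1" "fst s1 ''N'' 0 = N" "fst s1 ''P'' 0 = P" "fst s1 ''e'' 0 = e" "fst s1 ''f'' 0 = f" "fst s1 ''D'' = fst s0 ''D''"
      "fst s1 ''B'' = fst s0 ''B''" "snd s1 ''ic'' = snd s0 ''ic''" "snd s1 ''sl'' = snd s0 ''sl''"
      using 1(2) i N P(1) ef unfolding agree_def inputs_def by simp_all
    have ok1: "A.slots_ok N (fst s1 ''W'') (fst s1 ''D'') (fst s1 ''B'') (snd s1 ''ic'') (snd s1 ''sl'')" using 1(1) s1 by simp
    have tab1: "table m (fst s1 ''W'') P ?S" "t1 \<le> 60 * P + 60" using 1(1) by simp_all
    show ?case unfolding wp_Seq[of "UpdateSlots l"]
    proof (rule wp_use[OF wp_UpdateSlots[OF sw s1(1,2,4,5) ef(3,4) ok1]], goal_cases)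
      case (1 t2 s2)
      let ?s3 = "nstore ''z'' 0 e s2"
      have s2: "fst s2 ''e'' 0 = e" using 1(2) s1 unfolding agree_def by simp
      have s3: "inputs ?s3" "fst ?s3 ''N'' 0 = N" "fst ?s3 ''P'' 0 = P" "fst ?s3 ''z'' 0 = e" "digit_table l N P (fst ?s3 ''D'')"
        "table m (fst ?s3 ''W'') P ?S" "fst ?s3 ''f'' 0 = f"
        using 1(2) s1 D tab1 unfolding agree_def inputs_def by simp_all
      have ok3: "B.slots_ok N (fst ?s3 ''W'') (fst ?s3 ''D'') (fst ?s3 ''B'') (snd ?s3 ''ic'') (snd ?s3 ''sl'')"
        "t2 \<le> N * (\<tau> + 50 * l + 250) + 20"
        using 1 unfolding agree_def by simp_all
      have "wp (Seq Clean (Seq (NSet ''z'' (Var ''f'')) Clean)) ?s3 (\<lambda>t s. t \<le> 80 * N + 100 * P + 150 \<and>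
        table m (fst s ''W'') P (B.relevant l) \<and> B.slots_ok N (fst s ''W'') (fst s ''D'') (fst s ''B'') (snd s ''ic'') (snd s ''sl''))"
        unfolding wp_Seq[of Clean]
      proof (rule wp_use[OF B.wp_Clean_table[OF s3(1-4) ef(3) s3(5,6) S cS ok3(1)]], goal_cases)
        case (1 t4 s4)
        then obtain S4 where S4: "table m (fst s4 ''W'') P S4" "B.relevant l \<subseteq> S4" "S4 \<subseteq> ?S" "e \<in> S4 \<longrightarrow> e \<in> B.relevant l" by blast
        have t4: "t4 \<le> 40 * N + 50 * P + 60" using 1(1) by blast
        let ?s5 = "nstore ''z'' 0 f s4"
        have s4: "fst s4 ''f'' 0 = f" using 1(2) s3 unfolding agree_def by simp
        have s5: "inputs ?s5" "fst ?s5 ''N'' 0 = N" "fst ?s5 ''P'' 0 = P" "fst ?s5 ''z'' 0 = f" "digit_table l N P (fst ?s5 ''D'')"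
          "table m (fst ?s5 ''W'') P S4"
          using 1(2) s3 S4(1) unfolding agree_def inputs_def by simp_all
        have ok5: "B.slots_ok N (fst ?s5 ''W'') (fst ?s5 ''D'') (fst ?s5 ''B'') (snd ?s5 ''ic'') (snd ?s5 ''sl'')"
          using 1 unfolding agree_def by simp
        have fin: "finite ?S" using A.finite_relevant by simp
        have c5: "S4 \<subseteq> E" "card S4 < P" using S4(3) S(2) cS card_mono[OF fin S4(3)] by auto
        have "wp Clean ?s5 (\<lambda>t s. t \<le> 40 * N + 50 * P + 60 \<and> table m (fst s ''W'') P (B.relevant l) \<and>
          B.slots_ok N (fst s ''W'') (fst s ''D'') (fst s ''B'') (snd s ''ic'') (snd s ''sl''))"
        proof (rule wp_use[OF B.wp_Clean_table[OF s5(1-4) ef(4) s5(5,6) S4(2) c5 ok5]], goal_cases)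
          case (1 t6 s6)
          then obtain S6 where S6: "table m (fst s6 ''W'') P S6" "B.relevant l \<subseteq> S6" "S6 \<subseteq> S4" "f \<in> S6 \<longrightarrow> f \<in> B.relevant l" by blast
          have "x \<in> B.relevant l" if x: "x \<in> S6" for x
          proof (cases "x = e \<or> x = f")
            case True
            then show ?thesis using x S6(3,4) S4(4) by blast
          next
            case False
            then have "x \<in> A.relevant l" using x S6(3) S4(3) by blast
            then show ?thesis using rel False by blast
          qed
          then have "S6 = B.relevant l" using S6(2) by blast
          then show ?case using 1 S6(1) unfolding agree_def by simp
        qed
        then have run: "wp Clean ?s5 (\<lambda>t s. t \<le> 40 * N + 50 * P + 60 \<and> table m (fst s ''W'') P (B.relevant l) \<and>
          B.slots_ok N (fst s ''W'') (fst s ''D'') (fst s ''B'') (snd s ''ic'') (snd s ''sl''))" .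
        show ?case
          by (rule wp_SetI[where p = 0 and v = f], simp, simp add: s4, rule wp_mono[OF run]) (use t4 in simp)
      qed
      then have run: "wp (Seq Clean (Seq (NSet ''z'' (Var ''f'')) Clean)) ?s3 (\<lambda>t s. t \<le> 80 * N + 100 * P + 150 \<and>
        table m (fst s ''W'') P (B.relevant l) \<and> B.slots_ok N (fst s ''W'') (fst s ''D'') (fst s ''B'') (snd s ''ic'') (snd s ''sl''))" .
      show ?case
        by (rule wp_SetI[where p = 0 and v = e], simp, simp add: s2, rule wp_mono[OF run]) (use tab1 ok3(2) in \<open>simp add: algebra_simps\<close>)
    qed
  qed
qed

end

section \<open>Upper envelopes of lines on an interval\<close>

text \<open>The flags \<open>Lf\<close> and \<open>Rf\<close> say whether the ends \<open>L\<close>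
  and \<open>R\<close> are finite. As the lines come by increasing slope, a later line that has
  reached an earlier one stays at or above it to the right.\<close>

locale envelope =
  fixes line :: "nat \<Rightarrow> real \<Rightarrow> real" and sl :: "nat \<Rightarrow> real" and v :: "nat \<Rightarrow> nat" and n :: nat
    and Lf Rf :: bool and L R :: real
  assumes slopes: "\<And>p x y. x \<le> y \<Longrightarrow> line p y = line p x + (y - x) * sl p"
    and sorted: "\<And>i j. i < j \<Longrightarrow> j < n \<Longrightarrow> sl (v i) \<le> sl (v j)"
    and n_pos: "0 < n"
begin

text \<open>The part of the domain assigned to entry \<open>i\<close> of a stack of height
  \<open>h\<close>; the bottom and the top entry extend to the ends of the domain.\<close>

definition segment :: "(nat \<Rightarrow> real) \<Rightarrow> nat \<Rightarrow> nat \<Rightarrow> real set" where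
  "segment st h i = {\<theta>. (Lf \<longrightarrow> L \<le> \<theta>) \<and> (Rf \<longrightarrow> \<theta> \<le> R) \<and> (0 < i \<longrightarrow> st i \<le> \<theta>) \<and> (Suc i < h \<longrightarrow> \<theta> \<le> st (Suc i))}"

definition domain :: "real set" where
  "domain = {\<theta>. (Lf \<longrightarrow> L \<le> \<theta>) \<and> (Rf \<longrightarrow> \<theta> \<le> R)}"

definition dominates :: "nat \<Rightarrow> nat \<Rightarrow> real \<Rightarrow> bool" where
  "dominates q c \<theta> \<longleftrightarrow> (\<forall>p<c. line (v p) \<theta> \<le> line q \<theta>)"

text \<open>
  While lines are being removed because of the candidate \<open>v c\<close>, the stack need not describe the
  envelope of the first \<open>c\<close> lines any more, but where it fails the candidate dominates.
\<close>
definition hull_inv :: "nat \<Rightarrow> nat \<Rightarrow> (nat \<Rightarrow> nat) \<Rightarrow> (nat \<Rightarrow> real) \<Rightarrow> bool" where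
  "hull_inv c h hs st \<longleftrightarrow> c \<le> n \<and> (\<forall>i<h. \<exists>p<c. hs i = v p) \<and>
     (\<forall>i. 0 < i \<longrightarrow> i < h \<longrightarrow> (Lf \<longrightarrow> L < st i) \<and> (Rf \<longrightarrow> st i < R)) \<and>
     (\<forall>i. 0 < i \<longrightarrow> Suc i < h \<longrightarrow> st i < st (Suc i)) \<and>
     (\<forall>i<h. \<forall>\<theta>\<in>segment st h i. dominates (hs i) c \<theta> \<or> c < n \<and> dominates (v c) c \<theta>) \<and>
     (h = 0 \<longrightarrow> c < n \<and> (\<forall>\<theta>\<in>domain. dominates (v c) c \<theta>))"

lemma hull_inv_init: "hull_inv 0 0 hs st"
  unfolding hull_inv_def dominates_def using n_pos by simp

lemma hull_inv_final:
  assumes "hull_inv n h hs st" shows "0 < h" "\<And>i \<theta>. i < h \<Longrightarrow> \<theta> \<in> segment st h i \<Longrightarrow> dominates (hs i) n \<theta>"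
    "\<And>i. i < h \<Longrightarrow> \<exists>p<n. hs i = v p"
  using assms unfolding hull_inv_def by auto

text \<open>The candidate is at least as high as the top entry on the whole segment of the latter,
  so it dominates there. After the removal this segment falls to the entry below, where the
  invariant tolerates that the candidate dominates instead.\<close>

lemma hull_inv_pop:
  assumes inv: "hull_inv c (Suc h) hs st" and c: "c < n"
    and pop: "\<And>\<theta>. \<theta> \<in> domain \<Longrightarrow> (0 < h \<Longrightarrow> st h \<le> \<theta>) \<Longrightarrow> line (hs h) \<theta> \<le> line (v c) \<theta>"
  shows "hull_inv c h hs st"
proof -
  have alt: "dominates (hs i) c \<theta> \<or> c < n \<and> dominates (v c) c \<theta>" if "i \<le> h" "\<theta> \<in> segment st (Suc h) i" for i \<theta>
    using inv that unfolding hull_inv_def by (simp add: less_Suc_eq_le)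
  have top: "dominates (v c) c \<theta>" if t: "\<theta> \<in> segment st (Suc h) h" for \<theta>
  proof -
    have "line (hs h) \<theta> \<le> line (v c) \<theta>" using t by (intro pop) (auto simp: segment_def domain_def)
    then show ?thesis using alt[OF order_refl t] unfolding dominates_def by (meson order_trans)
  qed
  have "dominates (hs i) c \<theta> \<or> c < n \<and> dominates (v c) c \<theta>" if i: "i < h" "\<theta> \<in> segment st h i" for i \<theta>
  proof (cases "\<theta> \<in> segment st (Suc h) i")
    case True
    then show ?thesis using alt i by simp
  next
    case False
    then have "Suc i = h" "st h \<le> \<theta>" using i unfolding segment_def by (auto simp: less_Suc_eq)
    then have "\<theta> \<in> segment st (Suc h) h" using i unfolding segment_def by auto
    then show ?thesis using top c by blast
  qed
  moreover have "\<forall>\<theta>\<in>domain. dominates (v c) c \<theta>" if "h = 0"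
    using top that unfolding domain_def segment_def by auto
  ultimately show ?thesis using inv c unfolding hull_inv_def by auto
qed

lemma hull_inv_bottom:
  assumes inv: "hull_inv c 0 hs st" and c: "c < n"
  shows "hull_inv (Suc c) (Suc 0) (hs(0 := v c)) (st(0 := x))"
  using assms unfolding hull_inv_def dominates_def segment_def domain_def by (auto simp: less_Suc_eq)

text \<open>The top entry is not removed, so the candidate is below it at the start of its segment,
  and by the slopes also to the left. Hence the candidate dominates nowhere on the lower segments,
  and the exception in the invariant disappears there.\<close>

lemma below_start:
  assumes inv: "hull_inv c (Suc h) hs st" and c: "c < n" and np: "0 < h \<Longrightarrow> line (v c) (st h) < line (hs h) (st h)"
    and i: "i < h" "\<theta> \<in> segment st (Suc h) i"
  shows "dominates (hs i) (Suc c) \<theta>"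
proof -
  obtain p where p: "p < c" "hs h = v p" using inv unfolding hull_inv_def by auto
  have st: "\<theta> \<le> st h"
  proof -
    have "st (Suc i) \<le> st h"
    proof -
      have "st (Suc i) \<le> st j" if "Suc i \<le> j" "j \<le> h" for j using that
      proof (induction j rule: dec_induct)
        case (step j)
        have "st j < st (Suc j)" using inv step unfolding hull_inv_def by auto
        then show ?case using step by simp
      qed simp
      then show ?thesis using i(1) by simp
    qed
    then show ?thesis using i unfolding segment_def by auto
  qed
  have "sl (hs h) \<le> sl (v c)" using sorted p c by simp
  then have "(st h - \<theta>) * sl (hs h) \<le> (st h - \<theta>) * sl (v c)" using st by (intro mult_left_mono) simp_all
  then have less: "line (v c) \<theta> < line (hs h) \<theta>"
    using slopes[OF st, of "v c"] slopes[OF st, of "hs h"] np i(1) by simp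
  have "dominates (hs i) c \<theta> \<or> c < n \<and> dominates (v c) c \<theta>"
    using inv i unfolding hull_inv_def by simp
  moreover have "\<not> dominates (v c) c \<theta>" using less p unfolding dominates_def by force
  ultimately have d: "dominates (hs i) c \<theta>" by blast
  then have "line (hs h) \<theta> \<le> line (hs i) \<theta>" using p unfolding dominates_def by simp
  then show ?thesis using d less unfolding dominates_def by (auto simp: less_Suc_eq)
qed

text \<open>The crossing \<open>x\<close> with the top entry splits its segment; on either part the
  higher of the two lines dominates all lines seen so far.\<close>

lemma hull_inv_above:
  assumes inv: "hull_inv c (Suc h) hs st" and c: "c < n" and np: "0 < h \<Longrightarrow> line (v c) (st h) < line (hs h) (st h)"
    and x: "0 < h \<Longrightarrow> st h < x" "Lf \<Longrightarrow> L < x" "Rf \<Longrightarrow> x < R"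
    and cross: "\<And>\<theta>. \<theta> \<le> x \<Longrightarrow> line (v c) \<theta> \<le> line (hs h) \<theta>" "\<And>\<theta>. x \<le> \<theta> \<Longrightarrow> line (hs h) \<theta> \<le> line (v c) \<theta>"
  shows "hull_inv (Suc c) (Suc (Suc h)) (hs(Suc h := v c)) (st(Suc h := x))"
proof -
  let ?hs = "hs(Suc h := v c)" and ?st = "st(Suc h := x)"
  have alt: "dominates (hs h) c \<theta> \<or> dominates (v c) c \<theta>" if "\<theta> \<in> segment st (Suc h) h" for \<theta>
    using inv that unfolding hull_inv_def by auto
  have "dominates (?hs i) (Suc c) \<theta>" if i: "i < Suc (Suc h)" "\<theta> \<in> segment ?st (Suc (Suc h)) i" for i \<theta>
  proof -
    consider "i < h" | "i = h" | "i = Suc h" using i(1) by linarith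
    then show ?thesis
    proof cases
      case 1
      then have "\<theta> \<in> segment st (Suc h) i" using i(2) unfolding segment_def by auto
      then show ?thesis using below_start[OF inv c np 1] 1 by simp
    next
      case 2
      then have t: "\<theta> \<in> segment st (Suc h) h" "\<theta> \<le> x" using i(2) unfolding segment_def by auto
      then show ?thesis using alt[OF t(1)] cross(1)[OF t(2)] 2 unfolding dominates_def
        by (auto simp: less_Suc_eq intro: order_trans)
    next
      case 3
      then have "x \<le> \<theta>" "\<theta> \<in> segment st (Suc h) h" using i(2) x(1) unfolding segment_def by auto
      then show ?thesis using alt[of \<theta>] cross(2)[of \<theta>] 3 unfolding dominates_def
        by (auto simp: less_Suc_eq intro: order_trans)
    qed
  qed
  moreover have "\<forall>i<Suc (Suc h). \<exists>p<Suc c. ?hs i = v p"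
    using inv unfolding hull_inv_def by (auto simp: less_Suc_eq)
  moreover have "\<forall>i. 0 < i \<longrightarrow> i < Suc (Suc h) \<longrightarrow> (Lf \<longrightarrow> L < ?st i) \<and> (Rf \<longrightarrow> ?st i < R)"
    using inv x unfolding hull_inv_def by (auto simp: less_Suc_eq)
  moreover have "\<forall>i. 0 < i \<longrightarrow> Suc i < Suc (Suc h) \<longrightarrow> ?st i < ?st (Suc i)"
    using inv x unfolding hull_inv_def by (auto simp: less_Suc_eq)
  ultimately show ?thesis using c unfolding hull_inv_def by auto
qed

text \<open>Covers both ways in which a candidate is useless: it is parallel to the top entry and
  lower, or it overtakes it only at or beyond the right end.\<close>

lemma hull_inv_skip:
  assumes inv: "hull_inv c (Suc h) hs st" and c: "c < n" and np: "0 < h \<Longrightarrow> line (v c) (st h) < line (hs h) (st h)"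
    and le: "\<And>\<theta>. \<theta> \<in> domain \<Longrightarrow> line (v c) \<theta> \<le> line (hs h) \<theta>"
  shows "hull_inv (Suc c) (Suc h) hs st"
proof -
  have "dominates (hs i) (Suc c) \<theta>" if i: "i < Suc h" "\<theta> \<in> segment st (Suc h) i" for i \<theta>
  proof (cases "i = h")
    case True
    have "dominates (hs h) c \<theta> \<or> dominates (v c) c \<theta>" using inv i True unfolding hull_inv_def by auto
    moreover have "line (v c) \<theta> \<le> line (hs h) \<theta>" using i by (intro le) (auto simp: segment_def domain_def)
    ultimately show ?thesis using True unfolding dominates_def by (auto simp: less_Suc_eq intro: order_trans)
  next
    case False
    then show ?thesis using below_start[OF inv c np] i by simp
  qed
  moreover have "\<forall>i<Suc h. \<exists>p<Suc c. hs i = v p" using inv unfolding hull_inv_def by (meson less_SucI)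
  ultimately show ?thesis using inv c unfolding hull_inv_def by auto
qed

end

definition PushBottom :: com where
  "PushBottom = Block [NAssign ''hs'' (NConst 0) (Var ''s''), RAssign ''st'' (NConst 0) (RVar ''L''),
     NSet ''h'' (NConst 1), Increment ''hp'']"

definition PushAbove :: com where
  "PushAbove = Seq (Cond (RLess (RCell ''sl'' (Var ''y'')) (RCell ''sl'' (Var ''s'')))
     (Seq (RSet ''xx'' (RDiv (RSub (RCell ''ic'' (Var ''y'')) (RCell ''ic'' (Var ''s'')))
            (RSub (RCell ''sl'' (Var ''s'')) (RCell ''sl'' (Var ''y'')))))
       (Cond (BAnd (Positive (Var ''Rf'')) (BNot (RLess (RVar ''xx'') (RVar ''R'')))) Skip
         (Block [NAssign ''hs'' (Var ''h'') (Var ''s''), RAssign ''st'' (Var ''h'') (RVar ''xx''), Increment ''h''])))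
     Skip) (Increment ''hp'')"

abbreviation LineAt :: "name \<Rightarrow> rexp" where
  "LineAt p \<equiv> RAdd (RCell ''ic'' (Var p)) (RMul (RCell ''st'' (NSub (Var ''h'') (NConst 1))) (RCell ''sl'' (Var p)))"

definition PopTest :: com where
  "PopTest = Seq (NSet ''y'' (NCell ''hs'' (NSub (Var ''h'') (NConst 1))))
     (Cond (Positive (NAdd (NSub (Var ''h'') (NConst 1)) (Var ''Lf'')))
       (Cond (RLess (LineAt ''s'') (LineAt ''y'')) (NSet ''g'' (NConst 0)) (NSet ''g'' (NConst 1)))
       (Cond (BAnd (BNot (RLess (RCell ''sl'' (Var ''y'')) (RCell ''sl'' (Var ''s''))))
           (BNot (RLess (RCell ''ic'' (Var ''s'')) (RCell ''ic'' (Var ''y'')))))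
         (NSet ''g'' (NConst 1)) (NSet ''g'' (NConst 0))))"

definition HullStep :: com where
  "HullStep = Seq (NSet ''s'' (NCell ''vs'' (NCell ''idx'' (Var ''hp''))))
     (Cond (Positive (Var ''h'')) (Seq PopTest
        (Cond (Positive (Var ''g'')) (NSet ''h'' (NSub (Var ''h'') (NConst 1))) PushAbove)) PushBottom)"

text \<open>Every effective step either removes an entry or advances to the next line, so a counting
  loop of \<open>2 * n\<close> rounds replaces the usual nested loops of the sweep.\<close>

definition Hull :: com where
  "Hull = Block [NSet ''h'' (NConst 0), NSet ''hp'' (NConst 0),
     For ''it'' (NAdd (Var ''n'') (Var ''n'')) (Cond (NLess (Var ''hp'') (Var ''n'')) HullStep Skip)]"

lemma writes_hull [simp]:
  "nat_writes PushBottom = {''hs'', ''h'', ''hp''}" "real_writes PushBottom = {''st''}"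
  "nat_writes PushAbove = {''hs'', ''h'', ''hp''}" "real_writes PushAbove = {''xx'', ''st''}"
  "nat_writes PopTest = {''y'', ''g''}" "real_writes PopTest = {}"
  "nat_writes HullStep = {''s'', ''y'', ''g'', ''hs'', ''h'', ''hp''}" "real_writes HullStep = {''xx'', ''st''}"
  "nat_writes Hull = {''it'', ''s'', ''y'', ''g'', ''hs'', ''h'', ''hp''}" "real_writes Hull = {''xx'', ''st''}"
  by (auto simp: PushBottom_def PushAbove_def PopTest_def HullStep_def Hull_def)

context machine
begin

lemma wp_HullStep:
  fixes s0 :: state
  assumes env: "envelope (\<lambda>p \<theta>. ic p + \<theta> * sl p) sl v n" and icsl: "snd s0 ''ic'' = ic" "snd s0 ''sl'' = sl"
    and v: "\<forall>i<n. fst s0 ''vs'' (fst s0 ''idx'' i) = v i" and LR: "snd s0 ''L'' 0 = L" "snd s0 ''R'' 0 = R"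
    "Lf = (0 < fst s0 ''Lf'' 0)" "Rf = (0 < fst s0 ''Rf'' 0)"
    and inv: "envelope.hull_inv (\<lambda>p \<theta>. ic p + \<theta> * sl p) v n Lf Rf L R (fst s0 ''hp'' 0) (fst s0 ''h'' 0) (fst s0 ''hs'') (snd s0 ''st'')"
    and st0: "0 < fst s0 ''h'' 0 \<longrightarrow> snd s0 ''st'' 0 = L" and hp: "fst s0 ''hp'' 0 < n"
  shows "wp HullStep s0 (\<lambda>t s. t \<le> 200 \<and>
    envelope.hull_inv (\<lambda>p \<theta>. ic p + \<theta> * sl p) v n Lf Rf L R (fst s ''hp'' 0) (fst s ''h'' 0) (fst s ''hs'') (snd s ''st'') \<and>
    (0 < fst s ''h'' 0 \<longrightarrow> snd s ''st'' 0 = L) \<and>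
    (fst s ''hp'' 0 = fst s0 ''hp'' 0 \<and> Suc (fst s ''h'' 0) = fst s0 ''h'' 0 \<or>
     fst s ''hp'' 0 = Suc (fst s0 ''hp'' 0) \<and> fst s ''h'' 0 \<le> Suc (fst s0 ''h'' 0)))"
proof -
  let ?line = "\<lambda>p \<theta>. ic p + \<theta> * sl p"
  interpret envelope ?line sl v n Lf Rf L R by (rule env)
  define c where "c = fst s0 ''hp'' 0"
  have rf: "(0 < fst s0 ''Rf'' 0) = Rf" using LR(4) by simp
  have c: "c < n" "fst s0 ''vs'' (fst s0 ''idx'' c) = v c" using hp v unfolding c_def by simp_all
  show ?thesis
  proof (cases "fst s0 ''h'' 0")
    case 0
    let ?s = "nstore ''hp'' 0 (Suc c) (nstore ''h'' 0 1 (rstore ''st'' 0 L (nstore ''hs'' 0 (v c) (nstore ''s'' 0 (v c) s0))))"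
    have "wp HullStep s0 (\<lambda>t s. t \<le> 200 \<and> s = ?s)"
      unfolding HullStep_def PushBottom_def Block.simps using 0 c LR by (simp add: c_def[symmetric])
    moreover have "hull_inv (Suc c) (Suc 0) ((fst s0 ''hs'')(0 := v c)) ((snd s0 ''st'')(0 := L))"
      using hull_inv_bottom[of c] inv 0 c(1) unfolding c_def by simp
    ultimately show ?thesis by (elim wp_mono) (simp add: 0 c_def)
  next
    case (Suc h)
    define y where "y = fst s0 ''hs'' h"
    have invh: "hull_inv c (Suc h) (fst s0 ''hs'') (snd s0 ''st'')" using inv Suc unfolding c_def by simp
    obtain p where p: "p < c" "y = v p" using invh unfolding hull_inv_def y_def by auto
    have sly: "sl y \<le> sl (v c)" using sorted[of p c] p c by simp
    define b where "b = snd s0 ''st'' h"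
    define pop where "pop = (if 0 < h \<or> Lf then ?line y b \<le> ?line (v c) b else sl (v c) \<le> sl y \<and> ic y \<le> ic (v c))"
    let ?s1 = "nstore ''g'' 0 (of_bool pop) (nstore ''y'' 0 y (nstore ''s'' 0 (v c) s0))"
    have test: "wp PopTest (nstore ''s'' 0 (v c) s0) (\<lambda>t s. t \<le> 60 \<and> s = ?s1)"
      unfolding PopTest_def using Suc icsl LR by (auto simp: pop_def y_def b_def not_less)
    have bL: "b = L" if "h = 0" using st0 Suc that unfolding b_def by simp
    have seq: "wp (Cond (Positive (Var ''h'')) (Seq PopTest
        (Cond (Positive (Var ''g'')) (NSet ''h'' (NSub (Var ''h'') (NConst 1))) PushAbove)) PushBottom)
        (nstore ''s'' 0 (v c) s0) (\<lambda>t s. 4 + 1 + 1 + t \<le> 190 + 6 \<and> Q s)"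
      if "wp (Cond (Positive (Var ''g'')) (NSet ''h'' (NSub (Var ''h'') (NConst 1))) PushAbove) ?s1 (\<lambda>t s. t \<le> 120 \<and> Q s)" for Q
    proof -
      have b: "bval (Positive (Var ''h'')) (nstore ''s'' 0 (v c) s0)" using Suc by simp
      show ?thesis unfolding wp_Cond[of "Positive (Var ''h'')"] if_P[OF b] wp_Seq
        by (rule wp_mono[OF test]) (use that in \<open>auto elim!: wp_mono\<close>)
    qed
    have main: "wp (Cond (Positive (Var ''g'')) (NSet ''h'' (NSub (Var ''h'') (NConst 1))) PushAbove) ?s1 (\<lambda>t s. t \<le> 120 \<and>
      hull_inv (fst s ''hp'' 0) (fst s ''h'' 0) (fst s ''hs'') (snd s ''st'') \<and>
      (0 < fst s ''h'' 0 \<longrightarrow> snd s ''st'' 0 = L) \<and>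
      (fst s ''hp'' 0 = c \<and> Suc (fst s ''h'' 0) = Suc h \<or> fst s ''hp'' 0 = Suc c \<and> fst s ''h'' 0 \<le> Suc (Suc h)))"
    proof (cases pop)
      case True
      have "hull_inv c h (fst s0 ''hs'') (snd s0 ''st'')"
      proof (rule hull_inv_pop[OF invh c(1)])
        fix \<theta> assume t: "\<theta> \<in> domain" "0 < h \<Longrightarrow> snd s0 ''st'' h \<le> \<theta>"
        show "?line (fst s0 ''hs'' h) \<theta> \<le> ?line (v c) \<theta>"
        proof (cases "0 < h \<or> Lf")
          case fin: True
          then have "b \<le> \<theta>" using t bL unfolding b_def domain_def by (cases "0 < h") auto
          moreover have "?line y b \<le> ?line (v c) b" using True fin unfolding pop_def by simp
          moreover have "(\<theta> - b) * sl y \<le> (\<theta> - b) * sl (v c)" using sly \<open>b \<le> \<theta>\<close> by (intro mult_left_mono) simp_all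
          ultimately show ?thesis using slopes[of b \<theta> y] slopes[of b \<theta> "v c"] unfolding y_def by linarith
        next
          case False
          then have "sl y = sl (v c)" "ic y \<le> ic (v c)" using True sly unfolding pop_def by simp_all
          then show ?thesis unfolding y_def by simp
        qed
      qed
      then show ?thesis using True Suc st0 by (simp add: c_def)
    next
      case npop: False
      have np: "?line (v c) (snd s0 ''st'' h) < ?line (fst s0 ''hs'' h) (snd s0 ''st'' h)" if "0 < h"
        using npop that unfolding pop_def y_def b_def by (simp split: if_splits)
      show ?thesis
      proof (cases "sl y < sl (v c)")
        case eq: False
        then have sleq: "sl y = sl (v c)" using sly by simp
        have less: "ic (v c) < ic y" using npop sleq unfolding pop_def by (auto split: if_splits)
        have "hull_inv (Suc c) (Suc h) (fst s0 ''hs'') (snd s0 ''st'')"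
          using less sleq unfolding y_def by (intro hull_inv_skip[OF invh c(1) np]) auto
        then show ?thesis using npop eq Suc st0 icsl unfolding PushAbove_def by (simp add: c_def)
      next
        case lt: True
        define x where "x = (ic y - ic (v c)) / (sl (v c) - sl y)"
        have d: "0 < sl (v c) - sl y" using lt by simp
        then have xe: "x * (sl (v c) - sl y) = ic y - ic (v c)" unfolding x_def by simp
        have diff: "?line (v c) \<theta> - ?line y \<theta> = (\<theta> - x) * (sl (v c) - sl y)" for \<theta>
          using xe by (simp add: algebra_simps)
        have cross1: "?line (v c) \<theta> \<le> ?line (fst s0 ''hs'' h) \<theta>" if "\<theta> \<le> x" for \<theta>
          using diff[of \<theta>] mult_nonpos_nonneg[of "\<theta> - x" "sl (v c) - sl y"] d that unfolding y_def[symmetric] by simp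
        have cross2: "?line (fst s0 ''hs'' h) \<theta> \<le> ?line (v c) \<theta>" if "x \<le> \<theta>" for \<theta>
        proof -
          have "0 \<le> (\<theta> - x) * (sl (v c) - sl y)" using d that by (intro mult_nonneg_nonneg) simp_all
          then show ?thesis using diff[of \<theta>] unfolding y_def[symmetric] by linarith
        qed
        have bx: "b < x" if "0 < h \<or> Lf"
        proof (rule ccontr)
          assume "\<not> b < x"
          then have "?line y b \<le> ?line (v c) b" using cross2[of b] unfolding y_def by simp
          then show False using npop that unfolding pop_def by simp
        qed
        have x1: "0 < h \<Longrightarrow> snd s0 ''st'' h < x" using bx unfolding b_def by simp
        have x2: "Lf \<Longrightarrow> L < x"
        proof (cases "h = 0")
          case True
          then show "Lf \<Longrightarrow> L < x" using bx bL by simp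
        next
          case False
          then have "Lf \<Longrightarrow> L < snd s0 ''st'' h" using invh unfolding hull_inv_def by blast
          then show "Lf \<Longrightarrow> L < x" using x1 False by simp
        qed
        show ?thesis
        proof (cases "Rf \<and> R \<le> x")
          case True
          have "hull_inv (Suc c) (Suc h) (fst s0 ''hs'') (snd s0 ''st'')"
          proof (rule hull_inv_skip[OF invh c(1) np])
            fix \<theta> assume "\<theta> \<in> domain"
            then show "?line (v c) \<theta> \<le> ?line (fst s0 ''hs'' h) \<theta>" using True unfolding domain_def by (intro cross1) simp
          qed
          moreover have "wp (Cond (Positive (Var ''g'')) (NSet ''h'' (NSub (Var ''h'') (NConst 1))) PushAbove) ?s1
              (\<lambda>t s. t \<le> 120 \<and> s = nstore ''hp'' 0 (Suc c) (rstore ''xx'' 0 x ?s1))"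
            using npop lt Suc icsl True LR(1,2) rf unfolding PushAbove_def
            by (simp add: c_def[symmetric] x_def[symmetric] not_less)
          ultimately show ?thesis using Suc st0 by (elim wp_mono) (simp add: c_def[symmetric])
        next
          case False
          have "hull_inv (Suc c) (Suc (Suc h)) ((fst s0 ''hs'')(Suc h := v c)) ((snd s0 ''st'')(Suc h := x))"
            using False by (intro hull_inv_above[OF invh c(1) np x1 x2 _ cross1 cross2]) auto
          moreover have "wp (Cond (Positive (Var ''g'')) (NSet ''h'' (NSub (Var ''h'') (NConst 1))) PushAbove) ?s1
              (\<lambda>t s. t \<le> 120 \<and> s = nstore ''hp'' 0 (Suc c) (nstore ''h'' 0 (Suc (Suc h)) (rstore ''st'' (Suc h) x
                (nstore ''hs'' (Suc h) (v c) (rstore ''xx'' 0 x ?s1)))))"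
            using npop lt Suc icsl False LR(1,2) rf unfolding PushAbove_def
            by (auto simp: c_def[symmetric] x_def[symmetric] not_less)
          ultimately show ?thesis using Suc st0 by (elim wp_mono) (simp add: c_def[symmetric])
        qed
      qed
    qed
    show ?thesis unfolding HullStep_def
      by (rule wp_SetI[where p = 0 and v = "v c"], simp, simp add: c c_def[symmetric], rule wp_mono[OF seq[OF main]])
        (simp add: c_def Suc)
  qed
qed

lemma wp_Hull:
  fixes s0 :: state
  assumes env: "envelope (\<lambda>p \<theta>. ic p + \<theta> * sl p) sl v n" and icsl: "snd s0 ''ic'' = ic" "snd s0 ''sl'' = sl"
    and v: "\<forall>i<n. fst s0 ''vs'' (fst s0 ''idx'' i) = v i" and LR: "snd s0 ''L'' 0 = L" "snd s0 ''R'' 0 = R"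
    "Lf = (0 < fst s0 ''Lf'' 0)" "Rf = (0 < fst s0 ''Rf'' 0)" and n: "fst s0 ''n'' 0 = n"
  shows "wp Hull s0 (\<lambda>t s. t \<le> 500 * n + 50 \<and> fst s ''h'' 0 \<le> n \<and> snd s ''st'' 0 = L \<and>
    envelope.hull_inv (\<lambda>p \<theta>. ic p + \<theta> * sl p) v n Lf Rf L R n (fst s ''h'' 0) (fst s ''hs'') (snd s ''st''))"
proof -
  let ?line = "\<lambda>p \<theta>. ic p + \<theta> * sl p"
  interpret envelope ?line sl v n Lf Rf L R by (rule env)
  define s1 where "s1 = nstore ''hp'' 0 0 (nstore ''h'' 0 0 s0)"
  have s1: "snd s1 = snd s0" "fst s1 ''vs'' = fst s0 ''vs''" "fst s1 ''idx'' = fst s0 ''idx''" "fst s1 ''Lf'' = fst s0 ''Lf''"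
    "fst s1 ''Rf'' = fst s0 ''Rf''" "fst s1 ''n'' 0 = n" "fst s1 ''h'' 0 = 0" "fst s1 ''hp'' 0 = 0"
    using n unfolding s1_def by simp_all
  \<comment> \<open>The potential is \<open>2 * hp - h\<close>: a removal raises it by one, an
    advance by at least one. After \<open>2 * n\<close> rounds \<open>hp\<close> can no longer be
    below \<open>n\<close>.\<close>
  define Inv where "Inv j s \<longleftrightarrow> hull_inv (fst s ''hp'' 0) (fst s ''h'' 0) (fst s ''hs'') (snd s ''st'') \<and>
      (0 < fst s ''h'' 0 \<longrightarrow> snd s ''st'' 0 = L) \<and> (fst s ''hp'' 0 < n \<longrightarrow> j + fst s ''h'' 0 \<le> 2 * fst s ''hp'' 0) \<and>
      fst s ''h'' 0 \<le> fst s ''hp'' 0" for j and s :: state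
  have run: "wp (For ''it'' (NAdd (Var ''n'') (Var ''n'')) (Cond (NLess (Var ''hp'') (Var ''n'')) HullStep Skip)) s1
    (\<lambda>t s. t \<le> 500 * n + 30 \<and> fst s ''h'' 0 \<le> n \<and> snd s ''st'' 0 = L \<and> hull_inv n (fst s ''h'' 0) (fst s ''hs'') (snd s ''st''))"
  proof (rule wp_For[where n = "n + n" and T = 210 and Inv = Inv], goal_cases)
    case (6 j s)
    have e: "snd s ''ic'' = ic" "snd s ''sl'' = sl" "\<forall>i<n. fst s ''vs'' (fst s ''idx'' i) = v i" "snd s ''L'' 0 = L" "snd s ''R'' 0 = R"
      "Lf = (0 < fst s ''Lf'' 0)" "Rf = (0 < fst s ''Rf'' 0)" "fst s ''n'' 0 = n"
      using 6(2) s1 icsl v LR unfolding agree_def by simp_all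
    show ?case
    proof (cases "fst s ''hp'' 0 < n")
      case True
      have h: "hull_inv (fst s ''hp'' 0) (fst s ''h'' 0) (fst s ''hs'') (snd s ''st'')" "0 < fst s ''h'' 0 \<longrightarrow> snd s ''st'' 0 = L"
        using 6(4) unfolding Inv_def by blast+
      have "wp HullStep s (\<lambda>t s'. 1 + bcost (NLess (Var ''hp'') (Var ''n'')) + t \<le> 210 \<and> Inv (Suc j) s')"
      proof (rule wp_mono[OF wp_HullStep[OF env e(1-7) h True]], goal_cases)
        case (1 t s')
        then show ?case using 6(4) True unfolding Inv_def by auto
      qed
      then show ?thesis using True e(8) by simp
    next
      case False
      then show ?thesis using 6(4) e(8) unfolding Inv_def by simp
    qed
  next
    case (7 t s)
    have "fst s ''hp'' 0 \<le> n" using 7(3) unfolding Inv_def hull_inv_def by blast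
    moreover have "\<not> fst s ''hp'' 0 < n" using 7(3) unfolding Inv_def by auto
    ultimately have "fst s ''hp'' 0 = n" by simp
    then have "hull_inv n (fst s ''h'' 0) (fst s ''hs'') (snd s ''st'')" "fst s ''h'' 0 \<le> n" "0 < fst s ''h'' 0 \<longrightarrow> snd s ''st'' 0 = L"
      using 7(3) unfolding Inv_def by simp_all
    then show ?case using hull_inv_final(1) 7(1) by (auto simp: algebra_simps)
  qed (use s1 hull_inv_init in \<open>auto simp: Inv_def\<close>)
  show ?thesis unfolding Hull_def Block.simps
    by (rule wp_SetI[where p = 0 and v = 0], simp, simp, rule wp_SetI[where p = 0 and v = 0], simp, simp, fold s1_def,
        rule wp_mono[OF run]) simp
qed

end

section \<open>One cell between consecutive equality points\<close>

definition CheckValid :: "nat \<Rightarrow> com" where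
  "CheckValid l = Seq (NSet ''g'' (NConst 1)) (For ''i'' (NConst l) (Block [
     NSet ''x'' (NCell ''W'' (NCell ''D'' (NAdd (NMul (Var ''s'') (NConst l)) (Var ''i'')))),
     Cond (NEq (Var ''x'') (Var ''m'')) (NSet ''g'' (NConst 0)) Skip,
     For ''j'' (Var ''i'') (Cond (NEq (NCell ''W'' (NCell ''D'' (NAdd (NMul (Var ''s'') (NConst l)) (Var ''j'')))) (Var ''x''))
       (NSet ''g'' (NConst 0)) Skip)]))"

definition Collect :: "nat \<Rightarrow> com" where
  "Collect l = Seq (NSet ''n'' (NConst 0)) (For ''s'' (Var ''N'') (Seq (CheckValid l) (Cond (Positive (Var ''g''))
     (Block [RAssign ''key'' (Var ''n'') (RCell ''sl'' (Var ''s'')), NAssign ''vs'' (Var ''n'') (Var ''s''), Increment ''n'']) Skip)))"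

definition OutputSet :: "nat \<Rightarrow> com" where
  "OutputSet l = For ''j'' (NConst l) (NAssign ''F'' (NAdd (NMul (Var ''pieces'') (NConst l)) (Var ''j''))
     (NCell ''W'' (NCell ''D'' (NAdd (NMul (Var ''s'') (NConst l)) (Var ''j'')))))"

definition OutputPiece :: "nat \<Rightarrow> com" where
  "OutputPiece l = Block [NSet ''s'' (NCell ''hs'' (Var ''oi'')), OutputSet l,
     RAssign ''bp'' (Var ''pieces'') (RCell ''st'' (Var ''oi'')), RAssign ''icpt'' (Var ''pieces'') (RCell ''ic'' (Var ''s'')),
     RAssign ''slope'' (Var ''pieces'') (RCell ''sl'' (Var ''s'')), Increment ''pieces'']"

definition Output :: "nat \<Rightarrow> com" where
  "Output l = For ''oi'' (Var ''h'') (OutputPiece l)"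

definition Cell :: "nat \<Rightarrow> com" where
  "Cell l = Block [Collect l, MergeSort, Hull, Output l]"

lemma writes_cell [simp]:
  "nat_writes (CheckValid l) = {''g'', ''i'', ''x'', ''j''}" "real_writes (CheckValid l) = {}"
  "nat_writes (Collect l) = {''n'', ''s'', ''g'', ''i'', ''x'', ''j'', ''vs''}" "real_writes (Collect l) = {''key''}"
  "nat_writes (OutputSet l) = {''j'', ''F''}" "real_writes (OutputSet l) = {}"
  "nat_writes (OutputPiece l) = {''s'', ''j'', ''F'', ''pieces''}" "real_writes (OutputPiece l) = {''bp'', ''icpt'', ''slope''}"
  "nat_writes (Output l) = {''oi'', ''s'', ''j'', ''F'', ''pieces''}" "real_writes (Output l) = {''bp'', ''icpt'', ''slope''}"
  "nat_writes (Cell l) = {''n'', ''s'', ''g'', ''i'', ''x'', ''j'', ''vs'', ''si'', ''sm'', ''sj'', ''se'', ''so'', ''tmp'',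
     ''idx'', ''sw'', ''it'', ''y'', ''hs'', ''h'', ''hp'', ''oi'', ''F'', ''pieces''}"
  "real_writes (Cell l) = {''key'', ''xx'', ''st'', ''bp'', ''icpt'', ''slope''}"
  by (auto simp: CheckValid_def Collect_def OutputSet_def OutputPiece_def Output_def Cell_def)

text \<open>Slots with dummies or repetitions serve to detect relevance; only the others represent
  sets of exactly \<open>l\<close> elements and may compete for the maximum.\<close>

definition valid_slot :: "nat \<Rightarrow> nat \<Rightarrow> (nat \<Rightarrow> nat) \<Rightarrow> (nat \<Rightarrow> nat) \<Rightarrow> nat \<Rightarrow> bool" where
  "valid_slot l m W D r \<longleftrightarrow> m \<notin> slot_set l W D r \<and> card (slot_set l W D r) = l"

lemma valid_slot_iff:
  "valid_slot l m W D r \<longleftrightarrow> (\<forall>i<l. W (D (r * l + i)) \<noteq> m \<and> (\<forall>j<i. W (D (r * l + j)) \<noteq> W (D (r * l + i))))"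
proof -
  let ?g = "\<lambda>j. W (D (r * l + j))"
  have "card (slot_set l W D r) = l \<longleftrightarrow> inj_on ?g {..<l}"
    unfolding slot_set_def using card_image[of ?g "{..<l}"] eq_card_imp_inj_on[of "{..<l}" ?g] by auto
  also have "\<dots> \<longleftrightarrow> (\<forall>i<l. \<forall>j<i. ?g j \<noteq> ?g i)"
  proof
    assume "inj_on ?g {..<l}"
    then show "\<forall>i<l. \<forall>j<i. ?g j \<noteq> ?g i" by (auto dest!: inj_onD)
  next
    assume h: "\<forall>i<l. \<forall>j<i. ?g j \<noteq> ?g i"
    show "inj_on ?g {..<l}"
    proof (rule inj_onI)
      fix i j assume "i \<in> {..<l}" "j \<in> {..<l}" "?g i = ?g j"
      then show "i = j" using h[rule_format, of i j] h[rule_format, of j i] by (cases i j rule: linorder_cases) auto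
    qed
  qed
  finally show ?thesis unfolding valid_slot_def by (auto simp: slot_set_def)
qed

lemma lg_mono: "i \<le> j \<Longrightarrow> lg i \<le> lg j"
  unfolding lg_def by (rule Least_le) (use lg_le[of j] in \<open>simp add: lg_def\<close>)

lemma mset_map_upt:
  assumes "mset (map f [0..<n]) = mset [0..<n]"
  shows "f ` {..<n} = {..<n}" "inj_on f {..<n}"
proof -
  have "set (map f [0..<n]) = set [0..<n]" using assms by (rule mset_eq_setD)
  then show "f ` {..<n} = {..<n}" by (simp add: atLeast0LessThan)
  have "distinct (map f [0..<n])" using assms mset_eq_imp_distinct_iff by (metis distinct_upt)
  then show "inj_on f {..<n}" by (simp add: distinct_map atLeast0LessThan)
qed

context interdiction_machine
begin

lemma wp_CheckValid:
  fixes s0 :: state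
  assumes i: "inputs s0" and r: "fst s0 ''s'' 0 = r"
  shows "wp (CheckValid l) s0 (\<lambda>t s. t \<le> l * (60 * l + 80) + 30 \<and> (fst s ''g'' 0 > 0 \<longleftrightarrow> valid_slot l m (fst s0 ''W'') (fst s0 ''D'') r))"
proof -
  let ?g = "\<lambda>j. fst s0 ''W'' (fst s0 ''D'' (r * l + j))"
  show ?thesis unfolding CheckValid_def
  proof (rule wp_SetI[where p = 0 and v = 1], simp, simp,
      rule wp_For[where n = l and T = "60 * l + 64" and Inv = "\<lambda>k s. fst s ''g'' 0 > 0 \<longleftrightarrow>
      (\<forall>i<k. ?g i \<noteq> m \<and> (\<forall>j<i. ?g j \<noteq> ?g i))"], goal_cases)
    case (6 k s)
    have c: "fst s ''s'' 0 = r" "fst s ''m'' 0 = m" "fst s ''W'' = fst s0 ''W''" "fst s ''D'' = fst s0 ''D''"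
      using 6(2) i r unfolding agree_def inputs_def by simp_all
    let ?s1 = "nstore ''x'' 0 (?g k) s"
    have 1: "wp (Cond (NEq (Var ''x'') (Var ''m'')) (NSet ''g'' (NConst 0)) Skip) ?s1
      (\<lambda>t s'. t \<le> 20 \<and> (fst s' ''g'' 0 > 0 \<longleftrightarrow> (\<forall>i<k. ?g i \<noteq> m \<and> (\<forall>j<i. ?g j \<noteq> ?g i)) \<and> ?g k \<noteq> m))"
      using 6(4) c by auto
    have "wp (Seq (Cond (NEq (Var ''x'') (Var ''m'')) (NSet ''g'' (NConst 0)) Skip)
      (For ''j'' (Var ''i'') (Cond (NEq (NCell ''W'' (NCell ''D'' (NAdd (NMul (Var ''s'') (NConst l)) (Var ''j'')))) (Var ''x''))
       (NSet ''g'' (NConst 0)) Skip))) ?s1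
      (\<lambda>t s. t \<le> 60 * l + 50 \<and> (fst s ''g'' 0 > 0 \<longleftrightarrow> (\<forall>i<Suc k. ?g i \<noteq> m \<and> (\<forall>j<i. ?g j \<noteq> ?g i))))"
      unfolding wp_Seq
    proof (rule wp_use[OF 1], goal_cases)
      case (1 t s2)
      have c2: "fst s2 ''s'' 0 = r" "fst s2 ''W'' = fst s0 ''W''" "fst s2 ''D'' = fst s0 ''D''" "fst s2 ''i'' 0 = k" "fst s2 ''x'' 0 = ?g k"
        using 1(2) c 6(3) unfolding agree_def by simp_all
      show ?case
      proof (rule wp_For[where n = k and T = 35 and Inv = "\<lambda>j s. fst s ''g'' 0 > 0 \<longleftrightarrow>
          ((\<forall>i<k. ?g i \<noteq> m \<and> (\<forall>j<i. ?g j \<noteq> ?g i)) \<and> ?g k \<noteq> m) \<and> (\<forall>j'<j. ?g j' \<noteq> ?g k)"], goal_cases)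
        case (6 j s)
        have "fst s ''s'' 0 = r" "fst s ''W'' = fst s0 ''W''" "fst s ''D'' = fst s0 ''D''" "fst s ''x'' 0 = ?g k"
          using 6(2) c2 unfolding agree_def by simp_all
        then show ?case using 6(3,4) by (auto simp: less_Suc_eq)
      next
        case (7 t' s)
        have "t' \<le> l * 50 + 14" using 7(1) \<open>k < l\<close> by (simp add: mult_le_mono1 order_trans[OF _ add_right_mono[OF mult_le_mono1[of k l 50]]])
        then show ?case using 7(3) 1(1) by (auto simp: less_Suc_eq)
      qed (use c2 1(1) in auto)
    qed
    then have run: "wp (Seq (Cond (NEq (Var ''x'') (Var ''m'')) (NSet ''g'' (NConst 0)) Skip)
      (For ''j'' (Var ''i'') (Cond (NEq (NCell ''W'' (NCell ''D'' (NAdd (NMul (Var ''s'') (NConst l)) (Var ''j'')))) (Var ''x''))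
       (NSet ''g'' (NConst 0)) Skip))) ?s1
      (\<lambda>t s. t \<le> 60 * l + 50 \<and> (fst s ''g'' 0 > 0 \<longleftrightarrow> (\<forall>i<Suc k. ?g i \<noteq> m \<and> (\<forall>j<i. ?g j \<noteq> ?g i))))" .
    show ?case unfolding Block.simps
      by (rule wp_SetI[where p = 0 and v = "?g k"], simp, simp add: c 6(3), rule wp_mono[OF run]) simp
  next
    case (7 t s)
    then show ?case unfolding valid_slot_iff by (simp add: algebra_simps)
  qed auto
qed

lemma wp_Collect:
  fixes s0 :: state
  assumes i: "inputs s0" and N: "fst s0 ''N'' 0 = N"
  shows "wp (Collect l) s0 (\<lambda>t s. t \<le> N * (l * (60 * l + 80) + 100) + 30 \<and> fst s ''n'' 0 \<le> N \<and>
     fst s ''vs'' ` {..<fst s ''n'' 0} = {r. r < N \<and> valid_slot l m (fst s0 ''W'') (fst s0 ''D'') r} \<and>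
     (\<forall>i<fst s ''n'' 0. snd s ''key'' i = snd s0 ''sl'' (fst s ''vs'' i)))"
  unfolding Collect_def
proof (rule wp_SetI[where p = 0 and v = 0], simp, simp,
    rule wp_For[where n = N and T = "l * (60 * l + 80) + 80" and Inv = "\<lambda>j s. fst s ''n'' 0 \<le> j \<and>
     fst s ''vs'' ` {..<fst s ''n'' 0} = {r. r < j \<and> valid_slot l m (fst s0 ''W'') (fst s0 ''D'') r} \<and>
     (\<forall>i<fst s ''n'' 0. snd s ''key'' i = snd s0 ''sl'' (fst s ''vs'' i))"], goal_cases)
  case (6 j s)
  let ?v = "valid_slot l m (fst s0 ''W'') (fst s0 ''D'')"
  have c: "inputs s" "fst s ''W'' = fst s0 ''W''" "fst s ''D'' = fst s0 ''D''" "snd s ''sl'' = snd s0 ''sl''"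
    using 6(2) i unfolding agree_def inputs_def by simp_all
  have "wp (CheckValid l) s (\<lambda>t s'. t \<le> l * (60 * l + 80) + 30 \<and> (fst s' ''g'' 0 > 0 \<longleftrightarrow> ?v j))"
    using wp_CheckValid[OF c(1) 6(3)] c by simp
  then show ?case unfolding wp_Seq[of "CheckValid l"]
  proof (rule wp_use, goal_cases)
    case (1 t s')
    have d: "fst s' ''n'' = fst s ''n''" "fst s' ''vs'' = fst s ''vs''" "snd s' ''key'' = snd s ''key''" "snd s' ''sl'' = snd s0 ''sl''"
      "fst s' ''s'' 0 = j"
      using 1(2) c 6(3) unfolding agree_def by simp_all
    let ?n = "fst s ''n'' 0"
    show ?case
    proof (cases "?v j")
      case True
      have e: "{r. r < Suc j \<and> ?v r} = insert j {r. r < j \<and> ?v r}" using True by (auto simp: less_Suc_eq)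
      have im: "(fst s ''vs'')(?n := j) ` {..<Suc ?n} = insert j (fst s ''vs'' ` {..<?n})"
        unfolding lessThan_Suc by (auto simp: image_iff)
      show ?thesis unfolding e using 1(1) True d 6(4) im by (auto simp: less_Suc_eq)
    next
      case False
      then have e: "{r. r < Suc j \<and> ?v r} = {r. r < j \<and> ?v r}" by (auto simp: less_Suc_eq)
      show ?thesis unfolding e using 1(1) False d 6(4) by auto
    qed
  qed
next
  case (7 t s)
  then show ?case by (simp add: algebra_simps)
qed (use N in auto)

text \<open>
  The end point \<open>r\<close> of the part of the interval that has been processed is infinite unless \<open>fin\<close>;
  \<open>bp 0\<close> is never looked at.
\<close>
definition out_ok ::
  "nat \<Rightarrow> (nat \<Rightarrow> nat) \<Rightarrow> (nat \<Rightarrow> real) \<Rightarrow> (nat \<Rightarrow> real) \<Rightarrow> (nat \<Rightarrow> real) \<Rightarrow> bool \<Rightarrow> real \<Rightarrow> bool" where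
  "out_ok q Fa bp ip sp fin r \<longleftrightarrow> (\<forall>i. 0 < i \<longrightarrow> i < q \<longrightarrow> bp i \<in> I \<and> (fin \<longrightarrow> bp i < r)) \<and>
     (\<forall>i. 0 < i \<longrightarrow> Suc i < q \<longrightarrow> bp i < bp (Suc i)) \<and>
     (\<forall>i<q. \<forall>\<theta>\<in>I. (0 < i \<longrightarrow> bp i \<le> \<theta>) \<longrightarrow> (Suc i < q \<longrightarrow> \<theta> \<le> bp (Suc i)) \<longrightarrow> (Suc i = q \<longrightarrow> fin \<longrightarrow> \<theta> \<le> r) \<longrightarrow>
        most_vital l m \<F> a b \<theta> ((\<lambda>j. Fa (i * l + j)) ` {..<l}) \<and> interdiction_value l m \<F> a b \<theta> = ip i + \<theta> * sp i)"

text \<open>A new piece starts where the processed part ended, and this point becomes its left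
  breakpoint. The very first piece has no such point, which is why the conditions on
  \<open>r\<close> are needed only for \<open>0 < q\<close>.\<close>

lemma out_ok_append:
  assumes ok: "out_ok q Fa bp ip sp fin r" and r: "0 < q \<Longrightarrow> fin \<and> r \<in> I \<and> x = r \<and> (fin' \<longrightarrow> r < r')"
    and Fa: "\<And>p. p < q * l \<Longrightarrow> Fa' p = Fa p"
    and new: "\<And>\<theta>. \<theta> \<in> I \<Longrightarrow> (0 < q \<Longrightarrow> r \<le> \<theta>) \<Longrightarrow> (fin' \<Longrightarrow> \<theta> \<le> r') \<Longrightarrow>
      most_vital l m \<F> a b \<theta> ((\<lambda>j. Fa' (q * l + j)) ` {..<l}) \<and> interdiction_value l m \<F> a b \<theta> = c + \<theta> * d"
  shows "out_ok (Suc q) Fa' (bp(q := x)) (ip(q := c)) (sp(q := d)) fin' r'"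
  unfolding out_ok_def
proof (intro conjI allI ballI impI)
  show "(bp(q := x)) i \<in> I" if "0 < i" "i < Suc q" for i
    using that ok r unfolding out_ok_def by (auto simp: less_Suc_eq)
  show "(bp(q := x)) i < r'" if "0 < i" "i < Suc q" "fin'" for i
    using that ok r unfolding out_ok_def by (auto simp: less_Suc_eq intro: less_trans)
  show "(bp(q := x)) i < (bp(q := x)) (Suc i)" if "0 < i" "Suc i < Suc q" for i
    using that ok r unfolding out_ok_def by (auto simp: less_Suc_eq)
  have "most_vital l m \<F> a b \<theta> ((\<lambda>j. Fa' (i * l + j)) ` {..<l}) \<and> interdiction_value l m \<F> a b \<theta> = (ip(q := c)) i + \<theta> * (sp(q := d)) i"
    if i: "i < Suc q" "\<theta> \<in> I" "0 < i \<longrightarrow> (bp(q := x)) i \<le> \<theta>" "Suc i < Suc q \<longrightarrow> \<theta> \<le> (bp(q := x)) (Suc i)"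
      "Suc i = Suc q \<longrightarrow> fin' \<longrightarrow> \<theta> \<le> r'" for i \<theta>
  proof (cases "i = q")
    case True
    then show ?thesis using new[OF i(2)] i r by simp
  next
    case False
    then have iq: "i < q" using i(1) by simp
    have "Suc i * l \<le> q * l" using iq by (intro mult_right_mono) simp_all
    then have F: "(\<lambda>j. Fa' (i * l + j)) ` {..<l} = (\<lambda>j. Fa (i * l + j)) ` {..<l}"
      using Fa by (intro image_cong) simp_all
    have b2: "Suc i < q \<longrightarrow> \<theta> \<le> bp (Suc i)" using i(4) iq by auto
    have b3: "Suc i = q \<longrightarrow> fin \<longrightarrow> \<theta> \<le> r" using i(4) iq r by auto
    show ?thesis unfolding F using ok iq i(2,3) b2 b3 unfolding out_ok_def by simp
  qed
  then show "most_vital l m \<F> a b \<theta> ((\<lambda>j. Fa' (i * l + j)) ` {..<l})"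
    "interdiction_value l m \<F> a b \<theta> = (ip(q := c)) i + \<theta> * (sp(q := d)) i"
    if "i < Suc q" "\<theta> \<in> I" "0 < i \<longrightarrow> (bp(q := x)) i \<le> \<theta>" "Suc i < Suc q \<longrightarrow> \<theta> \<le> (bp(q := x)) (Suc i)"
      "Suc i = Suc q \<longrightarrow> fin' \<longrightarrow> \<theta> \<le> r'" for i \<theta>
    using that by blast+
qed

lemma wp_OutputSet:
  fixes s0 :: state
  assumes "fst s0 ''s'' 0 = r" "fst s0 ''pieces'' 0 = q"
  shows "wp (OutputSet l) s0 (\<lambda>t s. t \<le> 50 * l + 20 \<and> (\<forall>p<q * l. fst s ''F'' p = fst s0 ''F'' p) \<and>
    (\<lambda>j. fst s ''F'' (q * l + j)) ` {..<l} = slot_set l (fst s0 ''W'') (fst s0 ''D'') r)"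
  unfolding OutputSet_def
proof (rule wp_For[where n = l and T = 30 and Inv = "\<lambda>j s. (\<forall>p<q * l. fst s ''F'' p = fst s0 ''F'' p) \<and>
    (\<forall>j'<j. fst s ''F'' (q * l + j') = fst s0 ''W'' (fst s0 ''D'' (r * l + j')))"], goal_cases)
  case (6 j s)
  have "fst s ''s'' 0 = r" "fst s ''pieces'' 0 = q" "fst s ''W'' = fst s0 ''W''" "fst s ''D'' = fst s0 ''D''"
    using 6(2) assms unfolding agree_def by simp_all
  then show ?case using 6(3,4) by (auto simp: less_Suc_eq)
next
  case (7 t s)
  have "(\<lambda>j. fst s ''F'' (q * l + j)) ` {..<l} = slot_set l (fst s0 ''W'') (fst s0 ''D'') r"
    unfolding slot_set_def using 7(3) by (intro image_cong) simp_all
  then show ?case using 7 by simp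
qed auto

lemma wp_OutputPiece:
  fixes s0 :: state
  assumes q: "fst s0 ''pieces'' 0 = q" and j: "fst s0 ''oi'' 0 = j"
    and ok: "out_ok q (fst s0 ''F'') (snd s0 ''bp'') (snd s0 ''icpt'') (snd s0 ''slope'') fin r"
    and r: "0 < q \<Longrightarrow> fin \<and> r \<in> I \<and> snd s0 ''st'' j = r \<and> (fin' \<longrightarrow> r < r')"
    and new: "\<And>\<theta>. \<theta> \<in> I \<Longrightarrow> (0 < q \<Longrightarrow> r \<le> \<theta>) \<Longrightarrow> (fin' \<Longrightarrow> \<theta> \<le> r') \<Longrightarrow>
      most_vital l m \<F> a b \<theta> (slot_set l (fst s0 ''W'') (fst s0 ''D'') (fst s0 ''hs'' j)) \<and>
      interdiction_value l m \<F> a b \<theta> = snd s0 ''ic'' (fst s0 ''hs'' j) + \<theta> * snd s0 ''sl'' (fst s0 ''hs'' j)"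
  shows "wp (OutputPiece l) s0 (\<lambda>t s. t \<le> 50 * l + 100 \<and> fst s ''pieces'' 0 = Suc q \<and>
    out_ok (Suc q) (fst s ''F'') (snd s ''bp'') (snd s ''icpt'') (snd s ''slope'') fin' r')"
proof -
  let ?r = "fst s0 ''hs'' j"
  let ?s1 = "nstore ''s'' 0 ?r s0"
  have "wp (OutputSet l) ?s1 (\<lambda>t s. t \<le> 50 * l + 20 \<and> (\<forall>p<q * l. fst s ''F'' p = fst ?s1 ''F'' p) \<and>
    (\<lambda>j. fst s ''F'' (q * l + j)) ` {..<l} = slot_set l (fst ?s1 ''W'') (fst ?s1 ''D'') ?r)"
    using q by (intro wp_OutputSet) simp_all
  then have run: "wp (Seq (OutputSet l) (Seq (RAssign ''bp'' (Var ''pieces'') (RCell ''st'' (Var ''oi'')))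
     (Seq (RAssign ''icpt'' (Var ''pieces'') (RCell ''ic'' (Var ''s'')))
     (Seq (RAssign ''slope'' (Var ''pieces'') (RCell ''sl'' (Var ''s''))) (Increment ''pieces''))))) ?s1
     (\<lambda>t s. t \<le> 50 * l + 80 \<and> fst s ''pieces'' 0 = Suc q \<and>
    out_ok (Suc q) (fst s ''F'') (snd s ''bp'') (snd s ''icpt'') (snd s ''slope'') fin' r')" unfolding wp_Seq[of "OutputSet l"]
  proof (rule wp_use, goal_cases)
    case (1 t s)
    have c: "fst s ''pieces'' 0 = q" "fst s ''oi'' 0 = j" "fst s ''s'' 0 = ?r" "snd s = snd s0"
      using 1(2) q j unfolding agree_def by (simp_all add: fun_eq_iff)
    have "out_ok (Suc q) (fst s ''F'') ((snd s0 ''bp'')(q := snd s0 ''st'' j)) ((snd s0 ''icpt'')(q := snd s0 ''ic'' ?r))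
      ((snd s0 ''slope'')(q := snd s0 ''sl'' ?r)) fin' r'"
      by (rule out_ok_append[OF ok r]) (use 1(1) new in simp_all)
    then show ?case using 1(1) c by simp
  qed
  show ?thesis unfolding OutputPiece_def Block.simps
    by (rule wp_SetI[where p = 0 and v = ?r], simp, simp add: j, rule wp_mono[OF run]) simp
qed

end

context ordered_machine
begin

lemma slot_line:
  assumes "slots_ok N W D B ic sl" "r < N"
  shows "weight a b (gb (E - slot_set l W D r)) \<theta> = ic r + \<theta> * sl r"
  using assms unfolding slots_ok_def weight_def elem_weight_def by (simp add: sum.distrib sum_distrib_left)

lemma cell_optimal:
  assumes ok: "slots_ok N W D B ic sl" and t: "table m W P (relevant l)" "card (relevant l) < P" and D: "digit_table l N P D"
    and c: "compatible lt \<theta>" and r: "r < N" "valid_slot l m W D r"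
    and opt: "\<And>r'. r' < N \<Longrightarrow> valid_slot l m W D r' \<Longrightarrow> ic r' + \<theta> * sl r' \<le> ic r + \<theta> * sl r"
  shows "most_vital l m \<F> a b \<theta> (slot_set l W D r) \<and> interdiction_value l m \<F> a b \<theta> = ic r + \<theta> * sl r"
proof -
  define S where "S = slot_set l W D ` {r. r < N \<and> valid_slot l m W D r}"
  have W: "W p \<le> m" if "p < P" for p using t(1) relevant_sub[of l] that unfolding table_def by force
  have sub: "slot_set l W D r' \<subseteq> E" if "r' < N" "valid_slot l m W D r'" for r'
  proof
    fix x assume x: "x \<in> slot_set l W D r'"
    then obtain j where "j < l" "x = W (D (r' * l + j))" unfolding slot_set_def by blast
    then have "x \<le> m" using D W that(1) unfolding digit_table_def by blast
    moreover have "x \<noteq> m" using x that(2) unfolding valid_slot_def by blast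
    ultimately show "x \<in> E" by simp
  qed
  have 1: "F \<subseteq> E \<and> card F = l" if "F \<in> S" for F using that sub unfolding S_def by (auto simp: valid_slot_def)
  have 2: "F \<in> S" if F: "F \<subseteq> relevant l" "card F = l" for F
  proof -
    obtain r' where r': "r' < N" "slot_set l W D r' = F"
      by (rule slot_exists[OF t(1) relevant_sub t(2) D F(1)]) (use F in auto)
    moreover have "m \<notin> F" using F relevant_sub[of l] by auto
    ultimately show ?thesis unfolding S_def valid_slot_def using F by blast
  qed
  have 3: "slot_set l W D r \<in> S" using r unfolding S_def by blast
  have 4: "weight a b (gb (E - F)) \<theta> \<le> weight a b (gb (E - slot_set l W D r)) \<theta>" if "F \<in> S" for F
    using that opt slot_line[OF ok] r(1) unfolding S_def by auto
  have "most_vital l m \<F> a b \<theta> (slot_set l W D r)"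
    by (rule most_vital_cell(1)[OF c, of S]) (use 1 2 3 4 in blast)+
  moreover have "interdiction_value l m \<F> a b \<theta> = weight a b (gb (E - slot_set l W D r)) \<theta>"
    by (rule most_vital_cell(2)[OF c, of S]) (use 1 2 3 4 in blast)+
  ultimately show ?thesis using slot_line[OF ok r(1)] by simp
qed

text \<open>There are more than \<open>l\<close> relevant elements, and some slot lists
  \<open>l\<close> of them. So the envelope is taken over a non-empty list of lines.\<close>

lemma valid_exists:
  assumes t: "table m W P (relevant l)" "card (relevant l) < P" and D: "digit_table l N P D"
  shows "\<exists>r<N. valid_slot l m W D r"
proof -
  obtain F where F: "F \<subseteq> relevant l" "card F = l"
    using card_relevant_gt by (metis less_imp_le obtain_subset_with_card_n)
  obtain r where r: "r < N" "slot_set l W D r = F"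
    by (rule slot_exists[OF t(1) relevant_sub t(2) D F(1)]) (use F in auto)
  moreover have "m \<notin> F" using F relevant_sub[of l] by auto
  ultimately show ?thesis unfolding valid_slot_def using F by blast
qed

lemma wp_Cell:
  fixes s0 :: state
  assumes i: "inputs s0" and N: "fst s0 ''N'' 0 = N" and D: "digit_table l N P (fst s0 ''D'')"
    and t: "table m (fst s0 ''W'') P (relevant l)" "card (relevant l) < P"
    and ok: "slots_ok N (fst s0 ''W'') (fst s0 ''D'') (fst s0 ''B'') (snd s0 ''ic'') (snd s0 ''sl'')"
    and LR: "snd s0 ''L'' 0 = L" "snd s0 ''R'' 0 = R" "Lf = (0 < fst s0 ''Lf'' 0)" "Rf = (0 < fst s0 ''Rf'' 0)"
    and comp: "\<And>\<theta>. \<theta> \<in> I \<Longrightarrow> (Lf \<Longrightarrow> L \<le> \<theta>) \<Longrightarrow> (Rf \<Longrightarrow> \<theta> \<le> R) \<Longrightarrow> compatible lt \<theta>"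
    and out: "out_ok (fst s0 ''pieces'' 0) (fst s0 ''F'') (snd s0 ''bp'') (snd s0 ''icpt'') (snd s0 ''slope'') Lf L"
    and L0: "fst s0 ''pieces'' 0 = 0 \<Longrightarrow> Lf \<Longrightarrow> \<forall>\<theta>\<in>I. L \<le> \<theta>"
    and L1: "0 < fst s0 ''pieces'' 0 \<Longrightarrow> Lf \<and> L \<in> I \<and> (Rf \<longrightarrow> L < R)"
    and inner: "\<And>\<theta>. (Lf \<Longrightarrow> L < \<theta>) \<Longrightarrow> (Rf \<Longrightarrow> \<theta> < R) \<Longrightarrow> \<theta> \<in> I"
  shows "wp (Cell l) s0 (\<lambda>t s. t \<le> (lg N + 1) * ((N + 1) * (100 * l * l + 300 * l + 1500)) \<and> 0 < fst s ''pieces'' 0 \<and>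
    out_ok (fst s ''pieces'' 0) (fst s ''F'') (snd s ''bp'') (snd s ''icpt'') (snd s ''slope'') Rf R)"
proof -
  let ?W = "fst s0 ''W''" and ?D = "fst s0 ''D''" and ?ic = "snd s0 ''ic''" and ?sl = "snd s0 ''sl''"
  let ?line = "\<lambda>p \<theta>. ?ic p + \<theta> * ?sl p"
  let ?V = "{r. r < N \<and> valid_slot l m ?W ?D r}"
  let ?q = "fst s0 ''pieces'' 0"
  show ?thesis unfolding Cell_def Block.simps wp_Seq[of "Collect l"]
  proof (rule wp_use[OF wp_Collect[OF i N]], goal_cases)
    case (1 t1 s1)
    define n where "n = fst s1 ''n'' 0"
    have t1: "t1 \<le> N * (l * (60 * l + 80) + 100) + 30" "n \<le> N" using 1(1) n_def by blast+
    have V1: "fst s1 ''vs'' ` {..<n} = ?V" "\<And>i. i < n \<Longrightarrow> snd s1 ''key'' i = ?sl (fst s1 ''vs'' i)"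
      using 1(1) unfolding n_def by blast+
    have a1: "agree {''n'', ''s'', ''g'', ''i'', ''x'', ''j'', ''vs''} {''key''} s0 s1" using 1(2) by simp
    have "?V \<noteq> {}" using valid_exists[OF t D] by blast
    then have n_pos: "0 < n" using V1(1) by (cases n) auto
    show ?case unfolding wp_Seq[of "MergeSort"]
    proof (rule wp_use[OF wp_MergeSort[OF n_def[symmetric]]], goal_cases)
      case (1 t2 s2)
      have t2: "t2 \<le> (lg n + 1) * (300 * n + 300)" using 1(1) by blast
      have perm: "fst s2 ''idx'' ` {..<n} = {..<n}" using mset_map_upt(1) 1(1) by blast
      have srt: "snd s1 ''key'' (fst s2 ''idx'' x) \<le> snd s1 ''key'' (fst s2 ''idx'' y)" if "x < y" "y < n" for x y
        using 1(1) that by blast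
      define v where "v i = fst s1 ''vs'' (fst s2 ''idx'' i)" for i
      have vV: "v ` {..<n} = ?V" unfolding v_def using V1(1) perm by (metis image_image)
      have idx: "fst s2 ''idx'' x < n" if "x < n" for x using perm that by blast
      have sv: "?sl (v x) \<le> ?sl (v y)" if "x < y" "y < n" for x y
        using srt[OF that] V1(2)[OF idx[OF that(2)]] V1(2)[OF idx[of x]] that unfolding v_def by simp
      interpret env: envelope ?line ?sl v n Lf Rf L R
        by unfold_locales (simp add: algebra_simps, rule sv, assumption, assumption, rule n_pos)
      have s2: "snd s2 ''ic'' = ?ic" "snd s2 ''sl'' = ?sl" "\<forall>i<n. fst s2 ''vs'' (fst s2 ''idx'' i) = v i" "snd s2 ''L'' 0 = L" "snd s2 ''R'' 0 = R"
        "Lf = (0 < fst s2 ''Lf'' 0)" "Rf = (0 < fst s2 ''Rf'' 0)" "fst s2 ''n'' 0 = n"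
        using 1(2) a1 LR n_def unfolding v_def agree_def by simp_all
      have a2: "agree {''n'', ''s'', ''g'', ''i'', ''x'', ''j'', ''vs'', ''si'', ''sm'', ''sj'', ''se'', ''so'', ''tmp'', ''idx'', ''sw''} {''key''} s0 s2"
        using 1(2) a1 unfolding agree_def by simp
      show ?case unfolding wp_Seq[of Hull]
      proof (rule wp_use[OF wp_Hull[OF env.envelope_axioms s2]], goal_cases)
        case (1 t3 s3)
        define h where "h = fst s3 ''h'' 0"
        let ?hs = "fst s3 ''hs''" and ?st = "snd s3 ''st''"
        have h: "t3 \<le> 500 * n + 50" "h \<le> n" "?st 0 = L" "env.hull_inv n h ?hs ?st" using 1(1) unfolding h_def by blast+
        have s3: "fst s3 ''W'' = ?W" "fst s3 ''D'' = ?D" "snd s3 ''ic'' = ?ic" "snd s3 ''sl'' = ?sl" "fst s3 ''pieces'' 0 = ?q"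
          "fst s3 ''F'' = fst s0 ''F''" "snd s3 ''bp'' = snd s0 ''bp''" "snd s3 ''icpt'' = snd s0 ''icpt''" "snd s3 ''slope'' = snd s0 ''slope''"
          using 1(2) a2 unfolding agree_def by simp_all
        have hpos: "0 < h" using env.hull_inv_final(1)[OF h(4)] .
        have st: "Lf \<longrightarrow> L < ?st j" "Rf \<longrightarrow> ?st j < R" if "0 < j" "j < h" for j
          using h(4) that unfolding env.hull_inv_def by blast+
        have stI: "?st j \<in> I" if "0 < j" "j < h" for j using inner st[OF that] by blast
        have stinc: "?st j < ?st (Suc j)" if "0 < j" "Suc j < h" for j using h(4) that unfolding env.hull_inv_def by blast
        \<comment> \<open>\<open>efin j\<close> and \<open>eval j\<close> describe the right end of
          the processed part once \<open>j\<close> entries of the stack have been written: the left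
          end of the cell for \<open>j = 0\<close>, its right end for \<open>j = h\<close>.\<close>
        define efin where "efin j = (if j < h then if j = 0 then Lf else True else Rf)" for j
        define eval where "eval j = (if j < h then if j = 0 then L else ?st j else R)" for j
        have good: "most_vital l m \<F> a b \<theta> (slot_set l ?W ?D (?hs j)) \<and> interdiction_value l m \<F> a b \<theta> = ?ic (?hs j) + \<theta> * ?sl (?hs j)"
          if j: "j < h" "\<theta> \<in> I" "0 < ?q + j \<Longrightarrow> eval j \<le> \<theta>" "efin (Suc j) \<Longrightarrow> \<theta> \<le> eval (Suc j)" for j \<theta>
        proof -
          have 1: "L \<le> \<theta>" if Lf
          proof (cases "j = 0")
            case True
            then show ?thesis using L0 that j hpos unfolding eval_def by (cases "?q = 0") auto
          next
            case False
            then show ?thesis using st(1)[of j] that j unfolding eval_def by fastforce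
          qed
          have 2: "\<theta> \<le> R" if Rf
          proof (cases "Suc j < h")
            case True
            then show ?thesis using st(2)[of "Suc j"] that j unfolding eval_def efin_def by fastforce
          next
            case False
            then show ?thesis using that j unfolding eval_def efin_def by simp
          qed
          have seg: "\<theta> \<in> env.segment ?st h j"
            unfolding env.segment_def using 1 2 j unfolding eval_def efin_def by auto
          have dom: "env.dominates (?hs j) n \<theta>" using env.hull_inv_final(2)[OF h(4) j(1) seg] .
          obtain p where p: "p < n" "?hs j = v p" using env.hull_inv_final(3)[OF h(4) j(1)] by blast
          then have "?hs j \<in> ?V" using vV by blast
          then have r: "?hs j < N" "valid_slot l m ?W ?D (?hs j)" by blast+
          show ?thesis
          proof (rule cell_optimal[OF ok t D comp[OF j(2) 1 2] r])
            fix r' assume "r' < N" "valid_slot l m ?W ?D r'"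
            then have "r' \<in> v ` {..<n}" using vV by blast
            then show "?line r' \<theta> \<le> ?line (?hs j) \<theta>" using dom unfolding env.dominates_def by blast
          qed
        qed
        have run: "wp (Output l) s3 (\<lambda>t s. t \<le> n * (50 * l + 150) + 20 \<and> fst s ''pieces'' 0 = ?q + h \<and>
          out_ok (?q + h) (fst s ''F'') (snd s ''bp'') (snd s ''icpt'') (snd s ''slope'') (efin h) (eval h))"
          unfolding Output_def
        proof (rule wp_For[where n = h and T = "50 * l + 100" and Inv = "\<lambda>j s. fst s ''pieces'' 0 = ?q + j \<and>
          out_ok (?q + j) (fst s ''F'') (snd s ''bp'') (snd s ''icpt'') (snd s ''slope'') (efin j) (eval j)"], goal_cases)
          case 4
          have "efin 0 = Lf" "eval 0 = L" unfolding efin_def eval_def using hpos by simp_all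
          then show ?case using out s3 by simp
        next
          case (6 j s)
          have c: "fst s ''W'' = ?W" "fst s ''D'' = ?D" "snd s ''ic'' = ?ic" "snd s ''sl'' = ?sl" "fst s ''hs'' = ?hs" "snd s ''st'' = ?st"
            using 6(2) s3 unfolding agree_def by simp_all
          have bnd: "efin j \<and> eval j \<in> I \<and> snd s ''st'' j = eval j \<and> (efin (Suc j) \<longrightarrow> eval j < eval (Suc j))" if "0 < ?q + j"
          proof (cases "j = 0")
            case True
            then have "Lf" "L \<in> I" "Rf \<longrightarrow> L < R" using L1 that by simp_all
            then show ?thesis using True hpos h(3) c st(1)[of 1] unfolding efin_def eval_def by simp
          next
            case False
            then show ?thesis using 6(1) c stI[of j] stinc[of j] st(2)[of j] unfolding efin_def eval_def by simp
          qed
          have "wp (OutputPiece l) s (\<lambda>t s. t \<le> 50 * l + 100 \<and> fst s ''pieces'' 0 = Suc (?q + j) \<and>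
            out_ok (Suc (?q + j)) (fst s ''F'') (snd s ''bp'') (snd s ''icpt'') (snd s ''slope'') (efin (Suc j)) (eval (Suc j)))"
            by (rule wp_OutputPiece[where fin = "efin j" and r = "eval j" and j = j]) (use 6 bnd good c in simp_all)
          then show ?case by simp
        next
          case (7 t s)
          have "t \<le> h * (50 * l + 120) + 20" using 7(1) by (simp add: algebra_simps)
          also have "\<dots> \<le> n * (50 * l + 150) + 20" using h(2) by (intro add_mono mult_mono) simp_all
          finally show ?case using 7 by simp
        qed (use h_def in auto)
        have eh: "efin h = Rf" "eval h = R" unfolding efin_def eval_def by simp_all
        show ?case
        proof (rule wp_mono[OF run], goal_cases)
          case (1 t4 s4)
          have lgn: "lg n \<le> lg N" using t1(2) by (rule lg_mono)
          let ?A = "100 * l * l + 300 * l + 1500"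
          have "t2 \<le> (lg N + 1) * ((N + 1) * 300)"
          proof -
            have "(lg n + 1) * (300 * n + 300) \<le> (lg N + 1) * ((N + 1) * 300)"
              using lgn t1(2) by (intro mult_mono) simp_all
            then show ?thesis using t2 by simp
          qed
          moreover have "(N + 1) * (60 * l * l + 130 * l + 1200) \<le> (lg N + 1) * ((N + 1) * (60 * l * l + 130 * l + 1200))"
            by simp
          moreover have "t1 + t3 + t4 + 10 \<le> (N + 1) * (60 * l * l + 130 * l + 1200)"
          proof -
            have "n * (50 * l + 150) \<le> N * (50 * l + 150)" using t1(2) by (rule mult_right_mono) simp
            then have "t4 \<le> N * (50 * l + 150) + 20" using 1 by linarith
            moreover have "t3 \<le> 500 * N + 50" using h(1) t1(2) by simp
            ultimately show ?thesis using t1(1) by (simp add: algebra_simps)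
          qed
          ultimately have "1 + t1 + (1 + t2 + (1 + t3 + t4)) \<le> (lg N + 1) * ((N + 1) * 300) + (lg N + 1) * ((N + 1) * (60 * l * l + 130 * l + 1200))"
            by linarith
          also have "\<dots> = (lg N + 1) * ((N + 1) * (60 * l * l + 130 * l + 1500))" by (simp add: algebra_simps)
          also have "\<dots> \<le> (lg N + 1) * ((N + 1) * ?A)" by (intro mult_le_mono2) simp
          finally show ?case using 1 eh hpos by simp
        qed
      qed
    qed
  qed
qed

end

section \<open>Equality points and the main loop\<close>

text \<open>The pair is oriented so that \<open>e\<close> has the larger slope, hence precedes
  \<open>f\<close> to the left of the crossing. Parallel lines never cross, and a crossing outside
  the interior of the interval is dropped.\<close>

definition GatherPair :: com where
  "GatherPair = Seq (Cond (RLess (RCell ''b'' (Var ''j'')) (RCell ''b'' (Var ''i'')))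
       (Seq (NSet ''e'' (Var ''i'')) (NSet ''f'' (Var ''j''))) (Seq (NSet ''e'' (Var ''j'')) (NSet ''f'' (Var ''i''))))
     (Cond (RLess (RCell ''b'' (Var ''f'')) (RCell ''b'' (Var ''e'')))
       (Seq (RSet ''xx'' (RDiv (RSub (RCell ''a'' (Var ''f'')) (RCell ''a'' (Var ''e'')))
              (RSub (RCell ''b'' (Var ''e'')) (RCell ''b'' (Var ''f'')))))
         (Cond (BAnd (BNot (BAnd (Positive (Var ''lo_finite'')) (BNot (RLess (RVar ''lo'') (RVar ''xx'')))))
             (BNot (BAnd (Positive (Var ''hi_finite'')) (BNot (RLess (RVar ''xx'') (RVar ''hi''))))))
           (Block [RAssign ''key'' (Var ''n'') (RVar ''xx''), NAssign ''E0'' (Var ''n'') (Var ''e''),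
              NAssign ''F0'' (Var ''n'') (Var ''f''), Increment ''n'']) Skip))
       Skip)"

definition Gather :: com where
  "Gather = Seq (NSet ''n'' (NConst 0)) (For ''i'' (Var ''m'') (For ''j'' (Var ''i'') GatherPair))"

text \<open>The arrays \<open>key\<close> and \<open>idx\<close> and the length \<open>n\<close> are
  overwritten by the sorting inside every cell, so the list of equality points is saved
  first.\<close>

definition CopyEvents :: com where
  "CopyEvents = Seq (For ''c'' (Var ''n'') (Block [
       RAssign ''T'' (Var ''c'') (RCell ''key'' (NCell ''idx'' (Var ''c''))),
       NAssign ''Ee'' (Var ''c'') (NCell ''E0'' (NCell ''idx'' (Var ''c''))),
       NAssign ''Ef'' (Var ''c'') (NCell ''F0'' (NCell ''idx'' (Var ''c'')))]))
     (NSet ''nE'' (Var ''n''))"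

definition MainStep :: "nat \<Rightarrow> com" where
  "MainStep l = Block [
     Cond (NLess (Var ''c'') (Var ''nE'')) (Seq (NSet ''Rf'' (NConst 1)) (RSet ''R'' (RCell ''T'' (Var ''c''))))
       (Seq (NSet ''Rf'' (Var ''hi_finite'')) (RSet ''R'' (RVar ''hi''))),
     Cell l,
     Cond (NLess (Var ''c'') (Var ''nE'')) (Seq (NSet ''e'' (NCell ''Ee'' (Var ''c''))) (Seq (NSet ''f'' (NCell ''Ef'' (Var ''c''))) (Event l))) Skip,
     NSet ''Lf'' (NConst 1), RSet ''L'' (RVar ''R'')]"

text \<open>There is one more cell than there are equality points; the last round has no equality
  point to pass.\<close>

definition Main :: "nat \<Rightarrow> com" where
  "Main l = Block [NSet ''Lf'' (Var ''lo_finite''), RSet ''L'' (RVar ''lo''),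
     For ''c'' (NAdd (Var ''nE'') (NConst 1)) (MainStep l)]"

lemma writes_main [simp]:
  "nat_writes GatherPair = {''e'', ''f'', ''E0'', ''F0'', ''n''}" "real_writes GatherPair = {''xx'', ''key''}"
  "nat_writes Gather = {''i'', ''j'', ''e'', ''f'', ''E0'', ''F0'', ''n''}" "real_writes Gather = {''xx'', ''key''}"
  "nat_writes CopyEvents = {''c'', ''Ee'', ''Ef'', ''nE''}" "real_writes CopyEvents = {''T''}"
  "nat_writes (MainStep l) = {''Rf'', ''n'', ''s'', ''g'', ''i'', ''x'', ''j'', ''vs'', ''si'', ''sm'', ''sj'', ''se'', ''so'', ''tmp'',
     ''idx'', ''sw'', ''it'', ''y'', ''hs'', ''h'', ''hp'', ''oi'', ''F'', ''pieces'', ''e'', ''f'', ''p'', ''fr'', ''W'', ''o'', ''B'', ''t'', ''z'', ''Lf''}"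
  "real_writes (MainStep l) = {''R'', ''key'', ''xx'', ''st'', ''bp'', ''icpt'', ''slope'', ''ic'', ''sl'', ''L''}"
  by (auto simp: GatherPair_def Gather_def CopyEvents_def MainStep_def)

section \<open>Equality points in the interior of the interval\<close>

context interdiction_machine
begin

definition interior_point :: "real \<Rightarrow> bool" where
  "interior_point \<theta> \<longleftrightarrow> (bdd_below I \<longrightarrow> Inf I < \<theta>) \<and> (bdd_above I \<longrightarrow> \<theta> < Sup I)"

text \<open>Points of the interval exist on both sides of \<open>\<theta>\<close>, and an interval
  contains everything in between.\<close>

lemma interior_point_in: "interior_point \<theta> \<Longrightarrow> \<theta> \<in> I"
proof -
  assume \<theta>: "interior_point \<theta>"
  obtain x where x: "x \<in> I" "x < \<theta>"
  proof (cases "bdd_below I")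
    case True
    then have "Inf I < \<theta>" using \<theta> unfolding interior_point_def by simp
    then show ?thesis using that cInf_lessD[OF I_ne, of \<theta>] by blast
  next
    case False
    then show ?thesis using that unfolding bdd_below_def by (meson not_le)
  qed
  obtain y where y: "y \<in> I" "\<theta> < y"
  proof (cases "bdd_above I")
    case True
    then have "\<theta> < Sup I" using \<theta> unfolding interior_point_def by simp
    then show ?thesis using that less_cSupD[OF I_ne, of \<theta>] by blast
  next
    case False
    then show ?thesis using that unfolding bdd_above_def by (meson not_le)
  qed
  show "\<theta> \<in> I" using mem_is_interval_1_I[OF I_interval x(1) y(1)] x y by simp
qed

definition event :: "real \<Rightarrow> nat \<Rightarrow> nat \<Rightarrow> bool" where
  "event \<theta> e f \<longleftrightarrow> e < m \<and> f < m \<and> b f < b e \<and> wt e \<theta> = wt f \<theta> \<and> interior_point \<theta>"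

text \<open>\<open>Q\<close> holds the pairs examined so far. Pairwise different unordered pairs are
  recorded because, ties being unique, they have different equality points.\<close>

definition gathered :: "(nat \<times> nat) set \<Rightarrow> nat \<Rightarrow> (nat \<Rightarrow> real) \<Rightarrow> (nat \<Rightarrow> nat) \<Rightarrow> (nat \<Rightarrow> nat) \<Rightarrow> bool" where
  "gathered Q n T Ee Ef \<longleftrightarrow> (\<forall>c<n. event (T c) (Ee c) (Ef c) \<and> (\<exists>(x, y)\<in>Q. {Ee c, Ef c} = {x, y})) \<and>
     inj_on (\<lambda>c. {Ee c, Ef c}) {..<n} \<and>
     (\<forall>(x, y)\<in>Q. \<forall>\<theta>. interior_point \<theta> \<longrightarrow> wt x \<theta> = wt y \<theta> \<longrightarrow> (\<exists>c<n. T c = \<theta>))"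

lemma gathered_skip:
  assumes "gathered Q n T Ee Ef" "\<And>\<theta>. interior_point \<theta> \<Longrightarrow> wt i \<theta> \<noteq> wt j \<theta>"
  shows "gathered (insert (i, j) Q) n T Ee Ef"
proof -
  note g = assms(1)[unfolded gathered_def]
  have "\<forall>c<n. event (T c) (Ee c) (Ef c) \<and> (\<exists>(x, y)\<in>insert (i, j) Q. {Ee c, Ef c} = {x, y})"
    using g by blast
  moreover have "\<forall>(x, y)\<in>insert (i, j) Q. \<forall>\<theta>. interior_point \<theta> \<longrightarrow> wt x \<theta> = wt y \<theta> \<longrightarrow> (\<exists>c<n. T c = \<theta>)"
    using g assms(2) by auto
  ultimately show ?thesis using g unfolding gathered_def by blast
qed

lemma gathered_append:
  assumes g: "gathered Q n T Ee Ef" and ev: "event t e f" "{e, f} = {i, j}"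
    and uniq: "\<And>\<theta>. wt i \<theta> = wt j \<theta> \<Longrightarrow> \<theta> = t" and new: "\<forall>(x, y)\<in>Q. {x, y} \<noteq> {i, j}"
  shows "gathered (insert (i, j) Q) (Suc n) (T(n := t)) (Ee(n := e)) (Ef(n := f))"
  unfolding gathered_def
proof (intro conjI)
  show "\<forall>c<Suc n. event ((T(n := t)) c) ((Ee(n := e)) c) ((Ef(n := f)) c) \<and>
      (\<exists>(x, y)\<in>insert (i, j) Q. {(Ee(n := e)) c, (Ef(n := f)) c} = {x, y})"
    using g ev unfolding gathered_def by (auto simp: less_Suc_eq)
  have "{Ee c, Ef c} \<noteq> {e, f}" if "c < n" for c using g new that ev(2) unfolding gathered_def by fastforce
  then show "inj_on (\<lambda>c. {(Ee(n := e)) c, (Ef(n := f)) c}) {..<Suc n}"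
    using g unfolding gathered_def inj_on_def by (auto simp: less_Suc_eq)
  show "\<forall>(x, y)\<in>insert (i, j) Q. \<forall>\<theta>. interior_point \<theta> \<longrightarrow> wt x \<theta> = wt y \<theta> \<longrightarrow> (\<exists>c<Suc n. (T(n := t)) c = \<theta>)"
  proof (intro ballI, clarify)
    fix x y \<theta> assume xy: "(x, y) \<in> insert (i, j) Q" "interior_point \<theta>" "wt x \<theta> = wt y \<theta>"
    show "\<exists>c<Suc n. (T(n := t)) c = \<theta>"
    proof (cases "(x, y) = (i, j)")
      case True
      then show ?thesis using uniq xy by (intro exI[of _ n]) simp
    next
      case False
      then have "(x, y) \<in> Q" using xy(1) by blast
      then obtain c where "c < n" "T c = \<theta>" using g xy(2,3) unfolding gathered_def by blast
      then show ?thesis by (intro exI[of _ c]) simp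
    qed
  qed
qed

definition pairs_upto :: "nat \<Rightarrow> nat \<Rightarrow> (nat \<times> nat) set" where
  "pairs_upto i j = {(x, y). y < x \<and> (x < i \<or> x = i \<and> y < j)}"

lemma pairs_upto_Suc: "j < i \<Longrightarrow> pairs_upto i (Suc j) = insert (i, j) (pairs_upto i j)"
  unfolding pairs_upto_def by (auto simp: less_Suc_eq)

lemma pairs_upto_row: "pairs_upto i i = pairs_upto (Suc i) 0"
  unfolding pairs_upto_def by auto

lemma pairs_upto_new: "j < i \<Longrightarrow> \<forall>(x, y)\<in>pairs_upto i j. {x, y} \<noteq> {i, j}"
  unfolding pairs_upto_def by (auto simp: doubleton_eq_iff)

definition bounds :: "state \<Rightarrow> bool" where
  "bounds s \<longleftrightarrow> fst s ''lo_finite'' 0 = of_bool (bdd_below I) \<and> (bdd_below I \<longrightarrow> snd s ''lo'' 0 = Inf I) \<and>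
     fst s ''hi_finite'' 0 = of_bool (bdd_above I) \<and> (bdd_above I \<longrightarrow> snd s ''hi'' 0 = Sup I)"

lemma wp_GatherPair:
  fixes s0 :: state
  assumes inp: "inputs s0" and bd: "bounds s0" and ij: "fst s0 ''i'' 0 = i" "fst s0 ''j'' 0 = j" "i < m" "j < i"
    and g: "gathered (pairs_upto i j) (fst s0 ''n'' 0) (snd s0 ''key'') (fst s0 ''E0'') (fst s0 ''F0'')"
  shows "wp GatherPair s0 (\<lambda>t s. t \<le> 150 \<and> fst s ''n'' 0 \<le> Suc (fst s0 ''n'' 0) \<and>
    gathered (pairs_upto i (Suc j)) (fst s ''n'' 0) (snd s ''key'') (fst s ''E0'') (fst s ''F0''))"
proof -
  let ?n = "fst s0 ''n'' 0"
  define e where "e = (if b j < b i then i else j)"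
  define f where "f = (if b j < b i then j else i)"
  let ?s1 = "nstore ''f'' 0 f (nstore ''e'' 0 e s0)"
  have ef: "e < m" "f < m" "{e, f} = {i, j}" "b f \<le> b e" using ij unfolding e_def f_def by (auto simp: insert_commute)
  have ab: "snd s0 ''a'' x = of_rat (a x)" "snd s0 ''b'' x = of_rat (b x)" if "x < m" for x
    using inp that unfolding inputs_def by simp_all
  have jm: "j < m" using ij by simp
  have wij: "wt i \<theta> = wt j \<theta> \<longleftrightarrow> wt e \<theta> = wt f \<theta>" for \<theta> unfolding e_def f_def by auto
  have "wp (Cond (RLess (RCell ''b'' (Var ''j'')) (RCell ''b'' (Var ''i'')))
       (Seq (NSet ''e'' (Var ''i'')) (NSet ''f'' (Var ''j''))) (Seq (NSet ''e'' (Var ''j'')) (NSet ''f'' (Var ''i'')))) s0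
    (\<lambda>t s. t \<le> 30 \<and> s = ?s1)"
    using ij ab jm by (simp add: of_rat_less e_def f_def)
  then show ?thesis unfolding GatherPair_def wp_Seq[of "Cond _ _ _"]
  proof (rule wp_mono)
    fix t1 :: nat and s1 :: state assume "t1 \<le> 30 \<and> s1 = ?s1"
    then have t1: "t1 \<le> 30" and s1: "s1 = ?s1" by simp_all
    show "wp (Cond (RLess (RCell ''b'' (Var ''f'')) (RCell ''b'' (Var ''e'')))
       (Seq (RSet ''xx'' (RDiv (RSub (RCell ''a'' (Var ''f'')) (RCell ''a'' (Var ''e'')))
              (RSub (RCell ''b'' (Var ''e'')) (RCell ''b'' (Var ''f'')))))
         (Cond (BAnd (BNot (BAnd (Positive (Var ''lo_finite'')) (BNot (RLess (RVar ''lo'') (RVar ''xx'')))))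
             (BNot (BAnd (Positive (Var ''hi_finite'')) (BNot (RLess (RVar ''xx'') (RVar ''hi''))))))
           (Block [RAssign ''key'' (Var ''n'') (RVar ''xx''), NAssign ''E0'' (Var ''n'') (Var ''e''),
              NAssign ''F0'' (Var ''n'') (Var ''f''), Increment ''n'']) Skip))
       Skip) s1 (\<lambda>t' s. 1 + t1 + t' \<le> 150 \<and> fst s ''n'' 0 \<le> Suc ?n \<and>
       gathered (pairs_upto i (Suc j)) (fst s ''n'' 0) (snd s ''key'') (fst s ''E0'') (fst s ''F0''))"
    proof (cases "b f < b e")
      case False
      then have beq: "b e = b f" using ef(4) by simp
      have "e \<noteq> f" using ij unfolding e_def f_def by auto
      then have "a e \<noteq> a f" using coeffs_distinct[OF ef(1,2)] beq by auto
      then have "wt i \<theta> \<noteq> wt j \<theta>" for \<theta> unfolding wij using beq by (simp add: elem_weight_def)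
      then have "gathered (pairs_upto i (Suc j)) ?n (snd s0 ''key'') (fst s0 ''E0'') (fst s0 ''F0'')"
        unfolding pairs_upto_Suc[OF ij(4)] using gathered_skip[OF g] by blast
      then show ?thesis unfolding s1 using False t1 ab ef by (simp add: of_rat_less)
    next
      case True
      define x :: real where "x = (of_rat (a f) - of_rat (a e)) / (of_rat (b e) - of_rat (b f))"
      have d: "(of_rat (b e) - of_rat (b f) :: real) > 0" using True by (simp add: of_rat_less)
      then have nz: "of_rat (b e) - of_rat (b f) \<noteq> (0 :: real)" by linarith
      have xe: "x * (of_rat (b e) - of_rat (b f)) = of_rat (a f) - of_rat (a e)"
        unfolding x_def by (rule nonzero_eq_divide_eq[OF nz, THEN iffD1]) (rule refl)
      have wx: "wt e \<theta> = wt f \<theta> \<longleftrightarrow> \<theta> = x" for \<theta>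
      proof -
        have "wt e \<theta> - wt f \<theta> = (\<theta> - x) * (of_rat (b e) - of_rat (b f))"
          using xe unfolding elem_weight_def by (simp add: algebra_simps)
        then show ?thesis using nz by auto
      qed
      let ?s2 = "rstore ''xx'' 0 x s1"
      have test: "bval (BAnd (BNot (BAnd (Positive (Var ''lo_finite'')) (BNot (RLess (RVar ''lo'') (RVar ''xx'')))))
             (BNot (BAnd (Positive (Var ''hi_finite'')) (BNot (RLess (RVar ''xx'') (RVar ''hi'')))))) ?s2 \<longleftrightarrow> interior_point x"
        unfolding s1 using bd unfolding bounds_def interior_point_def by auto
      have b1: "bval (RLess (RCell ''b'' (Var ''f'')) (RCell ''b'' (Var ''e''))) s1"
        unfolding s1 using True ab ef by (simp add: of_rat_less)
      have rv: "rval (RDiv (RSub (RCell ''a'' (Var ''f'')) (RCell ''a'' (Var ''e'')))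
              (RSub (RCell ''b'' (Var ''e'')) (RCell ''b'' (Var ''f'')))) s1 = x"
        unfolding s1 x_def using ab ef by simp
      have "wp (Cond (BAnd (BNot (BAnd (Positive (Var ''lo_finite'')) (BNot (RLess (RVar ''lo'') (RVar ''xx'')))))
             (BNot (BAnd (Positive (Var ''hi_finite'')) (BNot (RLess (RVar ''xx'') (RVar ''hi''))))))
           (Block [RAssign ''key'' (Var ''n'') (RVar ''xx''), NAssign ''E0'' (Var ''n'') (Var ''e''),
              NAssign ''F0'' (Var ''n'') (Var ''f''), Increment ''n'']) Skip) ?s2 (\<lambda>t s. t \<le> 70 \<and> fst s ''n'' 0 \<le> Suc ?n \<and>
       gathered (pairs_upto i (Suc j)) (fst s ''n'' 0) (snd s ''key'') (fst s ''E0'') (fst s ''F0''))"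
      proof (cases "interior_point x")
        case int: True
        have "gathered (insert (i, j) (pairs_upto i j)) (Suc ?n) ((snd s0 ''key'')(?n := x)) ((fst s0 ''E0'')(?n := e)) ((fst s0 ''F0'')(?n := f))"
          by (rule gathered_append[OF g _ ef(3) _ pairs_upto_new[OF ij(4)]]) (use ef True wx wij int in \<open>simp_all add: event_def\<close>)
        then show ?thesis unfolding wp_Cond if_P[OF test[THEN iffD2, OF int]]
          unfolding pairs_upto_Suc[OF ij(4)] s1 by simp
      next
        case int: False
        then have "wt i \<theta> \<noteq> wt j \<theta>" if "interior_point \<theta>" for \<theta> unfolding wij wx using that by blast
        then have "gathered (insert (i, j) (pairs_upto i j)) ?n (snd s0 ''key'') (fst s0 ''E0'') (fst s0 ''F0'')"
          using gathered_skip[OF g] by blast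
        moreover have nb: "\<not> bval (BAnd (BNot (BAnd (Positive (Var ''lo_finite'')) (BNot (RLess (RVar ''lo'') (RVar ''xx'')))))
             (BNot (BAnd (Positive (Var ''hi_finite'')) (BNot (RLess (RVar ''xx'') (RVar ''hi'')))))) ?s2" using test int by blast
        ultimately show ?thesis unfolding wp_Cond if_not_P[OF nb]
          unfolding pairs_upto_Suc[OF ij(4)] s1 by simp
      qed
      note run = this
      show ?thesis unfolding wp_Cond[of "RLess (RCell ''b'' (Var ''f'')) (RCell ''b'' (Var ''e''))"] if_P[OF b1]
        by (rule wp_RSetI[where p = 0 and v = x], simp, rule rv, rule wp_mono[OF run]) (use t1 in simp)
    qed
  qed
qed

lemma wp_Gather:
  fixes s0 :: state
  assumes inp: "inputs s0" and bd: "bounds s0"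
  shows "wp Gather s0 (\<lambda>t s. t \<le> m * (m * 170 + 50) + 40 \<and> fst s ''n'' 0 \<le> m * m \<and>
    gathered (pairs_upto m 0) (fst s ''n'' 0) (snd s ''key'') (fst s ''E0'') (fst s ''F0''))"
  unfolding Gather_def
proof (rule wp_SetI[where p = 0 and v = 0], simp, simp,
    rule wp_For[where n = m and T = "m * 170 + 30" and Inv = "\<lambda>i s. fst s ''n'' 0 \<le> i * m \<and>
    gathered (pairs_upto i 0) (fst s ''n'' 0) (snd s ''key'') (fst s ''E0'') (fst s ''F0'')"], goal_cases)
  case 4
  have "pairs_upto 0 0 = {}" unfolding pairs_upto_def by simp
  then show ?case by (simp add: gathered_def)
next
  case (6 i s)
  have c: "inputs s" "bounds s" using 6(2) inp bd unfolding agree_def inputs_def bounds_def by simp_all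
  show ?case
  proof (rule wp_For[where n = i and T = 150 and Inv = "\<lambda>j s. fst s ''n'' 0 \<le> i * m + j \<and>
    gathered (pairs_upto i j) (fst s ''n'' 0) (snd s ''key'') (fst s ''E0'') (fst s ''F0'')"], goal_cases)
    case (6 j s')
    have d: "inputs s'" "bounds s'" "fst s' ''i'' 0 = i"
      using 6(2) c \<open>fst s ''i'' 0 = i\<close> unfolding agree_def inputs_def bounds_def by simp_all
    show ?case
      by (rule wp_mono[OF wp_GatherPair[OF d(1,2,3) 6(3) \<open>i < m\<close> 6(1)]]) (use 6(4) in auto)
  next
    case (7 t s')
    have "i * 170 \<le> m * 170" using \<open>i < m\<close> by simp
    then show ?case using 7 \<open>i < m\<close> by (auto simp: pairs_upto_row algebra_simps)
  qed (use 6 in auto)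
next
  case (7 t s)
  then show ?case by (simp add: algebra_simps)
qed (use inp in \<open>auto simp: inputs_def\<close>)

definition events_ok :: "nat \<Rightarrow> (nat \<Rightarrow> real) \<Rightarrow> (nat \<Rightarrow> nat) \<Rightarrow> (nat \<Rightarrow> nat) \<Rightarrow> bool" where
  "events_ok n T Ee Ef \<longleftrightarrow> (\<forall>c<n. event (T c) (Ee c) (Ef c)) \<and> (\<forall>c c'. c < c' \<longrightarrow> c' < n \<longrightarrow> T c < T c') \<and>
     (\<forall>x\<in>E. \<forall>y\<in>E. \<forall>\<theta>. x \<noteq> y \<longrightarrow> interior_point \<theta> \<longrightarrow> wt x \<theta> = wt y \<theta> \<longrightarrow> (\<exists>c<n. T c = \<theta>))"

text \<open>Sorting yields only weak monotonicity. Equal neighbours would tie two pairs at the same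
  parameter, so the pairs and then the indices coincide.\<close>

lemma events_ok_sorted:
  assumes g: "gathered (pairs_upto m 0) n T Ee Ef" and p: "p ` {..<n} = {..<n}" "inj_on p {..<n}"
    and srt: "\<And>x y. x < y \<Longrightarrow> y < n \<Longrightarrow> T (p x) \<le> T (p y)"
  shows "events_ok n (\<lambda>c. T (p c)) (\<lambda>c. Ee (p c)) (\<lambda>c. Ef (p c))"
  unfolding events_ok_def
proof (intro conjI allI impI ballI)
  have pn: "p c < n" if "c < n" for c using p(1) that by blast
  show ev: "event (T (p c)) (Ee (p c)) (Ef (p c))" if "c < n" for c
    using g pn[OF that] unfolding gathered_def by blast
  show "T (p c) < T (p c')" if c: "c < c'" "c' < n" for c c'
  proof (rule ccontr)
    assume "\<not> ?thesis"
    then have eq: "T (p c) = T (p c')" using srt[OF c] by simp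
    have cn: "c < n" using c by simp
    note e1 = ev[OF cn, unfolded event_def] and e2 = ev[OF c(2), unfolded event_def]
    have "{Ee (p c), Ef (p c)} = {Ee (p c'), Ef (p c')}"
      by (rule unique_tie[of "T (p c)"]) (use e1 e2 eq interior_point_in in auto)
    then have "p c = p c'" using g pn[OF cn] pn[OF c(2)] unfolding gathered_def by (auto dest: inj_onD)
    then have "c = c'" using inj_onD[OF p(2)] cn c(2) by blast
    then show False using c by simp
  qed
  show "\<exists>c<n. T (p c) = \<theta>" if xy: "x \<in> E" "y \<in> E" "x \<noteq> y" "interior_point \<theta>" "wt x \<theta> = wt y \<theta>" for x y \<theta>
  proof -
    have all: "\<exists>c<n. T c = \<theta>" if "(u, w) \<in> pairs_upto m 0" "wt u \<theta> = wt w \<theta>" for u w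
      using g that xy(4) unfolding gathered_def by blast
    have "(x, y) \<in> pairs_upto m 0 \<or> (y, x) \<in> pairs_upto m 0" using xy unfolding pairs_upto_def by auto
    then obtain d where d: "d < n" "T d = \<theta>" using all[of x y] all[of y x] xy(5) by auto
    then obtain c where "c < n" "d = p c" using p(1) by (metis imageE lessThan_iff)
    then show ?thesis using d by blast
  qed
qed

lemma wp_CopyEvents:
  fixes s0 :: state
  assumes n: "fst s0 ''n'' 0 = n" and ok: "events_ok n (\<lambda>c. snd s0 ''key'' (fst s0 ''idx'' c)) (\<lambda>c. fst s0 ''E0'' (fst s0 ''idx'' c)) (\<lambda>c. fst s0 ''F0'' (fst s0 ''idx'' c))"
  shows "wp CopyEvents s0 (\<lambda>t s. t \<le> n * 60 + 30 \<and> fst s ''nE'' 0 = n \<and> events_ok n (snd s ''T'') (fst s ''Ee'') (fst s ''Ef''))"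
  unfolding CopyEvents_def Block.simps wp_Seq[of "For _ _ _"]
proof (rule wp_For[where n = n and T = 40 and Inv = "\<lambda>j s. \<forall>c<j. snd s ''T'' c = snd s0 ''key'' (fst s0 ''idx'' c) \<and>
    fst s ''Ee'' c = fst s0 ''E0'' (fst s0 ''idx'' c) \<and> fst s ''Ef'' c = fst s0 ''F0'' (fst s0 ''idx'' c)"], goal_cases)
  case (6 j s)
  have "snd s ''key'' = snd s0 ''key''" "fst s ''idx'' = fst s0 ''idx''" "fst s ''E0'' = fst s0 ''E0''" "fst s ''F0'' = fst s0 ''F0''"
    using 6(2) unfolding agree_def by simp_all
  then show ?case using 6(3,4) by (auto simp: less_Suc_eq)
next
  case (7 t s)
  have "events_ok n (snd s ''T'') (fst s ''Ee'') (fst s ''Ef'')"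
    unfolding events_ok_def
  proof (intro conjI allI impI ballI)
    show "event (snd s ''T'' c) (fst s ''Ee'' c) (fst s ''Ef'' c)" if "c < n" for c
      using ok 7(3) that unfolding events_ok_def by simp
    show "snd s ''T'' c < snd s ''T'' c'" if "c < c'" "c' < n" for c c'
    proof -
      have "c < n" using that by simp
      then show ?thesis using ok 7(3) that unfolding events_ok_def by simp
    qed
    show "\<exists>c<n. snd s ''T'' c = \<theta>" if xy: "x \<in> E" "y \<in> E" "x \<noteq> y" "interior_point \<theta>" "wt x \<theta> = wt y \<theta>" for x y \<theta>
    proof -
      obtain c where "c < n" "snd s0 ''key'' (fst s0 ''idx'' c) = \<theta>" using ok xy unfolding events_ok_def by blast
      then show ?thesis using 7(3) by (intro exI[of _ c]) simp
    qed
  qed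
  moreover have "fst s ''n'' 0 = n" using 7(2) n unfolding agree_def by simp
  ultimately show ?case using 7(1) by simp
qed (use n in auto)

definition cell_less :: "(nat \<Rightarrow> real) \<Rightarrow> nat \<Rightarrow> nat \<Rightarrow> nat \<Rightarrow> bool" where
  "cell_less T c = (if c = 0 then start_less else right_less (T (c - 1)))"

lemma cell_less_order: "strict_order_on E (cell_less T c)"
  unfolding cell_less_def using start_less_order right_less_order by simp

text \<open>The order taken immediately after the start of the cell can only be violated behind a
  crossing, and the open cell contains none.\<close>

lemma cell_compatible:
  assumes ev: "events_ok n T Ee Ef" and c: "c \<le> n" and \<theta>: "\<theta> \<in> I" "0 < c \<Longrightarrow> T (c - 1) \<le> \<theta>" "c < n \<Longrightarrow> \<theta> \<le> T c"
  shows "compatible (cell_less T c) \<theta>"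
proof -
  have up: "bdd_above I \<Longrightarrow> \<theta> \<le> Sup I" and low: "bdd_below I \<Longrightarrow> Inf I \<le> \<theta>"
    using \<theta>(1) by (auto intro: cSup_upper cInf_lower)
  \<comment> \<open>A tie here would be an interior equality point, hence listed; but the list is
    strictly increasing and has no entry strictly between the start of the cell and
    \<open>\<theta>\<close>.\<close>
  have nc: "wt x t \<noteq> wt y t" if t: "t < \<theta>" "0 < c \<Longrightarrow> T (c - 1) < t" "bdd_below I \<Longrightarrow> Inf I < t" and xy: "x \<in> E" "y \<in> E" "x \<noteq> y" for t x y
  proof
    assume "wt x t = wt y t"
    moreover have "interior_point t" unfolding interior_point_def using t up by force
    ultimately obtain d where d: "d < n" "T d = t" using ev xy unfolding events_ok_def by blast
    show False
    proof (cases "d < c")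
      case True
      then have "d = c - 1 \<or> d < c - 1" by linarith
      then have "T d \<le> T (c - 1)" using ev c True unfolding events_ok_def by (metis diff_less less_imp_le less_le_trans less_one order_refl zero_less_one not_gr_zero not_less_zero)
      then show False using t(2) d True by simp
    next
      case False
      then have "c = d \<or> c < d" by linarith
      then have "T c \<le> T d" using ev d unfolding events_ok_def by (auto intro: less_imp_le)
      then show False using \<theta>(3) t(1) d False by simp
    qed
  qed
  show ?thesis
  proof (cases "c = 0")
    case True
    show ?thesis
    proof (cases "bdd_below I")
      case b: True
      have "compatible (right_less (Inf I)) \<theta>"
        by (rule right_less_compatible[of "Inf I" \<theta>]) (use nc True low b in auto)
      then show ?thesis unfolding cell_less_def start_less_def using True b by simp
    next
      case b: False
      have "compatible left_less \<theta>" by (rule left_less_compatible) (use nc True b in auto)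
      then show ?thesis unfolding cell_less_def start_less_def using True b by simp
    qed
  next
    case False
    have "interior_point (T (c - 1))" using ev c False unfolding events_ok_def event_def by simp
    then have *: "bdd_below I \<Longrightarrow> Inf I < T (c - 1)" unfolding interior_point_def by simp
    have "compatible (right_less (T (c - 1))) \<theta>"
    proof (rule right_less_compatible[of "T (c - 1)" \<theta>])
      show "T (c - 1) \<le> \<theta>" using \<theta>(2) False by simp
      show "wt x t \<noteq> wt y t" if "T (c - 1) < t" "t < \<theta>" "x \<in> E" "y \<in> E" "x \<noteq> y" for t x y
      proof (rule nc)
        show "Inf I < t" if "bdd_below I" using *[OF that] \<open>T (c - 1) < t\<close> by (rule less_trans)
      qed (use that in simp_all)
    qed simp
    then show ?thesis unfolding cell_less_def using False by simp
  qed
qed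

lemma cell_swap:
  assumes ev: "events_ok n T Ee Ef" and c: "c < n"
  shows "order_swap E (Ee c) (Ef c) (cell_less T c) (cell_less T (Suc c))"
proof -
  have e: "event (T c) (Ee c) (Ef c)" using ev c unfolding events_ok_def by blast
  have I: "T c \<in> I" using e interior_point_in unfolding event_def by blast
  have inc: "0 < c \<Longrightarrow> T (c - 1) < T c" using ev c unfolding events_ok_def by simp
  have comp: "compatible (cell_less T c) (T c)" using cell_compatible[OF ev _ I, of c] c less_imp_le[OF inc] by simp
  \<comment> \<open>A parameter of the same cell strictly before the equality point, as required by
    \<open>order_change\<close> to see that \<open>e\<close> precedes \<open>f\<close> in the old
    order.\<close>
  obtain t where t: "t \<in> I" "t < T c" "0 < c \<Longrightarrow> T (c - 1) \<le> t"
  proof (cases "c = 0")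
    case True
    show ?thesis
    proof (cases "bdd_below I")
      case b: True
      then have "Inf I < T c" using e unfolding event_def interior_point_def by simp
      then show ?thesis using that cInf_lessD[OF I_ne] True by blast
    next
      case False
      then obtain t where "t \<in> I" "t < T c" unfolding bdd_below_def by (meson not_le)
      then show ?thesis using that True by blast
    qed
  next
    case False
    have "event (T (c - 1)) (Ee (c - 1)) (Ef (c - 1))" using ev c unfolding events_ok_def by simp
    then have "T (c - 1) \<in> I" using interior_point_in unfolding event_def by blast
    then show ?thesis using that inc False by blast
  qed
  have compt: "compatible (cell_less T c) t" using cell_compatible[OF ev _ t(1), of c] c t by simp
  have ef: "Ee c \<in> E" "Ef c \<in> E" "wt (Ee c) (T c) = wt (Ef c) (T c)" "b (Ef c) < b (Ee c)" using e unfolding event_def by simp_all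
  have S: "cell_less T (Suc c) = right_less (T c)" unfolding cell_less_def by simp
  note oc = order_change[OF cell_less_order comp I ef t(2) compt]
  show ?thesis unfolding order_swap_def S
    using cell_less_order right_less_order ef oc by blast
qed

end

text \<open>The first summand is the envelope, which uses no independence test; the terms after it
  pay for passing an equality point.\<close>

definition cell_time :: "nat \<Rightarrow> nat \<Rightarrow> nat \<Rightarrow> nat \<Rightarrow> nat" where
  "cell_time l N P \<tau> = (lg N + 1) * ((N + 1) * (100 * l * l + 300 * l + 1500)) + N * (\<tau> + 50 * l + 350) + 200 * P + 400"

context interdiction_machine
begin

definition start_ok :: "nat \<Rightarrow> (nat \<Rightarrow> real) \<Rightarrow> nat \<Rightarrow> real \<Rightarrow> bool" where
  "start_ok c T Lf L \<longleftrightarrow> (if c = 0 then Lf = of_bool (bdd_below I) \<and> (bdd_below I \<longrightarrow> L = Inf I) else 0 < Lf \<and> L = T (c - 1))"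

definition main_inv :: "nat \<Rightarrow> (nat \<Rightarrow> real) \<Rightarrow> nat \<Rightarrow> nat \<Rightarrow> (nat \<Rightarrow> nat) \<Rightarrow> nat \<Rightarrow> state \<Rightarrow> bool" where
  "main_inv n T N P D c s \<longleftrightarrow>
     table m (fst s ''W'') P (ordered_matroid.relevant {..<m} \<F> (cell_less T c) l) \<and>
     ordered_interdiction.slots_ok l m \<F> a b (cell_less T c) N (fst s ''W'') D (fst s ''B'') (snd s ''ic'') (snd s ''sl'') \<and>
     start_ok c T (fst s ''Lf'' 0) (snd s ''L'' 0) \<and> (0 < fst s ''pieces'' 0 \<longleftrightarrow> 0 < c) \<and>
     out_ok (fst s ''pieces'' 0) (fst s ''F'') (snd s ''bp'') (snd s ''icpt'') (snd s ''slope'') (0 < fst s ''Lf'' 0) (snd s ''L'' 0)"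

lemma wp_MainStep:
  fixes s0 :: state
  assumes i: "inputs s0" and bd: "bounds s0" and N: "fst s0 ''N'' 0 = N" and P: "fst s0 ''P'' 0 = P" "P = Suc l * k + 2"
    and D: "digit_table l N P (fst s0 ''D'')" and nE: "fst s0 ''nE'' 0 = n"
    and ev: "events_ok n (snd s0 ''T'') (fst s0 ''Ee'') (fst s0 ''Ef'')"
    and c: "fst s0 ''c'' 0 = c" "c \<le> n" and inv: "main_inv n (snd s0 ''T'') N P (fst s0 ''D'') c s0"
  shows "wp (MainStep l) s0 (\<lambda>t s. t \<le> cell_time l N P \<tau> \<and>
    (if c < n then main_inv n (snd s0 ''T'') N P (fst s0 ''D'') (Suc c) s
     else 0 < fst s ''pieces'' 0 \<and>
       out_ok (fst s ''pieces'' 0) (fst s ''F'') (snd s ''bp'') (snd s ''icpt'') (snd s ''slope'') (bdd_above I) (Sup I)))"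
proof -
  let ?T = "snd s0 ''T''" and ?D = "fst s0 ''D''"
  let ?lt = "cell_less ?T c"
  interpret A: ordered_machine l m \<F> a b I ?lt \<tau> by unfold_locales (rule cell_less_order)
  have evc: "event (?T c') (fst s0 ''Ee'' c') (fst s0 ''Ef'' c')" if "c' < n" for c' using ev that unfolding events_ok_def by blast
  have intT: "interior_point (?T c')" if "c' < n" for c' using evc[OF that] unfolding event_def by blast
  define L where "L = snd s0 ''L'' 0"
  define Lf where "Lf = (0 < fst s0 ''Lf'' 0)"
  define Rn :: nat where "Rn = (if c < n then 1 else of_bool (bdd_above I))"
  define R where "R = (if c < n then ?T c else snd s0 ''hi'' 0)"
  define Rf where "Rf = (0 < Rn)"
  have t: "table m (fst s0 ''W'') P (A.relevant l)"
    and ok: "A.slots_ok N (fst s0 ''W'') ?D (fst s0 ''B'') (snd s0 ''ic'') (snd s0 ''sl'')"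
    and st: "start_ok c ?T (fst s0 ''Lf'' 0) L" and pc: "0 < fst s0 ''pieces'' 0 \<longleftrightarrow> 0 < c"
    and out: "out_ok (fst s0 ''pieces'' 0) (fst s0 ''F'') (snd s0 ''bp'') (snd s0 ''icpt'') (snd s0 ''slope'') Lf L"
    using inv unfolding main_inv_def L_def Lf_def by blast+
  have cr: "card (A.relevant l) < P" using A.card_relevant[of l] A.card_gb_E unfolding P(2) by simp
  have L0: "Lf \<longleftrightarrow> bdd_below I" "bdd_below I \<Longrightarrow> L = Inf I" if "c = 0" using st that unfolding start_ok_def Lf_def by simp_all
  have L1: Lf "L = ?T (c - 1)" if "0 < c" using st that unfolding start_ok_def Lf_def by simp_all
  have hi: "fst s0 ''hi_finite'' 0 = of_bool (bdd_above I)" "bdd_above I \<Longrightarrow> snd s0 ''hi'' 0 = Sup I"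
    using bd unfolding bounds_def by simp_all
  have Rinf: "Rf \<longleftrightarrow> bdd_above I" "bdd_above I \<Longrightarrow> R = Sup I" if "\<not> c < n" using that hi unfolding Rf_def Rn_def R_def by simp_all
  have comp: "compatible ?lt \<theta>" if "\<theta> \<in> I" "Lf \<Longrightarrow> L \<le> \<theta>" "Rf \<Longrightarrow> \<theta> \<le> R" for \<theta>
    by (rule cell_compatible[OF ev c(2) that(1)]) (use that L1 in \<open>simp_all add: Rf_def Rn_def R_def\<close>)
  have inner: "\<theta> \<in> I" if l: "Lf \<Longrightarrow> L < \<theta>" and r: "Rf \<Longrightarrow> \<theta> < R" for \<theta>
  proof -
    have "Inf I < \<theta>" if b: "bdd_below I"
    proof (cases "c = 0")
      case True
      then show ?thesis using L0 l b by simp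
    next
      case False
      have "Inf I < ?T (c - 1)" using intT[of "c - 1"] c False b unfolding interior_point_def by simp
      then show ?thesis using L1 l False by simp
    qed
    moreover have "\<theta> < Sup I" if b: "bdd_above I"
    proof (cases "c < n")
      case True
      have "?T c < Sup I" using intT[of c] True b unfolding interior_point_def by simp
      moreover have "\<theta> < ?T c" using r True unfolding Rf_def Rn_def R_def by simp
      ultimately show ?thesis by simp
    next
      case False
      then show ?thesis using Rinf r b by simp
    qed
    ultimately have "interior_point \<theta>" unfolding interior_point_def by simp
    then show ?thesis by (rule interior_point_in)
  qed
  have LR0: "\<forall>\<theta>\<in>I. L \<le> \<theta>" if "fst s0 ''pieces'' 0 = 0" Lf
    using that pc L0 by (auto intro: cInf_lower)
  have LR1: "Lf \<and> L \<in> I \<and> (Rf \<longrightarrow> L < R)" if "0 < fst s0 ''pieces'' 0"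
  proof -
    have c0: "0 < c" using that pc by simp
    have int: "interior_point L" using intT[of "c - 1"] c c0 L1[OF c0] by simp
    have "L < R" if Rf
    proof (cases "c < n")
      case True
      then show ?thesis using ev c0 L1[OF c0] unfolding R_def events_ok_def by simp
    next
      case False
      then show ?thesis using Rinf that int unfolding interior_point_def by simp
    qed
    then show ?thesis using L1[OF c0] interior_point_in[OF int] by blast
  qed
  let ?s1 = "rstore ''R'' 0 R (nstore ''Rf'' 0 Rn s0)"
  have first: "wp (Cond (NLess (Var ''c'') (Var ''nE'')) (Seq (NSet ''Rf'' (NConst 1)) (RSet ''R'' (RCell ''T'' (Var ''c''))))
       (Seq (NSet ''Rf'' (Var ''hi_finite'')) (RSet ''R'' (RVar ''hi'')))) s0 (\<lambda>t s. t \<le> 30 \<and> s = ?s1)"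
    using c nE hi unfolding Rn_def R_def by simp
  have cell: "wp (Cell l) ?s1 (\<lambda>t s. t \<le> (lg N + 1) * ((N + 1) * (100 * l * l + 300 * l + 1500)) \<and> 0 < fst s ''pieces'' 0 \<and>
    out_ok (fst s ''pieces'' 0) (fst s ''F'') (snd s ''bp'') (snd s ''icpt'') (snd s ''slope'') Rf R)"
    by (rule A.wp_Cell[where L = L and Lf = Lf and N = N and P = P])
      (use i N D t cr ok comp out LR0 LR1 inner in \<open>simp_all add: inputs_def L_def Lf_def Rf_def\<close>)
  define ta where "ta = (lg N + 1) * ((N + 1) * (100 * l * l + 300 * l + 1500))"
  define tb where "tb = N * (\<tau> + 50 * l + 350) + 200 * P + 300"
  have ct: "cell_time l N P \<tau> = ta + tb + 100" unfolding cell_time_def ta_def tb_def by simp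
  show ?thesis unfolding MainStep_def Block.simps wp_Seq[of "Cond _ _ _" "Seq (Cell l) _"]
  proof (rule wp_mono[OF first], goal_cases)
    case (1 t1 s1)
    then have s1: "s1 = ?s1" and t1: "t1 \<le> 30" by simp_all
    show ?case unfolding s1 wp_Seq[of "Cell l"]
    proof (rule wp_use[OF cell], goal_cases)
      case (1 t2 s2)
      have t2: "t2 \<le> ta" using 1(1) unfolding ta_def by blast
      have s2: "inputs s2" "fst s2 ''N'' 0 = N" "fst s2 ''P'' 0 = P" "fst s2 ''D'' = ?D" "fst s2 ''W'' = fst s0 ''W''" "fst s2 ''B'' = fst s0 ''B''"
        "snd s2 ''ic'' = snd s0 ''ic''" "snd s2 ''sl'' = snd s0 ''sl''" "fst s2 ''c'' 0 = c" "fst s2 ''nE'' 0 = n" "fst s2 ''Ee'' = fst s0 ''Ee''" "fst s2 ''Ef'' = fst s0 ''Ef''"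
        "snd s2 ''R'' 0 = R"
        using 1(2) i N P c nE unfolding agree_def inputs_def by simp_all
      show ?case
      proof (cases "c < n")
        case False
        then have "out_ok (fst s2 ''pieces'' 0) (fst s2 ''F'') (snd s2 ''bp'') (snd s2 ''icpt'') (snd s2 ''slope'') (bdd_above I) (Sup I)"
          using 1(1) Rinf unfolding out_ok_def by auto
        then show ?thesis unfolding ct using False 1(1) t1 t2 s2 by simp
      next
        case True
        let ?e = "fst s0 ''Ee'' c" and ?f = "fst s0 ''Ef'' c"
        let ?s3 = "nstore ''f'' 0 ?f (nstore ''e'' 0 ?e s2)"
        have sw: "order_swap E ?e ?f ?lt (cell_less ?T (Suc c))" by (rule cell_swap[OF ev True])
        have ef: "?e < m" "?f < m" using evc[OF True] unfolding event_def by simp_all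
        have event: "wp (Event l) ?s3 (\<lambda>t s. t \<le> N * (\<tau> + 50 * l + 350) + 200 * P + 300 \<and>
          table m (fst s ''W'') P (ordered_matroid.relevant {..<m} \<F> (cell_less ?T (Suc c)) l) \<and>
          ordered_interdiction.slots_ok l m \<F> a b (cell_less ?T (Suc c)) N (fst s ''W'') (fst s ''D'') (fst s ''B'') (snd s ''ic'') (snd s ''sl''))"
          by (rule wp_Event[OF sw]) (use s2 P(2) D t ok ef in \<open>simp_all add: inputs_def\<close>)
        have b: "bval (NLess (Var ''c'') (Var ''nE'')) s2" using s2 True by simp
        have run: "wp (Seq (NSet ''e'' (NCell ''Ee'' (Var ''c''))) (Seq (NSet ''f'' (NCell ''Ef'' (Var ''c''))) (Event l))) s2
          (\<lambda>t s. t \<le> tb + 20 \<and> (\<forall>Lv Lw. start_ok (Suc c) ?T Lv Lw \<longrightarrow>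
             main_inv n ?T N P ?D (Suc c) (rstore ''L'' 0 Lw (nstore ''Lf'' 0 Lv s))) \<and> snd s ''R'' 0 = R)"
        proof (rule wp_SetI[where p = 0 and v = ?e], simp, simp add: s2, rule wp_SetI[where p = 0 and v = ?f], simp, simp add: s2,
            rule wp_use[OF event], goal_cases)
          case (1 t4 s4)
          have s4: "fst s4 ''D'' = ?D" "fst s4 ''pieces'' = fst s2 ''pieces''" "fst s4 ''F'' = fst s2 ''F''" "snd s4 ''bp'' = snd s2 ''bp''"
            "snd s4 ''icpt'' = snd s2 ''icpt''" "snd s4 ''slope'' = snd s2 ''slope''" "snd s4 ''R'' 0 = R"
            using 1(2) s2 unfolding agree_def by simp_all
          have RT: "Rf" "R = ?T c" using True unfolding Rf_def Rn_def R_def by simp_all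
          have "main_inv n ?T N P ?D (Suc c) (rstore ''L'' 0 Lw (nstore ''Lf'' 0 Lv s4))" if "start_ok (Suc c) ?T Lv Lw" for Lv Lw
            using that 1(1) s4 RT \<open>t2 \<le> _ \<and> _ \<and> _\<close> unfolding main_inv_def start_ok_def by simp
          then show ?case using 1(1) s4 unfolding tb_def by simp
        qed
        show ?thesis unfolding wp_Seq[of "Cond _ _ _"] wp_Cond if_P[OF b]
        proof (rule wp_mono[OF run], goal_cases)
          case (1 t5 s5)
          have "start_ok (Suc c) ?T 1 R" using True unfolding start_ok_def R_def by simp
          then have "main_inv n ?T N P ?D (Suc c) (rstore ''L'' 0 R (nstore ''Lf'' 0 1 s5))" using 1 by blast
          then show ?case unfolding ct using True 1 t1 t2 by simp
        qed
      qed
    qed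
  qed
qed

lemma wp_Main:
  fixes s0 :: state
  assumes i: "inputs s0" and bd: "bounds s0" and N: "fst s0 ''N'' 0 = N" and P: "fst s0 ''P'' 0 = P" "P = Suc l * k + 2"
    and D: "digit_table l N P (fst s0 ''D'')" and nE: "fst s0 ''nE'' 0 = n"
    and ev: "events_ok n (snd s0 ''T'') (fst s0 ''Ee'') (fst s0 ''Ef'')" and pc: "fst s0 ''pieces'' 0 = 0"
    and t: "table m (fst s0 ''W'') P (ordered_matroid.relevant {..<m} \<F> start_less l)"
    and ok: "ordered_interdiction.slots_ok l m \<F> a b start_less N (fst s0 ''W'') (fst s0 ''D'') (fst s0 ''B'') (snd s0 ''ic'') (snd s0 ''sl'')"
  shows "wp (Main l) s0 (\<lambda>t s. t \<le> (n + 1) * (cell_time l N P \<tau> + 20) + 40 \<and> solves_interdiction l m \<F> a b I s)"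
proof -
  let ?T = "snd s0 ''T''" and ?D = "fst s0 ''D''"
  define s1 where "s1 = rstore ''L'' 0 (snd s0 ''lo'' 0) (nstore ''Lf'' 0 (fst s0 ''lo_finite'' 0) s0)"
  have "wp (For ''c'' (NAdd (Var ''nE'') (NConst 1)) (MainStep l)) s1
    (\<lambda>t s. t \<le> (n + 1) * (cell_time l N P \<tau> + 20) + 20 \<and> solves_interdiction l m \<F> a b I s)"
  \<comment> \<open>After the last round there is no further cell whose table and bases could be
    described, so only the output remains in the invariant.\<close>
  proof (rule wp_For[where n = "n + 1" and T = "cell_time l N P \<tau>" and Inv = "\<lambda>c s. if c \<le> n then main_inv n ?T N P ?D c s
     else 0 < fst s ''pieces'' 0 \<and>
       out_ok (fst s ''pieces'' 0) (fst s ''F'') (snd s ''bp'') (snd s ''icpt'') (snd s ''slope'') (bdd_above I) (Sup I)"], goal_cases)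
    case (3 c v s)
    then show ?case by (auto simp: main_inv_def split: if_splits)
  next
    case 4
    have "start_ok 0 ?T (fst s0 ''lo_finite'' 0) (snd s0 ''lo'' 0)" using bd unfolding start_ok_def bounds_def by simp
    moreover have "cell_less ?T 0 = start_less" unfolding cell_less_def by simp
    moreover have "out_ok 0 Fa bp ip sp fin r" for Fa bp ip sp fin r unfolding out_ok_def by simp
    ultimately show ?case using t ok pc unfolding main_inv_def s1_def by simp
  next
    case (6 c s)
    have s: "inputs s" "bounds s" "fst s ''N'' 0 = N" "fst s ''P'' 0 = P" "fst s ''D'' = ?D" "fst s ''nE'' 0 = n" "snd s ''T'' = ?T"
      "fst s ''Ee'' = fst s0 ''Ee''" "fst s ''Ef'' = fst s0 ''Ef''"
      using 6(2) i bd N P nE unfolding agree_def inputs_def bounds_def s1_def by simp_all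
    have "c \<le> n" using 6(1) by simp
    then have "wp (MainStep l) s (\<lambda>t s'. t \<le> cell_time l N P \<tau> \<and>
    (if c < n then main_inv n (snd s ''T'') N P (fst s ''D'') (Suc c) s'
     else 0 < fst s' ''pieces'' 0 \<and>
       out_ok (fst s' ''pieces'' 0) (fst s' ''F'') (snd s' ''bp'') (snd s' ''icpt'') (snd s' ''slope'') (bdd_above I) (Sup I)))"
      using s P D ev 6(3,4) by (intro wp_MainStep) simp_all
    then show ?case by (rule wp_mono) (use s \<open>c \<le> n\<close> in \<open>auto split: if_splits\<close>)
  next
    case (7 t s)
    have p: "0 < fst s ''pieces'' 0"
      and out: "out_ok (fst s ''pieces'' 0) (fst s ''F'') (snd s ''bp'') (snd s ''icpt'') (snd s ''slope'') (bdd_above I) (Sup I)"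
      using 7(3) by simp_all
    have "\<theta> \<le> Sup I" if "\<theta> \<in> I" "bdd_above I" for \<theta> using that by (intro cSup_upper)
    then have "solves_interdiction l m \<F> a b I s"
      using p out unfolding solves_interdiction_def out_ok_def out_piece_def out_set_def Let_def by simp
    then show ?case using 7(1) by (simp add: algebra_simps)
  qed (use nE in \<open>auto simp: s1_def\<close>)
  note run = this
  show ?thesis unfolding Main_def Block.simps
    by (rule wp_SetI[where p = 0 and v = "fst s0 ''lo_finite'' 0"], simp, simp, rule wp_RSetI[where p = 0 and v = "snd s0 ''lo'' 0"], simp, simp,
        fold s1_def, rule wp_mono[OF run]) simp
qed

end

section \<open>The complete program\<close>

definition Program :: "nat \<Rightarrow> com" where
  "Program l = Block [OrderKeys, OrderRanks, Layers l, SetupTable l, CountSlots l, Digits l, InitSlots l, CleanAll,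
     Gather, MergeSort, CopyEvents, Main l]"

text \<open>One summand for each phase of \<open>Program\<close>, with \<open>n\<close> the number
  of equality points; the final 20 covers the sequencing.\<close>

definition total_time :: "nat \<Rightarrow> nat \<Rightarrow> nat \<Rightarrow> nat \<Rightarrow> nat \<Rightarrow> nat \<Rightarrow> nat" where
  "total_time l m P N \<tau> n = (60 * m + 20) + (m * (60 * m + 60) + 20) + (Suc l * (m * (\<tau> + 120) + 120) + 20) +
     (50 * m + 50 * P + 80) + (40 * l + 40) + (N * (50 * l + 120) + 40) + (N * (m * (\<tau> + 80) + 80 * l + 150) + 20) +
     (m * (40 * N + 50 * P + 80) + 20) + (m * (m * 170 + 50) + 40) + (lg n + 1) * (300 * n + 300) + (n * 60 + 30) +
     ((n + 1) * (cell_time l N P \<tau> + 20) + 40) + 20"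

context interdiction_machine
begin

lemma wp_Program:
  "wp (Program l) (input_state m a b I) (\<lambda>t s. (\<exists>n\<le>m * m. t \<le> total_time l m (Suc l * k + 2) ((Suc l * k + 2) ^ l) \<tau> n) \<and>
     solves_interdiction l m \<F> a b I s)"
proof -
  interpret ordered_machine l m \<F> a b I start_less \<tau> by unfold_locales (rule start_less_order)
  let ?s0 = "input_state m a b I"
  let ?P = "Suc l * k + 2"
  let ?N = "?P ^ l"
  have z: "inputs ?s0" "bounds ?s0" "fst ?s0 ''X'' = (\<lambda>_. 0)" "fst ?s0 ''V'' = (\<lambda>_. 0)" "fst ?s0 ''B'' = (\<lambda>_. 0)" "fst ?s0 ''pieces'' 0 = 0"
    unfolding inputs_def bounds_def input_state_def input_nat_def input_real_def by (auto simp: fun_eq_iff)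
  have P2: "1 < ?P" by simp
  have "wp OrderKeys ?s0 (\<lambda>t s. t \<le> 60 * m + 20 \<and> 
     (\<forall>x<m. \<forall>y<m. start_less x y \<longleftrightarrow> snd s ''u'' x < snd s ''u'' y \<or> snd s ''u'' x = snd s ''u'' y \<and> snd s ''v'' x < snd s ''v'' y))"
    using z unfolding bounds_def by (intro wp_OrderKeys) simp_all
  then show ?thesis unfolding Program_def Block.simps wp_Seq[of OrderKeys]
  proof (rule wp_use, goal_cases)
    case (1 t1 s1)
    note r1 = 1(1)
    have a1: "agree {''i''} {''u'', ''v''} ?s0 s1" using 1(2) by simp
    have i1: "inputs s1" using inputs_agree[OF a1 z(1)] by simp
    have "inj_on (\<lambda>x. card {y. y < m \<and> start_less y x}) {..<m}" using rnk_inj unfolding rnk_alt .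
    then have "wp OrderRanks s1 (\<lambda>t s. t \<le> m * (60 * m + 60) + 20 \<and> (\<forall>x<m. fst s ''ord'' (card {y. y < m \<and> start_less y x}) = x))"
      using r1 by (intro wp_OrderRanks[OF i1]) blast+
    then show ?case unfolding wp_Seq[of OrderRanks]
    proof (rule wp_use, goal_cases)
      case (1 t2 s2)
      note r2 = 1(1)
      have a2: "agree {''i'', ''j'', ''r'', ''ord''} {''u'', ''v''} ?s0 s2" using 1(2) a1 unfolding agree_def by simp
      have i2: "inputs s2" using inputs_agree[OF a2 z(1)] by simp
      have o2: "ordered (fst s2 ''ord'')" using r2 unfolding ordered_def rnk_alt by blast
      have "fst s2 ''X'' = (\<lambda>_. 0)" "fst s2 ''V'' = (\<lambda>_. 0)" using a2 z unfolding agree_def by simp_all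
      then have "wp (Layers l) s2 (\<lambda>t s. t \<le> Suc l * (m * (\<tau> + 120) + 120) + 20 \<and> fst s ''k'' 0 = k \<and>
        {x. x < m \<and> fst s ''X'' x \<noteq> 0} = (\<Union>j<Suc l. gb (layer j)))"
        by (intro wp_Layers[OF i2 o2]) simp_all
      then show ?case unfolding wp_Seq[of "Layers l"]
      proof (rule wp_use, goal_cases)
        case (1 t3 s3)
        note r3 = 1(1)
        let ?w3 = "{''i'', ''j'', ''r'', ''ord'', ''o'', ''cnt'', ''x'', ''V'', ''t'', ''k'', ''y'', ''X''}"
        have a3: "agree ?w3 {''u'', ''v'', ''ri'', ''rs''} ?s0 s3" using 1(2) a2 unfolding agree_def by simp
        have i3: "inputs s3" using inputs_agree[OF a3 z(1)] by simp
        have o3: "fst s3 ''ord'' = fst s2 ''ord''" using 1(2) unfolding agree_def by simp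
        define S where "S = (\<Union>j<Suc l. gb (layer j))"
        have k3: "fst s3 ''k'' 0 = k" using r3 by blast
        have S: "S = {x. x < m \<and> fst s3 ''X'' x \<noteq> 0}" using r3 unfolding S_def by blast
        have cS: "card S \<le> Suc l * k" using card_layers[of l] card_gb_E unfolding S_def by simp
        have "wp (SetupTable l) s3 (\<lambda>t s. t \<le> 50 * m + 50 * (Suc l * fst s3 ''k'' 0 + 2) + 80 \<and>
          (\<forall>x<m. fst s ''X'' x = 0) \<and> fst s ''P'' 0 = Suc l * fst s3 ''k'' 0 + 2 \<and> 
          table m (fst s ''W'') (Suc l * fst s3 ''k'' 0 + 2) S)"
          by (rule wp_SetupTable[OF i3 S]) (simp only: k3 cS)
        then show ?case unfolding k3 wp_Seq[of "SetupTable l"]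
        proof (rule wp_use, goal_cases)
          case (1 t4 s4)
          note r4 = 1(1)
          let ?w4 = "?w3 \<union> {''P'', ''W'', ''q''}"
          have a4: "agree ?w4 {''u'', ''v'', ''ri'', ''rs''} ?s0 s4" using 1(2) a3 unfolding agree_def by simp
          have o4: "fst s4 ''ord'' = fst s2 ''ord''" using 1(2) o3 unfolding agree_def by simp
          have P4: "fst s4 ''P'' 0 = ?P" using r4 by blast
          show ?case unfolding wp_Seq[of "CountSlots l"]
          proof (rule wp_use[OF wp_CountSlots[OF P4]], goal_cases)
            case (1 t5 s5)
            note r5 = 1(1)
            let ?w5 = "?w4 \<union> {''N''}"
            have a5: "agree ?w5 {''u'', ''v'', ''ri'', ''rs''} ?s0 s5" using 1(2) a4 unfolding agree_def by simp
            have c5: "fst s5 ''ord'' = fst s2 ''ord''" "fst s5 ''W'' = fst s4 ''W''" "fst s5 ''X'' = fst s4 ''X''" "fst s5 ''P'' 0 = ?P"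
              using 1(2) o4 P4 unfolding agree_def by simp_all
            have N5: "fst s5 ''N'' 0 = ?N" using r5 by blast
            show ?case unfolding wp_Seq[of "Digits l"]
            proof (rule wp_use[OF wp_Digits[OF N5 c5(4) P2]], goal_cases)
              case (1 t6 s6)
              note r6 = 1(1)
              let ?w6 = "?w5 \<union> {''D'', ''s''}"
              have a6: "agree ?w6 {''u'', ''v'', ''ri'', ''rs''} ?s0 s6" using 1(2) a5 unfolding agree_def by simp
              have c6: "fst s6 ''ord'' = fst s2 ''ord''" "fst s6 ''W'' = fst s4 ''W''" "fst s6 ''X'' = fst s4 ''X''" "fst s6 ''P'' 0 = ?P" "fst s6 ''N'' 0 = ?N"
                using 1(2) c5 N5 unfolding agree_def by simp_all
              have i6: "inputs s6" using inputs_agree[OF a6 z(1)] by simp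
              have B6: "\<forall>p. fst s6 ''B'' p = 0" using a6 z(5) unfolding agree_def by simp
              have "wp (InitSlots l) s6 (\<lambda>t s. t \<le> ?N * (m * (\<tau> + 80) + 80 * l + 150) + 20 \<and>
                slots_ok ?N (fst s6 ''W'') (fst s6 ''D'') (fst s ''B'') (snd s ''ic'') (snd s ''sl''))"
                by (rule wp_InitSlots[OF i6 _ c6(5) _ B6]) (use o2 c6 r4 in simp_all)
              then show ?case unfolding wp_Seq[of "InitSlots l"]
              proof (rule wp_use, goal_cases)
                case (1 t7 s7)
                note r7 = 1(1)
                let ?w7 = "?w6 \<union> {''B''}" and ?v7 = "{''u'', ''v'', ''ri'', ''rs'', ''ic'', ''sl''}"
                have a7: "agree ?w7 ?v7 ?s0 s7" using 1(2) a6 unfolding agree_def by simp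
                have i7: "inputs s7" using inputs_agree[OF a7 z(1)] by simp
                have c7: "fst s7 ''W'' = fst s4 ''W''" "fst s7 ''P'' 0 = ?P" "fst s7 ''N'' 0 = ?N" "fst s7 ''D'' = fst s6 ''D''"
                  using 1(2) c6 unfolding agree_def by simp_all
                have D7: "digit_table l ?N ?P (fst s7 ''D'')" using r6 c7(4) by simp
                have t7: "table m (fst s7 ''W'') ?P S" using r4 c7 by simp
                have ok7: "slots_ok ?N (fst s7 ''W'') (fst s7 ''D'') (fst s7 ''B'') (snd s7 ''ic'') (snd s7 ''sl'')"
                  using r7 c7 c6 by simp
                have S7: "relevant l \<subseteq> S" "S \<subseteq> E" "card S < ?P" using relevant_in_layers cS unfolding S_def using S[unfolded S_def] by auto
                show ?case unfolding wp_Seq[of CleanAll]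
                proof (rule wp_use[OF wp_CleanAll[OF i7 c7(3,2) D7 t7 S7 ok7]], goal_cases)
                  case (1 t8 s8)
                  note r8 = 1(1)
                  let ?w8 = "?w7 \<union> {''z'', ''g'', ''p''}"
                  have a8: "agree ?w8 ?v7 ?s0 s8" using 1(2) a7 unfolding agree_def by simp
                  have c8: "fst s8 ''P'' 0 = ?P" "fst s8 ''N'' 0 = ?N" "digit_table l ?N ?P (fst s8 ''D'')"
                    "slots_ok ?N (fst s8 ''W'') (fst s8 ''D'') (fst s8 ''B'') (snd s8 ''ic'') (snd s8 ''sl'')"
                    using 1 c7 D7 unfolding agree_def by simp_all
                  have ib8: "inputs s8" "bounds s8" using inputs_agree[OF a8 z(1)] a8 z(2) unfolding agree_def bounds_def by simp_all
                  show ?case unfolding wp_Seq[of Gather]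
                  proof (rule wp_use[OF wp_Gather[OF ib8]], goal_cases)
                    case (1 t9 s9)
                    note r9 = 1(1)
                    define n where "n = fst s9 ''n'' 0"
                    let ?w9 = "?w8 \<union> {''e'', ''f'', ''E0'', ''F0'', ''n''}" and ?v9 = "?v7 \<union> {''xx'', ''key''}"
                    have a9: "agree ?w9 ?v9 ?s0 s9" using 1(2) a8 unfolding agree_def by simp
                    have a89: "agree {''i'', ''j'', ''e'', ''f'', ''E0'', ''F0'', ''n''} {''xx'', ''key''} s8 s9" using 1(2) by simp
                    show ?case unfolding wp_Seq[of MergeSort]
                    proof (rule wp_use[OF wp_MergeSort[OF n_def[symmetric]]], goal_cases)
                      case (1 t10 s10)
                      note r10 = 1(1)
                      let ?ms = "{''si'', ''sm'', ''sj'', ''se'', ''so'', ''tmp'', ''idx'', ''sw''}"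
                      have a10: "agree (?w9 \<union> ?ms) ?v9 ?s0 s10" using 1(2) a9 unfolding agree_def by simp
                      have c10: "fst s10 ''n'' 0 = n" "snd s10 ''key'' = snd s9 ''key''" "fst s10 ''E0'' = fst s9 ''E0''" "fst s10 ''F0'' = fst s9 ''F0''"
                        using 1(2) n_def unfolding agree_def by simp_all
                      have a810: "agree ({''i'', ''j'', ''e'', ''f'', ''E0'', ''F0'', ''n''} \<union> ?ms) {''xx'', ''key''} s8 s10"
                        using 1(2) a89 unfolding agree_def by simp
                      have "gathered (pairs_upto m 0) n (snd s9 ''key'') (fst s9 ''E0'') (fst s9 ''F0'')" using r9 n_def by simp
                      then have ev: "events_ok n (\<lambda>c. snd s10 ''key'' (fst s10 ''idx'' c)) (\<lambda>c. fst s10 ''E0'' (fst s10 ''idx'' c)) (\<lambda>c. fst s10 ''F0'' (fst s10 ''idx'' c))"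
                        unfolding c10(2-4) by (rule events_ok_sorted) (use r10 mset_map_upt in blast)+
                      show ?case unfolding wp_Seq[of CopyEvents]
                      proof (rule wp_use[OF wp_CopyEvents[OF c10(1) ev]], goal_cases)
                        case (1 t11 s11)
                        note r11 = 1(1)
                        have a11: "agree (?w9 \<union> ?ms \<union> {''c'', ''Ee'', ''Ef'', ''nE''}) (?v9 \<union> {''T''}) ?s0 s11"
                          using 1(2) a10 unfolding agree_def by simp
                        have ib11: "inputs s11" "bounds s11" using inputs_agree[OF a11 z(1)] a11 z(2) unfolding agree_def bounds_def by simp_all
                        have p11: "fst s11 ''pieces'' 0 = 0" using a11 z(6) unfolding agree_def by simp
                        have c11: "fst s11 ''P'' = fst s8 ''P''" "fst s11 ''N'' = fst s8 ''N''" "fst s11 ''D'' = fst s8 ''D''" "fst s11 ''W'' = fst s8 ''W''"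
                          "fst s11 ''B'' = fst s8 ''B''" "snd s11 ''ic'' = snd s8 ''ic''" "snd s11 ''sl'' = snd s8 ''sl''"
                          using 1(2) a810 unfolding agree_def by simp_all
                        have "wp (Main l) s11 (\<lambda>t s. t \<le> (n + 1) * (cell_time l ?N ?P \<tau> + 20) + 40 \<and> solves_interdiction l m \<F> a b I s)"
                          by (rule wp_Main[where n = n]) (use ib11 p11 c11 c8 r8 r11 in simp_all)
                        then show ?case
                        proof (rule wp_mono, goal_cases)
                          case (1 t12 s12)
                          have "1 + t1 + (1 + t2 + (1 + t3 + (1 + t4 + (1 + t5 + (1 + t6 + (1 + t7 + (1 + t8 + (1 + t9 + (1 + t10 + (1 + t11 + t12))))))))))
                            \<le> total_time l m ?P ?N \<tau> n"
                            unfolding total_time_def using r1 r2 r3 r4 r5 r6 r7 r8 r9 r10 r11 1 by linarith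
                          moreover have "n \<le> m * m" using r9 n_def by simp
                          ultimately show ?case using 1 by blast
                        qed
                      qed
                    qed
                  qed
                qed
              qed
            qed
          qed
        qed
      qed
    qed
  qed
qed

end

section \<open>The running time\<close>

text \<open>Everything is charged to \<open>m * m * (N * (\<tau> + lg N + 1))\<close>, except for
  the sorting of the at most \<open>m * m\<close> equality points, which gives the second term. The
  quadratic dependence of the factor on \<open>l\<close> comes from the duplicate check in
  \<open>CheckValid\<close>.\<close>

lemma total_time_le:
  assumes m: "1 \<le> m" and n: "n \<le> m * m" and P: "1 \<le> P" "P \<le> N"
  shows "total_time l m P N \<tau> n \<le> (2000 * l * l + 3000 * l + 15000) * (m * m * (N * (\<tau> + lg N + 1)) + m * m * (lg (m * m) + 1))"
proof -
  define G where "G = N * (\<tau> + lg N + 1)"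
  define X where "X = m * m * G"
  define Z where "Z = m * m * (lg (m * m) + 1)"
  have N1: "1 \<le> N" using P by simp
  have G: "N \<le> G" "N * \<tau> \<le> G" "N * (lg N + 1) \<le> G" unfolding G_def by (simp_all add: algebra_simps)
  have M: "m \<le> m * m" "1 \<le> m * m" using m by simp_all
  have x: "u * v \<le> X" if "u \<le> m * m" "v \<le> G" for u v unfolding X_def using that by (rule mult_le_mono)
  have "1 \<le> G" "\<tau> \<le> G" "P \<le> G"
  proof -
    have "1 * \<tau> \<le> N * \<tau>" using N1 by (rule mult_le_mono1)
    then show "1 \<le> G" "\<tau> \<le> G" "P \<le> G" using G N1 P by linarith+
  qed
  note G = G this
  have f: "1 \<le> X" "m \<le> X" "m * m \<le> X" "N \<le> X" "P \<le> X" "m * N \<le> X" "m * P \<le> X" "m * (N * \<tau>) \<le> X" "m * \<tau> \<le> X" "G \<le> X"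
    using x[of 1 1] x[of m 1] x[of "m * m" 1] x[of 1 N] x[of 1 P] x[of m N] x[of m P] x[of m "N * \<tau>"] x[of m \<tau>] x[of 1 G] M G by simp_all
  have nX: "n \<le> X" using n f by simp
  have l1: "l * y \<le> l * X" if "y \<le> X" for y using that by (rule mult_le_mono2)
  \<comment> \<open>Treating \<open>l * X\<close> as an atom makes the estimates that contain a
    factor \<open>l\<close> linear.\<close>
  define Y where "Y = l * X"
  have fl: "l * (m * \<tau>) \<le> Y" "l * m \<le> Y" "l * N \<le> Y" "l \<le> Y"
    using l1[OF f(9)] l1[OF f(2)] l1[OF f(4)] l1[OF f(1)] unfolding Y_def by simp_all
  have a1: "(60 * m + 20) + (m * (60 * m + 60) + 20) + (50 * m + 50 * P + 80) + (m * (40 * N + 50 * P + 80) + 20) + (m * (m * 170 + 50) + 40) + (n * 60 + 30) \<le> 2000 * X"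
    using f nX by (simp add: algebra_simps)
  have a2: "(Suc l * (m * (\<tau> + 120) + 120) + 20) + (40 * l + 40) + (N * (50 * l + 120) + 40) + (N * (m * (\<tau> + 80) + 80 * l + 150) + 20) \<le> (1000 * l + 2000) * X"
  proof -
    have "(Suc l * (m * (\<tau> + 120) + 120) + 20) + (40 * l + 40) + (N * (50 * l + 120) + 40) + (N * (m * (\<tau> + 80) + 80 * l + 150) + 20) \<le> 1000 * Y + 2000 * X"
      using f fl by (simp add: algebra_simps)
    then show ?thesis unfolding Y_def by (simp add: algebra_simps)
  qed
  have a3: "(lg n + 1) * (300 * n + 300) \<le> 600 * Z"
  proof -
    have "(lg n + 1) * (300 * n + 300) \<le> (lg (m * m) + 1) * (600 * (m * m))"
    proof (rule mult_le_mono)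
      show "300 * n + 300 \<le> 600 * (m * m)" using n M by linarith
    qed (use lg_mono[OF n] in simp)
    then show ?thesis unfolding Z_def by (simp add: algebra_simps)
  qed
  have a4: "(n + 1) * (cell_time l N P \<tau> + 20) \<le> (2000 * l * l + 2000 * l + 10000) * X"
  proof -
    let ?A = "100 * l * l + 300 * l + 1500"
    have "(lg N + 1) * ((N + 1) * ?A) \<le> (lg N + 1) * (2 * N * ?A)" using N1 by (intro mult_le_mono2 mult_le_mono1) simp
    also have "\<dots> = 2 * ?A * (N * (lg N + 1))" by (simp add: algebra_simps)
    also have "\<dots> \<le> 2 * ?A * G" using G(3) by (rule mult_le_mono2)
    finally have 1: "(lg N + 1) * ((N + 1) * ?A) \<le> 2 * ?A * G" .
    have "N * (50 * l + 350) \<le> G * (50 * l + 350)" using G(1) by (rule mult_le_mono1)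
    then have "N * (\<tau> + 50 * l + 350) \<le> (50 * l + 351) * G" using G(2) by (simp add: algebra_simps)
    then have "cell_time l N P \<tau> + 20 \<le> 2 * ?A * G + (50 * l + 351) * G + 200 * G + 420 * G"
      using 1 G unfolding cell_time_def by linarith
    also have "\<dots> \<le> (1000 * l * l + 1000 * l + 5000) * G" by (simp add: algebra_simps)
    finally have "(n + 1) * (cell_time l N P \<tau> + 20) \<le> (2 * (m * m)) * ((1000 * l * l + 1000 * l + 5000) * G)"
    proof (intro mult_le_mono)
      show "n + 1 \<le> 2 * (m * m)" using n M by linarith
    qed
    also have "\<dots> = (2000 * l * l + 2000 * l + 10000) * X" unfolding X_def by (simp add: algebra_simps)
    finally show ?thesis .
  qed
  have "total_time l m P N \<tau> n \<le> 2000 * X + (1000 * l + 2000) * X + 600 * Z + (2000 * l * l + 2000 * l + 10000) * X + 60 * X"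
    unfolding total_time_def using a1 a2 a3 a4 f(1) by linarith
  also have "\<dots> \<le> (2000 * l * l + 3000 * l + 15000) * X + 600 * Z" by (simp add: algebra_simps)
  also have "\<dots> \<le> (2000 * l * l + 3000 * l + 15000) * (X + Z)" by (simp add: algebra_simps)
  finally show ?thesis unfolding X_def Z_def G_def .
qed

lemma lg_mult: "lg (x * y) \<le> lg x + lg y"
proof -
  have "x * y \<le> 2 ^ lg x * 2 ^ lg y" by (rule mult_le_mono[OF lg_le lg_le])
  then show ?thesis unfolding lg_def[of "x * y"] by (intro Least_le) (simp add: power_add)
qed

lemma lg_power: "lg (x ^ l) \<le> l * lg x"
proof -
  have "x ^ l \<le> (2 ^ lg x) ^ l" using lg_le by (intro power_mono) simp_all
  then show ?thesis unfolding lg_def[of "x ^ l"] by (intro Least_le) (simp add: power_mult[symmetric] mult.commute)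
qed

lemma lg_le_ln:
  assumes "1 \<le> x" shows "real (lg x) \<le> 1 + ln (real x) / ln 2"
proof (cases "lg x = 0")
  case True
  then show ?thesis using assms by simp
next
  case False
  then have "\<not> x \<le> 2 ^ (lg x - 1)" using not_less_Least[of "lg x - 1" "\<lambda>p. x \<le> 2 ^ p"] unfolding lg_def by simp
  then have "2 ^ (lg x - 1) \<le> x" by simp
  then have "real (2 ^ (lg x - 1)) \<le> real x" by (simp only: of_nat_le_iff)
  then have "ln (2 ^ (lg x - 1)) \<le> ln (real x)" using assms by simp
  then have "real (lg x - 1) * ln 2 \<le> ln (real x)" by (simp add: ln_realpow)
  then have "real (lg x - 1) \<le> ln (real x) / ln 2" by (simp add: pos_le_divide_eq)
  then show ?thesis using False by simp
qed

text \<open>All factors that depend on \<open>l\<close> alone are collected in front. What needs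
  care is the absorption of the summands that carry neither \<open>\<tau>\<close> nor a logarithm,
  since \<open>\<tau>\<close> may be 0 and \<open>ln (k * l)\<close> may vanish.\<close>

lemma running_time_bound:
  fixes k l m \<tau> :: nat
  assumes k: "1 \<le> k" and l: "1 \<le> l" and m: "2 \<le> m"
  defines "N \<equiv> (Suc l * k + 2) ^ l"
  shows "real (m * m * (N * (\<tau> + lg N + 1)) + m * m * (lg (m * m) + 1)) \<le>
    ((real l + 3) ^ l * (1 + (real l * (real (lg (l + 3)) + 1) + 1) / ln 2 + real l / ln 2) + 5 / ln 2) *
    ((real m)\<^sup>2 * (real k ^ l * real l ^ l * (real \<tau> + ln (real k * real l)) + ln (real m)))"
proof -
  define A where "A = (real l + 3) ^ l"
  define c where "c = real l * (real (lg (l + 3)) + 1) + 1"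
  define K where "K = real k ^ l * real l ^ l"
  define Lk where "Lk = ln (real k * real l)"
  define Lm where "Lm = ln (real m)"
  have l2: "0 < ln (2 :: real)" "ln (2 :: real) \<le> 1" using ln_2_less_1 by simp_all
  have A0: "0 \<le> A" and c0: "0 \<le> c" unfolding A_def c_def by simp_all
  have k1: "1 \<le> real k ^ l" using k by simp
  have ll: "1 \<le> real l ^ l" using l by simp
  have K1: "real k ^ l \<le> K" unfolding K_def using mult_left_mono[OF ll, of "real k ^ l"] k1 by simp
  have kl: "1 \<le> real k * real l" using k l by (metis mult_le_mono mult.right_neutral of_nat_1 of_nat_le_iff of_nat_mult)
  have Lk0: "0 \<le> Lk" unfolding Lk_def using kl by simp
  have Lm2: "ln 2 \<le> Lm" unfolding Lm_def using m by simp
  have kk: "ln (real k) \<le> Lk"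
  proof -
    have "real k * 1 \<le> real k * real l" using l by (intro mult_left_mono) simp_all
    then show ?thesis unfolding Lk_def using k by simp
  qed
  \<comment> \<open>The summand 2 is at most \<open>2 * k\<close>; this is the origin of
    \<open>l + 3\<close>.\<close>
  have P: "Suc l * k + 2 \<le> (l + 3) * k" using k by (simp add: algebra_simps)
  have "real N \<le> real (((l + 3) * k) ^ l)" unfolding N_def of_nat_le_iff using P by (intro power_mono) simp_all
  also have "\<dots> = A * real k ^ l" unfolding A_def by (simp add: power_mult_distrib)
  finally have N: "real N \<le> A * real k ^ l" .
  have "lg N \<le> l * lg (Suc l * k + 2)" unfolding N_def by (rule lg_power)
  also have "\<dots> \<le> l * lg ((l + 3) * k)" using lg_mono[OF P] by (rule mult_le_mono2)
  also have "\<dots> \<le> l * (lg (l + 3) + lg k)" using lg_mult by (rule mult_le_mono2)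
  finally have "real (lg N) \<le> real l * (real (lg (l + 3)) + real (lg k))" by (metis of_nat_add of_nat_le_iff of_nat_mult)
  also have "\<dots> \<le> real l * (real (lg (l + 3)) + (1 + Lk / ln 2))"
  proof (intro mult_left_mono add_left_mono)
    have "ln (real k) / ln 2 \<le> Lk / ln 2" using kk l2 by (intro divide_right_mono) simp_all
    then show "real (lg k) \<le> 1 + Lk / ln 2" using lg_le_ln[OF k] by linarith
  qed simp
  finally have lgN: "real (lg N) + 1 \<le> c + real l / ln 2 * Lk" unfolding c_def by (simp add: algebra_simps)
  have "real (N * (\<tau> + lg N + 1)) = real N * (real \<tau> + (real (lg N) + 1))" by (simp add: algebra_simps)
  also have "\<dots> \<le> (A * real k ^ l) * (real \<tau> + (c + real l / ln 2 * Lk))"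
    using N lgN A0 k1 by (intro mult_mono add_left_mono) simp_all
  also have "\<dots> = A * (real k ^ l * real \<tau> + c * real k ^ l + real l / ln 2 * (real k ^ l * Lk))" by (simp add: algebra_simps)
  also have "\<dots> \<le> A * ((K * (real \<tau> + Lk) + Lm) + c * ((K * (real \<tau> + Lk) + Lm) / ln 2) + real l / ln 2 * (K * (real \<tau> + Lk) + Lm))"
  proof (intro mult_left_mono add_mono)
    have K0: "0 \<le> K" using K1 k1 by simp
    have 1: "0 \<le> K * real \<tau>" "0 \<le> K * Lk" "0 \<le> Lm" using K0 Lk0 Lm2 l2 by (simp, simp, linarith)
    have "real k ^ l * real \<tau> \<le> K * real \<tau>" using K1 by (intro mult_right_mono) simp_all
    then show "real k ^ l * real \<tau> \<le> K * (real \<tau> + Lk) + Lm" using 1 by (simp add: distrib_left)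
    have "real k ^ l * Lk \<le> K * Lk" using K1 Lk0 by (intro mult_right_mono) simp_all
    then show "real k ^ l * Lk \<le> K * (real \<tau> + Lk) + Lm" using 1 by (simp add: distrib_left)
    show "real k ^ l \<le> (K * (real \<tau> + Lk) + Lm) / ln 2"
    \<comment> \<open>If \<open>k * l = 1\<close>, the logarithm of the product is 0, but then the
      left side is 1 and \<open>ln m \<ge> ln 2\<close> pays for it. Otherwise \<open>k * l\<close>
      is at least 2, and the logarithm of the product pays.\<close>
    proof (cases "k * l = 1")
      case True
      then have "k = 1" by simp
      then have "real k ^ l * ln 2 \<le> K * (real \<tau> + Lk) + Lm" using 1 Lm2 by (simp add: distrib_left)
      then show ?thesis using l2 by (simp add: pos_le_divide_eq)
    next
      case False
      have "1 \<le> k * l" using mult_le_mono[OF k l] by simp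
      then have "2 \<le> k * l" using False by linarith
      then have "2 \<le> real k * real l" by (metis of_nat_le_iff of_nat_mult of_nat_numeral)
      then have "ln 2 \<le> Lk" unfolding Lk_def by simp
      then have "real k ^ l * ln 2 \<le> K * Lk" using K1 K0 l2 by (intro mult_mono) simp_all
      then have "real k ^ l * ln 2 \<le> K * (real \<tau> + Lk) + Lm" using 1 by (simp add: distrib_left)
      then show ?thesis using l2 by (simp add: pos_le_divide_eq)
    qed
  qed (use A0 c0 l2 in simp_all)
  also have "\<dots> = A * (1 + c / ln 2 + real l / ln 2) * (K * (real \<tau> + Lk) + Lm)"
    by (simp add: algebra_simps add_divide_distrib)
  finally have first: "real (N * (\<tau> + lg N + 1)) \<le> A * (1 + c / ln 2 + real l / ln 2) * (K * (real \<tau> + Lk) + Lm)" .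
  have "real (lg (m * m)) \<le> real (lg m) + real (lg m)" using lg_mult[of m m] by (metis of_nat_add of_nat_le_iff)
  also have "\<dots> \<le> 2 + 2 * (Lm / ln 2)" using lg_le_ln[of m] m unfolding Lm_def by simp
  finally have "real (lg (m * m)) + 1 \<le> 3 + 2 * (Lm / ln 2)" by simp
  also have "\<dots> \<le> 5 * (Lm / ln 2)"
  proof -
    have "1 \<le> Lm / ln 2" using Lm2 l2 by (simp add: pos_le_divide_eq)
    then show ?thesis by linarith
  qed
  also have "\<dots> = 5 / ln 2 * Lm" by simp
  also have "\<dots> \<le> 5 / ln 2 * (K * (real \<tau> + Lk) + Lm)"
    using K1 k1 Lk0 l2 by (intro mult_left_mono) simp_all
  finally have second: "real (lg (m * m)) + 1 \<le> 5 / ln 2 * (K * (real \<tau> + Lk) + Lm)" .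
  have "real (m * m * (N * (\<tau> + lg N + 1)) + m * m * (lg (m * m) + 1)) =
      (real m)\<^sup>2 * (real (N * (\<tau> + lg N + 1)) + (real (lg (m * m)) + 1))"
    by (simp add: power2_eq_square distrib_left)
  also have "\<dots> \<le> (real m)\<^sup>2 * (A * (1 + c / ln 2 + real l / ln 2) * (K * (real \<tau> + Lk) + Lm) + 5 / ln 2 * (K * (real \<tau> + Lk) + Lm))"
    using first second by (intro mult_left_mono add_mono) simp_all
  also have "\<dots> = (A * (1 + c / ln 2 + real l / ln 2) + 5 / ln 2) * ((real m)\<^sup>2 * (K * (real \<tau> + Lk) + Lm))"
    by (simp add: algebra_simps add_divide_distrib)
  finally show ?thesis unfolding A_def c_def K_def Lk_def Lm_def .
qed

theorem theorem4p5:
  fixes l :: nat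
  assumes "0 < l"
  shows "\<exists>(P :: com) (C :: real).
    \<forall>(f :: nat \<Rightarrow> nat) (m :: nat) (\<F> :: nat set set) (a :: nat \<Rightarrow> rat) (b :: nat \<Rightarrow> rat) (I :: real set).
      interdiction_instance l m \<F> a b I \<longrightarrow>
      (let k = matroid_rank \<F> in
       \<exists>t s. exec m \<F> (f m) P (input_state m a b I) t s \<and>
         solves_interdiction l m \<F> a b I s \<and>
         real t \<le> C * ((real m)\<^sup>2 *
           (real k ^ l * real l ^ l * (real (f m) + ln (real k * real l)) + ln (real m))))"
proof -
  define C1 where "C1 = real (2000 * l * l + 3000 * l + 15000)"
  define C2 where "C2 = (real l + 3) ^ l * (1 + (real l * (real (lg (l + 3)) + 1) + 1) / ln 2 + real l / ln 2) + 5 / ln 2"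
  show ?thesis
  proof (intro exI[of _ "Program l"] exI[of _ "C1 * C2"] allI impI)
    fix f :: "nat \<Rightarrow> nat" and m \<F> a b I
    assume inst: "interdiction_instance l m \<F> a b I"
    interpret interdiction_machine l m \<F> a b I "f m" by unfold_locales (use inst assms in simp_all)
    interpret ordered_interdiction l m \<F> a b I start_less by unfold_locales (rule start_less_order)
    let ?k = "matroid_rank \<F>"
    let ?N = "(Suc l * ?k + 2) ^ l"
    obtain t s n where t: "exec m \<F> (f m) (Program l) (input_state m a b I) t s" "solves_interdiction l m \<F> a b I s"
      "n \<le> m * m" "t \<le> total_time l m (Suc l * ?k + 2) ?N (f m) n"
      using wp_Program unfolding wp_def by blast
    have "card (relevant l) \<le> m" using card_mono[OF finite_E relevant_sub] by simp
    \<comment> \<open>There are more than \<open>l\<close> relevant elements and \<open>l\<close> is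
      positive, so the ground set has at least two elements and \<open>ln m\<close> is
      positive.\<close>
    then have m: "2 \<le> m" using card_relevant_gt l_pos by linarith
    have k: "1 \<le> ?k" using k_pos by simp
    have PN: "Suc l * ?k + 2 \<le> ?N" using l_pos by (intro self_le_power) simp_all
    have "t \<le> (2000 * l * l + 3000 * l + 15000) * (m * m * (?N * (f m + lg ?N + 1)) + m * m * (lg (m * m) + 1))"
      using t(4) total_time_le[of m n "Suc l * ?k + 2" ?N l "f m"] m t(3) PN by linarith
    then have "real t \<le> C1 * real (m * m * (?N * (f m + lg ?N + 1)) + m * m * (lg (m * m) + 1))"
      unfolding C1_def by (metis of_nat_le_iff of_nat_mult)
    also have "\<dots> \<le> C1 * (C2 * ((real m)\<^sup>2 * (real ?k ^ l * real l ^ l * (real (f m) + ln (real ?k * real l)) + ln (real m))))"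
      using running_time_bound[OF k _ m, of l "f m"] l_pos unfolding C2_def C1_def by (intro mult_left_mono) simp_all
    finally show "let k = ?k in \<exists>t s. exec m \<F> (f m) (Program l) (input_state m a b I) t s \<and>
         solves_interdiction l m \<F> a b I s \<and>
         real t \<le> C1 * C2 * ((real m)\<^sup>2 * (real k ^ l * real l ^ l * (real (f m) + ln (real k * real l)) + ln (real m)))"
      unfolding Let_def using t(1,2) by (intro exI[of _ t], intro exI[of _ s]) (simp add: mult.assoc)
  qed
qed

end
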